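(* Assume that $d>2$, let $\widetilde L$ be the Bessel operator on $\widetilde X=(-\infty,-1]\cup[1,\infty)$ (with $-1$ and $1$ glued together), and let $T_t(x,y)$ be the integral kernel (with respect to $\mu$) of the semigroup $T_t=\exp(-t\widetilde L)$. Then there exist $C,c_1,c_2>0$ such that for all $t>0$ and $x,y\in\widetilde X$: $$\frac{C^{-1}}{\mu(B(x,\sqrt t))}e^{-\frac{\rho(x,y)^2}{c_1t}}\le T_t(x,y)\le\frac{C}{\mu(B(x,\sqrt t))}e^{-\frac{\rho(x,y)^2}{c_2t}}\quad\text{if }x\cdot y>0,$$ $$C^{-1}\frac{|x|^{2-d}+|y|^{2-d}}{\mu(B(x,\sqrt t))}e^{-\frac{\rho(x,y)^2}{c_1t}}\le T_t(x,y)\le C\frac{|x|^{2-d}+|y|^{2-d}}{\mu(B(x,\sqrt t))}e^{-\frac{\rho(x,y)^2}{c_2t}}\quad\text{if }x\cdot y<0.$$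
   Context: The space. $\widetilde{X}=(-\infty,-1]\cup[1,\infty)$ with the points $-1$ and $1$ identified. The metric is $\rho(x,y)=|x-y|$ if $xy>0$ and $\rho(x,y)=|x-y|-2$ if $xy<0$; thus $(\widetilde X,\rho)$ is isometric to $\mathbb{R}$. The measure is $d\mu(x)=|x|^{d-1}\,dx$. Balls are $B(x,r)=\{y\in\widetilde X:\rho(x,y)<r\}$. The operator. $C^1_c(\widetilde X)$ denotes the compactly supported functions that are $C^1$ when $\widetilde X$ is identified isometrically with $\mathbb{R}$ (so $f(-1)=f(1)$ and the one-sided derivatives at $-1$ and $1$ agree). $\widetilde L$ is the nonnegative self-adjoint operator on $L^2(\widetilde X,\mu)$ associated with the closure of the quadratic form $Q(f,g)=\int_{\widetilde X}f'(x)g'(x)\,d\mu(x)$, $f,g\in C^1_c(\widetilde X)$. On each half-line it acts as $-f''-\frac{d-1}{x}f'$. The kernel is defined by $T_tf(x)=\int_{\widetilde X}T_t(x,y)f(y)\,d\mu(y)$. *)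

theory Defs
  imports "HOL-Analysis.Analysis"
begin

section \<open>Semigroups and kernels on real \<open>L\<^sup>2\<close> spaces\<close>

text \<open>
  Elements of \<open>L\<^sup>2(M)\<close> are represented by measurable functions; equality of elements is equality
  almost everywhere. Operators therefore act on representatives, and an unbounded operator
  is given by its graph, a relation between functions.
\<close>

definition L2 :: "'a measure \<Rightarrow> ('a \<Rightarrow> real) set" where
  "L2 M = {f. f \<in> borel_measurable M \<and> integrable M (\<lambda>x. (f x)\<^sup>2)}"

definition L2_inner :: "'a measure \<Rightarrow> ('a \<Rightarrow> real) \<Rightarrow> ('a \<Rightarrow> real) \<Rightarrow> real" where
  "L2_inner M f g = (LINT x|M. f x * g x)"

definition L2_norm :: "'a measure \<Rightarrow> ('a \<Rightarrow> real) \<Rightarrow> real" where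
  "L2_norm M f = sqrt (L2_inner M f f)"

text \<open>
  \<open>F\<close> witnesses that \<open>f\<close> lies in the domain of the closure of the form \<open>Q\<close> with domain \<open>D\<close>:
  it converges to \<open>f\<close> in \<open>L\<^sup>2\<close> and is Cauchy for the seminorm induced by \<open>Q\<close>.
\<close>

definition form_approx :: "'a measure \<Rightarrow> ('a \<Rightarrow> real) set \<Rightarrow>
    (('a \<Rightarrow> real) \<Rightarrow> ('a \<Rightarrow> real) \<Rightarrow> real) \<Rightarrow> (nat \<Rightarrow> 'a \<Rightarrow> real) \<Rightarrow> ('a \<Rightarrow> real) \<Rightarrow> bool" where
  "form_approx M D Q F f \<longleftrightarrow>
     (\<forall>n. F n \<in> D) \<and> f \<in> L2 M \<and>
     (\<lambda>n. L2_norm M (\<lambda>x. F n x - f x)) \<longlonglongrightarrow> 0 \<and>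
     (\<forall>e>0. \<exists>N. \<forall>m\<ge>N. \<forall>n\<ge>N. Q (\<lambda>x. F m x - F n x) (\<lambda>x. F m x - F n x) < e)"

definition closure_domain :: "'a measure \<Rightarrow> ('a \<Rightarrow> real) set \<Rightarrow>
    (('a \<Rightarrow> real) \<Rightarrow> ('a \<Rightarrow> real) \<Rightarrow> real) \<Rightarrow> ('a \<Rightarrow> real) set" where
  "closure_domain M D Q = {f. \<exists>F. form_approx M D Q F f}"

text \<open>The limit below exists and is independent of the sequences when \<open>Q\<close> is closable.\<close>

definition closure_form :: "'a measure \<Rightarrow> ('a \<Rightarrow> real) set \<Rightarrow>
    (('a \<Rightarrow> real) \<Rightarrow> ('a \<Rightarrow> real) \<Rightarrow> real) \<Rightarrow> ('a \<Rightarrow> real) \<Rightarrow> ('a \<Rightarrow> real) \<Rightarrow> real" where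
  "closure_form M D Q f g =
     (THE q. \<forall>F G. form_approx M D Q F f \<longrightarrow> form_approx M D Q G g \<longrightarrow>
        (\<lambda>n. Q (F n) (G n)) \<longlonglongrightarrow> q)"

text \<open>
  Graph of the operator associated with the closure of \<open>Q\<close>: \<open>f\<close> is in the operator domain and
  is mapped to \<open>h\<close>.
\<close>

definition form_operator :: "'a measure \<Rightarrow> ('a \<Rightarrow> real) set \<Rightarrow>
    (('a \<Rightarrow> real) \<Rightarrow> ('a \<Rightarrow> real) \<Rightarrow> real) \<Rightarrow> ('a \<Rightarrow> real) \<Rightarrow> ('a \<Rightarrow> real) \<Rightarrow> bool" where
  "form_operator M D Q f h \<longleftrightarrow>
     f \<in> closure_domain M D Q \<and> h \<in> L2 M \<and>
     (\<forall>g \<in> closure_domain M D Q. closure_form M D Q f g = L2_inner M h g)"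

text \<open>
  Linearity and boundedness together imply that \<open>S t\<close> respects equality almost everywhere.
\<close>

definition C0_semigroup :: "'a measure \<Rightarrow> (real \<Rightarrow> ('a \<Rightarrow> real) \<Rightarrow> 'a \<Rightarrow> real) \<Rightarrow> bool" where
  "C0_semigroup M S \<longleftrightarrow>
     (\<forall>t\<ge>0. \<forall>f\<in>L2 M. S t f \<in> L2 M) \<and>
     (\<forall>t\<ge>0. \<forall>f\<in>L2 M. \<forall>g\<in>L2 M. \<forall>a b.
        AE x in M. S t (\<lambda>z. a * f z + b * g z) x = a * S t f x + b * S t g x) \<and>
     (\<forall>t\<ge>0. \<exists>K. \<forall>f\<in>L2 M. L2_norm M (S t f) \<le> K * L2_norm M f) \<and>
     (\<forall>f\<in>L2 M. AE x in M. S 0 f x = f x) \<and>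
     (\<forall>s\<ge>0. \<forall>t\<ge>0. \<forall>f\<in>L2 M. AE x in M. S (s + t) f x = S s (S t f) x) \<and>
     (\<forall>f\<in>L2 M. ((\<lambda>t. L2_norm M (\<lambda>x. S t f x - f x)) \<longlongrightarrow> 0) (at_right 0))"

definition generator :: "'a measure \<Rightarrow> (real \<Rightarrow> ('a \<Rightarrow> real) \<Rightarrow> 'a \<Rightarrow> real) \<Rightarrow>
    ('a \<Rightarrow> real) \<Rightarrow> ('a \<Rightarrow> real) \<Rightarrow> bool" where
  "generator M S f h \<longleftrightarrow> f \<in> L2 M \<and> h \<in> L2 M \<and>
     ((\<lambda>t. L2_norm M (\<lambda>x. (S t f x - f x) / t - h x)) \<longlongrightarrow> 0) (at_right 0)"

text \<open>\<open>S t = exp (-t A)\<close>: the strongly continuous semigroup whose generator is \<open>-A\<close>.\<close>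

definition exp_semigroup :: "'a measure \<Rightarrow> (('a \<Rightarrow> real) \<Rightarrow> ('a \<Rightarrow> real) \<Rightarrow> bool) \<Rightarrow>
    (real \<Rightarrow> ('a \<Rightarrow> real) \<Rightarrow> 'a \<Rightarrow> real) \<Rightarrow> bool" where
  "exp_semigroup M A S \<longleftrightarrow>
     C0_semigroup M S \<and> (\<forall>f h. A f h \<longleftrightarrow> generator M S f (\<lambda>x. - h x))"

definition integral_kernel :: "'a measure \<Rightarrow> (('a \<Rightarrow> real) \<Rightarrow> 'a \<Rightarrow> real) \<Rightarrow>
    ('a \<Rightarrow> 'a \<Rightarrow> real) \<Rightarrow> bool" where
  "integral_kernel M P K \<longleftrightarrow>
     (\<lambda>(x, y). K x y) \<in> borel_measurable (M \<Otimes>\<^sub>M M) \<and>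
     (\<forall>f\<in>L2 M. AE x in M. integrable M (\<lambda>y. K x y * f y) \<and>
        P f x = (LINT y|M. K x y * f y))"


section \<open>The glued space\<close>

text \<open>
  Points of the glued space are represented by reals in \<open>(-\<infinity>, -1] \<union> [1, \<infinity>)\<close>, where \<open>-1\<close> and \<open>1\<close>
  represent the same point. Functions on the space are functions on this set that agree at
  \<open>-1\<close> and \<open>1\<close>; values inside \<open>(-1, 1)\<close> are irrelevant. In particular \<open>rho (-1) 1 = 0\<close>.
\<close>

definition X :: "real set" where
  "X = {..-1} \<union> {1..}"

definition rho :: "real \<Rightarrow> real \<Rightarrow> real" where
  "rho x y = (if x * y > 0 then \<bar>x - y\<bar> else \<bar>x - y\<bar> - 2)"

definition rball :: "real \<Rightarrow> real \<Rightarrow> real set" where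
  "rball x r = {y \<in> X. rho x y < r}"

definition mu :: "real \<Rightarrow> real measure" where
  "mu d = density (restrict_space lborel X) (\<lambda>x. ennreal (\<bar>x\<bar> powr (d - 1)))"

text \<open>
  The isometric identification with the real line: \<open>chart\<close> maps the line to the space (choosing
  \<open>1\<close> to represent the glued point), and \<open>coord\<close> is its inverse, with \<open>coord (-1) = coord 1 = 0\<close>.
\<close>

definition chart :: "real \<Rightarrow> real" where
  "chart s = (if s < 0 then s - 1 else s + 1)"

definition coord :: "real \<Rightarrow> real" where
  "coord x = x - sgn x"

definition C1c :: "(real \<Rightarrow> real) set" where
  "C1c = {f. f (-1) = f 1 \<and> (f \<circ> chart) C1_differentiable_on UNIV \<and>
             compact (closure {s. f (chart s) \<noteq> 0})}"

definition xderiv :: "(real \<Rightarrow> real) \<Rightarrow> real \<Rightarrow> real" where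
  "xderiv f x = deriv (f \<circ> chart) (coord x)"

definition continuous_kernel :: "(real \<Rightarrow> real \<Rightarrow> real) \<Rightarrow> bool" where
  "continuous_kernel K \<longleftrightarrow>
     (\<forall>x\<in>X. K x (-1) = K x 1 \<and> K (-1) x = K 1 x) \<and>
     continuous_on UNIV (\<lambda>(s, r). K (chart s) (chart r))"


section \<open>The Bessel operator\<close>

definition bessel_form :: "real \<Rightarrow> (real \<Rightarrow> real) \<Rightarrow> (real \<Rightarrow> real) \<Rightarrow> real" where
  "bessel_form d f g = (LINT x|mu d. xderiv f x * xderiv g x)"

definition bessel_operator :: "real \<Rightarrow> (real \<Rightarrow> real) \<Rightarrow> (real \<Rightarrow> real) \<Rightarrow> bool" where
  "bessel_operator d = form_operator (mu d) C1c (bessel_form d)"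

text \<open>
  The integral kernel of \<open>exp (-t L)\<close> is determined only up to null sets; pointwise statements
  refer to its version that is continuous on the glued space for each \<open>t > 0\<close>.
\<close>

definition bessel_heat_kernel :: "real \<Rightarrow> (real \<Rightarrow> real \<Rightarrow> real \<Rightarrow> real) \<Rightarrow> bool" where
  "bessel_heat_kernel d T \<longleftrightarrow>
     (\<exists>S. exp_semigroup (mu d) (bessel_operator d) S \<and>
          (\<forall>t>0. integral_kernel (mu d) (S t) (T t) \<and> continuous_kernel (T t)))"

end

theory Submission imports Defs begin

text \<open>
  In the coordinate \<open>s\<close> the glued space is the real line with weight \<open>w s = (1 + \<bar>s\<bar>) powr (d - 1)\<close>. The
  semigroup enters the estimates only through the symmetry of its continuous kernel, the Chapman--Kolmogorov
  equation, Sobolev-type bounds, and comparison: if \<open>q = - (g'' + drift g')\<close> satisfies \<open>q + K g \<ge> 0\<close>, then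
  \<open>P\<^sub>t g \<le> exp (K t) g\<close>. All further information comes from the choice of \<open>g\<close>. The functions \<open>exp \<phi>\<close> and
  \<open>hm exp \<phi>\<close>, where the harmonic function \<open>hm\<close> behaves like \<open>\<bar>x\<bar> powr (2 - d)\<close> on the right half-line, give
  exponential moments, the invariance of \<open>1\<close> and of \<open>hm\<close>, and the factor \<open>\<bar>x\<bar> powr (2 - d)\<close> for crossing the
  gluing point. The function \<open>(R\<^sup>2 + s\<^sup>2) powr (- \<gamma>)\<close> bounds occupation times near the gluing point and yields
  the decay \<open>t powr (- d / 2)\<close> on the diagonal. The upper bounds follow from the moments by Chapman--Kolmogorov. For
  the lower bounds, conservation of mass gives the diagonal, Hoelder continuity its neighbourhood, and chaining
  one half-line; since \<open>P\<^sub>t hm = hm\<close>, the mass that crosses the gluing point is of order \<open>hm x\<close>, which settles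
  the case of large time near that point and points on opposite sides.
\<close>

text \<open>The gluing point is a bottleneck: at large times a ball of radius \<open>sqrt t\<close>
  around it has volume of order \<open>t powr (d / 2)\<close>, while the neck keeps unit size. So no
  single argument treats all pairs of points alike. The moments of
  \<open>exp (\<alpha> * abs z)\<close> do not see the side, hence Chapman--Kolmogorov first yields
  a Gaussian in \<open>abs x - abs y\<close> only. It is final on one half-line; across the neck it
  is combined with the one-sided moments weighted by \<open>hm\<close>. The sum of two powers in the
  second estimate reflects the position of the midpoint at half time: if it lies on the side of
  \<open>y\<close>, the passage is paid for by the path from \<open>x\<close>, otherwise by the path
  from \<open>y\<close>. In the lower bounds, Hoelder continuity is effective only where
  \<open>1 + abs x\<close> is at least of order \<open>sqrt t\<close>. Closer to the neck the weight
  is too small compared with the volume of the ball, and two points are joined through an annulus at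
  distance of order \<open>sqrt t\<close>, which the process reaches with probability at least
  \<open>hm x / 2\<close>.\<close>

abbreviation meas :: "(real => real) => bool" where "meas f == f \<in> borel_measurable borel"

abbreviation cont :: "(real => real) => bool" where "cont == continuous_on UNIV"

section \<open>Square-integrable functions\<close>

lemma L2_measurable [measurable_dest]: "f \<in> L2 M ==> f \<in> borel_measurable M"
 and L2_integrable_sq: "f \<in> L2 M ==> integrable M (%x. (f x)^2)"
 by (auto simp: L2_def)

lemma L2_I: "f \<in> borel_measurable M ==> integrable M (%x. (f x)^2) ==> f \<in> L2 M"
 by (auto simp: L2_def)

lemma L2_mult_integrable:
 assumes "f \<in> L2 M" "g \<in> L2 M"
 shows "integrable M (%x. f x * g x)"
proof (rule Bochner_Integration.integrable_bound[where f = "%x. (f x)^2 + (g x)^2"])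
 show "integrable M (%x. (f x)^2 + (g x)^2)" using assms by (auto intro: L2_integrable_sq)
 show "(%x. f x * g x) \<in> borel_measurable M"
  using assms[THEN L2_measurable] by measurable
 have "abs (a * b) <= a^2 + b^2" for a b :: real
 proof -
  have "2 * (abs a * abs b) <= a^2 + b^2" using sum_squares_bound[of "abs a" "abs b"] by simp
  moreover have "0 <= abs a * abs b" by simp
  ultimately show ?thesis unfolding abs_mult by linarith
 qed
 then show "AE x in M. norm (f x * g x) <= norm ((f x)^2 + (g x)^2)" by simp
qed

lemma L2_bound:
 assumes "f \<in> borel_measurable M" "g \<in> L2 M" "AE x in M. abs (f x) <= c * abs (g x)"
 shows "f \<in> L2 M"
proof (rule L2_I)
 show "integrable M (%x. (f x)^2)"
 proof (rule Bochner_Integration.integrable_bound[where f = "%x. c^2 * (g x)^2"])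
  show "integrable M (%x. c^2 * (g x)^2)" using assms by (auto intro: L2_integrable_sq)
  show "AE x in M. norm ((f x)^2) <= norm (c^2 * (g x)^2)"
   using assms(3)
  proof eventually_elim
   case (elim x)
   have "abs (f x)^2 <= (c * abs (g x))^2" by (rule power_mono[OF elim]) simp
   then show ?case by (simp add: power_mult_distrib)
  qed
 qed (use assms in auto)
qed fact

lemma L2_scale: "f \<in> L2 M ==> (%x. c * f x) \<in> L2 M"
 by (rule L2_bound[where g = f and c = "abs c"]) (auto dest: L2_measurable simp: abs_mult)

lemma L2_add: "f \<in> L2 M ==> g \<in> L2 M ==> (%x. f x + g x) \<in> L2 M"
proof (rule L2_I)
 assume a: "f \<in> L2 M" "g \<in> L2 M"
 show "(%x. f x + g x) \<in> borel_measurable M"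
  using a[THEN L2_measurable] by measurable
 show "integrable M (%x. (f x + g x)^2)"
  unfolding power2_sum using a
  by (auto intro!: Bochner_Integration.integrable_add L2_integrable_sq
    simp: mult.assoc L2_mult_integrable)
qed

lemma L2_zero: "(%x. 0) \<in> L2 M"
 by (simp add: L2_def)

lemma L2_uminus: "f \<in> L2 M ==> (%x. - f x) \<in> L2 M"
 using L2_scale[of f M "-1"] by simp

lemma L2_diff: "f \<in> L2 M ==> g \<in> L2 M ==> (%x. f x - g x) \<in> L2 M"
 using L2_add[of f M "%x. - g x"] L2_uminus[of g M] by simp

lemma L2_lincomb: "f \<in> L2 M ==> g \<in> L2 M ==> (%x. a * f x + b * g x) \<in> L2 M"
 by (intro L2_add L2_scale)

lemma L2_divide: "f \<in> L2 M ==> (%x. f x / c) \<in> L2 M"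
 using L2_scale[of f M "inverse c"] by (simp add: field_simps)

lemma L2_abs: "f \<in> L2 M ==> (%x. abs (f x)) \<in> L2 M"
 by (rule L2_bound[where g = f and c = 1]) (auto dest: L2_measurable)

lemma L2_cong_AE:
 assumes "f \<in> L2 M" "g \<in> borel_measurable M" "AE x in M. f x = g x"
 shows "g \<in> L2 M"
 by (rule L2_bound[where g = f and c = 1]) (use assms in auto)

lemmas L2_intros = L2_add L2_scale L2_diff L2_uminus L2_lincomb L2_zero L2_divide

lemma L2_inner_commute: "L2_inner M f g = L2_inner M g f"
 by (simp add: L2_inner_def mult.commute)

lemma L2_inner_nonneg: "0 <= L2_inner M f f"
 by (simp add: L2_inner_def)

lemma L2_inner_add_left:
 assumes "f \<in> L2 M" "g \<in> L2 M" "h \<in> L2 M"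
 shows "L2_inner M (%x. f x + g x) h = L2_inner M f h + L2_inner M g h"
 unfolding L2_inner_def using assms
 by (simp add: distrib_right L2_mult_integrable)

lemma L2_inner_diff_left:
 assumes "f \<in> L2 M" "g \<in> L2 M" "h \<in> L2 M"
 shows "L2_inner M (%x. f x - g x) h = L2_inner M f h - L2_inner M g h"
 unfolding L2_inner_def using assms
 by (simp add: left_diff_distrib L2_mult_integrable)

lemma L2_inner_scale_left: "L2_inner M (%x. c * f x) h = c * L2_inner M f h"
 by (simp add: L2_inner_def mult.assoc)

lemma L2_inner_add_right:
 assumes "f \<in> L2 M" "g \<in> L2 M" "h \<in> L2 M"
 shows "L2_inner M h (%x. f x + g x) = L2_inner M h f + L2_inner M h g"
 using L2_inner_add_left[OF assms] by (simp add: L2_inner_commute)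

lemma L2_inner_diff_right:
 assumes "f \<in> L2 M" "g \<in> L2 M" "h \<in> L2 M"
 shows "L2_inner M h (%x. f x - g x) = L2_inner M h f - L2_inner M h g"
 using L2_inner_diff_left[OF assms] by (simp add: L2_inner_commute)

lemma L2_inner_scale_right: "L2_inner M h (%x. c * f x) = c * L2_inner M h f"
 using L2_inner_scale_left[of M c f h] by (simp add: L2_inner_commute)

lemma L2_inner_uminus_left: "L2_inner M (%x. - f x) h = - L2_inner M f h"
 by (simp add: L2_inner_def)

lemma L2_inner_uminus_right: "L2_inner M h (%x. - f x) = - L2_inner M h f"
 by (simp add: L2_inner_def)

lemma L2_norm_nonneg: "0 <= L2_norm M f"
 by (simp add: L2_norm_def L2_inner_nonneg)

lemma L2_norm_sq: "(L2_norm M f)^2 = L2_inner M f f"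
 by (simp add: L2_norm_def L2_inner_nonneg)

lemma L2_inner_self: "L2_inner M f f = (LINT x|M. (f x)^2)"
 by (simp add: L2_inner_def power2_eq_square)

lemma L2_norm_zero: "L2_norm M (%x. 0) = 0"
 by (simp add: L2_norm_def L2_inner_def)

lemma L2_norm_scale: "L2_norm M (%x. c * f x) = abs c * L2_norm M f"
 by (simp add: L2_norm_def L2_inner_scale_left L2_inner_scale_right real_sqrt_mult)

lemma L2_norm_uminus: "L2_norm M (%x. - f x) = L2_norm M f"
 using L2_norm_scale[of M "-1" f] by simp

lemma L2_norm_minus_commute: "L2_norm M (%x. f x - g x) = L2_norm M (%x. g x - f x)"
 using L2_norm_uminus[of M "%x. f x - g x"] by simp

lemma L2_inner_cong_AE:
 assumes "AE x in M. f x = f' x" "AE x in M. g x = g' x"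
  "f \<in> borel_measurable M" "f' \<in> borel_measurable M"
  "g \<in> borel_measurable M" "g' \<in> borel_measurable M"
 shows "L2_inner M f g = L2_inner M f' g'"
 unfolding L2_inner_def
proof (rule integral_cong_AE)
 show "AE x in M. f x * g x = f' x * g' x" using assms(1,2) by eventually_elim simp
qed (use assms in auto)

lemma L2_norm_cong_AE:
 assumes "AE x in M. f x = f' x" "f \<in> borel_measurable M" "f' \<in> borel_measurable M"
 shows "L2_norm M f = L2_norm M f'"
 using L2_inner_cong_AE[OF assms(1,1) assms(2,3) assms(2,3)] by (simp add: L2_norm_def)

lemma L2_norm_eq_0_iff:
 assumes "f \<in> L2 M"
 shows "L2_norm M f = 0 \<longleftrightarrow> (AE x in M. f x = 0)"
proof -
 have "L2_norm M f = 0 \<longleftrightarrow> (LINT x|M. (f x)^2) = 0"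
  by (simp add: L2_norm_def L2_inner_self)
 also have "... \<longleftrightarrow> (AE x in M. (f x)^2 = 0)"
  by (rule integral_nonneg_eq_0_iff_AE) (use assms in \<open>auto dest: L2_integrable_sq\<close>)
 finally show ?thesis by simp
qed

lemma L2_cauchy_schwarz:
 assumes "f \<in> L2 M" "g \<in> L2 M"
 shows "abs (L2_inner M f g) <= L2_norm M f * L2_norm M g"
proof (cases "L2_norm M f = 0 \<or> L2_norm M g = 0")
 case True
 then have "AE x in M. f x * g x = 0"
  using L2_norm_eq_0_iff[OF assms(1)] L2_norm_eq_0_iff[OF assms(2)] by (auto elim!: AE_mp)
 then have "L2_inner M f g = (LINT x|M. 0)"
  unfolding L2_inner_def using assms by (intro integral_cong_AE borel_measurable_times L2_measurable[OF assms(1)]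
    L2_measurable[OF assms(2)]) auto
 then show ?thesis by (simp add: L2_norm_nonneg)
next
 case False
 let ?a = "L2_norm M f" and ?b = "L2_norm M g"
 have pos: "?a > 0" "?b > 0" using False L2_norm_nonneg[of M f] L2_norm_nonneg[of M g] by auto
 have quad: "L2_inner M (%x. p * f x + q * g x) (%x. p * f x + q * g x)
   = p * p * L2_inner M f f + 2 * p * q * L2_inner M f g + q * q * L2_inner M g g" for p q
  using assms
  by (simp add: L2_inner_add_left L2_inner_add_right L2_intros L2_inner_scale_left
    L2_inner_scale_right L2_inner_commute[of M g f]) (simp add: algebra_simps)
 have main: "2 * (?a * ?b) * s * L2_inner M f g <= 2 * (?a * ?b) * (?a * ?b)"
  if "abs s = 1" for s
 proof -
  have ss: "s * s = 1" using that by (metis abs_mult_self_eq mult_1)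
  have "0 <= L2_inner M (%x. ?b * f x + (- (s * ?a)) * g x) (%x. ?b * f x + (- (s * ?a)) * g x)"
   by (rule L2_inner_nonneg)
  also have "... = ?b * ?b * L2_inner M f f + (s * s) * ?a * ?a * L2_inner M g g
    - 2 * (?a * ?b) * s * L2_inner M f g"
   unfolding quad by (simp add: algebra_simps)
  also have "... = 2 * (?a * ?b) * (?a * ?b) - 2 * (?a * ?b) * s * L2_inner M f g"
   unfolding ss by (simp add: L2_norm_sq[symmetric] power2_eq_square)
  finally show ?thesis by linarith
 qed
 have "2 * (?a * ?b) > 0" using pos by simp
 then have "s * L2_inner M f g <= ?a * ?b" if "abs s = 1" for s
  using main[OF that] mult_le_cancel_left_pos[of "2 * (?a * ?b)" "s * L2_inner M f g" "?a * ?b"]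
  by (simp only: mult.assoc)
 from this[of 1] this[of "-1"] show ?thesis by simp
qed

lemma L2_norm_triangle:
 assumes "f \<in> L2 M" "g \<in> L2 M"
 shows "L2_norm M (%x. f x + g x) <= L2_norm M f + L2_norm M g"
proof (rule power2_le_imp_le)
 have "(L2_norm M (%x. f x + g x))^2 = (L2_norm M f)^2 + (L2_norm M g)^2 + 2 * L2_inner M f g"
  using assms by (simp add: L2_norm_sq L2_inner_add_left L2_inner_add_right L2_intros
    L2_inner_commute[of M g f])
 also have "... <= (L2_norm M f + L2_norm M g)^2"
  using L2_cauchy_schwarz[OF assms] by (simp add: power2_sum)
 finally show "(L2_norm M (%x. f x + g x))^2 <= (L2_norm M f + L2_norm M g)^2" .
qed (simp add: L2_norm_nonneg)

lemma L2_norm_triangle_diff: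
 assumes "f \<in> L2 M" "g \<in> L2 M" "h \<in> L2 M"
 shows "L2_norm M (%x. f x - h x) <= L2_norm M (%x. f x - g x) + L2_norm M (%x. g x - h x)"
 using L2_norm_triangle[of "%x. f x - g x" M "%x. g x - h x"] assms by (simp add: L2_intros)

lemma L2_norm_triangle_sub:
 assumes "f \<in> L2 M" "g \<in> L2 M"
 shows "L2_norm M f <= L2_norm M g + L2_norm M (%x. f x - g x)"
 using L2_norm_triangle[of g M "%x. f x - g x"] assms by (simp add: L2_intros)

lemma L2_norm_triangle_ineq3:
 assumes "f \<in> L2 M" "g \<in> L2 M"
 shows "abs (L2_norm M f - L2_norm M g) <= L2_norm M (%x. f x - g x)"
 using L2_norm_triangle_sub[OF assms] L2_norm_triangle_sub[OF assms(2,1)]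
 unfolding L2_norm_minus_commute[of M g f] by linarith

lemma L2_norm_mono:
 assumes "f \<in> borel_measurable M" "g \<in> L2 M" "AE x in M. abs (f x) <= abs (g x)"
 shows "L2_norm M f <= L2_norm M g"
 unfolding L2_norm_def L2_inner_self real_sqrt_le_iff
proof (rule integral_mono_AE)
 have "f \<in> L2 M" by (rule L2_bound[where g = g and c = 1]) (use assms in auto)
 then show "integrable M (%x. (f x)^2)" by (rule L2_integrable_sq)
 show "integrable M (%x. (g x)^2)" by (rule L2_integrable_sq) fact
 show "AE x in M. (f x)^2 <= (g x)^2" using assms(3) by eventually_elim (simp add: abs_le_square_iff)
qed

lemma L2_inner_tendsto:
 assumes "\<forall>\<^sub>F n in A. F n \<in> L2 M" "f \<in> L2 M" "\<forall>\<^sub>F n in A. G n \<in> L2 M" "g \<in> L2 M"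
  "((%n. L2_norm M (%x. F n x - f x)) \<longlongrightarrow> 0) A"
  "((%n. L2_norm M (%x. G n x - g x)) \<longlongrightarrow> 0) A"
 shows "((%n. L2_inner M (F n) (G n)) \<longlongrightarrow> L2_inner M f g) A"
proof -
 let ?a = "%n. L2_norm M (%x. F n x - f x)" and ?b = "%n. L2_norm M (%x. G n x - g x)"
 have "((%n. ?a n * ?b n + ?a n * L2_norm M g + L2_norm M f * ?b n) \<longlongrightarrow> 0) A"
  using assms(5,6) by (auto intro!: tendsto_eq_intros)
 moreover have "\<forall>\<^sub>F n in A. norm (L2_inner M (F n) (G n) - L2_inner M f g)
   <= ?a n * ?b n + ?a n * L2_norm M g + L2_norm M f * ?b n"
  using assms(1,3)
 proof eventually_elim
  case (elim n)
  have "L2_inner M (F n) (G n) - L2_inner M f g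
   = L2_inner M (%x. F n x - f x) (%x. G n x - g x) + L2_inner M (%x. F n x - f x) g
    + L2_inner M f (%x. G n x - g x)"
   using assms(2,4) elim by (simp add: L2_inner_diff_left L2_inner_diff_right L2_intros)
  then show ?case
   using L2_cauchy_schwarz[of "%x. F n x - f x" M "%x. G n x - g x"]
    L2_cauchy_schwarz[of "%x. F n x - f x" M g] L2_cauchy_schwarz[of f M "%x. G n x - g x"]
    assms(2,4) elim by (simp add: L2_intros)
 qed
 ultimately have "((%n. L2_inner M (F n) (G n) - L2_inner M f g) \<longlongrightarrow> 0) A"
  by (rule Lim_null_comparison[rotated])
 then show ?thesis by (rule LIM_zero_cancel)
qed

lemma L2_inner_tendsto_left:
 assumes "\<forall>\<^sub>F n in A. F n \<in> L2 M" "f \<in> L2 M" "g \<in> L2 M"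
  "((%n. L2_norm M (%x. F n x - f x)) \<longlongrightarrow> 0) A"
 shows "((%n. L2_inner M (F n) g) \<longlongrightarrow> L2_inner M f g) A"
 using L2_inner_tendsto[OF assms(1,2) _ _ assms(4), of "%n. g" g] assms(3) by (simp add: L2_norm_zero)

lemma L2_norm_tendsto:
 assumes "\<forall>\<^sub>F n in A. F n \<in> L2 M" "f \<in> L2 M" "((%n. L2_norm M (%x. F n x - f x)) \<longlongrightarrow> 0) A"
 shows "((%n. L2_norm M (F n)) \<longlongrightarrow> L2_norm M f) A"
 unfolding L2_norm_def
 by (intro tendsto_real_sqrt L2_inner_tendsto assms)

section \<open>Fatou's lemma and completeness\<close>

lemma integral_Fatou:
 fixes u :: "nat => 'a => real"
 assumes "!!n. integrable M (u n)" "!!n. AE x in M. 0 <= u n x" "v \<in> borel_measurable M"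
  "AE x in M. (%n. u n x) \<longlonglongrightarrow> v x" "\<forall>\<^sub>F n in sequentially. (LINT x|M. u n x) <= B"
 shows "integrable M v" "(LINT x|M. v x) <= B"
proof -
 have nn: "AE x in M. 0 <= v x"
 proof -
  have "AE x in M. ALL n. 0 <= u n x" using assms(2) by (simp add: AE_all_countable)
  then show ?thesis using assms(4)
   by eventually_elim (auto intro: LIMSEQ_le_const)
 qed
 have B: "B >= 0"
 proof -
  obtain n where "(LINT x|M. u n x) <= B" using assms(5) by (auto simp: eventually_sequentially)
  moreover have "0 <= (LINT x|M. u n x)" using assms(2) by (intro integral_nonneg_AE) auto
  ultimately show ?thesis by linarith
 qed
 have "(\<integral>\<^sup>+x. ennreal (v x) \<partial>M) = (\<integral>\<^sup>+x. liminf (%n. ennreal (u n x)) \<partial>M)"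
 proof (rule nn_integral_cong_AE)
  show "AE x in M. ennreal (v x) = liminf (%n. ennreal (u n x))"
   using assms(4)
  proof eventually_elim
   case (elim x)
   then have "(%n. ennreal (u n x)) \<longlonglongrightarrow> ennreal (v x)" by simp
   then show ?case by (intro lim_imp_Liminf[symmetric]) auto
  qed
 qed
 also have "... <= liminf (%n. \<integral>\<^sup>+x. ennreal (u n x) \<partial>M)"
  by (rule nn_integral_liminf) (use assms(1) in auto)
 also have "... = liminf (%n. ennreal (LINT x|M. u n x))"
  using assms(1,2) by (simp add: nn_integral_eq_integral)
 also have "... <= limsup (%n. ennreal (LINT x|M. u n x))"
  by (rule Liminf_le_Limsup) simp
 also have "... <= ennreal B"
  by (rule Limsup_bounded) (use assms(5) in \<open>auto elim!: eventually_mono intro: ennreal_leI\<close>)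
 finally have le: "(\<integral>\<^sup>+x. ennreal (v x) \<partial>M) <= ennreal B" .
 then have "(\<integral>\<^sup>+x. ennreal (v x) \<partial>M) < \<infinity>" by (simp add: order_le_less_trans)
 then show int: "integrable M v" using nn assms(3) by (intro integrableI_nonneg) auto
 show "(LINT x|M. v x) <= B"
  using le nn_integral_eq_integral[OF int nn] B by (simp add: ennreal_le_iff)
qed

lemma L2_Fatou:
 assumes "!!n. F n \<in> L2 M" "f \<in> borel_measurable M" "AE x in M. (%n. F n x) \<longlonglongrightarrow> f x"
  "\<forall>\<^sub>F n in sequentially. L2_norm M (F n) <= B" "0 <= B"
 shows "f \<in> L2 M" "L2_norm M f <= B"
proof -
 have conv: "AE x in M. (%n. (F n x)^2) \<longlonglongrightarrow> (f x)^2"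
  using assms(3) by eventually_elim (rule tendsto_power)
 have ev: "\<forall>\<^sub>F n in sequentially. (LINT x|M. (F n x)^2) <= B^2"
  using assms(4)
 proof eventually_elim
  case (elim n)
  then have "(L2_norm M (F n))^2 <= B^2" by (intro power_mono) (auto simp: L2_norm_nonneg)
  then show ?case by (simp add: L2_norm_sq L2_inner_self)
 qed
 have m: "(%x. (f x)^2) \<in> borel_measurable M" using assms(2) by measurable
 note * = integral_Fatou[OF L2_integrable_sq[OF assms(1)] _ m conv ev, simplified]
 show "f \<in> L2 M" using assms(2) * by (intro L2_I)
 show "L2_norm M f <= B" unfolding L2_norm_def L2_inner_self
  using *(2) assms(5) by (intro real_le_lsqrt) auto
qed

text \<open>A subsequence with increments of norm at most \<open>(1/2)^k\<close> converges almost
  everywhere, and Fatou's lemma bounds the distance of the whole sequence to that limit. On an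
  infinite measure space the norms of the increments do not control their integrals, so monotone
  convergence is applied to weighted squares instead.\<close>

lemma L2_complete:
 assumes F: "!!n. F n \<in> L2 M"
  and cauchy: "!!e. e > 0 ==> EX N. ALL m>=N. ALL n>=N. L2_norm M (%x. F m x - F n x) < e"
 obtains f where "f \<in> L2 M" "(%n. L2_norm M (%x. F n x - f x)) \<longlonglongrightarrow> 0"
proof -
 have "EX N. ALL m>=N. ALL n>=N. L2_norm M (%x. F m x - F n x) < (1/2)^k" for k
  by (rule cauchy) simp
 then obtain N where N: "!!k m n. m >= N k ==> n >= N k ==> L2_norm M (%x. F m x - F n x) < (1/2)^k"
  by metis
 define r where "r k = (MAX j\<in>{..k}. N j) + k" for k
 have rN: "r k >= N k" for k
  unfolding r_def by (rule trans_le_add1) (auto intro: Max_ge)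
 have rmono: "r k <= r (Suc k)" for k
  unfolding r_def by (intro add_mono Max_mono) auto
 have r1: "k <= r k" for k unfolding r_def by simp
 define D where "D k x = F (r (Suc k)) x - F (r k) x" for k x
 have D: "D k \<in> L2 M" for k unfolding D_def using F by (intro L2_intros)
 have Dn: "L2_norm M (D k) <= (1/2)^k" for k
  unfolding D_def using N[of k "r (Suc k)" "r k"] rN[of k] rmono[of k] by (simp add: less_imp_le)
 have Dm: "D k \<in> borel_measurable M" for k using D by (rule L2_measurable)
 \<comment> \<open>The weight \<open>2^k\<close> leaves the integrals summable, because
   \<open>2^k * ((1/2)^k)^2 = (1/2)^k\<close>, and it is just large enough for the
   arithmetic-geometric mean to give \<open>abs (D k x) <= (1/2)^k + 2^k * (D k x)^2\<close>, so
   that the series of increments converges absolutely.\<close>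
 have "(\<integral>\<^sup>+x. (\<Sum>k. ennreal (2^k * (D k x)^2)) \<partial>M) = (\<Sum>k. \<integral>\<^sup>+x. ennreal (2^k * (D k x)^2) \<partial>M)"
  using Dm by (intro nn_integral_suminf) auto
 also have "... <= (\<Sum>k. ennreal ((1/2)^k))"
 proof (rule suminf_le)
  fix k
  have "(\<integral>\<^sup>+x. ennreal (2^k * (D k x)^2) \<partial>M) = ennreal (LINT x|M. 2^k * (D k x)^2)"
   by (rule nn_integral_eq_integral) (use D in \<open>auto dest: L2_integrable_sq\<close>)
  also have "(LINT x|M. 2^k * (D k x)^2) = 2^k * (L2_norm M (D k))^2"
   by (simp add: L2_norm_sq L2_inner_self)
  also have "... <= 2^k * ((1/2)^k)^2"
   using Dn[of k] by (intro mult_left_mono power_mono) (auto simp: L2_norm_nonneg)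
  also have "... = (1/2)^k" by (simp add: power2_eq_square power_one_over)
  finally show "(\<integral>\<^sup>+x. ennreal (2^k * (D k x)^2) \<partial>M) <= ennreal ((1/2)^k)"
   by (simp add: ennreal_leI)
 qed auto
 also have "... < \<infinity>"
  using summable_geometric[of "1/2::real"] by (simp add: suminf_ennreal2)
 finally have "AE x in M. (\<Sum>k. ennreal (2^k * (D k x)^2)) ~= \<infinity>"
  using Dm by (intro nn_integral_PInf_AE) auto
 then have conv: "AE x in M. convergent (%k. F (r k) x)"
 proof eventually_elim
  case (elim x)
  have s: "summable (%k. 2^k * (D k x)^2)"
   by (rule summable_suminf_not_top) (use elim in \<open>auto simp: top_ennreal_def\<close>)
  have "summable (%k. D k x)"
  proof (rule summable_comparison_test'[where N = 0])
   show "summable (%k. (1/2)^k + 2^k * (D k x)^2)" using s by (intro summable_add) auto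
   fix k :: nat
   have "2 * (sqrt ((1/2)^k) * (sqrt (2^k) * abs (D k x))) <= (sqrt ((1/2)^k))^2 + (sqrt (2^k) * abs (D k x))^2"
    using sum_squares_bound[of "sqrt ((1/2)^k)" "sqrt (2^k) * abs (D k x)"] by simp
   moreover have "sqrt ((1/2)^k) * (sqrt (2^k) * abs (D k x)) = abs (D k x)"
    by (simp add: mult.assoc[symmetric] real_sqrt_mult[symmetric] power_mult_distrib[symmetric] del: real_sqrt_power)
   ultimately show "norm (D k x) <= (1/2)^k + 2^k * (D k x)^2"
    by (simp add: power_mult_distrib)
  qed
  then have "convergent (%n. \<Sum>k<n. D k x)" by (simp add: summable_iff_convergent)
  moreover have "(\<Sum>k<n. D k x) = F (r n) x - F (r 0) x" for n
   unfolding D_def by (rule sum_lessThan_telescope)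
  ultimately have "convergent (%n. (F (r n) x - F (r 0) x) + F (r 0) x)"
   by (intro convergent_add) (auto simp: convergent_const)
  then show ?case by simp
 qed
 define f where "f x = lim (%k. F (r k) x)" for x
 have fm: "f \<in> borel_measurable M"
  unfolding f_def using F by (intro borel_measurable_lim_metric) (auto dest: L2_measurable)
 have fl: "AE x in M. (%k. F (r k) x) \<longlonglongrightarrow> f x"
  using conv by eventually_elim (simp add: f_def convergent_LIMSEQ_iff)
 have est: "(%x. F n x - f x) \<in> L2 M & L2_norm M (%x. F n x - f x) <= (1/2)^k" if "n >= N k" for n k
 proof -
  have m: "(%x. F n x - f x) \<in> borel_measurable M" using F[of n] fm by (auto dest: L2_measurable)
  have c: "AE x in M. (%j. F n x - F (r j) x) \<longlonglongrightarrow> F n x - f x"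
   using fl by eventually_elim (intro tendsto_intros)
  have "\<forall>\<^sub>F j in sequentially. L2_norm M (%x. F n x - F (r j) x) <= (1/2)^k"
   unfolding eventually_sequentially
  proof (intro exI allI impI)
   fix j assume "N k <= j"
   then have "N k <= r j" using r1[of j] by linarith
   then show "L2_norm M (%x. F n x - F (r j) x) <= (1/2)^k" using N[OF that] by (simp add: less_imp_le)
  qed
  then show ?thesis using L2_Fatou[of "%j x. F n x - F (r j) x", OF _ m c] F by (auto simp: L2_intros)
 qed
 have "(%x. F (N 0) x - (F (N 0) x - f x)) \<in> L2 M"
  using L2_diff[OF F[of "N 0"], of "%x. F (N 0) x - f x"] est[of 0 "N 0"] by simp
 then have f2: "f \<in> L2 M" by simp
 have "(%n. L2_norm M (%x. F n x - f x)) \<longlonglongrightarrow> 0"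
 proof (rule LIMSEQ_I)
  fix e :: real assume "e > 0"
  then obtain k where k: "(1/2)^k < e" using real_arch_pow_inv[of e "1/2"] by auto
  show "EX no. ALL n>=no. norm (L2_norm M (%x. F n x - f x) - 0) < e"
  proof (intro exI allI impI)
   fix n assume "N k <= n"
   from est[OF this] k show "norm (L2_norm M (%x. F n x - f x) - 0) < e"
    by (simp add: L2_norm_nonneg)
  qed
 qed
 with f2 show thesis by (rule that)
qed

section \<open>Strongly continuous semigroups on square-integrable functions\<close>

text \<open>The strong derivative of a curve of representatives. \<open>L2_norm\<close> is only a
  seminorm on functions, so the limit of the difference quotients is spelled out, and membership in
  \<open>L2 M\<close> is required near \<open>t\<close> because a nonintegrable square would have
  the integral \<open>0\<close>.\<close>

definition L2_deriv :: "'a measure => (real => 'a => real) => real => ('a => real) => bool" where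
 "L2_deriv M U t V \<longleftrightarrow> U t \<in> L2 M & V \<in> L2 M & (\<forall>\<^sub>F s in at t. U s \<in> L2 M) &
   ((%s. L2_norm M (%x. (U s x - U t x) / (s - t) - V x)) \<longlongrightarrow> 0) (at t)"

lemma L2_deriv_tendsto:
 assumes "L2_deriv M U t V"
 shows "((%s. L2_norm M (%x. U s x - U t x)) \<longlongrightarrow> 0) (at t)"
proof (rule Lim_null_comparison)
 let ?N = "%s. L2_norm M (%x. (U s x - U t x) / (s - t) - V x)"
 have "((%s. abs (s - t) * (?N s + L2_norm M V)) \<longlongrightarrow> abs (t - t) * (0 + L2_norm M V)) (at t)"
  using assms unfolding L2_deriv_def by (intro tendsto_intros) auto
 then show "((%s. abs (s - t) * (?N s + L2_norm M V)) \<longlongrightarrow> 0) (at t)" by simp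
 have "\<forall>\<^sub>F s in at t. U s \<in> L2 M & s ~= t"
  using assms unfolding L2_deriv_def by (intro eventually_conj) (auto simp: eventually_at_filter)
 then show "\<forall>\<^sub>F s in at t. norm (L2_norm M (%x. U s x - U t x)) <= abs (s - t) * (?N s + L2_norm M V)"
 proof eventually_elim
  case (elim s)
  have L: "(%x. (U s x - U t x) / (s - t)) \<in> L2 M" "V \<in> L2 M"
   using elim assms unfolding L2_deriv_def by (auto intro!: L2_intros)
  have "L2_norm M (%x. (s - t) * ((U s x - U t x) / (s - t))) <= abs (s - t) * (?N s + L2_norm M V)"
   unfolding L2_norm_scale using L2_norm_triangle_sub[OF L] by (intro mult_left_mono) auto
  then show ?case using elim by (simp add: L2_norm_nonneg)
 qed
qed

lemma L2_deriv_inner: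
 assumes U: "L2_deriv M U t V" and W: "L2_deriv M W t Z"
 shows "DERIV (%s. L2_inner M (U s) (W s)) t :> (L2_inner M V (W t) + L2_inner M (U t) Z)"
proof -
 have L: "U t \<in> L2 M" "V \<in> L2 M" "W t \<in> L2 M" "Z \<in> L2 M"
  using assms by (auto simp: L2_deriv_def)
 have ev: "\<forall>\<^sub>F s in at t. U s \<in> L2 M" "\<forall>\<^sub>F s in at t. W s \<in> L2 M"
  using assms by (auto simp: L2_deriv_def)
 let ?D = "%s x. (U s x - U t x) / (s - t)" and ?E = "%s x. (W s x - W t x) / (s - t)"
 have evD: "\<forall>\<^sub>F s in at t. ?D s \<in> L2 M" using ev(1) by eventually_elim (intro L2_intros L)
 have evE: "\<forall>\<^sub>F s in at t. ?E s \<in> L2 M" using ev(2) by eventually_elim (intro L2_intros L)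
 have "((%s. L2_inner M (?D s) (W s)) \<longlongrightarrow> L2_inner M V (W t)) (at t)"
  using U L2_deriv_tendsto[OF W] by (intro L2_inner_tendsto evD ev L) (auto simp: L2_deriv_def)
 moreover have "((%s. L2_inner M (?E s) (U t)) \<longlongrightarrow> L2_inner M Z (U t)) (at t)"
  using W by (intro L2_inner_tendsto_left evE L) (auto simp: L2_deriv_def)
 ultimately have "((%s. L2_inner M (?D s) (W s) + L2_inner M (?E s) (U t))
   \<longlongrightarrow> L2_inner M V (W t) + L2_inner M Z (U t)) (at t)" by (rule tendsto_add)
 moreover have "\<forall>\<^sub>F s in at t. L2_inner M (?D s) (W s) + L2_inner M (?E s) (U t)
   = (L2_inner M (U s) (W s) - L2_inner M (U t) (W t)) / (s - t)"
  using ev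
 proof eventually_elim
  case (elim s)
  have "?D s = (%x. inverse (s - t) * (U s x - U t x))" "?E s = (%x. inverse (s - t) * (W s x - W t x))"
   by (auto simp: field_simps)
  then show ?case
   using elim L by (simp add: L2_inner_scale_left L2_inner_diff_left)
    (simp add: field_simps L2_inner_commute[of M _ "U t"] L2_inner_diff_right
     flip: add_divide_distrib)
 qed
 ultimately show ?thesis
  unfolding has_field_derivative_iff L2_inner_commute[of M "U t" Z]
  by (rule Lim_transform_eventually)
qed

lemma L2_deriv_const: "g \<in> L2 M ==> L2_deriv M (%s. g) t (%x. 0)"
 by (auto simp: L2_deriv_def L2_zero L2_norm_zero)

lemma L2_inner_const_zero: "L2_inner M g (%x. 0) = 0"
 by (simp add: L2_inner_def)

text \<open>The first-order Taylor estimate for \<open>\<Phi>\<close> makes the remainder quadratic in the \<open>L\<^sup>2\<close> norm.\<close>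

lemma L2_deriv_integral:
 fixes \<Phi> \<Psi> :: "real => real"
 assumes U: "L2_deriv M U t V"
  and taylor: "!!a b. \<bar>\<Phi> b - \<Phi> a - \<Psi> a * (b - a)\<bar> <= (b - a)^2"
  and int: "!!f. f \<in> L2 M ==> integrable M (%x. \<Phi> (f x))" "!!f. f \<in> L2 M ==> (%x. \<Psi> (f x)) \<in> L2 M"
 shows "DERIV (%s. LINT x|M. \<Phi> (U s x)) t :> L2_inner M (%x. \<Psi> (U t x)) V"
proof -
 have L: "U t \<in> L2 M" "V \<in> L2 M" "(%x. \<Psi> (U t x)) \<in> L2 M"
  using assms by (auto simp: L2_deriv_def)
 have ev: "\<forall>\<^sub>F s in at t. U s \<in> L2 M & s ~= t"
  using assms unfolding L2_deriv_def by (intro eventually_conj) (auto simp: eventually_at_filter)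
 let ?N = "%s. L2_norm M (%x. (U s x - U t x) / (s - t) - V x)"
 let ?m = "%s. L2_norm M (%x. U s x - U t x)"
 let ?g = "%s. L2_norm M (%x. \<Psi> (U t x)) * ?N s + (?N s + L2_norm M V) * ?m s"
 have "((%s. ((LINT x|M. \<Phi> (U s x)) - (LINT x|M. \<Phi> (U t x))) / (s - t) - L2_inner M (%x. \<Psi> (U t x)) V)
   \<longlongrightarrow> 0) (at t)"
 proof (rule Lim_null_comparison)
  have "(?g \<longlongrightarrow> L2_norm M (%x. \<Psi> (U t x)) * 0 + (0 + L2_norm M V) * 0) (at t)"
   using U L2_deriv_tendsto[OF U] by (intro tendsto_intros) (auto simp: L2_deriv_def)
  then show "(?g \<longlongrightarrow> 0) (at t)" by simp
  show "\<forall>\<^sub>F s in at t. norm (((LINT x|M. \<Phi> (U s x)) - (LINT x|M. \<Phi> (U t x))) / (s - t)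
    - L2_inner M (%x. \<Psi> (U t x)) V) <= ?g s"
   using ev
  proof eventually_elim
   case (elim s)
   then have Ls: "U s \<in> L2 M" and ne: "s - t ~= 0" by auto
   let ?D = "%x. (U s x - U t x) / (s - t)"
   have LD: "?D \<in> L2 M" "(%x. U s x - U t x) \<in> L2 M" by (intro L2_intros Ls L)+
   let ?R = "%x. \<Phi> (U s x) - \<Phi> (U t x) - \<Psi> (U t x) * (U s x - U t x)"
   have iR: "integrable M ?R"
    by (intro Bochner_Integration.integrable_diff int L2_mult_integrable Ls L LD)
   have "abs (LINT x|M. ?R x) <= (LINT x|M. abs (?R x))" by (rule integral_abs_bound)
   also have "... <= (LINT x|M. (U s x - U t x)^2)"
    using iR LD(2) taylor by (intro integral_mono integrable_abs L2_integrable_sq) auto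
   also have "... = ?m s * ?m s"
    using L2_norm_sq[of M "%x. U s x - U t x"] by (simp add: L2_inner_self power2_eq_square)
   finally have R: "abs (LINT x|M. ?R x) <= ?m s * ?m s" .
   have ms: "?m s <= abs (s - t) * (?N s + L2_norm M V)"
   proof -
    have "L2_norm M (%x. (s - t) * ?D x) <= abs (s - t) * (?N s + L2_norm M V)"
     unfolding L2_norm_scale using L2_norm_triangle_sub[OF LD(1) L(2)] by (intro mult_left_mono) auto
    then show ?thesis using ne by simp
   qed
   have split: "((LINT x|M. \<Phi> (U s x)) - (LINT x|M. \<Phi> (U t x)))
     = (LINT x|M. ?R x) + (s - t) * L2_inner M (%x. \<Psi> (U t x)) ?D"
   proof -
    have "(s - t) * L2_inner M (%x. \<Psi> (U t x)) ?D
      = L2_inner M (%x. \<Psi> (U t x)) (%x. (s - t) * ?D x)"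
     by (rule L2_inner_scale_right[symmetric])
    also have "... = (LINT x|M. \<Psi> (U t x) * (U s x - U t x))"
     unfolding L2_inner_def using ne by simp
    finally show ?thesis
     using int(1)[OF Ls] int(1)[OF L(1)] L2_mult_integrable[OF L(3) LD(2)] by simp
   qed
   have R2: "abs (LINT x|M. ?R x) / abs (s - t) <= (?N s + L2_norm M V) * ?m s"
   proof -
    have "abs (LINT x|M. ?R x) <= (abs (s - t) * (?N s + L2_norm M V)) * ?m s"
     by (rule order_trans[OF R mult_right_mono[OF ms L2_norm_nonneg]])
    then have "abs (LINT x|M. ?R x) <= ((?N s + L2_norm M V) * ?m s) * abs (s - t)"
     by (simp only: mult_ac)
    moreover have "abs (s - t) > 0" using ne by simp
    ultimately show ?thesis by (rule pos_divide_le_eq[THEN iffD2, rotated])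
   qed
   have eq: "((LINT x|M. \<Phi> (U s x)) - (LINT x|M. \<Phi> (U t x))) / (s - t) - L2_inner M (%x. \<Psi> (U t x)) V
     = L2_inner M (%x. \<Psi> (U t x)) (%x. ?D x - V x) + (LINT x|M. ?R x) / (s - t)"
    unfolding split using ne L LD by (simp add: L2_inner_diff_right add_divide_distrib)
   show ?case
    unfolding eq real_norm_def
    by (rule order_trans[OF abs_triangle_ineq add_mono[OF
       L2_cauchy_schwarz[OF L(3) L2_diff[OF LD(1) L(2)]] R2[folded abs_divide]]])
  qed
 qed
 then show ?thesis unfolding has_field_derivative_iff by (rule LIM_zero_cancel)
qed

text \<open>Strong continuity and the generator are one-sided limits at \<open>0\<close>. By the
  semigroup law the increments between \<open>s\<close> and \<open>t\<close> depend on
  \<open>abs (s - t)\<close>, and this filter turns the limits at \<open>0\<close> into two-sided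
  ones at \<open>t\<close>.\<close>

lemma filterlim_abs_diff: "filterlim (%s. abs (s - t)) (at_right 0) (at t within A)" for t :: real
 unfolding filterlim_at
proof
 have "((%s. abs (s - t)) \<longlongrightarrow> abs (t - t)) (at t within A)" by (intro tendsto_intros)
 then show "filterlim (%s. abs (s - t)) (nhds 0) (at t within A)" by simp
qed (auto simp: eventually_at_filter)

section \<open>Boundedness, continuity and differentiability of orbits\<close>

locale c0_semigroup =
 fixes M :: "'a measure" and S :: "real => ('a => real) => 'a => real"
 assumes C0: "C0_semigroup M S"
begin

lemma S_L2 [intro]: "t >= 0 ==> f \<in> L2 M ==> S t f \<in> L2 M"
 using C0 by (auto simp: C0_semigroup_def)

lemma S_lin: "t >= 0 ==> f \<in> L2 M ==> g \<in> L2 M ==>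
  AE x in M. S t (%z. a * f z + b * g z) x = a * S t f x + b * S t g x"
 using C0 by (auto simp: C0_semigroup_def)

lemma S_bounded: "t >= 0 ==> EX K. \<forall>f\<in>L2 M. L2_norm M (S t f) <= K * L2_norm M f"
 using C0 by (auto simp: C0_semigroup_def)

lemma S_zero: "f \<in> L2 M ==> AE x in M. S 0 f x = f x"
 using C0 by (auto simp: C0_semigroup_def)

lemma S_plus: "s >= 0 ==> t >= 0 ==> f \<in> L2 M ==> AE x in M. S (s + t) f x = S s (S t f) x"
 using C0 by (auto simp: C0_semigroup_def)

lemma S_cont0: "f \<in> L2 M ==> ((%t. L2_norm M (%x. S t f x - f x)) \<longlongrightarrow> 0) (at_right 0)"
 using C0 by (auto simp: C0_semigroup_def)

lemma S_diff: "t >= 0 ==> f \<in> L2 M ==> g \<in> L2 M ==> AE x in M. S t (%z. f z - g z) x = S t f x - S t g x"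
 using S_lin[of t f g 1 "-1"] by simp

lemma S_scale: "t >= 0 ==> f \<in> L2 M ==> AE x in M. S t (%z. a * f z) x = a * S t f x"
 using S_lin[of t f f a 0] by simp

lemma S_cong:
 assumes "t >= 0" "f \<in> L2 M" "g \<in> L2 M" "AE x in M. f x = g x"
 shows "AE x in M. S t f x = S t g x"
proof -
 obtain K where K: "!!f. f \<in> L2 M ==> L2_norm M (S t f) <= K * L2_norm M f"
  using S_bounded[OF assms(1)] by auto
 have d: "(%z. f z - g z) \<in> L2 M" by (intro L2_intros assms)
 then have "L2_norm M (%z. f z - g z) = 0" using assms(4) by (subst L2_norm_eq_0_iff) auto
 then have "L2_norm M (S t (%z. f z - g z)) = 0"
  using K[OF d] L2_norm_nonneg[of M "S t (%z. f z - g z)"] by simp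
 then have "AE x in M. S t (%z. f z - g z) x = 0"
  using L2_norm_eq_0_iff[OF S_L2[OF assms(1) d]] by simp
 then show ?thesis using S_diff[OF assms(1-3)] by eventually_elim simp
qed

text \<open>Uniform boundedness near \<open>0\<close> by a gliding hump: if it failed, one could sum \<open>3\<^sup>-\<^sup>n\<close> times
  almost extremal unit vectors of \<open>S t\<^sub>n\<close>, with signs chosen so that no cancellation occurs.\<close>

lemma S_bounded_near_0: "\<exists>\<delta>>0. EX K. \<forall>t\<in>{0..\<delta>}. \<forall>f\<in>L2 M. L2_norm M (S t f) <= K * L2_norm M f"
proof (rule ccontr)
 assume neg: "~ ?thesis"
 have "EX t e K. 0 <= t & t <= 1 / real (Suc n) & e \<in> L2 M & L2_norm M e = 1 & 4 ^ n <= K &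
   (\<forall>f\<in>L2 M. L2_norm M (S t f) <= K * L2_norm M f) & 3 / 4 * K <= L2_norm M (S t e)" for n
 proof -
  obtain t f where t: "0 <= t" "t <= 1 / real (Suc n)" and f: "f \<in> L2 M"
   and big: "L2_norm M (S t f) > 4 ^ n * L2_norm M f"
  proof -
   have "~ (\<forall>t\<in>{0..1 / real (Suc n)}. \<forall>f\<in>L2 M. L2_norm M (S t f) <= 4 ^ n * L2_norm M f)"
    using neg by (auto simp del: of_nat_Suc)
   then show ?thesis using that by (auto simp: not_le)
  qed
  define bd where "bd K \<longleftrightarrow> (\<forall>f\<in>L2 M. L2_norm M (S t f) <= K * L2_norm M f)" for K
  obtain K0 where K0: "bd K0" using S_bounded[OF t(1)] unfolding bd_def by auto
  have bd_mono: "bd K'" if "bd K" "K <= K'" for K K'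
   using that unfolding bd_def by (meson L2_norm_nonneg mult_right_mono order_trans)
  have n4: "~ bd (4 ^ n)" using f big unfolding bd_def by (auto simp: not_le intro!: bexI[of _ f])
  \<comment> \<open>An almost optimal bound is found by descent: a bound is multiplied by
    \<open>3/4\<close> until it ceases to be one. The last bound \<open>K\<close> has the property
    that \<open>3 / 4 * K\<close> fails for some \<open>g\<close>, and normalising this
    \<open>g\<close> gives the almost extremal unit vector.\<close>
  obtain j where "(3/4::real) ^ j < 4 ^ n / (abs K0 + 1)"
   using real_arch_pow_inv[of "4 ^ n / (abs K0 + 1)" "3/4::real"] by (auto simp: add_nonneg_pos)
  then have "(abs K0 + 1) * (3/4) ^ j < 4 ^ n" by (simp add: field_simps add_nonneg_pos)
  then have ex: "~ bd ((abs K0 + 1) * (3/4) ^ j)" using n4 bd_mono less_imp_le by blast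
  define i where "i = (LEAST j. ~ bd ((abs K0 + 1) * (3/4) ^ j))"
  have i: "~ bd ((abs K0 + 1) * (3/4) ^ i)" unfolding i_def using ex by (rule LeastI)
  have "bd (abs K0 + 1)" using K0 by (rule bd_mono) auto
  then have "i ~= 0" using i by (cases i) auto
  then obtain i' where i': "i = Suc i'" by (cases i) auto
  define K where "K = (abs K0 + 1) * (3/4) ^ i'"
  have bK: "bd K" using not_less_Least[of i' "%j. ~ bd ((abs K0 + 1) * (3/4) ^ j)"] i'
   unfolding K_def i_def by auto
  have nK: "~ bd (3 / 4 * K)" using i unfolding i' K_def by (simp add: mult_ac)
  have K4: "4 ^ n <= K" using n4 bK bd_mono[of K "4 ^ n"] by force
  from nK obtain g where g: "g \<in> L2 M" "L2_norm M (S t g) > 3 / 4 * K * L2_norm M g"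
   unfolding bd_def by (auto simp: not_le)
  have "L2_norm M (S t g) <= K * L2_norm M g" using bK g(1) unfolding bd_def by auto
  have gn: "L2_norm M g > 0"
  proof (rule ccontr)
   assume "~ ?thesis"
   then have "L2_norm M g = 0" using L2_norm_nonneg[of M g] by simp
   then show False using g(2) \<open>L2_norm M (S t g) <= K * L2_norm M g\<close> by simp
  qed
  define e where "e = (%x. inverse (L2_norm M g) * g x)"
  have e: "e \<in> L2 M" unfolding e_def by (intro L2_intros g)
  have en: "L2_norm M e = 1" unfolding e_def L2_norm_scale using gn by simp
  have "AE x in M. S t e x = inverse (L2_norm M g) * S t g x"
   unfolding e_def by (rule S_scale[OF t(1) g(1)])
  then have "L2_norm M (S t e) = L2_norm M (%x. inverse (L2_norm M g) * S t g x)"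
   using S_L2[OF t(1) e] S_L2[OF t(1) g(1)] by (intro L2_norm_cong_AE) auto
  then have "L2_norm M (S t e) = inverse (L2_norm M g) * L2_norm M (S t g)"
   unfolding L2_norm_scale using gn by simp
  then have "3 / 4 * K <= L2_norm M (S t e)"
  proof -
   have "L2_norm M (S t e) * L2_norm M g = L2_norm M (S t g)"
    using gn \<open>L2_norm M (S t e) = inverse (L2_norm M g) * L2_norm M (S t g)\<close> by simp
   with g(2) have "3 / 4 * K * L2_norm M g < L2_norm M (S t e) * L2_norm M g" by linarith
   then show ?thesis using gn by (simp add: mult_less_cancel_right)
  qed
  with t e en K4 bK show ?thesis unfolding bd_def by blast
 qed
 then obtain t e K where t: "!!n. 0 <= t n" "!!n. t n <= 1 / real (Suc n)"
  and e: "!!n. e n \<in> L2 M" "!!n. L2_norm M (e n) = 1"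
  and K: "!!n. 4 ^ n <= K n" "!!n f. f \<in> L2 M ==> L2_norm M (S (t n) f) <= K n * L2_norm M f"
   "!!n. 3 / 4 * K n <= L2_norm M (S (t n) (e n))"
  by metis
 define step where "step n f \<sigma> = (%x. f x + (\<sigma> * (1/3) ^ n) * e n x)" for n f and \<sigma> :: real
 have step_L2: "step n f \<sigma> \<in> L2 M" if "f \<in> L2 M" for n f \<sigma>
  unfolding step_def by (intro L2_intros that e)
 \<comment> \<open>The images of the two candidates differ by
   \<open>2 * (1/3) ^ n * S (t n) (e n)\<close>, so at least one of them has half that norm.\<close>
 have ex: "\<exists>\<sigma>\<in>{1,-1}. L2_norm M (S (t n) (step n f \<sigma>)) >= (1/3) ^ n * (3 / 4 * K n)"
  if f: "f \<in> L2 M" for n f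
 proof -
  have St: "AE x in M. S (t n) (step n f \<sigma>) x = S (t n) f x + (\<sigma> * (1/3) ^ n) * S (t n) (e n) x" for \<sigma>
   using S_lin[OF t(1) f e(1), of n 1 "\<sigma> * (1/3)^n"] unfolding step_def by simp
  have L: "S (t n) (step n f \<sigma>) \<in> L2 M" for \<sigma> by (intro S_L2 t step_L2 f)
  have "AE x in M. S (t n) (step n f 1) x - S (t n) (step n f (-1)) x = 2 * (1/3) ^ n * S (t n) (e n) x"
   using St[of 1] St[of "-1"] by eventually_elim (simp add: algebra_simps)
  then have "L2_norm M (%x. S (t n) (step n f 1) x - S (t n) (step n f (-1)) x)
    = L2_norm M (%x. 2 * (1/3) ^ n * S (t n) (e n) x)"
   using L S_L2[OF t(1) e(1)] by (intro L2_norm_cong_AE) auto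
  also have "... = 2 * (1/3) ^ n * L2_norm M (S (t n) (e n))"
   unfolding L2_norm_scale by simp
  finally have "2 * (1/3) ^ n * L2_norm M (S (t n) (e n))
    <= L2_norm M (S (t n) (step n f 1)) + L2_norm M (S (t n) (step n f (-1)))"
   using L2_norm_triangle[OF L[of 1] L2_uminus[OF L[of "-1"]]] by (simp add: L2_norm_uminus)
  moreover have "(1/3) ^ n * (3 / 4 * K n) <= (1/3) ^ n * L2_norm M (S (t n) (e n))"
   using K(3) by (intro mult_left_mono) auto
  ultimately have "(1/3) ^ n * (3 / 4 * K n) <= L2_norm M (S (t n) (step n f 1)) \<or>
    (1/3) ^ n * (3 / 4 * K n) <= L2_norm M (S (t n) (step n f (-1)))" by linarith
  then show ?thesis by blast
 qed
 define sg where "sg n f = (SOME \<sigma>. \<sigma> \<in> {1,-1} & L2_norm M (S (t n) (step n f \<sigma>)) >= (1/3) ^ n * (3 / 4 * K n))" for n f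
 have sg: "sg n f \<in> {1,-1}" "L2_norm M (S (t n) (step n f (sg n f))) >= (1/3) ^ n * (3 / 4 * K n)"
  if "f \<in> L2 M" for n f
  using someI_ex[of "%\<sigma>. \<sigma> \<in> {1,-1} & L2_norm M (S (t n) (step n f \<sigma>)) >= (1/3) ^ n * (3 / 4 * K n)"]
   ex[OF that] unfolding sg_def by auto
 define X where "X = rec_nat (%x. 0) (%n f. step n f (sg n f))"
 have X_Suc: "X (Suc n) = step n (X n) (sg n (X n))" for n by (simp add: X_def)
 have X: "X n \<in> L2 M" for n
 proof (induction n)
  case 0 then show ?case by (simp add: X_def L2_zero)
 next
  case (Suc n) then show ?case unfolding X_Suc by (intro step_L2)
 qed
 have dX: "L2_norm M (%x. X (Suc n) x - X n x) = (1/3) ^ n" for n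
 proof -
  have "(%x. X (Suc n) x - X n x) = (%x. (sg n (X n) * (1/3) ^ n) * e n x)"
   unfolding X_Suc step_def by auto
  moreover have "abs (sg n (X n)) = 1" using sg(1)[OF X[of n], of n] by auto
  ultimately show ?thesis by (simp add: L2_norm_scale e abs_mult)
 qed
 have tail: "L2_norm M (%x. X (n + k) x - X n x) <= 3 / 2 * (1/3) ^ n * (1 - (1/3) ^ k)" for n k
 proof (induction k)
  case 0 then show ?case by (simp add: L2_norm_zero)
 next
  case (Suc k)
  have "L2_norm M (%x. X (n + Suc k) x - X n x) <= (1/3) ^ (n + k) + L2_norm M (%x. X (n + k) x - X n x)"
   using L2_norm_triangle_diff[OF X[of "Suc (n + k)"] X[of "n + k"] X[of n]] dX[of "n + k"] by simp
  also have "... <= (1/3) ^ (n + k) + 3 / 2 * (1/3) ^ n * (1 - (1/3) ^ k)" using Suc by simp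
  also have "... = 3 / 2 * (1/3) ^ n * (1 - (1/3) ^ Suc k)"
   by (simp add: power_add field_simps)
  finally show ?case .
 qed
 have tail': "L2_norm M (%x. X m x - X n x) <= 3 / 2 * (1/3) ^ n" if "n <= m" for m n
 proof -
  have "L2_norm M (%x. X m x - X n x) <= 3 / 2 * (1/3) ^ n * (1 - (1/3) ^ (m - n))"
   using tail[of n "m - n"] that by simp
  also have "... <= 3 / 2 * (1/3) ^ n * 1" by (intro mult_left_mono) auto
  finally show ?thesis by simp
 qed
 obtain Y where Y: "Y \<in> L2 M" "(%n. L2_norm M (%x. X n x - Y x)) \<longlonglongrightarrow> 0"
 proof (rule L2_complete[of X M])
  fix \<epsilon> :: real assume "\<epsilon> > 0"
  then obtain N where N: "(1/3::real) ^ N < \<epsilon> / 3" using real_arch_pow_inv[of "\<epsilon> / 3" "1/3"] by auto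
  show "EX N. ALL m>=N. ALL n>=N. L2_norm M (%x. X m x - X n x) < \<epsilon>"
  proof (intro exI allI impI)
   fix m n assume "N <= m" "N <= n"
   have "L2_norm M (%x. X m x - X n x) <= L2_norm M (%x. X m x - X N x) + L2_norm M (%x. X N x - X n x)"
    by (intro L2_norm_triangle_diff X)
   also have "... <= 3 / 2 * (1/3) ^ N + 3 / 2 * (1/3) ^ N"
    using tail'[OF \<open>N <= m\<close>] tail'[OF \<open>N <= n\<close>] unfolding L2_norm_minus_commute[of M "X N"] by simp
   finally show "L2_norm M (%x. X m x - X n x) < \<epsilon>" using N by linarith
  qed
 qed (use X in auto)
 \<comment> \<open>The remaining corrections add up to \<open>(1/3) ^ n * (1/3 + 1/9 + ...)\<close>,
   that is, half of the \<open>n\<close>-th one.\<close>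
 have Ytail: "L2_norm M (%x. Y x - X (Suc n) x) <= 1 / 2 * (1/3) ^ n" for n
 proof (rule LIMSEQ_le_const)
  have "(%m. L2_norm M (%x. X m x - Y x) + 1 / 2 * (1/3) ^ n) \<longlonglongrightarrow> 0 + 1 / 2 * (1/3) ^ n"
   by (intro tendsto_intros Y)
  then show "(%m. L2_norm M (%x. X m x - Y x) + 1 / 2 * (1/3) ^ n) \<longlonglongrightarrow> 1 / 2 * (1/3) ^ n" by simp
  show "EX N. ALL m>=N. L2_norm M (%x. Y x - X (Suc n) x) <= L2_norm M (%x. X m x - Y x) + 1 / 2 * (1/3) ^ n"
  proof (intro exI allI impI)
   fix m assume "Suc n <= m"
   have "L2_norm M (%x. Y x - X (Suc n) x) <= L2_norm M (%x. Y x - X m x) + L2_norm M (%x. X m x - X (Suc n) x)"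
    by (intro L2_norm_triangle_diff X Y)
   then show "L2_norm M (%x. Y x - X (Suc n) x) <= L2_norm M (%x. X m x - Y x) + 1 / 2 * (1/3) ^ n"
    using tail'[OF \<open>Suc n <= m\<close>] unfolding L2_norm_minus_commute[of M Y] by simp
  qed
 qed
 \<comment> \<open>The step chosen at stage \<open>n\<close> contributes \<open>3 / 4\<close> of
   \<open>K n * (1/3) ^ n\<close> and the tail can destroy at most \<open>1 / 2\<close> of it. Since
   \<open>K n >= 4 ^ n\<close>, what is left grows like \<open>(4/3) ^ n\<close>, although
   \<open>t n\<close> tends to \<open>0\<close>; this contradicts strong continuity at
   \<open>Y\<close>.\<close>
 have low: "L2_norm M (S (t n) Y) >= 1 / 4 * (4/3) ^ n" for n
 proof -
  have K0: "0 <= K n" using K(1)[of n] by (meson order_trans zero_le_numeral zero_le_power)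
  have dL: "(%x. Y x - X (Suc n) x) \<in> L2 M" by (intro L2_intros X Y)
  have "L2_norm M (%x. S (t n) Y x - S (t n) (X (Suc n)) x) = L2_norm M (S (t n) (%x. Y x - X (Suc n) x))"
   using S_diff[OF t(1) Y(1) X, of n "Suc n"] S_L2[OF t(1) Y(1)] S_L2[OF t(1) X] S_L2[OF t(1) dL]
   by (intro L2_norm_cong_AE) (auto elim!: AE_mp)
  also have "... <= K n * L2_norm M (%x. Y x - X (Suc n) x)" by (rule K(2)[OF dL])
  also have "... <= K n * (1 / 2 * (1/3) ^ n)" by (intro mult_left_mono Ytail K0)
  finally have 1: "L2_norm M (%x. S (t n) Y x - S (t n) (X (Suc n)) x) <= K n * (1 / 2 * (1/3) ^ n)" .
  have "L2_norm M (S (t n) (X (Suc n))) >= (1/3) ^ n * (3 / 4 * K n)"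
   unfolding X_Suc by (rule sg(2)[OF X])
  then have "L2_norm M (S (t n) (X (Suc n))) >= 3 / 4 * (K n * (1/3) ^ n)" by (simp add: mult.commute)
  moreover have "L2_norm M (%x. S (t n) Y x - S (t n) (X (Suc n)) x) <= 1 / 2 * (K n * (1/3) ^ n)"
   using 1 by simp
  ultimately have "L2_norm M (S (t n) Y) >= 1 / 4 * (K n * (1/3) ^ n)"
   using L2_norm_triangle_ineq3[OF S_L2[OF t(1) Y(1)] S_L2[OF t(1) X], of n n "Suc n"] by linarith
  moreover have "4 ^ n * (1/3) ^ n <= K n * (1/3::real) ^ n" using K(1) by (intro mult_right_mono) auto
  moreover have "4 ^ n * (1/3) ^ n = (4/3::real) ^ n" by (simp flip: power_mult_distrib)
  ultimately show ?thesis by simp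
 qed
 have "\<forall>\<^sub>F h in at_right 0. L2_norm M (%x. S h Y x - Y x) < 1"
  using order_tendstoD(2)[OF S_cont0[OF Y(1)], of 1] by simp
 then obtain \<delta> where \<delta>: "\<delta> > 0" "!!h. 0 < h ==> h < \<delta> ==> L2_norm M (%x. S h Y x - Y x) < 1"
  unfolding eventually_at_right_field by auto
 have up: "L2_norm M (S h Y) <= L2_norm M Y + 1" if "0 <= h" "h < \<delta>" for h
 proof (cases "h = 0")
  case True
  have "L2_norm M (S 0 Y) = L2_norm M Y"
   using S_zero[OF Y(1)] S_L2[OF order_refl Y(1)] Y(1) by (intro L2_norm_cong_AE) auto
  then show ?thesis using True by simp
 next
  case False
  then show ?thesis using \<delta>(2)[of h] that L2_norm_triangle_sub[OF S_L2[OF that(1) Y(1)] Y(1)] by simp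
 qed
 obtain n0 where n0: "1 / real (Suc n0) < \<delta>" using nat_approx_posE[OF \<delta>(1)] by auto
 obtain n1 where n1: "4 * (L2_norm M Y + 1) < (4/3::real) ^ n1"
  using real_arch_pow[of "4/3::real"] by auto
 define n where "n = max n0 n1"
 have "1 / real (Suc n) <= 1 / real (Suc n0)" unfolding n_def by (intro divide_left_mono) auto
 then have "t n < \<delta>" using t(2)[of n] n0 by linarith
 then have "L2_norm M (S (t n) Y) <= L2_norm M Y + 1" by (rule up[OF t(1)])
 moreover have "4 * (L2_norm M Y + 1) < (4/3::real) ^ n"
  by (rule less_le_trans[OF n1]) (auto simp: n_def intro!: power_increasing)
 moreover have "(4/3) ^ n <= 4 * L2_norm M (S (t n) Y)" using low[of n] by simp
 ultimately show False by (meson less_le_trans mult_le_cancel_left_pos not_le zero_less_numeral)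
qed

lemma S_bounded_on:
 obtains K where "K >= 0" "!!t f. 0 <= t ==> t <= T ==> f \<in> L2 M ==> L2_norm M (S t f) <= K * L2_norm M f"
proof -
 obtain \<delta> K0 where \<delta>: "\<delta> > 0" and K0: "!!t f. 0 <= t ==> t <= \<delta> ==> f \<in> L2 M ==> L2_norm M (S t f) <= K0 * L2_norm M f"
  using S_bounded_near_0 by (meson atLeastAtMost_iff)
 define K where "K = max K0 1"
 have K: "L2_norm M (S t f) <= K * L2_norm M f" if "0 <= t" "t <= \<delta>" "f \<in> L2 M" for t f
  using K0[OF that] mult_right_mono[of K0 K "L2_norm M f"] L2_norm_nonneg[of M f] unfolding K_def by simp
 have K1: "K >= 1" unfolding K_def by simp
 have main: "0 <= t ==> t <= real m * \<delta> ==> f \<in> L2 M ==> L2_norm M (S t f) <= K ^ m * L2_norm M f" for m t f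
 proof (induction m arbitrary: t)
  case 0
  then have "t = 0" by simp
  have "L2_norm M (S 0 f) = L2_norm M f"
   using S_zero[OF 0(3)] S_L2[OF order_refl 0(3)] 0(3) by (intro L2_norm_cong_AE) auto
  then show ?case using \<open>t = 0\<close> by simp
 next
  case (Suc m)
  define s where "s = max 0 (t - \<delta>)"
  have s: "0 <= s" "s <= real m * \<delta>" "0 <= t - s" "t - s <= \<delta>"
   using Suc.prems \<delta> by (auto simp: s_def algebra_simps)
  have "L2_norm M (S t f) = L2_norm M (S (t - s) (S s f))"
   using S_plus[OF s(3,1) Suc.prems(3)] Suc.prems s by (intro L2_norm_cong_AE) (auto intro!: L2_measurable S_L2)
  also have "... <= K * L2_norm M (S s f)" using s Suc.prems by (intro K S_L2) auto
  also have "... <= K * (K ^ m * L2_norm M f)" using s Suc K1 by (intro mult_left_mono Suc.IH) auto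
  finally show ?case by (simp add: mult_ac)
 qed
 obtain m where "T / \<delta> < real m" using reals_Archimedean2 by auto
 then have m: "T <= real m * \<delta>" using \<delta> by (simp add: field_simps)
 show thesis
 proof (rule that)
  show "K ^ m >= 0" using K1 by simp
  show "L2_norm M (S t f) <= K ^ m * L2_norm M f" if "0 <= t" "t <= T" "f \<in> L2 M" for t f
   using that m by (intro main) auto
 qed
qed

text \<open>For \<open>r <= s\<close> the difference equals \<open>S r\<close> applied to
  \<open>S (s - r) f - f\<close>. With the uniform bound on \<open>S r\<close> near
  \<open>t\<close>, the right continuity at \<open>0\<close> serves for the approach from either
  side.\<close>

lemma S_continuous:
 assumes "t >= 0" "f \<in> L2 M"
 shows "((%s. L2_norm M (%x. S s f x - S t f x)) \<longlongrightarrow> 0) (at t within {0..})"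
proof -
 obtain K where K: "K >= 0" "!!s f. 0 <= s ==> s <= t + 1 ==> f \<in> L2 M ==> L2_norm M (S s f) <= K * L2_norm M f"
  using S_bounded_on[of "t + 1"] by metis
 let ?\<phi> = "%h. L2_norm M (%x. S h f x - f x)"
 have est: "L2_norm M (%x. S s f x - S r f x) <= K * ?\<phi> (s - r)" if "0 <= r" "r <= s" "s <= t + 1" for r s
 proof -
  have L: "S (s - r) f \<in> L2 M" "(%x. S (s - r) f x - f x) \<in> L2 M" "S s f \<in> L2 M" "S r f \<in> L2 M"
   using that assms by (auto intro!: L2_intros)
  have "AE x in M. S s f x = S r (S (s - r) f) x"
   using S_plus[of r "s - r" f] that assms by simp
  moreover have "AE x in M. S r (%x. S (s - r) f x - f x) x = S r (S (s - r) f) x - S r f x"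
   by (rule S_diff[OF that(1) L(1) assms(2)])
  ultimately have "AE x in M. S s f x - S r f x = S r (%x. S (s - r) f x - f x) x"
   by eventually_elim simp
  then have "L2_norm M (%x. S s f x - S r f x) = L2_norm M (S r (%x. S (s - r) f x - f x))"
   using L S_L2[OF that(1) L(2)] by (intro L2_norm_cong_AE) auto
  also have "... <= K * ?\<phi> (s - r)" using that by (intro K L) auto
  finally show ?thesis .
 qed
 show ?thesis
 proof (rule Lim_null_comparison)
  have "((%s. ?\<phi> (abs (s - t))) \<longlongrightarrow> 0) (at t within {0..})"
   by (rule filterlim_compose[OF S_cont0[OF assms(2)] filterlim_abs_diff])
  then have "((%s. K * ?\<phi> (abs (s - t))) \<longlongrightarrow> K * 0) (at t within {0..})" by (intro tendsto_intros)
  then show "((%s. K * ?\<phi> (abs (s - t))) \<longlongrightarrow> 0) (at t within {0..})" by simp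
  have "\<forall>\<^sub>F s in at t within {0..}. s \<in> {0..} & s < t + 1"
   using order_tendstoD(2)[OF tendsto_ident_at, of t "t + 1" "{0..}"]
   by (intro eventually_conj) (auto simp: eventually_at_filter)
  then show "\<forall>\<^sub>F s in at t within {0..}. norm (L2_norm M (%x. S s f x - S t f x)) <= K * ?\<phi> (abs (s - t))"
  proof eventually_elim
   case (elim s)
   show ?case
   proof (cases "t <= s")
    case True then show ?thesis using est[of t s] elim assms by (simp add: L2_norm_nonneg)
   next
    case False
    then show ?thesis using est[of s t] elim assms
     by (simp add: L2_norm_nonneg L2_norm_minus_commute[of M "S s f"])
   qed
  qed
 qed
qed

lemma continuous_on_inner_S:
 assumes "f \<in> L2 M" "g \<in> L2 M"
 shows "continuous_on {0..} (%t. L2_inner M (S t f) g)"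
 unfolding continuous_on_def
proof
 fix t :: real assume "t \<in> {0..}"
 then show "((%t. L2_inner M (S t f) g) \<longlongrightarrow> L2_inner M (S t f) g) (at t within {0..})"
  using assms S_continuous[of t f]
  by (intro L2_inner_tendsto_left) (auto simp: eventually_at_filter intro!: always_eventually)
qed

text \<open>\<open>S t\<close> is linear and commutes with the semigroup, so the difference quotient
  at \<open>t\<close> is \<open>S t\<close> applied to the one at \<open>0\<close>. Both the
  invariance of the generator domain and the derivative of orbits reduce to this estimate.\<close>

lemma S_quotient:
 assumes "t >= 0" "\<delta> > 0" "f \<in> L2 M" "h \<in> L2 M"
  and K: "!!g. g \<in> L2 M ==> L2_norm M (S t g) <= K * L2_norm M g"
 shows "L2_norm M (%x. (S (t + \<delta>) f x - S t f x) / \<delta> - S t h x) <= K * L2_norm M (%x. (S \<delta> f x - f x) / \<delta> - h x)"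
proof -
 let ?q = "%x. (1 / \<delta>) * S \<delta> f x + (- 1 / \<delta>) * f x" and ?d = "%x. (S \<delta> f x - f x) / \<delta> - h x"
 have L: "S \<delta> f \<in> L2 M" "?q \<in> L2 M" using assms(2-4) by (intro L2_lincomb S_L2; simp)+
 have d: "?d = (%x. 1 * ?q x + (-1) * h x)" by (auto simp: diff_divide_distrib)
 have Ld: "?d \<in> L2 M" unfolding d by (intro L2_lincomb L assms)
 have "AE x in M. S (t + \<delta>) f x = S t (S \<delta> f) x" using assms(1-4) by (intro S_plus) auto
 moreover have "AE x in M. S t ?d x = 1 * S t ?q x + (-1) * S t h x" unfolding d by (rule S_lin[OF assms(1) L(2) assms(4)])
 moreover have "AE x in M. S t ?q x = (1 / \<delta>) * S t (S \<delta> f) x + (- 1 / \<delta>) * S t f x" by (rule S_lin[OF assms(1) L(1) assms(3)])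
 ultimately have "AE x in M. (S (t + \<delta>) f x - S t f x) / \<delta> - S t h x = S t ?d x"
  by eventually_elim (simp add: diff_divide_distrib)
 moreover have "S t f \<in> L2 M" "S (t + \<delta>) f \<in> L2 M" "S t h \<in> L2 M" "S t ?d \<in> L2 M" using Ld assms(1-4) by (auto intro!: S_L2)
 ultimately have "L2_norm M (%x. (S (t + \<delta>) f x - S t f x) / \<delta> - S t h x) = L2_norm M (S t ?d)"
  by (intro L2_norm_cong_AE) auto
 with K[OF Ld] show ?thesis by simp
qed

lemma generator_S:
 assumes "generator M S f h" "t >= 0"
 shows "generator M S (S t f) (S t h)"
proof -
 have L: "f \<in> L2 M" "h \<in> L2 M" using assms by (auto simp: generator_def)
 obtain K where K: "!!f. f \<in> L2 M ==> L2_norm M (S t f) <= K * L2_norm M f"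
  using S_bounded[OF assms(2)] by auto
 let ?N = "%s. L2_norm M (%x. (S s f x - f x) / s - h x)"
 have "((%s. L2_norm M (%x. (S s (S t f) x - S t f x) / s - S t h x)) \<longlongrightarrow> 0) (at_right 0)"
 proof (rule Lim_null_comparison)
  have "((%s. K * ?N s) \<longlongrightarrow> K * 0) (at_right 0)"
   using assms by (intro tendsto_intros) (auto simp: generator_def)
  then show "((%s. K * ?N s) \<longlongrightarrow> 0) (at_right 0)" by simp
  show "\<forall>\<^sub>F s in at_right 0. norm (L2_norm M (%x. (S s (S t f) x - S t f x) / s - S t h x)) <= K * ?N s"
   using eventually_at_right_less[of "0::real"]
  proof eventually_elim
   case (elim s)
   have "AE x in M. S s (S t f) x = S (t + s) f x"
    using S_plus[of s t f] L elim assms by (auto simp: add.commute elim!: AE_mp)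
   moreover have "S t f \<in> L2 M" "S s (S t f) \<in> L2 M" "S (t + s) f \<in> L2 M" "S t h \<in> L2 M" using L elim assms by auto
   ultimately have "L2_norm M (%x. (S s (S t f) x - S t f x) / s - S t h x) = L2_norm M (%x. (S (t + s) f x - S t f x) / s - S t h x)"
    by (intro L2_norm_cong_AE) auto
   then show ?case using S_quotient[OF assms(2) elim L K] by (simp add: L2_norm_nonneg)
  qed
 qed
 then show ?thesis using L assms by (auto simp: generator_def)
qed

lemma S_deriv:
 assumes "generator M S f h" "t > 0"
 shows "L2_deriv M (%s. S s f) t (S t h)"
proof -
 have L: "f \<in> L2 M" "h \<in> L2 M" using assms by (auto simp: generator_def)
 obtain K where K: "K >= 0" "!!s f. 0 <= s ==> s <= t + 1 ==> f \<in> L2 M ==> L2_norm M (S s f) <= K * L2_norm M f"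
  using S_bounded_on[of "t + 1"] by metis
 let ?N = "%s. L2_norm M (%x. (S s f x - f x) / s - h x)"
 let ?\<phi> = "%s. L2_norm M (%x. S s h x - h x)"
 let ?D = "%s x. (S s f x - S t f x) / (s - t) - S t h x"
 have right: "L2_norm M (?D s) <= K * (?N (abs (s - t)) + ?\<phi> (abs (s - t)))" if "s > t" for s
 proof -
  have "L2_norm M (?D s) <= K * ?N (s - t)"
   using S_quotient[of t "s - t" f h K] L K(2)[of t] that assms by simp
  also have "... <= K * (?N (s - t) + ?\<phi> (s - t))" using K(1) by (intro mult_left_mono) (auto simp: L2_norm_nonneg)
  finally show ?thesis using that by simp
 qed
 \<comment> \<open>A quotient over \<open>[s, t]\<close> is \<open>S s\<close> applied to a quotient
   over \<open>[0, \<delta>]\<close>, which approaches \<open>h\<close>, whereas the claimed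
   derivative is \<open>S s (S \<delta> h)\<close>. The discrepancy between
   \<open>S \<delta> h\<close> and \<open>h\<close> is the extra term
   \<open>?\<phi>\<close>.\<close>
 have left: "L2_norm M (?D s) <= K * (?N (abs (s - t)) + ?\<phi> (abs (s - t)))" if "s < t" "0 <= s" for s
 proof -
  define \<delta> where "\<delta> = t - s"
  have \<delta>: "\<delta> > 0" "t = s + \<delta>" using that by (auto simp: \<delta>_def)
  have L': "S \<delta> f \<in> L2 M" "S \<delta> h \<in> L2 M" "S t f \<in> L2 M" "S s f \<in> L2 M" "S t h \<in> L2 M" "S s (S \<delta> h) \<in> L2 M"
   using S_L2[OF that(2) S_L2[of \<delta> h]] L \<delta> assms(2) that by auto
  have "AE x in M. S t h x = S s (S \<delta> h) x" using S_plus[OF that(2), of \<delta> h] L \<delta> by simp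
  then have "AE x in M. ?D s x = (S (s + \<delta>) f x - S s f x) / \<delta> - S s (S \<delta> h) x"
  proof eventually_elim
   case (elim x)
   have "(S s f x - S t f x) / (s - t) = (S (s + \<delta>) f x - S s f x) / \<delta>"
    using minus_divide_divide[of "S s f x - S t f x" "s - t"] \<delta> by simp
   then show ?case using elim by simp
  qed
  then have "L2_norm M (?D s) = L2_norm M (%x. (S (s + \<delta>) f x - S s f x) / \<delta> - S s (S \<delta> h) x)"
   using L' \<delta>(2) by (intro L2_norm_cong_AE) auto
  also have "... <= K * L2_norm M (%x. (S \<delta> f x - f x) / \<delta> - S \<delta> h x)"
   using that by (intro S_quotient \<delta> L L' K) auto
  also have "... <= K * (?N \<delta> + ?\<phi> \<delta>)"
  proof (intro mult_left_mono K)
   have "L2_norm M (%x. (S \<delta> f x - f x) / \<delta> - S \<delta> h x) <= ?N \<delta> + L2_norm M (%x. h x - S \<delta> h x)"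
    by (intro L2_norm_triangle_diff L2_intros L L')
   then show "L2_norm M (%x. (S \<delta> f x - f x) / \<delta> - S \<delta> h x) <= ?N \<delta> + ?\<phi> \<delta>"
    by (simp add: L2_norm_minus_commute[of M h])
  qed
  finally show ?thesis using \<delta> by simp
 qed
 have "((%s. L2_norm M (?D s)) \<longlongrightarrow> 0) (at t)"
 proof (rule Lim_null_comparison)
  have "((%s. ?N s + ?\<phi> s) \<longlongrightarrow> 0 + 0) (at_right 0)"
   using assms S_cont0[OF L(2)] by (intro tendsto_add) (auto simp: generator_def)
  then have "((%s. ?N (abs (s - t)) + ?\<phi> (abs (s - t))) \<longlongrightarrow> 0 + 0) (at t)"
   by (rule filterlim_compose[OF _ filterlim_abs_diff])
  then have "((%s. K * (?N (abs (s - t)) + ?\<phi> (abs (s - t)))) \<longlongrightarrow> K * (0 + 0)) (at t)" by (intro tendsto_mult tendsto_const)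
  then show "((%s. K * (?N (abs (s - t)) + ?\<phi> (abs (s - t)))) \<longlongrightarrow> 0) (at t)" by simp
  have "\<forall>\<^sub>F s in at t. s > 0 & s ~= t"
   using assms(2) order_tendstoD(1)[OF tendsto_ident_at, of 0 t UNIV]
   by (intro eventually_conj) (auto simp: eventually_at_filter)
  then show "\<forall>\<^sub>F s in at t. norm (L2_norm M (?D s)) <= K * (?N (abs (s - t)) + ?\<phi> (abs (s - t)))"
  proof eventually_elim
   case (elim s)
   then show ?case using left[of s] right[of s] by (cases "s < t") (auto simp: L2_norm_nonneg)
  qed
 qed
 moreover have "\<forall>\<^sub>F s in at t. S s f \<in> L2 M"
  by (rule eventually_mono[OF order_tendstoD(1)[OF tendsto_ident_at assms(2), of UNIV]]) (use L in auto)
 ultimately show ?thesis unfolding L2_deriv_def using L assms by auto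
qed

lemma inner_S_deriv:
 assumes "generator M S f h" "t > 0" "g \<in> L2 M"
 shows "DERIV (%s. L2_inner M (S s f) g) t :> L2_inner M (S t h) g"
 using L2_deriv_inner[OF S_deriv[OF assms(1,2)] L2_deriv_const[OF assms(3)]]
 by (simp add: L2_inner_const_zero)

end

lemma L2_deriv_reflect:
 assumes "L2_deriv M U (t - s) V"
 shows "L2_deriv M (%r. U (t - r)) s (%x. - V x)"
proof -
 have fl: "filterlim (%r. t - r) (at (t - s)) (at s)"
  unfolding filterlim_at
  by (auto intro!: tendsto_intros simp: eventually_at_filter)
 have "((%r. L2_norm M (%x. (U (t - r) x - U (t - s) x) / ((t - r) - (t - s)) - V x)) \<longlongrightarrow> 0) (at s)"
  using assms unfolding L2_deriv_def by (intro filterlim_compose[OF _ fl]) auto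
 moreover have "L2_norm M (%x. (U (t - r) x - U (t - s) x) / ((t - r) - (t - s)) - V x)
   = L2_norm M (%x. (U (t - r) x - U (t - s) x) / (r - s) - (- V x))" for r
 proof -
  have "(%x. (U (t - r) x - U (t - s) x) / (r - s) - (- V x))
    = (%x. - ((U (t - r) x - U (t - s) x) / ((t - r) - (t - s)) - V x))"
   by (rule ext) (simp add: minus_divide_right)
  then show ?thesis by (simp only: L2_norm_uminus)
 qed
 moreover have "\<forall>\<^sub>F r in at s. U (t - r) \<in> L2 M"
  using assms unfolding L2_deriv_def by (intro eventually_compose_filterlim[OF _ fl]) auto
 ultimately show ?thesis
  using assms unfolding L2_deriv_def by (auto intro: L2_uminus)
qed

section \<open>Symmetric contraction semigroups\<close>

locale symmetric_semigroup = c0_semigroup +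
 assumes gen_sym: "generator M S f h ==> generator M S g k ==> L2_inner M h g = L2_inner M f k"
  and gen_diss: "generator M S f h ==> L2_inner M h f <= 0"
  and gen_dense: "f \<in> L2 M ==> e > 0 ==> EX g h. generator M S g h & L2_norm M (%x. f x - g x) < e"
begin

lemma continuous_on_inner_S_S:
 assumes "f \<in> L2 M" "g \<in> L2 M"
 shows "continuous_on {0..t} (%s. L2_inner M (S s f) (S (t - s) g))"
  and "continuous_on {0..} (%s. L2_inner M (S s f) (S s g))"
proof -
 show "continuous_on {0..t} (%s. L2_inner M (S s f) (S (t - s) g))"
  unfolding continuous_on_def
 proof
  fix s assume s: "s \<in> {0..t}"
  have 1: "((%r. L2_norm M (%x. S r f x - S s f x)) \<longlongrightarrow> 0) (at s within {0..t})"
   using S_continuous[of s f] s assms by (auto intro: tendsto_within_subset)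
  have "filterlim (%r. t - r) (at (t - s) within {0..}) (at s within {0..t})"
   unfolding filterlim_at using s
   by (auto intro!: tendsto_intros simp: eventually_at_filter)
  then have 2: "((%r. L2_norm M (%x. S (t - r) g x - S (t - s) g x)) \<longlongrightarrow> 0) (at s within {0..t})"
   using S_continuous[of "t - s" g] s assms by (auto intro: filterlim_compose)
  show "((%s. L2_inner M (S s f) (S (t - s) g)) \<longlongrightarrow> L2_inner M (S s f) (S (t - s) g)) (at s within {0..t})"
   using s assms by (intro L2_inner_tendsto 1 2) (auto simp: eventually_at_filter intro!: always_eventually)
 qed
 show "continuous_on {0..} (%s. L2_inner M (S s f) (S s g))"
  unfolding continuous_on_def
 proof
  fix s :: real assume s: "s \<in> {0..}"
  show "((%s. L2_inner M (S s f) (S s g)) \<longlongrightarrow> L2_inner M (S s f) (S s g)) (at s within {0..})"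
   using s assms S_continuous[of s f] S_continuous[of s g]
   by (intro L2_inner_tendsto) (auto simp: eventually_at_filter intro!: always_eventually)
 qed
qed

lemma S_contraction_gen:
 assumes "generator M S f h" "t >= 0"
 shows "L2_norm M (S t f) <= L2_norm M f"
proof (cases "t = 0")
 case True
 have L: "f \<in> L2 M" using assms by (auto simp: generator_def)
 have "L2_norm M (S 0 f) = L2_norm M f"
  using S_zero[OF L] S_L2[OF order_refl L] L by (intro L2_norm_cong_AE) auto
 then show ?thesis using True by simp
next
 case False
 then have t: "0 < t" using assms by simp
 have L: "f \<in> L2 M" "h \<in> L2 M" using assms by (auto simp: generator_def)
 have "L2_inner M (S t f) (S t f) <= L2_inner M (S 0 f) (S 0 f)"
 proof (rule DERIV_nonpos_imp_decreasing_open[OF assms(2)])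
  show "continuous_on {0..t} (%s. L2_inner M (S s f) (S s f))"
   by (rule continuous_on_subset[OF continuous_on_inner_S_S(2)[OF L(1) L(1)]]) auto
  fix s assume s: "0 < s" "s < t"
  show "EX y. (DERIV (%s. L2_inner M (S s f) (S s f)) s :> y) & y <= 0"
   using L2_deriv_inner[OF S_deriv[OF assms(1) s(1)] S_deriv[OF assms(1) s(1)]]
    gen_diss[OF generator_S[OF assms(1), of s]] s
   by (intro exI[of _ "L2_inner M (S s h) (S s f) + L2_inner M (S s f) (S s h)"] conjI)
    (auto simp: L2_inner_commute[of M "S s f"])
 qed
 also have "... = L2_inner M f f"
  using S_zero[OF L(1)] S_L2[OF order_refl L(1)] L by (intro L2_inner_cong_AE) auto
 finally show ?thesis by (simp add: L2_norm_def)
qed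

lemma gen_approx:
 assumes "f \<in> L2 M"
 obtains F H where "!!n. generator M S (F n) (H n)" "(%n. L2_norm M (%x. F n x - f x)) \<longlonglongrightarrow> 0"
proof -
 have "EX g h. generator M S g h & L2_norm M (%x. f x - g x) < 1 / real (Suc n)" for n
  by (rule gen_dense[OF assms]) simp
 then obtain F H where FH: "!!n. generator M S (F n) (H n)" "!!n. L2_norm M (%x. f x - F n x) < 1 / real (Suc n)"
  by metis
 have "(%n. L2_norm M (%x. F n x - f x)) \<longlonglongrightarrow> 0"
 proof (rule Lim_null_comparison[OF always_eventually[OF allI]])
  show "norm (L2_norm M (%x. F n x - f x)) <= 1 / real (Suc n)" for n
   using FH(2)[of n] by (simp add: L2_norm_nonneg L2_norm_minus_commute[of M f])
  show "(%n. 1 / real (Suc n)) \<longlonglongrightarrow> 0" by (rule LIMSEQ_Suc[OF lim_1_over_n])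
 qed
 with FH(1) show thesis by (rule that)
qed

lemma S_approx:
 assumes "f \<in> L2 M" "!!n. F n \<in> L2 M" "(%n. L2_norm M (%x. F n x - f x)) \<longlonglongrightarrow> 0" "t >= 0"
 shows "(%n. L2_norm M (%x. S t (F n) x - S t f x)) \<longlonglongrightarrow> 0"
proof -
 obtain K where K: "!!f. f \<in> L2 M ==> L2_norm M (S t f) <= K * L2_norm M f"
  using S_bounded[OF assms(4)] by auto
 show ?thesis
 proof (rule Lim_null_comparison[OF always_eventually[OF allI]])
  show "norm (L2_norm M (%x. S t (F n) x - S t f x)) <= K * L2_norm M (%x. F n x - f x)" for n
  proof -
   have d: "(%x. F n x - f x) \<in> L2 M" by (intro L2_intros assms)
   have "L2_norm M (%x. S t (F n) x - S t f x) = L2_norm M (S t (%x. F n x - f x))"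
    using S_diff[OF assms(4) assms(2)[of n] assms(1)] S_L2[OF assms(4) d]
     S_L2[OF assms(4) assms(2)[of n]] S_L2[OF assms(4) assms(1)]
    by (intro L2_norm_cong_AE) (auto elim!: AE_mp)
   then show ?thesis using K[OF d] by (simp add: L2_norm_nonneg)
  qed
  have "(%n. K * L2_norm M (%x. F n x - f x)) \<longlonglongrightarrow> K * 0" by (intro tendsto_intros assms)
  then show "(%n. K * L2_norm M (%x. F n x - f x)) \<longlonglongrightarrow> 0" by simp
 qed
qed

lemma S_contraction:
 assumes "f \<in> L2 M" "t >= 0"
 shows "L2_norm M (S t f) <= L2_norm M f"
proof -
 obtain F H where F: "!!n. generator M S (F n) (H n)" "(%n. L2_norm M (%x. F n x - f x)) \<longlonglongrightarrow> 0"
  using gen_approx[OF assms(1)] by blast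
 have FL: "!!n. F n \<in> L2 M" using F by (auto simp: generator_def)
 show ?thesis
 proof (rule LIMSEQ_le)
  show "(%n. L2_norm M (S t (F n))) \<longlonglongrightarrow> L2_norm M (S t f)"
   by (rule L2_norm_tendsto[OF always_eventually[OF allI] _ S_approx])
    (use assms FL F in auto)
  show "(%n. L2_norm M (F n)) \<longlonglongrightarrow> L2_norm M f"
   by (rule L2_norm_tendsto[OF always_eventually[OF allI]]) (use assms FL F in auto)
  show "EX N. ALL n>=N. L2_norm M (S t (F n)) <= L2_norm M (F n)"
   using S_contraction_gen[OF F(1) assms(2)] by auto
 qed
qed

text \<open>The function \<open>L2_inner M (S s f) (S (t - s) g)\<close> is constant in
  \<open>s\<close>: its derivative is a difference of two terms that agree by the symmetry of the
  generator. The two ends of \<open>[0, t]\<close> give the claim.\<close>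

lemma S_symmetric_gen:
 assumes f: "generator M S f h" and g: "generator M S g k" and "t >= 0"
 shows "L2_inner M (S t f) g = L2_inner M f (S t g)"
proof (cases "t = 0")
 case True
 have L: "f \<in> L2 M" "g \<in> L2 M" using assms by (auto simp: generator_def)
 show ?thesis unfolding True using S_zero[OF L(1)] S_zero[OF L(2)] S_L2[OF order_refl L(1)] S_L2[OF order_refl L(2)] L
  by (intro L2_inner_cong_AE) auto
next
 case False
 then have t: "0 < t" using assms by simp
 have L: "f \<in> L2 M" "g \<in> L2 M" using assms by (auto simp: generator_def)
 have "L2_inner M (S t f) (S (t - t) g) = L2_inner M (S 0 f) (S (t - 0) g)"
 proof (rule DERIV_isconst_end[OF t])
  show "continuous_on {0..t} (%s. L2_inner M (S s f) (S (t - s) g))"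
   by (rule continuous_on_inner_S_S L)+
  fix s assume s: "0 < s" "s < t"
  have "DERIV (%s. L2_inner M (S s f) (S (t - s) g)) s :> L2_inner M (S s h) (S (t - s) g) + L2_inner M (S s f) (%x. - S (t - s) k x)"
   using s by (intro L2_deriv_inner S_deriv[OF f] L2_deriv_reflect S_deriv[OF g]) auto
  moreover have "L2_inner M (S s h) (S (t - s) g) = L2_inner M (S s f) (S (t - s) k)"
   using s by (intro gen_sym generator_S f g) auto
  ultimately show "DERIV (%s. L2_inner M (S s f) (S (t - s) g)) s :> 0"
   by (simp add: L2_inner_uminus_right)
 qed
 moreover have "L2_inner M (S t f) (S 0 g) = L2_inner M (S t f) g"
  using S_zero[OF L(2)] S_L2[OF order_refl L(2)] S_L2[OF assms(3) L(1)] L by (intro L2_inner_cong_AE) auto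
 moreover have "L2_inner M (S 0 f) (S t g) = L2_inner M f (S t g)"
  using S_zero[OF L(1)] S_L2[OF order_refl L(1)] S_L2[OF assms(3) L(2)] L by (intro L2_inner_cong_AE) auto
 ultimately show ?thesis by simp
qed

lemma S_symmetric:
 assumes "f \<in> L2 M" "g \<in> L2 M" "t >= 0"
 shows "L2_inner M (S t f) g = L2_inner M f (S t g)"
proof -
 obtain F H where F: "!!n. generator M S (F n) (H n)" "(%n. L2_norm M (%x. F n x - f x)) \<longlonglongrightarrow> 0"
  using gen_approx[OF assms(1)] by blast
 obtain G K where G: "!!n. generator M S (G n) (K n)" "(%n. L2_norm M (%x. G n x - g x)) \<longlonglongrightarrow> 0"
  using gen_approx[OF assms(2)] by blast
 have FL: "!!n. F n \<in> L2 M" "!!n. G n \<in> L2 M" using F G by (auto simp: generator_def)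
 have "(%n. L2_inner M (S t (F n)) (G n)) \<longlonglongrightarrow> L2_inner M (S t f) g"
  using assms FL F(2) G(2) by (intro L2_inner_tendsto S_approx) (auto intro!: always_eventually)
 moreover have "(%n. L2_inner M (F n) (S t (G n))) \<longlonglongrightarrow> L2_inner M f (S t g)"
  using assms FL F(2) G(2) by (intro L2_inner_tendsto S_approx) (auto intro!: always_eventually)
 moreover have "L2_inner M (S t (F n)) (G n) = L2_inner M (F n) (S t (G n))" for n
  by (rule S_symmetric_gen[OF F(1) G(1) assms(3)])
 ultimately show ?thesis using LIMSEQ_unique by simp
qed

text \<open>Replaces the spectral theorem. The energy \<open>e s\<close> of \<open>S s f\<close>
  equals \<open>- L2_inner M (S (2 * s) f) h\<close>, whose derivative is \<open>-2\<close> times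
  the square norm of \<open>S s h\<close>; hence it decreases. By the mean value theorem the loss of
  square norm on \<open>[0, t]\<close> is \<open>2 * t\<close> times the energy at an intermediate
  time, which is at least \<open>e t\<close>.\<close>

lemma energy_bound:
 assumes "generator M S f h" "t > 0"
 shows "- L2_inner M (S t h) (S t f) * (2 * t) <= (L2_norm M f)^2"
proof -
 have L: "f \<in> L2 M" "h \<in> L2 M" using assms by (auto simp: generator_def)
 define e where "e s = - L2_inner M (S s h) (S s f)" for s
 have e_alt: "e s = - L2_inner M (S (2 * s) f) h" if "s >= 0" for s
 proof -
  have "L2_inner M (S s h) (S s f) = L2_inner M h (S s (S s f))"
   using that L by (intro S_symmetric) auto
  also have "... = L2_inner M h (S (s + s) f)"
   using S_plus[OF that that L(1)] that L
   by (intro L2_inner_cong_AE) (auto intro!: L2_measurable[OF S_L2] elim!: AE_mp)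
  finally show ?thesis unfolding e_def L2_inner_commute[of M _ h] mult_2 by simp
 qed
 have e_dec: "e t <= e s" if "0 < s" "s <= t" for s
 proof -
  have "- L2_inner M (S (2 * t) f) h <= - L2_inner M (S (2 * s) f) h"
  proof (rule DERIV_nonpos_imp_nonincreasing[OF that(2)])
   fix r assume r: "s <= r" "r <= t"
   have "DERIV (%r. L2_inner M (S (2 * r) f) h) r :> L2_inner M (S (2 * r) h) h * 2"
    using r that by (intro DERIV_chain2[where f = "%s. L2_inner M (S s f) h"] inner_S_deriv assms L)
     (auto intro!: derivative_eq_intros)
   moreover have "L2_inner M (S (2 * r) h) h >= 0"
   proof -
    have "L2_inner M (S (2 * r) h) h = L2_inner M (S r (S r h)) h"
     unfolding mult_2 using S_plus[of r r h] r that L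
     by (intro L2_inner_cong_AE) (auto intro!: L2_measurable[OF S_L2])
    also have "... = L2_inner M (S r h) (S r h)"
     using r that L by (intro S_symmetric) auto
    finally show ?thesis by (simp add: L2_inner_nonneg)
   qed
   ultimately show "EX y. (DERIV (%t. - L2_inner M (S (2 * t) f) h) r :> y) & y <= 0"
    by (intro exI[of _ "- (L2_inner M (S (2 * r) h) h * 2)"] conjI DERIV_minus) auto
  qed
  then show ?thesis using e_alt[of s] e_alt[of t] that by simp
 qed
 have der: "DERIV (%s. L2_inner M (S s f) (S s f)) s :> - 2 * e s" if "0 < s" for s
  using L2_deriv_inner[OF S_deriv[OF assms(1) that] S_deriv[OF assms(1) that]]
  unfolding e_def L2_inner_commute[of M "S s f" "S s h"] by simp
 have "EX l z. 0 < z & z < t & (DERIV (%s. L2_inner M (S s f) (S s f)) z :> l) &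
   L2_inner M (S t f) (S t f) - L2_inner M (S 0 f) (S 0 f) = (t - 0) * l"
 proof (rule MVT[OF assms(2)])
  show "continuous_on {0..t} (%s. L2_inner M (S s f) (S s f))"
   by (rule continuous_on_subset[OF continuous_on_inner_S_S(2)[OF L(1) L(1)]]) auto
  fix s :: real assume "0 < s" "s < t"
  then show "(%s. L2_inner M (S s f) (S s f)) differentiable at s"
   using der real_differentiable_def by blast
 qed
 then obtain l z where z: "0 < z" "z < t" "DERIV (%s. L2_inner M (S s f) (S s f)) z :> l"
  "L2_inner M (S t f) (S t f) - L2_inner M (S 0 f) (S 0 f) = (t - 0) * l" by blast
 have "l = - 2 * e z" by (rule DERIV_unique[OF z(3) der[OF z(1)]])
 moreover have "L2_inner M (S 0 f) (S 0 f) = L2_inner M f f"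
  using S_zero[OF L(1)] S_L2[OF order_refl L(1)] L by (intro L2_inner_cong_AE) auto
 ultimately have "e z * (2 * t) <= L2_inner M f f"
  using z(4) L2_inner_nonneg[of M "S t f"] by (simp add: mult_ac)
 moreover have "e t * (2 * t) <= e z * (2 * t)"
  using e_dec[of z] z assms by (intro mult_right_mono) auto
 ultimately show ?thesis unfolding e_def L2_norm_sq by simp
qed

end

section \<open>The weighted line and its test functions\<close>

lemma L2_dominated:
 assumes "!!n. F n \<in> borel_measurable M" "g \<in> L2 M" "!!n. AE x in M. abs (F n x) <= abs (g x)"
  "AE x in M. (%n. F n x) \<longlonglongrightarrow> 0"
 shows "(%n. L2_norm M (F n)) \<longlonglongrightarrow> 0"
proof -
 have "(%n. LINT x|M. (F n x)^2) \<longlonglongrightarrow> (LINT x|M. 0)"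
 proof (rule integral_dominated_convergence[where w = "%x. (g x)^2"])
  show "integrable M (%x. (g x)^2)" by (rule L2_integrable_sq) fact
  show "AE x in M. (%n. (F n x)^2) \<longlonglongrightarrow> 0"
   using assms(4) by eventually_elim (auto intro: tendsto_eq_intros)
  show "AE x in M. norm ((F n x)^2) <= (g x)^2" for n
   using assms(3)[of n] by eventually_elim (simp add: abs_le_square_iff)
 qed (use assms(1) in auto)
 then have "(%n. sqrt (LINT x|M. (F n x)^2)) \<longlonglongrightarrow> sqrt 0" by (intro tendsto_real_sqrt) simp
 then show ?thesis by (simp add: L2_norm_def L2_inner_self)
qed

lemma powr_le_exp:
 fixes p \<kappa> :: real
 assumes "\<kappa> > 0"
 obtains C where "C > 0" "!!x. x >= 0 ==> (1 + x) powr p <= C * exp (\<kappa> * x)"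
proof (cases "p > 0")
 case True
 \<comment> \<open>The bound is \<open>ln y <= y - 1\<close> at
   \<open>y = \<epsilon> * (1 + x)\<close>; this choice makes the resulting slope
   \<open>p * \<epsilon>\<close> equal to \<open>\<kappa>\<close>.\<close>
 define \<epsilon> where "\<epsilon> = \<kappa> / p"
 have \<epsilon>: "\<epsilon> > 0" using True assms by (simp add: \<epsilon>_def)
 show ?thesis
 proof (rule that[of "exp (\<kappa> - p - p * ln \<epsilon>)"])
  fix x :: real assume x: "x >= 0"
  have "ln \<epsilon> + ln (1 + x) = ln (\<epsilon> * (1 + x))" using \<epsilon> x by (simp add: ln_mult)
  also have "... <= \<epsilon> * (1 + x) - 1" using \<epsilon> x by (intro ln_le_minus_one) auto
  finally have "p * (ln \<epsilon> + ln (1 + x)) <= p * (\<epsilon> * (1 + x) - 1)" using True by (intro mult_left_mono) auto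
  also have "p * (\<epsilon> * (1 + x) - 1) = \<kappa> + \<kappa> * x - p" using True by (simp add: \<epsilon>_def field_simps)
  finally have "p * ln (1 + x) <= (\<kappa> - p - p * ln \<epsilon>) + \<kappa> * x" by (simp add: algebra_simps)
  then have "exp (p * ln (1 + x)) <= exp (\<kappa> - p - p * ln \<epsilon>) * exp (\<kappa> * x)" by (simp flip: exp_add)
  then show "(1 + x) powr p <= exp (\<kappa> - p - p * ln \<epsilon>) * exp (\<kappa> * x)" using x by (simp add: powr_def)
 qed simp
next
 case False
 show ?thesis
 proof (rule that[of 1])
  fix x :: real assume x: "x >= 0"
  have "(1 + x) powr p <= (1 + x) powr 0" using False x by (intro powr_mono) auto
  also have "... <= 1 * exp (\<kappa> * x)" using x assms by simp
  finally show "(1 + x) powr p <= 1 * exp (\<kappa> * x)" .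
 qed simp
qed

lemma integrable_exp_abs:
 assumes "\<kappa> > 0"
 shows "integrable lborel (%s::real. exp (- \<kappa> * abs s))"
proof -
 have fin: "(\<integral>\<^sup>+x. ennreal (exp (- \<kappa> * x)) * indicator {0..} x \<partial>lborel) < \<infinity>"
 proof -
  have "((%x::real. - exp (- \<kappa> * x) / \<kappa>) \<longlongrightarrow> - 0 / \<kappa>) at_top"
  proof (intro tendsto_divide tendsto_minus tendsto_const)
   have "filterlim (%x::real. \<kappa> * x) at_top at_top"
    using assms by (simp add: filterlim_tendsto_pos_mult_at_top[OF tendsto_const _ filterlim_ident])
   then have "filterlim (%x::real. - \<kappa> * x) at_bot at_top" by (simp add: filterlim_uminus_at_bot)
   then show "((%x::real. exp (- \<kappa> * x)) \<longlongrightarrow> 0) at_top" by (rule filterlim_compose[OF exp_at_bot])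
  qed (use assms in simp)
  then have "(\<integral>\<^sup>+x. ennreal (exp (- \<kappa> * x)) * indicator {0..} x \<partial>lborel) = ennreal (0 - (- exp (- \<kappa> * 0) / \<kappa>))"
   using assms by (intro nn_integral_FTC_atLeast) (auto intro!: derivative_eq_intros)
  then show ?thesis by simp
 qed
 have half: "integrable lborel (%s::real. exp (- \<kappa> * s) * indicator {0..} s)"
 proof (rule integrableI_nonneg)
  have "(\<integral>\<^sup>+x. ennreal (exp (- \<kappa> * x) * indicator {0..} x) \<partial>lborel)
    = (\<integral>\<^sup>+x. ennreal (exp (- \<kappa> * x)) * indicator {0..} x \<partial>lborel)"
   by (intro nn_integral_cong) (auto simp: indicator_def)
  then show "(\<integral>\<^sup>+x. ennreal (exp (- \<kappa> * x) * indicator {0..} x) \<partial>lborel) < \<infinity>" using fin by simp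
 qed auto
 have "integrable lborel (%s::real. exp (- \<kappa> * (0 + (-1) * s)) * indicator {0..} (0 + (-1) * s))"
  by (rule lborel_integrable_real_affine[OF half]) simp
 with half have "integrable lborel (%s::real. exp (- \<kappa> * s) * indicator {0..} s
   + exp (- \<kappa> * (0 + (-1) * s)) * indicator {0..} (0 + (-1) * s))"
  by (rule Bochner_Integration.integrable_add)
 then show ?thesis
  by (rule Bochner_Integration.integrable_bound) (auto simp: indicator_def)
qed

text \<open>Truncated powers supply the smoothness of both \<open>bump\<close> and
  \<open>Phi\<close>: each loses one degree per derivative and stays differentiable down to degree
  two.\<close>

lemma DERIV_max0_power:
 "DERIV (%y::real. (max 0 y) ^ Suc (Suc n)) y :> real (Suc (Suc n)) * (max 0 y) ^ Suc n"
proof -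
 consider "y > 0" | "y < 0" | "y = 0" by linarith
 then show ?thesis
 proof cases
  case 1
  have ev: "\<forall>\<^sub>F z in nhds y. z ^ Suc (Suc n) = (max 0 z) ^ Suc (Suc n)"
   using eventually_nhds_in_open[of "{0<..}" y] 1 by (auto elim!: eventually_mono)
  have "DERIV (%y::real. y ^ Suc (Suc n)) y :> real (Suc (Suc n)) * y ^ Suc n"
   by (rule derivative_eq_intros | simp)+
  from DERIV_cong_ev[THEN iffD1, OF refl ev refl this] show ?thesis using 1 by simp
 next
  case 2
  have ev: "\<forall>\<^sub>F z in nhds y. 0 = (max 0 z) ^ Suc (Suc n)"
   using eventually_nhds_in_open[of "{..<0}" y] 2 by (auto elim!: eventually_mono)
  have "DERIV (%y::real. 0::real) y :> 0" by simp
  from DERIV_cong_ev[THEN iffD1, OF refl ev refl this] show ?thesis using 2 by simp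
 next
  case 3
  have "((%z::real. (max 0 z) ^ Suc (Suc n) / z) \<longlongrightarrow> 0) (at 0)"
  proof (rule Lim_null_comparison[OF always_eventually[OF allI]])
   fix z :: real
   show "norm ((max 0 z) ^ Suc (Suc n) / z) <= abs z ^ Suc n" 
   proof (cases "z <= 0")
    case True
    then have "(max 0 z) ^ Suc (Suc n) = 0" by simp
    then show ?thesis unfolding \<open>(max 0 z) ^ Suc (Suc n) = 0\<close> by simp
   qed (simp add: power_abs)
   have "((%z::real. abs z ^ Suc n) \<longlongrightarrow> abs 0 ^ Suc n) (at 0)" by (intro tendsto_intros)
   then show "((%z::real. abs z ^ Suc n) \<longlongrightarrow> 0) (at 0)" by simp
  qed
  then show ?thesis using 3 by (simp add: has_field_derivative_iff)
 qed
qed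

lemma DERIV_abs_real:
 fixes s :: real
 assumes "s ~= 0"
 shows "DERIV abs s :> sgn s"
proof (cases "s > 0")
 case True
 then show ?thesis
  using has_field_derivative_transform_within_open[OF DERIV_ident, of "{0<..}" s abs] by simp
next
 case False
 then show ?thesis using assms
   has_field_derivative_transform_within_open[OF DERIV_minus[OF DERIV_ident], of "{..<0}" s abs] by simp
qed

text \<open>The third power is the least integer one that makes the truncated parabola twice
  continuously differentiable.\<close>

definition bump :: "real => real => real => real" where
 "bump a \<delta> s = (max 0 (1 - ((s - a) / \<delta>)^2)) ^ 3"

text \<open>Smoothness is meant in the coordinate, across the gluing point. The kink of the weight
  makes only the drift jump there, so these functions still lie in the operator domain.\<close>

definition test :: "(real => real) set" where
 "test = {f. EX f' f'' N. (ALL s. (DERIV f s :> f' s)) &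
   (ALL s. (DERIV f' s :> f'' s)) & cont f'' &
   (ALL s. abs s >= N --> f s = 0 & f' s = 0 & f'' s = 0)}"

lemma testI:
 assumes "!!s. (DERIV f s :> f' s)" "!!s. (DERIV f' s :> f'' s)"
  "cont f''" "!!s. abs s >= N ==> f s = 0 & f' s = 0 & f'' s = 0"
 shows "f \<in> test"
 unfolding test_def using assms by blast

lemma bump_nonneg: "0 <= bump a \<delta> s"
 and bump_le_1: "bump a \<delta> s <= 1"
 by (auto simp: bump_def intro!: power_le_one)

lemma bump_eq_0: "\<delta> > 0 ==> abs (s - a) >= \<delta> ==> bump a \<delta> s = 0"
proof -
 assume "\<delta> > 0" "abs (s - a) >= \<delta>"
 then have "1 <= \<bar>(s - a) / \<delta>\<bar>" by (simp add: field_simps)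
 then have "1 <= ((s - a) / \<delta>)^2" using power_mono[of 1 "\<bar>(s - a) / \<delta>\<bar>" 2] by (simp del: abs_divide)
 then show "bump a \<delta> s = 0" by (simp add: bump_def)
qed

lemma continuous_on_bump [continuous_intros]: "continuous_on A (bump a \<delta>)"
 unfolding bump_def by (cases "\<delta> = 0") (auto intro!: continuous_intros)

lemma bump_measurable [measurable]: "bump a \<delta> \<in> borel_measurable borel"
 by (intro borel_measurable_continuous_onI continuous_intros)

lemma bump_test:
 assumes "\<delta> > 0"
 shows "bump a \<delta> \<in> test"
proof -
 let ?u = "%s. 1 - ((s - a) / \<delta>)^2" and ?u' = "%s. - 2 * (s - a) / \<delta>^2"
 let ?f' = "%s. 3 * (max 0 (?u s))^2 * ?u' s"
 let ?f'' = "%s. 3 * (2 * max 0 (?u s) * ?u' s) * ?u' s + 3 * (max 0 (?u s))^2 * (- 2 / \<delta>^2)"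
 have u: "DERIV ?u s :> ?u' s" for s
  using assms by (auto intro!: derivative_eq_intros simp: power2_eq_square field_simps)
 have p3: "DERIV (%y::real. (max 0 y) ^ 3) y :> 3 * (max 0 y)^2" for y
  using DERIV_max0_power[of 1 y] by (simp add: numeral_eq_Suc)
 have p2: "DERIV (%y::real. (max 0 y)^2) y :> 2 * max 0 y" for y
  using DERIV_max0_power[of 0 y] by (simp add: numeral_eq_Suc)
 have 1: "DERIV (bump a \<delta>) s :> ?f' s" for s
  unfolding bump_def[abs_def] by (rule DERIV_chain2[OF p3 u])
 have q: "DERIV (%s. (max 0 (?u s))^2) s :> 2 * max 0 (?u s) * ?u' s" for s
  by (rule DERIV_chain2[OF p2 u])
 have 2: "DERIV ?f' s :> ?f'' s" for s
 proof -
  have "DERIV ?u' s :> - 2 / \<delta>^2"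
   using assms by (auto intro!: derivative_eq_intros simp: power4_eq_xxxx power2_eq_square field_simps)
  from DERIV_mult[OF DERIV_cmult[OF q, of 3] this] show ?thesis by (simp add: algebra_simps)
 qed
 have 3: "cont ?f''" using assms by (intro continuous_intros) auto
 have 4: "bump a \<delta> s = 0 & ?f' s = 0 & ?f'' s = 0" if "abs s >= abs a + \<delta>" for s
 proof -
  have "abs (s - a) >= \<delta>" using that by linarith
  then have "1 <= \<bar>(s - a) / \<delta>\<bar>" using assms by (simp add: field_simps)
  then have "1 <= ((s - a) / \<delta>)^2" using power_mono[of 1 "\<bar>(s - a) / \<delta>\<bar>" 2] by (simp del: abs_divide)
  then show ?thesis by (simp add: bump_def)
 qed
 show ?thesis by (rule testI[OF 1 2 3 4])
qed

lemma test_mult: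
 assumes "f \<in> test" "!!s. (DERIV p s :> p' s)" "!!s. (DERIV p' s :> p'' s)"
  "cont p''"
 shows "(%s. p s * f s) \<in> test"
proof -
 obtain f' f'' N where f: "!!s. (DERIV f s :> f' s)" "!!s. (DERIV f' s :> f'' s)"
  "cont f''" "!!s. abs s >= N ==> f s = 0 & f' s = 0 & f'' s = 0"
  using assms(1) unfolding test_def by blast
 have c: "cont f" "cont f'" "cont p" "cont p'"
  using f assms by (meson DERIV_isCont continuous_at_imp_continuous_on)+
 let ?g' = "%s. p' s * f s + p s * f' s"
 let ?g'' = "%s. p'' s * f s + 2 * p' s * f' s + p s * f'' s"
 have "DERIV (%s. p s * f s) s :> ?g' s" for s
  using DERIV_mult[OF assms(2) f(1)] by (simp add: mult.commute add.commute)
 moreover have "DERIV ?g' s :> ?g'' s" for s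
  using DERIV_add[OF DERIV_mult[OF assms(3) f(1)] DERIV_mult[OF assms(2) f(2)]]
  by (simp add: algebra_simps)
 moreover have "cont ?g''" using c f(3) assms(4) by (intro continuous_intros)
 moreover have "p s * f s = 0 & ?g' s = 0 & ?g'' s = 0" if "abs s >= N" for s
  using f(4)[OF that] by simp
 ultimately show ?thesis by (rule testI)
qed

lemma test_continuous: "f \<in> test ==> continuous_on A f"
 unfolding test_def by (auto intro!: continuous_at_imp_continuous_on dest: DERIV_isCont)

lemma test_measurable [measurable_dest]: "f \<in> test ==> f \<in> borel_measurable borel"
 by (intro borel_measurable_continuous_onI test_continuous)

lemma compact_support_exp_bound:
 fixes f :: "real => real"
 assumes "cont f" "!!s. abs s >= N ==> f s = 0"
 obtains C where "C > 0" "!!s. abs (f s) <= C * exp (- 1 * abs s)"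
proof -
 have "compact ((%s. f s * exp (abs s)) ` {-N..N})"
  by (intro compact_continuous_image continuous_intros continuous_on_subset[OF assms(1)]) auto
 then have "bounded ((%s. f s * exp (abs s)) ` {-N..N})" by (rule compact_imp_bounded)
 then obtain C where "\<forall>s\<in>{-N..N}. abs (f s * exp (abs s)) <= C"
  unfolding bounded_iff by auto
 then have C: "abs (f s * exp (abs s)) <= C" if "s \<in> {-N..N}" for s using that by blast
 show thesis
 proof (rule that)
  show "abs C + 1 > 0" by simp
  fix s
  show "abs (f s) <= (abs C + 1) * exp (- 1 * abs s)"
  proof (cases "abs s >= N")
   case True then show ?thesis using assms(2) by simp
  next
   case False
   then have "s \<in> {-N..N}" by auto
   then have "abs (f s) * exp (abs s) <= abs C + 1" using C[of s] by (simp add: abs_mult)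
   then show ?thesis by (simp add: exp_minus field_simps)
  qed
 qed
qed

locale bessel =
 fixes d :: real
 assumes d: "d > 2"
begin

text \<open>In the coordinate, \<open>abs x = 1 + abs s\<close>, so this is the density of the
  measure of the glued space.\<close>

definition w :: "real => real" where
 "w s = (1 + abs s) powr (d - 1)"

text \<open>The logarithmic derivative of \<open>w\<close> away from the kink, and the first-order
  coefficient of the generator. At \<open>0\<close> it has the value \<open>0\<close>, because
  \<open>sgn 0 = 0\<close>.\<close>

definition drift :: "real => real" where
 "drift s = (d - 1) * sgn s / (1 + abs s)"

definition nu :: "real measure" where
 "nu = density lborel (%s. ennreal (w s))"

abbreviation "nrm == L2_norm nu"

abbreviation "ip == L2_inner nu"

lemma w_ge_1: "w s >= 1"
 unfolding w_def using d by (intro ge_one_powr_ge_zero) auto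

lemma w_pos: "w s > 0"
 using w_ge_1[of s] by linarith

lemma continuous_on_w [continuous_intros]: "continuous_on A w"
 unfolding w_def by (intro continuous_intros) auto

lemma w_measurable [measurable]: "meas w"
 by (intro borel_measurable_continuous_onI continuous_intros)

lemma drift_measurable [measurable]: "meas drift"
 unfolding drift_def by measurable

lemma abs_drift_le: "abs (drift s) <= (d - 1) / (1 + abs s)"
 unfolding drift_def using d by (auto simp: abs_mult abs_sgn_eq)

lemma DERIV_w: "s ~= 0 ==> (DERIV w s :> drift s * w s)"
proof -
 assume s: "s ~= 0"
 have "DERIV (%s. 1 + abs s) s :> sgn s"
  using DERIV_add[OF DERIV_const DERIV_abs_real[OF s], of 1] by simp
 then have "DERIV w s :> ((d - 1) * (1 + abs s) powr (d - 1 - 1)) * sgn s"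
  unfolding w_def[abs_def] by (intro DERIV_chain2[where f = "%x. x powr (d - 1)"] has_real_derivative_powr) auto
 moreover have "(1 + abs s) powr (d - 1 - 1) = w s / (1 + abs s)"
  unfolding w_def by (simp add: powr_diff power2_eq_square)
 ultimately show ?thesis by (simp add: drift_def mult_ac)
qed

lemma sets_nu [simp, measurable_cong]: "sets nu = sets borel"
 by (simp add: nu_def)

lemma space_nu [simp]: "space nu = UNIV"
 by (simp add: nu_def)

lemma AE_nu: "(AE s in nu. P s) \<longleftrightarrow> (AE s in lborel. P s)"
 unfolding nu_def by (subst AE_density) (auto simp: w_pos)

lemma integrable_nu: "meas f ==> integrable nu f \<longleftrightarrow> integrable lborel (%s. w s * f s)"
 unfolding nu_def by (subst integrable_density) (auto simp: less_imp_le[OF w_pos])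

lemma integral_nu: "meas f ==> (LINT s|nu. f s) = (LINT s|lborel. w s * f s)"
 unfolding nu_def by (subst integral_density) (auto simp: less_imp_le[OF w_pos])

text \<open>Half of the exponential rate is spent on the polynomial weight, the other half on
  integrability.\<close>

lemma integrable_nu_bound:
 assumes "meas f" "\<kappa> > 0" "!!s. abs (f s) <= C * exp (- \<kappa> * abs s)"
 shows "integrable nu f"
proof -
 obtain D where D: "D > 0" "!!x. x >= 0 ==> (1 + x) powr (d - 1) <= D * exp (\<kappa> / 2 * x)"
  using powr_le_exp[of "\<kappa> / 2" "d - 1"] assms(2) by auto
 have C: "C >= 0" using order_trans[OF abs_ge_zero assms(3)[of 0]] by simp
 have "integrable lborel (%s. w s * f s)"
 proof (rule Bochner_Integration.integrable_bound)
  show "integrable lborel (%s::real. D * C * exp (- (\<kappa> / 2) * abs s))"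
   using assms(2) by (intro integrable_mult_right integrable_exp_abs) auto
  show "(%s. w s * f s) \<in> borel_measurable lborel" using assms(1) by measurable
  show "AE s in lborel. norm (w s * f s) <= norm (D * C * exp (- (\<kappa> / 2) * abs s))"
  proof (rule AE_I2)
   fix s
   have "abs (w s * f s) <= (D * exp (\<kappa> / 2 * abs s)) * (C * exp (- \<kappa> * abs s))"
    unfolding abs_mult using D(2)[of "abs s"] D(1) w_pos[of s] assms(3)[of s]
    by (intro mult_mono) (auto simp: w_def)
   also have "... = D * C * (exp (\<kappa> / 2 * abs s) * exp (- \<kappa> * abs s))" by simp
   also have "exp (\<kappa> / 2 * abs s) * exp (- \<kappa> * abs s) = exp (- (\<kappa> / 2) * abs s)"
    by (simp flip: exp_add add: field_simps)
   finally show "norm (w s * f s) <= norm (D * C * exp (- (\<kappa> / 2) * abs s))"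
    using D C by (simp add: abs_mult)
  qed
 qed
 then show ?thesis using integrable_nu[OF assms(1)] by simp
qed

lemma L2_nu_bound:
 assumes "meas f" "\<kappa> > 0" "!!s. abs (f s) <= C * exp (- \<kappa> * abs s)"
 shows "f \<in> L2 nu"
proof (rule L2_I)
 show "f \<in> borel_measurable nu" using assms(1) by simp
 show "integrable nu (%s. (f s)^2)"
 proof (rule integrable_nu_bound[of _ "2 * \<kappa>" "C\<^sup>2"])
  fix s
  have "abs (f s)^2 <= (C * exp (- \<kappa> * abs s))^2" using assms(3)[of s] by (intro power_mono) auto
  also have "... = C\<^sup>2 * exp (- (2 * \<kappa>) * abs s)"
   by (simp add: power_mult_distrib flip: exp_of_nat_mult)
  finally show "\<bar>(f s)^2\<bar> <= C\<^sup>2 * exp (- (2 * \<kappa>) * abs s)" by simp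
 qed (use assms in auto)
qed

lemma compact_support_L2:
 assumes "cont f" "!!s. abs s >= N ==> f s = 0"
 shows "f \<in> L2 nu"
proof -
 obtain C where "!!s. abs (f s) <= C * exp (- 1 * abs s)" using compact_support_exp_bound[OF assms] by blast
 then show ?thesis by (rule L2_nu_bound[of f 1 C, rotated 2]) (auto intro: borel_measurable_continuous_onI assms)
qed

lemma test_L2:
 assumes "f \<in> test"
 shows "f \<in> L2 nu"
proof -
 obtain N where "!!s. abs s >= N ==> f s = 0" using assms unfolding test_def by auto
 then show ?thesis by (rule compact_support_L2[OF test_continuous[OF assms]])
qed

lemma bump_L2: "\<delta> > 0 ==> bump a \<delta> \<in> L2 nu"
 by (intro test_L2 bump_test)

text \<open>Stone--Weierstrass on the support of the bump. Multiplying a polynomial by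
  \<open>bump\<close> restores compact support without leaving \<open>test\<close>, and the error
  inherits the factor \<open>bump\<close>.\<close>

lemma test_approx:
 assumes "cont c" "\<delta> > 0" "e > 0"
 obtains p where "(%s. p s * bump a \<delta> s) \<in> test" "!!s. \<bar>p s * bump a \<delta> s - c s * bump a \<delta> s\<bar> <= e * bump a \<delta> s"
proof -
 obtain p where p: "real_polynomial_function p" "!!s. s \<in> {a - \<delta>..a + \<delta>} ==> abs (c s - p s) < e"
  using Stone_Weierstrass_real_polynomial_function[of "{a - \<delta>..a + \<delta>}" c e] assms
  by (metis compact_Icc continuous_on_subset top_greatest)
 obtain p' where p': "real_polynomial_function p'" "!!s. (DERIV p s :> p' s)"
  using has_real_derivative_polynomial_function[OF p(1)] by blast
 obtain p'' where p'': "real_polynomial_function p''" "!!s. (DERIV p' s :> p'' s)"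
  using has_real_derivative_polynomial_function[OF p'(1)] by blast
 have "cont p''"
  using p''(1) by (intro continuous_on_polymonial_function) (simp add: real_polynomial_function_eq)
 then have "(%s. p s * bump a \<delta> s) \<in> test" using p' p'' assms by (intro test_mult bump_test) auto
 moreover have "\<bar>p s * bump a \<delta> s - c s * bump a \<delta> s\<bar> <= e * bump a \<delta> s" for s
 proof (cases "abs (s - a) >= \<delta>")
  case True then show ?thesis using bump_eq_0[OF assms(2)] by simp
 next
  case False
  then have "abs (c s - p s) < e" by (intro p) auto
  then have "abs (p s - c s) * bump a \<delta> s <= e * bump a \<delta> s" by (intro mult_right_mono bump_nonneg) linarith
  then show ?thesis using bump_nonneg[of a \<delta> s] by (simp add: left_diff_distrib[symmetric] abs_mult)
 qed
 ultimately show thesis by (rule that)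
qed

lemma test_approx_L2:
 assumes "cont c" "\<delta> > 0" "e > 0"
 obtains g where "g \<in> test" "nrm (%s. g s - c s * bump a \<delta> s) < e" "!!s. abs (s - a) >= \<delta> ==> g s = 0"
proof -
 let ?b = "nrm (bump a \<delta>)"
 have e': "e / (?b + 1) > 0" using assms L2_norm_nonneg[of nu "bump a \<delta>"] by simp
 obtain p where p: "(%s. p s * bump a \<delta> s) \<in> test"
  "!!s. \<bar>p s * bump a \<delta> s - c s * bump a \<delta> s\<bar> <= e / (?b + 1) * bump a \<delta> s"
  using test_approx[OF assms(1,2) e'] by blast
 have "nrm (%s. p s * bump a \<delta> s - c s * bump a \<delta> s) <= nrm (%s. e / (?b + 1) * bump a \<delta> s)"
 proof (rule L2_norm_mono)
  show "(%s. p s * bump a \<delta> s - c s * bump a \<delta> s) \<in> borel_measurable nu"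
   using test_measurable[OF p(1)] borel_measurable_continuous_onI[OF assms(1)] by measurable
  show "(%s. e / (?b + 1) * bump a \<delta> s) \<in> L2 nu" by (intro L2_scale bump_L2 assms)
  show "AE s in nu. \<bar>p s * bump a \<delta> s - c s * bump a \<delta> s\<bar> <= \<bar>e / (?b + 1) * bump a \<delta> s\<bar>"
  proof (rule AE_I2)
   fix s show "\<bar>p s * bump a \<delta> s - c s * bump a \<delta> s\<bar> <= \<bar>e / (?b + 1) * bump a \<delta> s\<bar>"
    using p(2)[of s] by linarith
  qed
 qed
 also have "... = e / (?b + 1) * ?b" unfolding L2_norm_scale using e' by (simp del: abs_divide)
 also have "... < e" using assms L2_norm_nonneg[of nu "bump a \<delta>"] by (simp add: field_simps add_nonneg_pos)
 finally show thesis using p(1) bump_eq_0[OF assms(2)] by (intro that[of "%s. p s * bump a \<delta> s"]) simp_all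
qed

lemma bump_tendsto_1: "(%n. bump 0 (real (Suc n)) s) \<longlonglongrightarrow> 1"
proof -
 have "(%n. (max 0 (1 - ((s - 0) * (1 / real (Suc n)))^2)) ^ 3) \<longlonglongrightarrow> (max 0 (1 - ((s - 0) * 0)^2)) ^ 3"
  by (intro tendsto_intros LIMSEQ_Suc[OF lim_1_over_n])
 then show ?thesis by (simp add: bump_def)
qed

text \<open>Three approximations with error \<open>e / 3\<close> each: clipping values and support,
  replacing the clipped function by a continuous one, and replacing that by a polynomial times a
  bump.\<close>

lemma test_dense:
 assumes f: "f \<in> L2 nu" and e: "e > 0"
 obtains g where "g \<in> test" "nrm (%s. f s - g s) < e"
proof -
 define cl where "cl n y = max (- real n) (min (real n) y)" for n :: nat and y :: real
 have cl_le: "abs (cl n y) <= abs y" "abs (cl n y) <= real n" for n y by (auto simp: cl_def)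
 have cl_tendsto: "(%n. cl (Suc n) y) \<longlonglongrightarrow> y" for y
 proof (rule tendsto_eventually)
  obtain m where "abs y <= real m" using real_arch_simple by blast
  then show "\<forall>\<^sub>F n in sequentially. cl (Suc n) y = y"
   unfolding eventually_sequentially cl_def by (intro exI[of _ m]) (auto simp: abs_le_iff)
 qed
 have fm: "meas f" using L2_measurable[OF f] by simp
 define F where "F n s = cl (Suc n) (f s) * bump 0 (real (Suc n)) s" for n s
 have clm: "cl n \<in> borel_measurable borel" for n unfolding cl_def by measurable
 have Fm: "F n \<in> borel_measurable borel" for n unfolding F_def using fm clm[of "Suc n"] by measurable
 have "(%n. nrm (%s. F n s - f s)) \<longlonglongrightarrow> 0"
 proof (rule L2_dominated[of _ _ "%s. 2 * abs (f s)"])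
  show "(%s. 2 * abs (f s)) \<in> L2 nu" by (intro L2_scale L2_abs f)
  show "AE s in nu. abs (F n s - f s) <= abs (2 * abs (f s))" for n
  proof (rule AE_I2)
   fix s
   have "abs (F n s) <= abs (f s) * 1" unfolding F_def abs_mult
    using cl_le(1)[of "Suc n" "f s"] bump_nonneg[of 0 "real (Suc n)" s] bump_le_1[of 0 "real (Suc n)" s]
    by (intro mult_mono) auto
   then show "abs (F n s - f s) <= abs (2 * abs (f s))" by linarith
  qed
  show "AE s in nu. (%n. F n s - f s) \<longlonglongrightarrow> 0"
  proof (rule AE_I2)
   fix s
   have "(%n. F n s - f s) \<longlonglongrightarrow> f s * 1 - f s"
    unfolding F_def by (intro tendsto_intros cl_tendsto bump_tendsto_1)
   then show "(%n. F n s - f s) \<longlonglongrightarrow> 0" by simp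
  qed
 qed (use Fm fm in auto)
 then have "\<forall>\<^sub>F n in sequentially. nrm (%s. F n s - f s) < e / 3"
  using e by (intro order_tendstoD) auto
 then obtain n where n: "nrm (%s. F n s - f s) < e / 3"
  by (auto simp: eventually_sequentially)
 have FL: "F n \<in> L2 nu"
 proof (rule L2_bound[where g = f and c = 1])
  show "AE x in nu. abs (F n x) <= 1 * abs (f x)"
  proof (rule AE_I2)
   fix s
   have "abs (F n s) <= abs (f s) * 1" unfolding F_def abs_mult
    using cl_le(1)[of "Suc n" "f s"] bump_nonneg[of 0 "real (Suc n)" s] bump_le_1[of 0 "real (Suc n)" s]
    by (intro mult_mono) auto
   then show "abs (F n s) <= 1 * abs (f s)" by simp
  qed
 qed (use Fm f in auto)
 \<comment> \<open>A measurable function is an almost everywhere limit of continuous ones, without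
   any control of their size. Clipping at \<open>Suc n\<close> after the fact keeps them continuous
   and supplies the dominating function.\<close>
 have "f measurable_on UNIV"
  using fm by (intro lebesgue_measurable_imp_measurable_on) (auto simp: measurable_completion)
 then obtain N g where g: "negligible N" "!!m. cont (g m)" "!!s. s \<notin> N ==> (%m. g m s) \<longlonglongrightarrow> f s"
  unfolding measurable_on_def by auto
 have gm: "g m \<in> borel_measurable borel" for m by (intro borel_measurable_continuous_onI g)
 let ?b = "bump 0 (real (Suc n))"
 have "(%m. nrm (%s. cl (Suc n) (g m s) * ?b s - F n s)) \<longlonglongrightarrow> 0"
 proof (rule L2_dominated[of _ _ "%s. 2 * real (Suc n) * ?b s"])
  show "(%s. cl (Suc n) (g m s) * ?b s - F n s) \<in> borel_measurable nu" for m
   using Fm gm[of m] clm[of "Suc n"] by measurable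
  show "(%s. 2 * real (Suc n) * ?b s) \<in> L2 nu" by (intro L2_scale bump_L2) simp
  show "AE s in nu. abs (cl (Suc n) (g m s) * ?b s - F n s) <= abs (2 * real (Suc n) * ?b s)" for m
  proof (rule AE_I2)
   fix s
   have "abs (cl (Suc n) (g m s) - cl (Suc n) (f s)) <= 2 * real (Suc n)"
    unfolding mult_2 by (rule order_trans[OF abs_triangle_ineq4 add_mono[OF cl_le(2) cl_le(2)]])
   then have "abs (cl (Suc n) (g m s) - cl (Suc n) (f s)) * ?b s <= 2 * real (Suc n) * ?b s"
    by (intro mult_right_mono bump_nonneg)
   then show "abs (cl (Suc n) (g m s) * ?b s - F n s) <= abs (2 * real (Suc n) * ?b s)"
    unfolding F_def using bump_nonneg[of 0 "real (Suc n)" s]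
    by (simp add: left_diff_distrib[symmetric] abs_mult)
  qed
  have "N \<in> null_sets lebesgue" using g(1) by (simp add: negligible_iff_null_sets)
  then have "AE s in lebesgue. s \<notin> N" by (rule AE_not_in)
  then have "AE s in lborel. s \<notin> N" by (simp add: AE_completion_iff)
  then have "AE s in nu. s \<notin> N" by (simp add: AE_nu)
  then show "AE s in nu. (%m. cl (Suc n) (g m s) * ?b s - F n s) \<longlonglongrightarrow> 0"
  proof eventually_elim
   case (elim s)
   have "(%m. cl (Suc n) (g m s) * ?b s - F n s) \<longlonglongrightarrow> cl (Suc n) (f s) * ?b s - F n s"
    unfolding cl_def by (intro tendsto_intros g elim)
   then show ?case by (simp add: F_def)
  qed
 qed
 then have "\<forall>\<^sub>F m in sequentially. nrm (%s. cl (Suc n) (g m s) * ?b s - F n s) < e / 3"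
  using e by (intro order_tendstoD) auto
 then obtain m where m: "nrm (%s. cl (Suc n) (g m s) * ?b s - F n s) < e / 3"
  by (auto simp: eventually_sequentially)
 have cont: "cont (%s. cl (Suc n) (g m s))"
  unfolding cl_def by (intro continuous_intros g)
 obtain h where h: "h \<in> test" "nrm (%s. h s - cl (Suc n) (g m s) * ?b s) < e / 3"
  using test_approx_L2[OF cont, of "real (Suc n)" "e / 3" 0] e by auto
 have GL: "(%s. cl (Suc n) (g m s) * ?b s) \<in> L2 nu"
 proof (rule compact_support_L2)
  show "cont (%s. cl (Suc n) (g m s) * ?b s)" by (intro continuous_intros cont)
  show "cl (Suc n) (g m s) * ?b s = 0" if "abs s >= real (Suc n)" for s
   using bump_eq_0[of "real (Suc n)" s 0] that by simp
 qed
 have "nrm (%s. f s - h s) <= nrm (%s. f s - F n s) + nrm (%s. F n s - h s)"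
  by (intro L2_norm_triangle_diff f FL test_L2 h)
 moreover have "nrm (%s. F n s - h s) <= nrm (%s. F n s - cl (Suc n) (g m s) * ?b s)
   + nrm (%s. cl (Suc n) (g m s) * ?b s - h s)"
  by (intro L2_norm_triangle_diff FL test_L2 h GL)
 ultimately have "nrm (%s. f s - h s) < e"
  using n m h(2) L2_norm_minus_commute[of nu f "F n"] L2_norm_minus_commute[of nu "F n" "%s. cl (Suc n) (g m s) * ?b s"]
   L2_norm_minus_commute[of nu "%s. cl (Suc n) (g m s) * ?b s" h] by linarith
 then show thesis using h(1) that by blast
qed

lemma L2_orthogonal_test:
 assumes "g \<in> L2 nu" "!!f. f \<in> test ==> ip g f = 0"
 shows "AE s in nu. g s = 0"
proof -
 have "nrm g <= e" if e: "e > 0" for e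
 proof -
  obtain f where f: "f \<in> test" "nrm (%s. g s - f s) < e"
   using test_dense[OF assms(1) e] by blast
  have "nrm g * nrm g = ip g g" by (simp add: L2_norm_sq[symmetric] power2_eq_square)
  also have "... = ip g (%s. g s - f s)"
   using assms(2)[OF f(1)] by (simp add: L2_inner_diff_right assms(1) test_L2[OF f(1)])
  also have "... <= nrm g * e"
   using L2_cauchy_schwarz[OF assms(1) L2_diff[OF assms(1) test_L2[OF f(1)]]]
    mult_left_mono[OF less_imp_le[OF f(2)] L2_norm_nonneg[of nu g]] by linarith
  finally have "nrm g * (nrm g - e) <= 0" by (simp add: algebra_simps)
  then show ?thesis using L2_norm_nonneg[of nu g] that by (auto simp: mult_le_0_iff)
 qed
 then have "nrm g <= 0" using field_le_epsilon[of "nrm g" 0] by simp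
 then have "nrm g = 0" using L2_norm_nonneg[of nu g] by simp
 then show ?thesis using L2_norm_eq_0_iff[OF assms(1)] by simp
qed

text \<open>The Riesz bound for a function that is not yet known to be square integrable. With
  \<open>h\<close> the product of \<open>c\<close> and a bump, \<open>h^2 <= c * h\<close> because a
  bump is at least its square; testing with approximations of \<open>h\<close> gives
  \<open>nrm h * nrm h <= B * nrm h\<close>. The cut-off is then removed by Fatou's lemma.\<close>

lemma L2_duality:
 assumes c: "cont c" and B: "B >= 0"
  and bd: "!!f. f \<in> test ==> abs (LINT s|nu. c s * f s) <= B * nrm f"
 shows "c \<in> L2 nu" "nrm c <= B"
proof -
 have cm: "meas c" by (intro borel_measurable_continuous_onI c)
 let ?h = "%n s. c s * bump 0 (real (Suc n)) s"
 have hL: "?h n \<in> L2 nu" for n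
 proof (rule compact_support_L2)
  show "cont (?h n)" by (intro continuous_intros c)
  show "?h n s = 0" if "abs s >= real (Suc n)" for s
   using bump_eq_0[of "real (Suc n)" s 0] that by simp
 qed
 have hB: "nrm (?h n) <= B" for n
 proof -
  let ?N = "real (Suc n)"
  \<comment> \<open>Square integrable and equal to \<open>c\<close> on the supports of all functions
    used for testing, so that the pairing with \<open>c\<close> can be treated as an inner
    product.\<close>
  define c' where "c' s = (if abs s <= ?N then c s else 0)" for s
  obtain K where K: "!!s. abs s <= ?N ==> abs (c s) <= K"
  proof -
   have "compact (c ` {-?N..?N})"
    by (intro compact_continuous_image continuous_on_subset[OF c]) auto
   then obtain K where "!!s. s \<in> {-?N..?N} ==> abs (c s) <= K"
    by (metis compact_imp_bounded bounded_iff imageI real_norm_def)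
   then show thesis by (intro that[of K]) (auto simp: abs_le_iff)
  qed
  have K0: "0 <= K" using K[of 0] by simp
  have c'L: "c' \<in> L2 nu"
  proof (rule L2_nu_bound[of _ 1 "K * exp ?N"])
   show "meas c'" unfolding c'_def using cm by measurable
   show "abs (c' s) <= K * exp ?N * exp (- 1 * abs s)" for s
   proof (cases "abs s <= ?N")
    case True
    have "1 <= exp ?N * exp (- 1 * abs s)" using True by (simp flip: exp_add)
    then have "K * 1 <= K * (exp ?N * exp (- 1 * abs s))" by (rule mult_left_mono[OF _ K0])
    then show ?thesis using K[OF True] True by (simp add: c'_def mult.assoc)
   qed (use K0 in \<open>simp add: c'_def\<close>)
  qed simp
  have eq: "(LINT s|nu. c s * f s) = ip c' f" if "!!s. abs (s - 0) >= ?N ==> f s = 0" for f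
   unfolding L2_inner_def c'_def using that by (intro Bochner_Integration.integral_cong) auto
  have "nrm (?h n) * nrm (?h n) <= B * nrm (?h n) + e" if e: "e > 0" for e
  proof -
   define e' where "e' = e / (nrm c' + B + 1)"
   have pos: "nrm c' + B + 1 > 0" using L2_norm_nonneg[of nu c'] B by linarith
   have e': "e' > 0" using e pos by (simp add: e'_def)
   have e'e: "e' * (nrm c' + B) <= e"
    using e pos L2_norm_nonneg[of nu c'] B unfolding e'_def by (simp add: field_simps)
   obtain g where g: "g \<in> test" "nrm (%s. g s - ?h n s) < e'" "!!s. abs (s - 0) >= ?N ==> g s = 0"
    using test_approx_L2[OF c, of ?N e' 0] e' by auto
   have gL: "g \<in> L2 nu" by (rule test_L2[OF g(1)])
   have "nrm (?h n) * nrm (?h n) = (LINT s|nu. (?h n s)^2)"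
    using L2_norm_sq[of nu "?h n"] by (simp add: power2_eq_square L2_inner_self)
   also have "... <= ip c' (?h n)"
    unfolding L2_inner_def
   proof (rule integral_mono)
    show "integrable nu (%s. (?h n s)^2)" by (rule L2_integrable_sq[OF hL])
    show "integrable nu (%s. c' s * ?h n s)" by (rule L2_mult_integrable[OF c'L hL])
    fix s
    show "(?h n s)^2 <= c' s * ?h n s"
    proof (cases "abs s <= ?N")
     case True
     have "(bump 0 ?N s)^2 <= bump 0 ?N s"
      using bump_nonneg[of 0 ?N s] bump_le_1[of 0 ?N s] by (simp add: power2_eq_square mult_left_le)
     then have "(c s)^2 * (bump 0 ?N s)^2 <= (c s)^2 * bump 0 ?N s" by (intro mult_left_mono) auto
     then show ?thesis using True by (simp add: c'_def power2_eq_square mult_ac)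
    next
     case False then show ?thesis using bump_eq_0[of ?N s 0] by simp
    qed
   qed
   also have "ip c' (?h n) = ip c' g - ip c' (%s. g s - ?h n s)"
    by (simp add: L2_inner_diff_right c'L gL hL del: of_nat_Suc)
   also have "... <= B * nrm g + nrm c' * e'"
   proof -
    have "abs (ip c' g) <= B * nrm g" using bd[OF g(1)] eq[OF g(3)] by simp
    moreover have "abs (ip c' (%s. g s - ?h n s)) <= nrm c' * e'"
     by (rule order_trans[OF L2_cauchy_schwarz[OF c'L L2_diff[OF gL hL]]
        mult_left_mono[OF less_imp_le[OF g(2)] L2_norm_nonneg]])
    ultimately show ?thesis by linarith
   qed
   also have "... <= B * (nrm (?h n) + e') + nrm c' * e'"
    by (rule add_right_mono[OF mult_left_mono[OF order_trans[OF L2_norm_triangle_sub[OF gL hL]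
        add_left_mono[OF less_imp_le[OF g(2)]]] B]])
   also have "... <= B * nrm (?h n) + e" using e'e unfolding distrib_left by (simp add: algebra_simps del: of_nat_Suc)
   finally show ?thesis .
  qed
  then have "nrm (?h n) * nrm (?h n) <= B * nrm (?h n)" by (rule field_le_epsilon)
  then have "nrm (?h n) * (nrm (?h n) - B) <= 0" by (simp add: algebra_simps)
  then show ?thesis using L2_norm_nonneg[of nu "?h n"] B by (auto simp: mult_le_0_iff)
 qed
 have "AE s in nu. (%n. ?h n s) \<longlonglongrightarrow> c s"
 proof (rule AE_I2)
  fix s
  have "(%n. ?h n s) \<longlonglongrightarrow> c s * 1" by (intro tendsto_intros bump_tendsto_1)
  then show "(%n. ?h n s) \<longlonglongrightarrow> c s" by simp
 qed
 with hL hB cm B show "c \<in> L2 nu" "nrm c <= B"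
  using L2_Fatou[of ?h nu c B] by (auto intro: always_eventually)
qed

text \<open>\<open>nu\<close> charges every interval. This is the bridge from operator identities,
  which hold almost everywhere, to pointwise statements about the continuous kernel.\<close>

lemma AE_nu_continuous_eq:
 fixes f g :: "real => real"
 assumes "cont f" "cont g" "AE s in nu. f s = g s"
 shows "f = g"
proof (rule ccontr)
 assume "f ~= g"
 then obtain a where a: "f a ~= g a" by auto
 have "open {s. f s ~= g s}" using assms(1,2) by (intro open_Collect_neq)
 then obtain e where e: "e > 0" "ball a e \<subseteq> {s. f s ~= g s}" using a by (auto simp: open_contains_ball)
 have "AE s in lborel. s \<notin> ball a e"
  using assms(3) unfolding AE_nu by eventually_elim (use e in auto)
 then have "emeasure lborel (ball a e) = 0"
  by (subst (asm) AE_iff_measurable[OF _ refl]) (auto simp: ball_def)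
 moreover have "ball a e = {a - e<..<a + e}" by (auto simp: dist_real_def)
 ultimately show False using e by simp
qed

end

section \<open>The closed form\<close>

definition C1R :: "(real => real) set" where
 "C1R = {f. f C1_differentiable_on UNIV & compact (closure {s. f s ~= 0})}"

lemma C1R_I:
 assumes "!!s. (DERIV f s :> f' s)" "cont f'" "!!s. abs s >= N ==> f s = 0"
 shows "f \<in> C1R"
proof -
 have "{s. f s ~= 0} \<subseteq> {-N..N}"
 proof
  fix s assume "s \<in> {s. f s ~= 0}"
  then have "abs s < N" using assms(3)[of s] by force
  then show "s \<in> {-N..N}" by auto
 qed
 then have "bounded {s. f s ~= 0}" by (rule bounded_subset[rotated]) simp
 then show ?thesis unfolding C1R_def C1_differentiable_on_def
  using assms by (auto simp: compact_eq_bounded_closed has_real_derivative_iff_has_vector_derivative)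
qed

lemma C1R_D:
 assumes "f \<in> C1R"
 obtains N where "!!s. (DERIV f s :> deriv f s)" "cont (deriv f)"
  "!!s. abs s >= N ==> f s = 0 & deriv f s = 0" "N > 0"
proof -
 obtain D where D: "!!s. (DERIV f s :> D s)" "cont D"
  using assms unfolding C1R_def C1_differentiable_on_def
  by (auto simp: has_real_derivative_iff_has_vector_derivative)
 have dD: "deriv f = D" using D(1) by (auto intro: DERIV_imp_deriv)
 have "bounded {s. f s ~= 0}" using assms unfolding C1R_def
  using bounded_subset[OF compact_imp_bounded closure_subset] by blast
 then obtain B where B: "!!s. f s ~= 0 ==> abs s <= B" unfolding bounded_iff by auto
 have z: "f s = 0 & deriv f s = 0" if s: "abs s >= abs B + 1" for s
 proof
  show "f s = 0" using B[of s] s by force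
  have "DERIV (%_. 0) s :> 0" by simp
  moreover have "\<forall>\<^sub>F y in nhds s. 0 = f y"
  proof -
   have "open (- {-abs B..abs B})" "s \<in> - {-abs B..abs B}" using s by auto
   then show ?thesis by (rule eventually_mono[OF eventually_nhds_in_open]) (use B in force)
  qed
  ultimately have "DERIV f s :> 0"
   using DERIV_cong_ev[OF refl _ refl, of "%_. 0" f s 0] by simp
  then show "deriv f s = 0" by (rule DERIV_imp_deriv)
 qed
 have "!!s. (DERIV f s :> deriv f s)" "cont (deriv f)" "abs B + 1 > 0"
  using D by (simp_all add: dD)
 then show thesis using z by (intro that[of "abs B + 1"]) auto
qed

lemma C1R_deriv:
 assumes "f \<in> C1R"
 shows "DERIV f s :> deriv f s"
 by (rule C1R_D[OF assms]) blast

lemma C1R_continuous: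
 assumes "f \<in> C1R"
 shows "continuous_on A f" "continuous_on A (deriv f)"
proof -
 show "continuous_on A f"
  by (intro continuous_at_imp_continuous_on ballI DERIV_isCont[OF C1R_deriv[OF assms]])
 show "continuous_on A (deriv f)"
  using C1R_D[OF assms] continuous_on_subset[of UNIV "deriv f" A] by blast
qed

lemma C1R_measurable: "f \<in> C1R ==> f \<in> borel_measurable borel" "f \<in> C1R ==> deriv f \<in> borel_measurable borel"
 by (auto intro: borel_measurable_continuous_onI C1R_continuous)

lemma C1R_diff:
 assumes "f \<in> C1R" "g \<in> C1R"
 shows "(%s. f s - g s) \<in> C1R" "deriv (%s. f s - g s) = (%s. deriv f s - deriv g s)"
proof -
 obtain N where N: "!!s. abs s >= N ==> f s = 0 & deriv f s = 0" using C1R_D[OF assms(1)] by metis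
 obtain N' where N': "!!s. abs s >= N' ==> g s = 0 & deriv g s = 0" using C1R_D[OF assms(2)] by metis
 have 1: "DERIV (%s. f s - g s) s :> deriv f s - deriv g s" for s
  by (intro DERIV_diff C1R_deriv assms)
 then show "deriv (%s. f s - g s) = (%s. deriv f s - deriv g s)" by (auto intro: DERIV_imp_deriv)
 show "(%s. f s - g s) \<in> C1R"
  by (rule C1R_I[OF 1 continuous_on_diff[OF C1R_continuous(2)[OF assms(1)] C1R_continuous(2)[OF assms(2)]], of "max N N'"])
   (use N N' in auto)
qed

lemma test_C1R: "f \<in> test ==> f \<in> C1R"
proof -
 assume "f \<in> test"
 then obtain f' f'' N where f: "!!s. (DERIV f s :> f' s)" "!!s. (DERIV f' s :> f'' s)"
  "!!s. abs s >= N ==> f s = 0" unfolding test_def by blast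
 show ?thesis
  by (rule C1R_I[OF f(1) _ f(3)]) (meson DERIV_isCont continuous_at_imp_continuous_on f(2))
qed

text \<open>The exceptional point \<open>0\<close> is needed because the weight has a kink there.\<close>

lemma integration_by_parts:
 assumes F: "F \<in> C1R" and p: "cont p" "!!s. s ~= 0 ==> (DERIV p s :> p' s)"
  and int: "integrable lborel (%s. deriv F s * p s + F s * p' s)"
 shows "(LINT s|lborel. deriv F s * p s + F s * p' s) = 0"
proof -
 obtain N where N: "!!s. abs s >= N ==> F s = 0 & deriv F s = 0" "N > 0" using C1R_D[OF F] by metis
 let ?g = "%s. deriv F s * p s + F s * p' s"
 have "(?g has_integral F N * p N - F (- N) * p (- N)) {-N..N}"
 proof (rule fundamental_theorem_of_calculus_interior_strong[where S = "{0}"])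
  show "continuous_on {-N..N} (%s. F s * p s)"
   by (intro continuous_on_mult C1R_continuous[OF F] continuous_on_subset[OF p(1)]) auto
  fix s assume "s \<in> {-N<..<N} - {0}"
  then show "((%s. F s * p s) has_vector_derivative ?g s) (at s)"
   using DERIV_mult[OF C1R_deriv[OF F] p(2), of s]
   by (simp add: has_real_derivative_iff_has_vector_derivative[symmetric] algebra_simps)
 qed (use N in auto)
 then have "(?g has_integral 0) {-N..N}" using N by simp
 then have "(?g has_integral 0) UNIV"
 proof (rule has_integral_on_superset)
  fix s assume "s \<notin> {-N..N}"
  then have "abs s >= N" by auto
  then show "?g s = 0" using N by simp
 qed simp
 then show ?thesis using has_integral_integral_lborel[OF int] has_integral_unique by blast
qed

text \<open>The slope tends to \<open>0\<close> as the plateau widens, so cutting off with these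
  bumps changes the energy by a vanishing amount.\<close>

lemma bump_deriv:
 assumes "\<delta> > 0"
 obtains b where "!!s. (DERIV (bump 0 \<delta>) s :> b s)" "cont b" "!!s. abs (b s) <= 6 / \<delta>"
proof -
 let ?b = "%s. 3 * (max 0 (1 - (s / \<delta>)^2))^2 * (- 2 * s / \<delta>^2)"
 have p3: "DERIV (%y::real. (max 0 y) ^ 3) y :> 3 * (max 0 y)^2" for y
  using DERIV_max0_power[of 1 y] by (simp add: numeral_eq_Suc)
 have u: "DERIV (%s. 1 - (s / \<delta>)^2) s :> - 2 * s / \<delta>^2" for s
  using assms by (auto intro!: derivative_eq_intros simp: power2_eq_square field_simps)
 have 1: "DERIV (bump 0 \<delta>) s :> ?b s" for s
  unfolding bump_def[abs_def] diff_0_right by (rule DERIV_chain2[OF p3 u])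
 have 2: "cont ?b" using assms by (intro continuous_intros) auto
 have 3: "abs (?b s) <= 6 / \<delta>" for s
 proof (cases "abs s >= \<delta>")
  case True
  then have "1 <= \<bar>s / \<delta>\<bar>" using assms by (simp add: field_simps)
  then have "1 <= (s / \<delta>)^2" using power_mono[of 1 "\<bar>s / \<delta>\<bar>" 2] by (simp del: abs_divide)
  then show ?thesis using assms by simp
 next
  case False
  have "(max 0 (1 - (s / \<delta>)^2))^2 <= 1" by (intro power_le_one) auto
  then have "abs (?b s) <= (3 * 1) * \<bar>- 2 * s / \<delta>^2\<bar>" unfolding abs_mult by (intro mult_mono) auto
  also have "... = 6 * abs s / \<delta>^2" by (simp add: abs_mult)
  also have "... <= 6 * \<delta> / \<delta>^2" using False by (intro divide_right_mono) auto
  also have "... = 6 / \<delta>" using assms by (simp add: power2_eq_square)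
  finally show ?thesis .
 qed
 show thesis by (rule that[OF 1 2 3])
qed

section \<open>Weak derivatives and closability of the form\<close>

context bessel
begin

definition QR :: "(real => real) => (real => real) => real" where
 "QR f g = (LINT s|nu. deriv f s * deriv g s)"

lemma C1R_L2:
 assumes "f \<in> C1R"
 shows "f \<in> L2 nu" "deriv f \<in> L2 nu"
proof -
 obtain N where N: "!!s. abs s >= N ==> f s = 0 & deriv f s = 0" using C1R_D[OF assms] by metis
 show "f \<in> L2 nu" "deriv f \<in> L2 nu"
  by (rule compact_support_L2[of _ N]; use N C1R_continuous[OF assms] in auto)+
qed

lemma QR_eq: "QR f g = ip (deriv f) (deriv g)"
 by (simp add: QR_def L2_inner_def)

text \<open>\<open>wderiv f g\<close>: \<open>f\<close> lies in the domain of the closure of the form and has weak derivative \<open>g\<close>.\<close>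

definition wderiv_seq :: "(nat => real => real) => (real => real) => (real => real) => bool" where
 "wderiv_seq F f g \<longleftrightarrow> f \<in> L2 nu & g \<in> L2 nu & (ALL n. F n \<in> C1R) &
   (%n. nrm (%s. F n s - f s)) \<longlonglongrightarrow> 0 & (%n. nrm (%s. deriv (F n) s - g s)) \<longlonglongrightarrow> 0"

definition wderiv :: "(real => real) => (real => real) => bool" where
 "wderiv f g \<longleftrightarrow> (EX F. wderiv_seq F f g)"

lemma QR_diff: "F \<in> C1R ==> G \<in> C1R ==>
  QR (%s. F s - G s) (%s. F s - G s) = (nrm (%s. deriv F s - deriv G s))^2"
 by (simp add: QR_eq C1R_diff L2_norm_sq)

text \<open>The form is the inner product of derivatives, so a Cauchy sequence for it is one whose
  derivatives are Cauchy in \<open>L2 nu\<close>; completeness supplies the limit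
  derivative.\<close>

lemma form_approx_iff: "form_approx nu C1R QR F f \<longleftrightarrow> (EX g. wderiv_seq F f g)"
proof
 assume a: "form_approx nu C1R QR F f"
 then have F: "F n \<in> C1R" for n unfolding form_approx_def by auto
 obtain g where "g \<in> L2 nu" "(%n. nrm (%x. deriv (F n) x - g x)) \<longlonglongrightarrow> 0"
 proof (rule L2_complete[of "%n. deriv (F n)" nu])
  fix e :: real assume "e > 0"
  then obtain N where N: "!!m n. m >= N ==> n >= N ==> QR (%x. F m x - F n x) (%x. F m x - F n x) < e^2"
   using a unfolding form_approx_def by (metis zero_less_power)
  show "EX N. ALL m>=N. ALL n>=N. nrm (%x. deriv (F m) x - deriv (F n) x) < e"
  proof (intro exI allI impI)
   fix m n assume "m >= N" "n >= N"
   then have "(nrm (%x. deriv (F m) x - deriv (F n) x))^2 < e^2"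
    using N F by (simp add: QR_diff)
   then show "nrm (%x. deriv (F m) x - deriv (F n) x) < e"
    using \<open>e > 0\<close> power_less_imp_less_base by fastforce
  qed
 qed (use F C1R_L2 in auto)
 then show "EX g. wderiv_seq F f g" using a unfolding form_approx_def wderiv_seq_def by blast
next
 assume "EX g. wderiv_seq F f g"
 then obtain g where g: "wderiv_seq F f g" by blast
 then have F: "F n \<in> C1R" for n unfolding wderiv_seq_def by auto
 have gL: "g \<in> L2 nu" using g unfolding wderiv_seq_def by auto
 have "EX N. ALL m>=N. ALL n>=N. QR (%x. F m x - F n x) (%x. F m x - F n x) < e" if e: "e > 0" for e
 proof -
  have "\<forall>\<^sub>F n in sequentially. nrm (%s. deriv (F n) s - g s) < sqrt e / 2"
   using g e unfolding wderiv_seq_def by (intro order_tendstoD(2)[of _ 0]) auto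
  then obtain N where N: "!!n. n >= N ==> nrm (%s. deriv (F n) s - g s) < sqrt e / 2"
   unfolding eventually_sequentially by auto
  show ?thesis
  proof (intro exI allI impI)
   fix m n assume mn: "m >= N" "n >= N"
   have "nrm (%s. deriv (F m) s - deriv (F n) s)
     <= nrm (%s. deriv (F m) s - g s) + nrm (%s. g s - deriv (F n) s)"
    by (intro L2_norm_triangle_diff C1R_L2 F gL)
   then have "nrm (%s. deriv (F m) s - deriv (F n) s) < sqrt e"
    using N[OF mn(1)] N[OF mn(2)] L2_norm_minus_commute[of nu g "deriv (F n)"] by simp
   then have "(nrm (%s. deriv (F m) s - deriv (F n) s))^2 < (sqrt e)^2"
    by (intro power_strict_mono) (auto simp: L2_norm_nonneg)
   then show "QR (%x. F m x - F n x) (%x. F m x - F n x) < e" using F e by (simp add: QR_diff)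
  qed
 qed
 then show "form_approx nu C1R QR F f" using g unfolding form_approx_def wderiv_seq_def by auto
qed

lemma closure_domain_iff: "f \<in> closure_domain nu C1R QR \<longleftrightarrow> (EX g. wderiv f g)"
 unfolding closure_domain_def form_approx_iff wderiv_def by auto

lemma abs_drift_le_const: "abs (drift s) <= d - 1"
proof (rule order_trans[OF abs_drift_le])
 have "(d - 1) / (1 + abs s) <= (d - 1) / 1" using d by (intro divide_left_mono) auto
 then show "(d - 1) / (1 + abs s) <= d - 1" by simp
qed

text \<open>The adjoint of differentiation with respect to \<open>nu\<close>: integrating by parts
  against \<open>w * \<phi>\<close> produces the drift as the logarithmic derivative of the
  weight.\<close>

lemma wderiv_test:
 assumes "wderiv f g" "\<phi> \<in> test" "!!s. (DERIV \<phi> s :> \<phi>' s)"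
 shows "ip g \<phi> = - ip f (%s. \<phi>' s + drift s * \<phi> s)"
proof -
 obtain F where F: "wderiv_seq F f g" using assms(1) unfolding wderiv_def by auto
 have dp: "deriv \<phi> = \<phi>'" using assms(3) by (auto intro: DERIV_imp_deriv)
 have c: "\<phi> \<in> L2 nu" "\<phi>' \<in> L2 nu" "\<phi>' \<in> borel_measurable borel" "\<phi> \<in> borel_measurable borel"
  using C1R_L2[OF test_C1R[OF assms(2)]] C1R_measurable[OF test_C1R[OF assms(2)]] unfolding dp by auto
 have "(%s. drift s * \<phi> s) \<in> L2 nu"
 proof (rule L2_bound[OF _ c(1), of _ "d - 1"])
  show "(%s. drift s * \<phi> s) \<in> borel_measurable nu" using c by measurable
  show "AE s in nu. \<bar>drift s * \<phi> s\<bar> <= (d - 1) * \<bar>\<phi> s\<bar>"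
   by (auto simp: abs_mult intro!: mult_right_mono abs_drift_le_const)
 qed
 then have hL: "(%s. \<phi>' s + drift s * \<phi> s) \<in> L2 nu" by (intro L2_add c)
 have *: "ip (deriv (F n)) \<phi> = - ip (F n) (%s. \<phi>' s + drift s * \<phi> s)" for n
 proof -
  have Fn: "F n \<in> C1R" using F unfolding wderiv_seq_def by auto
  let ?p = "%s. w s * \<phi> s" and ?p' = "%s. w s * (\<phi>' s + drift s * \<phi> s)"
  have i1: "integrable nu (%s. deriv (F n) s * \<phi> s)" "integrable nu (%s. F n s * (\<phi>' s + drift s * \<phi> s))"
   by (intro L2_mult_integrable C1R_L2 Fn c hL)+
  then have i2: "integrable lborel (%s. w s * (deriv (F n) s * \<phi> s))"
    "integrable lborel (%s. w s * (F n s * (\<phi>' s + drift s * \<phi> s)))"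
   using c C1R_measurable[OF Fn] by (auto simp: integrable_nu)
  have "(LINT s|lborel. deriv (F n) s * ?p s + F n s * ?p' s) = 0"
  proof (rule integration_by_parts[OF Fn])
   show "cont ?p" by (intro continuous_intros test_continuous assms)
   show "DERIV ?p s :> ?p' s" if "s ~= 0" for s
    using DERIV_mult[OF DERIV_w[OF that] assms(3)] by (simp add: algebra_simps)
   show "integrable lborel (%s. deriv (F n) s * ?p s + F n s * ?p' s)"
    using Bochner_Integration.integrable_add[OF i2] by (simp add: mult_ac)
  qed
  then have "(LINT s|lborel. w s * (deriv (F n) s * \<phi> s)) + (LINT s|lborel. w s * (F n s * (\<phi>' s + drift s * \<phi> s))) = 0"
   using Bochner_Integration.integral_add[OF i2] by (simp add: mult_ac)
  then show ?thesis unfolding L2_inner_def using c C1R_measurable[OF Fn] by (simp add: integral_nu)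
 qed
 have "(%n. ip (deriv (F n)) \<phi>) \<longlonglongrightarrow> ip g \<phi>"
  using F unfolding wderiv_seq_def by (intro L2_inner_tendsto_left c) (auto intro!: always_eventually C1R_L2)
 moreover have "(%n. - ip (F n) (%s. \<phi>' s + drift s * \<phi> s)) \<longlonglongrightarrow> - ip f (%s. \<phi>' s + drift s * \<phi> s)"
  using F hL unfolding wderiv_seq_def
  by (intro tendsto_minus L2_inner_tendsto_left) (auto intro!: always_eventually C1R_L2)
 ultimately show ?thesis unfolding * by (rule LIMSEQ_unique)
qed

lemma wderiv_L2: "wderiv f g ==> f \<in> L2 nu & g \<in> L2 nu"
 unfolding wderiv_def wderiv_seq_def by auto

text \<open>This is the closability of the form. It ensures that the description operator in
  \<open>closure_form\<close> denotes the limit common to all approximating sequences.\<close>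

lemma wderiv_unique:
 assumes "wderiv f g" "wderiv f g'"
 shows "AE s in nu. g s = g' s"
proof -
 have L: "g \<in> L2 nu" "g' \<in> L2 nu" using assms wderiv_L2 by auto
 have "AE s in nu. g s - g' s = 0"
 proof (rule L2_orthogonal_test)
  show "(%s. g s - g' s) \<in> L2 nu" by (intro L2_intros L)
  fix \<phi> assume \<phi>: "\<phi> \<in> test"
  then obtain \<phi>' where d\<phi>: "!!s. (DERIV \<phi> s :> \<phi>' s)" unfolding test_def by blast
  have "ip g \<phi> = ip g' \<phi>"
   unfolding wderiv_test[OF assms(1) \<phi> d\<phi>] wderiv_test[OF assms(2) \<phi> d\<phi>] ..
  then show "ip (%s. g s - g' s) \<phi> = 0" using L test_L2[OF \<phi>] by (simp add: L2_inner_diff_left)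
 qed
 then show ?thesis by eventually_elim simp
qed

lemma closure_form_eq:
 assumes "wderiv f f'" "wderiv g g'"
 shows "closure_form nu C1R QR f g = ip f' g'"
proof -
 have conv: "(%n. QR (F n) (G n)) \<longlonglongrightarrow> ip f' g'"
  if "form_approx nu C1R QR F f" "form_approx nu C1R QR G g" for F G
 proof -
  from that obtain f'' where F: "wderiv_seq F f f''" unfolding form_approx_iff by auto
  from \<open>form_approx nu C1R QR G g\<close> obtain g'' where G: "wderiv_seq G g g''" unfolding form_approx_iff by auto
  have "AE s in nu. f' s = f'' s" "AE s in nu. g' s = g'' s"
   using wderiv_unique[OF assms(1)] wderiv_unique[OF assms(2)] F G unfolding wderiv_def by blast+
  then have eq: "ip f' g' = ip f'' g''"
   using assms[THEN wderiv_L2] F G unfolding wderiv_seq_def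
   by (intro L2_inner_cong_AE) (auto dest: L2_measurable)
  show ?thesis unfolding eq QR_eq using F G unfolding wderiv_seq_def
   by (intro L2_inner_tendsto) (auto intro!: always_eventually C1R_L2)
 qed
 obtain F G where FG: "form_approx nu C1R QR F f" "form_approx nu C1R QR G g"
  using assms unfolding wderiv_def form_approx_iff by blast
 show ?thesis unfolding closure_form_def
 proof (rule the_equality)
  fix q assume "ALL F G. form_approx nu C1R QR F f --> form_approx nu C1R QR G g --> (%n. QR (F n) (G n)) \<longlonglongrightarrow> q"
  then have "(%n. QR (F n) (G n)) \<longlonglongrightarrow> q" using FG by blast
  then show "q = ip f' g'" using conv[OF FG] by (rule LIMSEQ_unique)
 qed (use conv in blast)
qed

section \<open>The operator and explicit elements of its domain\<close>

definition LR :: "(real => real) => (real => real) => bool" where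
 "LR = form_operator nu C1R QR"

lemma LR_D:
 assumes "LR f h"
 shows "EX f'. wderiv f f' & h \<in> L2 nu & (ALL g g'. wderiv g g' --> ip f' g' = ip h g)"
proof -
 obtain f' where f': "wderiv f f'" using assms unfolding LR_def form_operator_def closure_domain_iff by auto
 have "ip f' g' = ip h g" if g: "wderiv g g'" for g g'
 proof -
  have "closure_form nu C1R QR f g = ip h g"
   using assms closure_domain_iff[of g] g unfolding LR_def form_operator_def by blast
  then show ?thesis using closure_form_eq[OF f' g] by simp
 qed
 then show ?thesis using f' assms by (auto simp: LR_def form_operator_def)
qed

lemma LR_symmetric:
 assumes "LR f h" "LR g k"
 shows "ip h g = ip f k"
proof -
 obtain f' where f: "wderiv f f'" "!!g g'. wderiv g g' ==> ip f' g' = ip h g"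
  using LR_D[OF assms(1)] by blast
 obtain g' where g: "wderiv g g'" "!!f f'. wderiv f f' ==> ip g' f' = ip k f"
  using LR_D[OF assms(2)] by blast
 show ?thesis using f(2)[OF g(1)] g(2)[OF f(1)] L2_inner_commute[of nu f' g'] L2_inner_commute[of nu k f] by simp
qed

text \<open>A classical sufficient condition for the domain, with \<open>q\<close> the value of the
  operator. The equation is stated for the flux \<open>w * f'\<close>, which is continuous at
  \<open>0\<close> and differentiable elsewhere; the second derivative of \<open>f\<close> may jump
  at the kink.\<close>

definition domA :: "(real => real) => (real => real) => (real => real) => bool" where
 "domA f f' q \<longleftrightarrow> (ALL s. (DERIV f s :> f' s)) & cont f' &
   (ALL s. s ~= 0 --> (DERIV (%s. w s * f' s) s :> - (w s * q s))) &
   f \<in> L2 nu & f' \<in> L2 nu & q \<in> L2 nu"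

text \<open>Cut-offs of \<open>f\<close> by widening bumps lie in \<open>C1R\<close> and converge in
  the form norm, the error term \<open>f * b n\<close> having norm at most
  \<open>6 / real (Suc n) * nrm f\<close>. The weak equation is obtained by integrating the flux by
  parts against the approximants of the test element.\<close>

lemma domA_LR:
 assumes "domA f f' q"
 shows "LR f q"
proof -
 have D: "!!s. (DERIV f s :> f' s)" "cont f'"
   "!!s. s ~= 0 ==> (DERIV (%s. w s * f' s) s :> - (w s * q s))"
   "f \<in> L2 nu" "f' \<in> L2 nu" "q \<in> L2 nu" using assms unfolding domA_def by auto
 have cf: "cont f" using D(1) by (meson DERIV_isCont continuous_at_imp_continuous_on)
 have "ALL n. EX b. (ALL s. (bump 0 (real (Suc n)) has_real_derivative b s) (at s)) & cont b & (ALL s. abs (b s) <= 6 / real (Suc n))"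
  using bump_deriv[of "real (Suc _)"] by (metis of_nat_0_less_iff zero_less_Suc)
 then obtain b where b: "!!n s. (bump 0 (real (Suc n)) has_real_derivative b n s) (at s)"
   "!!n. cont (b n)" "!!n s. abs (b n s) <= 6 / real (Suc n)" by metis
 define F where "F n s = f s * bump 0 (real (Suc n)) s" for n s
 have dF: "DERIV (F n) s :> f' s * bump 0 (real (Suc n)) s + f s * b n s" for n s
  unfolding F_def using DERIV_mult[OF D(1) b(1)] by (simp add: algebra_simps)
 have F: "F n \<in> C1R" for n
 proof (rule C1R_I[OF dF])
  show "cont (%s. f' s * bump 0 (real (Suc n)) s + f s * b n s)" by (intro continuous_intros D cf b)
  show "F n s = 0" if "abs s >= real (Suc n)" for s
   using bump_eq_0[of "real (Suc n)" s 0] that by (simp add: F_def)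
 qed
 have dF': "deriv (F n) = (%s. f' s * bump 0 (real (Suc n)) s + f s * b n s)" for n
  using dF by (auto intro: DERIV_imp_deriv)
 have cut: "(%n. nrm (%s. g s * bump 0 (real (Suc n)) s - g s)) \<longlonglongrightarrow> 0" if g: "g \<in> L2 nu" for g
 proof (rule L2_dominated[OF _ g])
  show "(%s. g s * bump 0 (real (Suc n)) s - g s) \<in> borel_measurable nu" for n using L2_measurable[OF g] by measurable
  show "AE s in nu. abs (g s * bump 0 (real (Suc n)) s - g s) <= abs (g s)" for n
  proof (rule AE_I2)
   fix s
   have "abs (g s * (bump 0 (real (Suc n)) s - 1)) <= abs (g s) * 1" unfolding abs_mult
    using bump_nonneg[of 0 "real (Suc n)" s] bump_le_1[of 0 "real (Suc n)" s] by (intro mult_left_mono) auto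
   then show "abs (g s * bump 0 (real (Suc n)) s - g s) <= abs (g s)" by (simp add: algebra_simps)
  qed
  show "AE s in nu. (%n. g s * bump 0 (real (Suc n)) s - g s) \<longlonglongrightarrow> 0"
  proof (rule AE_I2)
   fix s
   have "(%n. g s * bump 0 (real (Suc n)) s - g s) \<longlonglongrightarrow> g s * 1 - g s" by (intro tendsto_intros bump_tendsto_1)
   then show "(%n. g s * bump 0 (real (Suc n)) s - g s) \<longlonglongrightarrow> 0" by simp
  qed
 qed
 have seq: "wderiv_seq F f f'"
  unfolding wderiv_seq_def
 proof (intro conjI allI D F)
  show "(%n. nrm (%s. F n s - f s)) \<longlonglongrightarrow> 0" unfolding F_def by (rule cut[OF D(4)])
  show "(%n. nrm (%s. deriv (F n) s - f' s)) \<longlonglongrightarrow> 0"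
  proof (rule Lim_null_comparison[OF always_eventually[OF allI]])
   let ?N = "%n. nrm (%s. f' s * bump 0 (real (Suc n)) s - f' s) + 6 * (1 / real (Suc n)) * nrm f"
   have "?N \<longlonglongrightarrow> 0 + 6 * 0 * nrm f"
    by (intro tendsto_intros cut D LIMSEQ_Suc[OF lim_1_over_n])
   then show "?N \<longlonglongrightarrow> 0" by simp
   fix n
   have bm: "b n \<in> borel_measurable borel" by (intro borel_measurable_continuous_onI b)
   have fbL: "(%s. f s * b n s) \<in> L2 nu"
    by (rule L2_bound[OF _ D(4), of _ "6 / real (Suc n)"])
     (use bm L2_measurable[OF D(4)] b(3) in \<open>auto simp: abs_mult mult.commute[of "abs (f _)"]
       intro!: mult_right_mono AE_I2 simp del: of_nat_Suc times_divide_eq_left times_divide_eq_right\<close>)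
   have gL: "(%s. f' s * bump 0 (real (Suc n)) s - f' s) \<in> L2 nu"
    using L2_diff[OF C1R_L2(2)[OF F[of n]] fbL] L2_diff D unfolding dF' by simp
   have "nrm (%s. f s * b n s) <= nrm (%s. 6 / real (Suc n) * f s)"
   proof (rule L2_norm_mono)
    show "AE s in nu. abs (f s * b n s) <= abs (6 / real (Suc n) * f s)"
    proof (rule AE_I2)
     fix s
     have "abs (f s) * abs (b n s) <= abs (f s) * (6 / real (Suc n))" by (intro mult_left_mono b) auto
     then show "abs (f s * b n s) <= abs (6 / real (Suc n) * f s)" unfolding abs_mult by (simp add: mult.commute)
    qed
   qed (rule L2_measurable[OF fbL], rule L2_scale[OF D(4)])
   then have 2: "nrm (%s. f s * b n s) <= 6 * (1 / real (Suc n)) * nrm f"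
    unfolding L2_norm_scale by simp
   have "nrm (%s. deriv (F n) s - f' s)
     = nrm (%s. (f' s * bump 0 (real (Suc n)) s - f' s) + f s * b n s)"
    unfolding dF' by (simp add: algebra_simps)
   then show "norm (nrm (%s. deriv (F n) s - f' s)) <= ?N n"
    using L2_norm_triangle[OF gL fbL] 2 by (simp add: L2_norm_nonneg)
  qed
 qed
 then have wf: "wderiv f f'" unfolding wderiv_def by auto
 have "closure_form nu C1R QR f g = ip q g" if gg: "wderiv g g'" for g g'
 proof -
  obtain G where G: "wderiv_seq G g g'" using gg unfolding wderiv_def by auto
  have *: "ip (deriv (G n)) f' = ip (G n) q" for n
  proof -
   have Gn: "G n \<in> C1R" using G unfolding wderiv_seq_def by auto
   have m: "meas f'" "meas q"
    using D(5,6)[THEN L2_measurable] by auto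
   have "integrable nu (%s. deriv (G n) s * f' s)" "integrable nu (%s. G n s * q s)"
    by (intro L2_mult_integrable C1R_L2 Gn D)+
   then have i2: "integrable lborel (%s. w s * (deriv (G n) s * f' s))" "integrable lborel (%s. w s * (G n s * q s))"
    using m C1R_measurable[OF Gn] by (auto simp: integrable_nu)
   have "(LINT s|lborel. deriv (G n) s * (w s * f' s) + G n s * (- (w s * q s))) = 0"
   proof (rule integration_by_parts[OF Gn])
    show "cont (%s. w s * f' s)" by (intro continuous_intros D)
    show "integrable lborel (%s. deriv (G n) s * (w s * f' s) + G n s * (- (w s * q s)))"
     using Bochner_Integration.integrable_diff[OF i2] by (simp add: mult_ac)
   qed (use D(3) in auto)
   then have "(LINT s|lborel. w s * (deriv (G n) s * f' s)) - (LINT s|lborel. w s * (G n s * q s)) = 0"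
    using Bochner_Integration.integral_diff[OF i2] by (simp add: mult_ac)
   then show ?thesis unfolding L2_inner_def using m C1R_measurable[OF Gn] by (simp add: integral_nu)
  qed
  have "(%n. ip (deriv (G n)) f') \<longlonglongrightarrow> ip g' f'"
   using G D unfolding wderiv_seq_def by (intro L2_inner_tendsto_left) (auto intro!: always_eventually C1R_L2)
  moreover have "(%n. ip (G n) q) \<longlonglongrightarrow> ip g q"
   using G D unfolding wderiv_seq_def by (intro L2_inner_tendsto_left) (auto intro!: always_eventually C1R_L2)
  ultimately have "ip g' f' = ip g q" unfolding * by (rule LIMSEQ_unique)
  then show ?thesis using closure_form_eq[OF wf that] by (simp add: L2_inner_commute)
 qed
 then show ?thesis unfolding LR_def form_operator_def using closure_domain_iff wf D(6) by blast
qed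

lemma domA_I:
 assumes "!!s. (DERIV f s :> f' s)" "!!s. s ~= 0 ==> (DERIV f' s :> f'' s)"
  "cont f'" "meas f''" "\<kappa> > 0"
  "!!s. abs (f s) <= C * exp (- \<kappa> * abs s)" "!!s. abs (f' s) <= C * exp (- \<kappa> * abs s)" "!!s. abs (f'' s) <= C * exp (- \<kappa> * abs s)"
 shows "domA f f' (%s. - (f'' s + drift s * f' s))"
 unfolding domA_def
proof (intro conjI allI impI assms(1,3))
 have m: "meas f" "meas f'"
  using assms(1,3) by (auto intro!: borel_measurable_continuous_onI continuous_at_imp_continuous_on DERIV_isCont)
 show "f \<in> L2 nu" "f' \<in> L2 nu" by (rule L2_nu_bound[OF _ assms(5)]; use m assms in blast)+
 have f''L: "f'' \<in> L2 nu" by (rule L2_nu_bound[OF assms(4,5,8)])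
 have "(%s. drift s * f' s) \<in> L2 nu"
 proof (rule L2_bound[OF _ \<open>f' \<in> L2 nu\<close>, of _ "d - 1"])
  show "AE s in nu. abs (drift s * f' s) <= (d - 1) * abs (f' s)"
   by (auto simp: abs_mult intro!: mult_right_mono abs_drift_le_const)
 qed (use m in measurable)
 then show "(%s. - (f'' s + drift s * f' s)) \<in> L2 nu" using f''L by (intro L2_uminus L2_add)
 fix s :: real assume "s ~= 0"
 from DERIV_mult[OF DERIV_w[OF this] assms(2)[OF this]]
 show "DERIV (%s. w s * f' s) s :> - (w s * - (f'' s + drift s * f' s))"
  by (simp add: algebra_simps)
qed

lemma test_domA:
 assumes "f \<in> test"
 obtains f' q where "domA f f' q"
proof -
 obtain f' f'' N where f: "!!s. (DERIV f s :> f' s)" "!!s. (DERIV f' s :> f'' s)"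
  "cont f''" "!!s. abs s >= N ==> f s = 0 & f' s = 0 & f'' s = 0"
  using assms unfolding test_def by blast
 have c: "cont f" "cont f'"
  using f by (meson DERIV_isCont continuous_at_imp_continuous_on)+
 obtain C where C: "!!s. abs (f s) <= C * exp (- 1 * abs s)" using compact_support_exp_bound[OF c(1)] f(4) by blast
 obtain C' where C': "!!s. abs (f' s) <= C' * exp (- 1 * abs s)" using compact_support_exp_bound[OF c(2)] f(4) by blast
 obtain C'' where C'': "!!s. abs (f'' s) <= C'' * exp (- 1 * abs s)" using compact_support_exp_bound[OF f(3)] f(4) by blast
 define K where "K = max C (max C' C'')"
 have "domA f f' (%s. - (f'' s + drift s * f' s))"
 proof (rule domA_I[OF f(1) f(2) c(2), of 1 K])
  show "meas f''" by (intro borel_measurable_continuous_onI f)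
  show "abs (f s) <= K * exp (- 1 * abs s)" for s
   by (rule order_trans[OF C mult_right_mono]) (auto simp: K_def)
  show "abs (f' s) <= K * exp (- 1 * abs s)" for s
   by (rule order_trans[OF C' mult_right_mono]) (auto simp: K_def)
  show "abs (f'' s) <= K * exp (- 1 * abs s)" for s
   by (rule order_trans[OF C'' mult_right_mono]) (auto simp: K_def)
 qed simp
 then show thesis by (rule that)
qed

end

section \<open>Sobolev inequalities and positivity\<close>

definition Psi' :: "real => real" where
 "Psi' y = max 0 (- y) - max 0 (- y - 1)"

definition Psi :: "real => real" where
 "Psi y = (max 0 (- y - 1))^2 / 2 - (max 0 (- y))^2 / 2"

definition Phi :: "real => real" where
 "Phi y = (max 0 (- y)) ^ 3 / 6 - (max 0 (- y - 1)) ^ 3 / 6"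

text \<open>\<open>Phi\<close> is a convex \<open>C\<^sup>2\<close> function with bounded second derivative \<open>Psi'\<close> that vanishes exactly on
  the nonnegative half-line; a decreasing \<open>\<integral> Phi (u t)\<close> therefore preserves positivity.\<close>

lemma DERIV_Psi: "DERIV Psi y :> Psi' y"
proof -
 have p2: "DERIV (%y::real. (max 0 y)^2) y :> 2 * max 0 y" for y
  using DERIV_max0_power[of 0 y] by (simp add: numeral_eq_Suc)
 have 1: "DERIV (%y. (max 0 (- y))^2) y :> 2 * max 0 (- y) * (-1)"
  by (rule DERIV_chain2[OF p2]) (auto intro!: derivative_eq_intros)
 have 2: "DERIV (%y. (max 0 (- y - 1))^2) y :> 2 * max 0 (- y - 1) * (-1)"
  by (rule DERIV_chain2[OF p2]) (auto intro!: derivative_eq_intros)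
 show ?thesis unfolding Psi_def[abs_def] Psi'_def
  using DERIV_diff[OF DERIV_cdivide[OF 2, of 2] DERIV_cdivide[OF 1, of 2]] by simp
qed

lemma DERIV_Phi: "DERIV Phi y :> Psi y"
proof -
 have p3: "DERIV (%y::real. (max 0 y) ^ 3) y :> 3 * (max 0 y)^2" for y
  using DERIV_max0_power[of 1 y] by (simp add: numeral_eq_Suc)
 have 1: "DERIV (%y. (max 0 (- y)) ^ 3) y :> 3 * (max 0 (- y))^2 * (-1)"
  by (rule DERIV_chain2[OF p3]) (auto intro!: derivative_eq_intros)
 have 2: "DERIV (%y. (max 0 (- y - 1)) ^ 3) y :> 3 * (max 0 (- y - 1))^2 * (-1)"
  by (rule DERIV_chain2[OF p3]) (auto intro!: derivative_eq_intros)
 show ?thesis unfolding Phi_def[abs_def] Psi_def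
  using DERIV_diff[OF DERIV_cdivide[OF 1, of 6] DERIV_cdivide[OF 2, of 6]] by simp
qed

lemma Psi'_bounds: "0 <= Psi' y" "Psi' y <= 1"
 by (auto simp: Psi'_def max_def)

lemma continuous_Psi': "continuous_on A Psi'"
 unfolding Psi'_def by (intro continuous_intros)

lemma Psi_lipschitz: "abs (Psi a - Psi b) <= abs (a - b)"
proof -
 have "norm (Psi a - Psi b) <= 1 * norm (a - b)"
  by (rule field_differentiable_bound[of UNIV Psi Psi'])
   (use DERIV_Psi Psi'_bounds in \<open>auto intro: has_field_derivative_at_within\<close>)
 then show ?thesis by simp
qed

lemma Psi_0 [simp]: "Psi 0 = 0" and Phi_0 [simp]: "Phi 0 = 0"
 by (simp_all add: Psi_def Phi_def)

lemma Phi_taylor: "abs (Phi b - Phi a - Psi a * (b - a)) <= (b - a)^2"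
proof -
 have "norm ((%y. Phi y - Psi a * y) b - (%y. Phi y - Psi a * y) a) <= abs (b - a) * norm (b - a)"
 proof (rule field_differentiable_bound[of "closed_segment a b" _ "%y. Psi y - Psi a"])
  show "((%y. Phi y - Psi a * y) has_field_derivative Psi z - Psi a) (at z within closed_segment a b)" for z
   by (rule has_field_derivative_at_within) (auto intro!: derivative_eq_intros DERIV_Phi)
  show "norm (Psi z - Psi a) <= abs (b - a)" if "z \<in> closed_segment a b" for z
   using Psi_lipschitz[of z a] that by (auto simp: closed_segment_eq_real_ivl split: if_splits)
 qed auto
 moreover have "(%y. Phi y - Psi a * y) b - (%y. Phi y - Psi a * y) a = Phi b - Phi a - Psi a * (b - a)"
  by (simp add: algebra_simps)
 moreover have "abs (b - a) * norm (b - a) = (b - a)^2" by (simp add: power2_eq_square)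
 ultimately show ?thesis by (simp only: real_norm_def)
qed

lemma Phi_bounds: "0 <= Phi y" "Phi y <= y^2"
proof -
 have "(max 0 (- y - 1)) ^ 3 <= (max 0 (- y)) ^ 3" by (intro power_mono) auto
 then show "0 <= Phi y" by (simp add: Phi_def)
 show "Phi y <= y^2" using Phi_taylor[of y 0] by simp
qed

lemma Phi_eq_0: "Phi y = 0 ==> 0 <= y"
proof (rule ccontr)
 assume "Phi y = 0" "~ 0 <= y"
 then have "(max 0 (- y - 1)) ^ 3 < (max 0 (- y)) ^ 3" by (intro power_strict_mono) auto
 moreover have "(max 0 (- y)) ^ 3 = (max 0 (- y - 1)) ^ 3" using \<open>Phi y = 0\<close> unfolding Phi_def by linarith
 ultimately show False by simp
qed

lemma Phi_eq_0_nonneg: "0 <= y ==> Phi y = 0"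
 by (simp add: Phi_def)

lemma Psi_measurable [measurable]: "meas Psi"
 and Phi_measurable [measurable]: "meas Phi"
 and Psi'_measurable [measurable]: "meas Psi'"
 unfolding Psi_def Phi_def Psi'_def by measurable

lemma L2_Psi: "f \<in> L2 M ==> (%x. Psi (f x)) \<in> L2 M"
 by (rule L2_bound[of _ _ f 1]) (use Psi_lipschitz[of _ 0] in auto)

lemma integrable_Phi:
 assumes "f \<in> L2 M"
 shows "integrable M (%x. Phi (f x))"
 by (rule Bochner_Integration.integrable_bound[OF L2_integrable_sq[OF assms]])
  (use assms Phi_bounds in auto)

section \<open>Sobolev inequalities, continuous representatives and the chain rule\<close>

context bessel
begin

lemma FTC_C1R:
 assumes G: "!!s. (DERIV G s :> g s)" and g: "cont g" and ab: "a <= b"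
 shows "abs (G b - G a) <= (LINT s|lborel. abs (g s) * indicator {a..b} s)"
  and "integrable lborel (%s. abs (g s) * indicator {a..b} s)"
proof -
 have i: "integrable lborel (%s. h s * indicator {a..b} s)" if "cont h" for h :: "real => real"
  using borel_integrable_atLeastAtMost'[OF continuous_on_subset[OF that]]
  by (simp add: set_integrable_def mult.commute)
 show "integrable lborel (%s. abs (g s) * indicator {a..b} s)" by (intro i continuous_intros g)
 have "G b - G a = (LINT s|lborel. g s * indicator {a..b} s)"
  using g by (intro integral_FTC_Icc_real[OF ab, symmetric] G) (simp add: continuous_on_eq_continuous_at)
 also have "abs (...) <= (LINT s|lborel. abs (g s * indicator {a..b} s))" by (rule integral_abs_bound)
 finally show "abs (G b - G a) <= (LINT s|lborel. abs (g s) * indicator {a..b} s)" by (simp add: abs_mult)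
qed

text \<open>Integrate the derivative of \<open>F^2\<close> from \<open>x\<close> outwards, away from
  \<open>0\<close>, to a point where \<open>F\<close> vanishes. Along this ray the weight is at
  least \<open>w x\<close>, so it can be moved inside the integral, and Cauchy--Schwarz
  finishes.\<close>

lemma sobolev_sup:
 assumes F: "F \<in> C1R"
 shows "(F x)^2 * w x <= 2 * nrm F * nrm (deriv F)"
proof -
 obtain N where N: "!!s. abs s >= N ==> F s = 0 & deriv F s = 0" using C1R_D[OF F] by metis
 define a where "a = (if x >= 0 then x else min (- abs N) x)"
 define b where "b = (if x >= 0 then max (abs N) x else x)"
 have ab: "a <= b" unfolding a_def b_def by auto
 let ?g = "%s. 2 * F s * deriv F s"
 have G: "DERIV (%s. (F s)^2) s :> ?g s" for s
  using DERIV_power[OF C1R_deriv[OF F], of 2 s] by (simp add: mult_ac)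
 have g: "cont ?g" by (intro continuous_intros C1R_continuous F)
 have "F (if x >= 0 then b else a) = 0" by (intro N[THEN conjunct1]) (auto simp: a_def b_def)
 then have Fx: "\<bar>(F b)^2 - (F a)^2\<bar> = (F x)^2" by (auto simp: a_def b_def split: if_splits)
 have wx: "w x <= w s" if "s \<in> {a..b}" for s
  unfolding w_def using d that by (intro powr_mono2) (auto simp: a_def b_def split: if_splits)
 have L: "F \<in> L2 nu" "deriv F \<in> L2 nu" "(%s. abs (F s)) \<in> L2 nu" "(%s. abs (deriv F s)) \<in> L2 nu"
  using C1R_L2[OF F] L2_abs by auto
 have m: "meas F" "deriv F \<in> borel_measurable borel" using C1R_measurable[OF F] by auto
 have "integrable nu (%s. abs (F s) * abs (deriv F s))" by (rule L2_mult_integrable[OF L(3,4)])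
 then have i: "integrable lborel (%s. 2 * (w s * (abs (F s) * abs (deriv F s))))"
  using m by (simp add: integrable_nu)
 have "(F x)^2 * w x <= (LINT s|lborel. abs (?g s) * indicator {a..b} s) * w x"
  using FTC_C1R(1)[OF G g ab] Fx w_pos[of x] by (intro mult_right_mono) auto
 also have "... = (LINT s|lborel. (abs (?g s) * indicator {a..b} s) * w x)" by simp
 also have "... <= (LINT s|lborel. 2 * (w s * (abs (F s) * abs (deriv F s))))"
 proof (rule integral_mono[OF _ i])
  show "integrable lborel (%s. (abs (?g s) * indicator {a..b} s) * w x)"
   using FTC_C1R(2)[OF G g ab] by simp
  fix s
  show "(abs (?g s) * indicator {a..b} s) * w x <= 2 * (w s * (abs (F s) * abs (deriv F s)))"
   using wx[of s] mult_right_mono[OF wx[of s], of "abs (F s) * abs (deriv F s)"] w_pos[of s]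
   by (auto simp: indicator_def abs_mult mult_ac)
 qed
 also have "... = 2 * ip (%s. abs (F s)) (%s. abs (deriv F s))"
  using m by (simp add: L2_inner_def integral_nu)
 also have "... <= 2 * (nrm (%s. abs (F s)) * nrm (%s. abs (deriv F s)))"
  using L2_cauchy_schwarz[OF L(3,4)] by simp
 also have "... = 2 * nrm F * nrm (deriv F)"
  by (simp add: L2_norm_def L2_inner_def)
 finally show ?thesis .
qed

text \<open>Cauchy--Schwarz on the interval. The lower bound \<open>m\<close> of the weight is kept
  explicit, because later its size relative to the ball volume decides how far Hoelder continuity
  reaches.\<close>

lemma sobolev_holder:
 assumes F: "F \<in> C1R" and xy: "x <= y" and m: "m > 0" "!!s. s \<in> {x..y} ==> m <= w s"
 shows "(F y - F x)^2 * m <= (y - x) * (nrm (deriv F))^2"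
proof -
 let ?I = "indicator {x..y} :: real => real"
 let ?g = "%s. abs (deriv F s) * ?I s"
 have IL: "?I \<in> L2 lborel"
 proof (rule L2_I)
  have "(%s. (?I s)^2) = ?I" by (auto simp: indicator_def)
  then show "integrable lborel (%s. (?I s)^2)" by (simp add: emeasure_lborel_Icc_eq)
 qed simp
 have gm: "deriv F \<in> borel_measurable borel" by (rule C1R_measurable[OF F])
 have i: "integrable lborel (%s. w s * (deriv F s)^2)"
  using L2_integrable_sq[OF C1R_L2(2)[OF F]] gm by (simp add: integrable_nu)
 have le: "m * (?g s)^2 <= w s * (deriv F s)^2" for s
  using m(2)[of s] w_pos[of s] by (auto simp: indicator_def intro: mult_right_mono)
 have "integrable lborel (%s. m * (?g s)^2)"
  by (rule Bochner_Integration.integrable_bound[OF i]) (use le gm m w_pos in \<open>auto simp: less_imp_le\<close>)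
 then have ig: "integrable lborel (%s. (?g s)^2)" using m by simp
 then have gL: "?g \<in> L2 lborel" using gm by (intro L2_I) auto
 have "abs (F y - F x) <= (LINT s|lborel. ?g s)"
  by (rule FTC_C1R(1)[OF C1R_deriv[OF F] C1R_continuous(2)[OF F] xy])
 also have "... = L2_inner lborel ?g ?I"
  unfolding L2_inner_def by (intro Bochner_Integration.integral_cong) (auto simp: indicator_def)
 also have "... <= L2_norm lborel ?g * L2_norm lborel ?I"
  using L2_cauchy_schwarz[OF gL IL] by simp
 finally have "(F y - F x)^2 <= (L2_norm lborel ?g * L2_norm lborel ?I)^2"
  using power_mono[of "abs (F y - F x)" _ 2] by simp
 also have "... = (LINT s|lborel. (?g s)^2) * (y - x)"
 proof -
  have "(LINT s|lborel. (?I s)^2) = (LINT s|lborel. ?I s)"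
   by (intro Bochner_Integration.integral_cong) (auto simp: indicator_def)
  then show ?thesis using xy by (simp add: power_mult_distrib L2_norm_sq L2_inner_self)
 qed
 finally have "(F y - F x)^2 * m <= (LINT s|lborel. (?g s)^2) * (y - x) * m"
  using m by (intro mult_right_mono) auto
 also have "... = (y - x) * (LINT s|lborel. m * (?g s)^2)" by simp
 also have "... <= (y - x) * (LINT s|lborel. w s * (deriv F s)^2)"
  using ig i le xy by (intro mult_left_mono integral_mono) auto
 also have "(LINT s|lborel. w s * (deriv F s)^2) = (nrm (deriv F))^2"
  using gm by (simp add: L2_norm_sq L2_inner_self integral_nu)
 finally show ?thesis .
qed

text \<open>\<open>sobolev_sup\<close> applied to differences makes the approximants converge at
  every point. The limit is the continuous representative, and both Sobolev bounds pass to
  it.\<close>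

lemma wderiv_rep:
 assumes "wderiv_seq F f g"
 shows "EX u. cont u & (AE s in nu. f s = u s) & (ALL x. (%n. F n x) \<longlonglongrightarrow> u x) &
  (ALL x. (u x)^2 * w x <= 2 * nrm f * nrm g) &
  (ALL x y m. x <= y --> m > 0 --> (\<forall>s\<in>{x..y}. m <= w s) --> (u y - u x)^2 * m <= (y - x) * (nrm g)^2)"
proof -
 have F: "F n \<in> C1R" for n using assms unfolding wderiv_seq_def by auto
 have L: "f \<in> L2 nu" "g \<in> L2 nu" using assms unfolding wderiv_seq_def by auto
 have c1: "(%n. nrm (%s. F n s - f s)) \<longlonglongrightarrow> 0" and c2: "(%n. nrm (%s. deriv (F n) s - g s)) \<longlonglongrightarrow> 0"
  using assms unfolding wderiv_seq_def by auto
 have n1: "(%n. nrm (F n)) \<longlonglongrightarrow> nrm f" and n2: "(%n. nrm (deriv (F n))) \<longlonglongrightarrow> nrm g"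
  by (rule L2_norm_tendsto; use c1 c2 L C1R_L2[OF F] in \<open>auto intro: always_eventually\<close>)+
 have cauchy: "Cauchy (%n. F n x)" for x
 proof (rule metric_CauchyI)
  fix e :: real assume e: "e > 0"
  define \<epsilon> where "\<epsilon> = e / 4"
  have \<epsilon>: "\<epsilon> > 0" using e by (simp add: \<epsilon>_def)
  have "\<forall>\<^sub>F n in sequentially. nrm (%s. F n s - f s) < \<epsilon> & nrm (%s. deriv (F n) s - g s) < \<epsilon>"
   using order_tendstoD(2)[OF c1 \<epsilon>] order_tendstoD(2)[OF c2 \<epsilon>] by (rule eventually_conj)
  then obtain N where N: "!!n. n >= N ==> nrm (%s. F n s - f s) < \<epsilon> & nrm (%s. deriv (F n) s - g s) < \<epsilon>"
   unfolding eventually_sequentially by auto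
  show "EX M. ALL m>=M. ALL n>=M. dist (F m x) (F n x) < e"
  proof (intro exI allI impI)
   fix m n assume mn: "m >= N" "n >= N"
   let ?D = "%s. F m s - F n s"
   have a: "nrm ?D <= 2 * \<epsilon>"
    using L2_norm_triangle_diff[OF C1R_L2(1)[OF F[of m]] L(1) C1R_L2(1)[OF F[of n]]] N[OF mn(1)] N[OF mn(2)]
     L2_norm_minus_commute[of nu f "F n"] by linarith
   have b: "nrm (deriv ?D) <= 2 * \<epsilon>"
    unfolding C1R_diff(2)[OF F F]
    using L2_norm_triangle_diff[OF C1R_L2(2)[OF F[of m]] L(2) C1R_L2(2)[OF F[of n]]] N[OF mn(1)] N[OF mn(2)]
     L2_norm_minus_commute[of nu g "deriv (F n)"] by linarith
   have "(?D x)^2 * 1 <= (?D x)^2 * w x" using w_ge_1 by (intro mult_left_mono) auto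
   also have "... <= 2 * nrm ?D * nrm (deriv ?D)" by (rule sobolev_sup[OF C1R_diff(1)[OF F F]])
   also have "... <= 2 * (2 * \<epsilon>) * (2 * \<epsilon>)" using a b \<epsilon> by (intro mult_mono) (auto simp: L2_norm_nonneg)
   also have "... < e^2" using e by (simp add: \<epsilon>_def power2_eq_square)
   finally have "abs (?D x)^2 < e^2" by simp
   then show "dist (F m x) (F n x) < e" unfolding dist_real_def using e
    by (auto intro: power_less_imp_less_base[of "abs (?D x)" 2 e] simp del: power2_abs)
  qed
 qed
 define u where "u x = lim (%n. F n x)" for x
 have lim: "(%n. F n x) \<longlonglongrightarrow> u x" for x
  using cauchy[of x] unfolding u_def by (simp add: Cauchy_convergent_iff convergent_LIMSEQ_iff)
 have sup: "(u x)^2 * w x <= 2 * nrm f * nrm g" for x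
  by (rule LIMSEQ_le[of "%n. (F n x)^2 * w x" _ "%n. 2 * nrm (F n) * nrm (deriv (F n))"])
   (use sobolev_sup[OF F] in \<open>auto intro!: tendsto_intros lim n1 n2\<close>)
 have hol: "(u y - u x)^2 * m <= (y - x) * (nrm g)^2"
  if "x <= y" "m > 0" "!!s. s \<in> {x..y} ==> m <= w s" for x y m
  by (rule LIMSEQ_le[of "%n. (F n y - F n x)^2 * m" _ "%n. (y - x) * (nrm (deriv (F n)))^2"])
   (use sobolev_holder[OF F that] in \<open>auto intro!: tendsto_intros lim n1 n2\<close>)
 have h1: "abs (u y - u x) <= sqrt (abs (y - x)) * nrm g" for x y
 proof -
  have *: "(u y - u x)^2 <= abs (y - x) * (nrm g)^2" for x y
  proof (cases "x <= y")
   case True then show ?thesis using hol[of x y 1] w_ge_1 by simp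
  next
   case False then show ?thesis using hol[of y x 1] w_ge_1 by (simp add: power2_commute)
  qed
  have "sqrt ((u y - u x)^2) <= sqrt (abs (y - x) * (nrm g)^2)" using * by (intro real_sqrt_le_mono)
  then show ?thesis by (simp add: real_sqrt_mult L2_norm_nonneg)
 qed
 have cont: "cont u"
  unfolding continuous_on_def
 proof
  fix x
  have "((%y. u y - u x) \<longlongrightarrow> 0) (at x)"
  proof (rule Lim_null_comparison[OF always_eventually[OF allI]])
   show "norm (u y - u x) <= sqrt (abs (y - x)) * nrm g" for y using h1 by simp
   have "((%y. sqrt (abs (y - x)) * nrm g) \<longlongrightarrow> sqrt (abs (x - x)) * nrm g) (at x)" by (intro tendsto_intros)
   then show "((%y. sqrt (abs (y - x)) * nrm g) \<longlongrightarrow> 0) (at x)" by simp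
  qed
  then show "(u \<longlongrightarrow> u x) (at x)" by (rule LIM_zero_cancel)
 qed
 have um: "meas u" by (intro borel_measurable_continuous_onI cont)
 have "nrm (%s. u s - f s) <= 0 & (%s. u s - f s) \<in> L2 nu"
 proof -
  have est: "(%s. u s - f s) \<in> L2 nu & nrm (%s. u s - f s) <= e" if e: "e > 0" for e
  proof -
   have m: "(%s. u s - f s) \<in> borel_measurable nu" using um L2_measurable[OF L(1)] by measurable
   have t: "AE s in nu. (%n. F n s - f s) \<longlonglongrightarrow> u s - f s" by (intro AE_I2 tendsto_intros lim)
   have ev: "\<forall>\<^sub>F n in sequentially. nrm (%s. F n s - f s) <= e"
    using order_tendstoD(2)[OF c1 e] by eventually_elim simp
   show ?thesis using L2_Fatou[OF L2_diff[OF C1R_L2(1)[OF F] L(1)] m t ev] e by simp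
  qed
  then show ?thesis using field_le_epsilon[of "nrm (%s. u s - f s)" 0] est[OF zero_less_one] by simp
 qed
 then have "AE s in nu. u s - f s = 0"
  using L2_norm_eq_0_iff[of "%s. u s - f s" nu] L2_norm_nonneg[of nu "%s. u s - f s"] by simp
 then have "AE s in nu. f s = u s" by eventually_elim simp
 then show ?thesis using cont lim sup hol by blast
qed

text \<open>The chain rule in the closed form. The approximants converge pointwise to the continuous
  representative \<open>u\<close>, so \<open>Psi' (F n s)\<close> converges to
  \<open>Psi' (u s)\<close>, and dominated convergence applies with the bound
  \<open>abs (g s)\<close>.\<close>

lemma wderiv_Psi:
 assumes "wderiv f g"
 obtains u where "AE s in nu. f s = u s" "meas u"
  "wderiv (%s. Psi (f s)) (%s. Psi' (u s) * g s)"
proof -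
 obtain F where S: "wderiv_seq F f g" using assms unfolding wderiv_def by auto
 obtain u where u: "cont u" "AE s in nu. f s = u s" "!!x. (%n. F n x) \<longlonglongrightarrow> u x"
  using wderiv_rep[OF S] by blast
 have um: "meas u" by (intro borel_measurable_continuous_onI u)
 have F: "F n \<in> C1R" for n using S unfolding wderiv_seq_def by auto
 have L: "f \<in> L2 nu" "g \<in> L2 nu" using S unfolding wderiv_seq_def by auto
 have gm: "meas g" using L2_measurable[OF L(2)] by simp
 have c1: "(%n. nrm (%s. F n s - f s)) \<longlonglongrightarrow> 0" and c2: "(%n. nrm (%s. deriv (F n) s - g s)) \<longlonglongrightarrow> 0"
  using S unfolding wderiv_seq_def by auto
 have dG: "DERIV (%s. Psi (F n s)) s :> Psi' (F n s) * deriv (F n) s" for n s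
  by (rule DERIV_chain2[OF DERIV_Psi C1R_deriv[OF F]])
 then have dG': "deriv (%s. Psi (F n s)) = (%s. Psi' (F n s) * deriv (F n) s)" for n
  by (auto intro: DERIV_imp_deriv)
 have G: "(%s. Psi (F n s)) \<in> C1R" for n
 proof -
  obtain N where N: "!!s. abs s >= N ==> F n s = 0 & deriv (F n) s = 0" using C1R_D[OF F] by metis
  have "cont (%s. Psi' (F n s))"
   by (rule continuous_on_compose2[OF continuous_Psi' C1R_continuous(1)[OF F]]) auto
  from C1R_I[OF dG continuous_on_mult[OF this C1R_continuous(2)[OF F]], of N] show ?thesis using N by simp
 qed
 have abs1: "abs (Psi' a * b) <= abs b" for a b
  using mult_right_mono[of "abs (Psi' a)" 1 "abs b"] Psi'_bounds[of a] by (simp add: abs_mult)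
 have gL: "(%s. Psi' (v s) * h s) \<in> L2 nu" if "h \<in> L2 nu" "meas v" for h v
  by (rule L2_bound[OF _ that(1), of _ 1]) (use L2_measurable[OF that(1)] that(2) abs1 in auto)
 have "wderiv_seq (%n s. Psi (F n s)) (%s. Psi (f s)) (%s. Psi' (u s) * g s)"
  unfolding wderiv_seq_def
 proof (intro conjI allI G L2_Psi L gL um)
  show "(%n. nrm (%s. Psi (F n s) - Psi (f s))) \<longlonglongrightarrow> 0"
  proof (rule Lim_null_comparison[OF always_eventually[OF allI] c1])
   fix n
   have "nrm (%s. Psi (F n s) - Psi (f s)) <= nrm (%s. F n s - f s)"
    using Psi_lipschitz C1R_L2(1)[OF F] L C1R_measurable[OF F] L2_measurable[OF L(1)]
    by (intro L2_norm_mono) (auto intro: L2_diff)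
   then show "norm (nrm (%s. Psi (F n s) - Psi (f s))) <= nrm (%s. F n s - f s)"
    by (simp add: L2_norm_nonneg)
  qed
  have "(%n. nrm (%s. (Psi' (F n s) - Psi' (u s)) * g s)) \<longlonglongrightarrow> 0"
  proof (rule L2_dominated[OF _ L(2)])
   show "(%s. (Psi' (F n s) - Psi' (u s)) * g s) \<in> borel_measurable nu" for n
    using C1R_measurable[OF F] um gm by measurable
   show "AE s in nu. abs ((Psi' (F n s) - Psi' (u s)) * g s) <= abs (g s)" for n
   proof (rule AE_I2)
    fix s
    have "abs (Psi' (F n s) - Psi' (u s)) <= 1" using Psi'_bounds[of "F n s"] Psi'_bounds[of "u s"] by linarith
    then show "abs ((Psi' (F n s) - Psi' (u s)) * g s) <= abs (g s)"
     unfolding abs_mult using mult_right_mono[of _ 1 "abs (g s)"] by fastforce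
   qed
   show "AE s in nu. (%n. (Psi' (F n s) - Psi' (u s)) * g s) \<longlonglongrightarrow> 0"
   proof (rule AE_I2)
    fix s
    have "isCont Psi' (u s)" using continuous_Psi'[of UNIV] by (simp add: continuous_on_eq_continuous_at)
    then have "(%n. (Psi' (F n s) - Psi' (u s)) * g s) \<longlonglongrightarrow> (Psi' (u s) - Psi' (u s)) * g s"
     by (intro tendsto_intros isCont_tendsto_compose[OF _ u(3)])
    then show "(%n. (Psi' (F n s) - Psi' (u s)) * g s) \<longlonglongrightarrow> 0" by simp
   qed
  qed
  from tendsto_add[OF c2 this]
  have lim: "(%n. nrm (%s. deriv (F n) s - g s) + nrm (%s. (Psi' (F n s) - Psi' (u s)) * g s)) \<longlonglongrightarrow> 0"
   by simp
  show "(%n. nrm (%s. deriv (%s. Psi (F n s)) s - Psi' (u s) * g s)) \<longlonglongrightarrow> 0"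
  proof (rule Lim_null_comparison[OF always_eventually[OF allI] lim])
   fix n
   let ?a = "%s. Psi' (F n s) * (deriv (F n) s - g s)" and ?b = "%s. (Psi' (F n s) - Psi' (u s)) * g s"
   have dL: "(%s. deriv (F n) s - g s) \<in> L2 nu" by (intro L2_diff C1R_L2 F L)
   have aL: "?a \<in> L2 nu" by (intro gL dL C1R_measurable F)
   have bL: "?b \<in> L2 nu"
    using L2_diff[OF gL[OF L(2) C1R_measurable(1)[OF F[of n]]] gL[OF L(2) um]] by (simp add: left_diff_distrib)
   have "nrm ?a <= nrm (%s. deriv (F n) s - g s)"
    using abs1 by (intro L2_norm_mono dL L2_measurable[OF aL] AE_I2)
   moreover have "(%s. deriv (%s. Psi (F n s)) s - Psi' (u s) * g s) = (%s. ?a s + ?b s)"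
    unfolding dG' by (simp add: algebra_simps)
   ultimately show "norm (nrm (%s. deriv (%s. Psi (F n s)) s - Psi' (u s) * g s))
     <= nrm (%s. deriv (F n) s - g s) + nrm ?b"
    using L2_norm_triangle[OF aL bL] by (simp add: L2_norm_nonneg)
  qed
 qed
 then show thesis using u um that unfolding wderiv_def by blast
qed

text \<open>By the chain rule the pairing equals the integral of
  \<open>Psi' (u s) * (f' s)^2\<close>, and \<open>Psi'\<close> is nonnegative. This is the
  Beurling--Deny mechanism behind positivity.\<close>

lemma LR_Psi_nonneg:
 assumes "LR f h"
 shows "0 <= ip (%s. Psi (f s)) h"
proof -
 obtain f' where f: "wderiv f f'" "!!g g'. wderiv g g' ==> ip f' g' = ip h g"
  using LR_D[OF assms] by blast
 obtain u where "wderiv (%s. Psi (f s)) (%s. Psi' (u s) * f' s)" using wderiv_Psi[OF f(1)] by metis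
 then have "ip h (%s. Psi (f s)) = ip f' (%s. Psi' (u s) * f' s)" using f(2) by simp
 also have "... >= 0" unfolding L2_inner_def
  by (rule integral_nonneg_AE, rule AE_I2)
   (use Psi'_bounds(1) in \<open>auto simp: mult.left_commute[of "f' _"] intro!: mult_nonneg_nonneg\<close>)
 finally show ?thesis by (simp add: L2_inner_commute)
qed

end

section \<open>From the semigroup to its kernel\<close>

text \<open>The properties of the heat kernel on which the estimates rest. They are invariant under the
  reflection \<open>s \<mapsto> -s\<close>.\<close>

locale heat_kernel = bessel +
 fixes k :: "real => real => real => real"
 assumes k_cont: "t > 0 ==> cont (k t x)"
  and k_nonneg: "t > 0 ==> 0 <= k t x y"
  and k_sym: "t > 0 ==> k t x y = k t y x"
  and k_L2: "t > 0 ==> k t x \<in> L2 nu"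
  and k_semi: "t > 0 ==> s > 0 ==> k (t + s) x y = ip (k t x) (k s y)"
  and k_diag: "t > 0 ==> k t x x <= 2 / (sqrt t * w x)"
  and k_diag_mono: "0 < s ==> s <= t ==> k t x x <= k s x x"
  and k_holder: "t > 0 ==> x <= y ==> m > 0 ==> (!!s. s \<in> {x..y} ==> m <= w s) ==>
    (nrm (%z. k t y z - k t x z))^2 * m <= (y - x) / (2 * t)"
  and k_deriv: "domA g g' q ==> t > 0 ==>
    (DERIV (%t. ip (k t x) g) t :> - ip (k t x) q)"
  and k_compare: "domA g g' q ==> t > 0 ==> (!!s. 0 <= q s + K * g s) ==>
    ip (k t x) g <= exp (K * t) * g x"

context bessel
begin

lemma nonneg_if_tested:
 assumes c: "cont c" and nn: "!!f. f \<in> test ==> (!!s. 0 <= f s) ==> 0 <= (LINT s|nu. c s * f s)"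
 shows "0 <= c z"
proof (rule ccontr)
 assume neg: "~ 0 <= c z"
 have "open {s. c s < 0}" using c by (intro open_Collect_less) auto
 moreover have "z \<in> {s. c s < 0}" using neg by simp
 ultimately obtain \<delta> where \<delta>: "\<delta> > 0" "ball z \<delta> \<subseteq> {s. c s < 0}" by (meson openE)
 let ?f = "bump z \<delta>"
 have le: "c s * ?f s <= 0" for s
 proof (cases "abs (s - z) < \<delta>")
  case True
  then have "s \<in> ball z \<delta>" by (simp add: dist_real_def abs_minus_commute)
  then have "c s < 0" using \<delta>(2) by blast
  then show ?thesis using bump_nonneg[of z \<delta> s] by (simp add: mult_nonpos_nonneg)
 next
  case False then show ?thesis using bump_eq_0[of \<delta> s z] \<delta> by simp
 qed
 have cm: "meas c" by (intro borel_measurable_continuous_onI c)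
 have cf: "cont (%s. c s * ?f s)" by (intro continuous_intros c)
 have z0: "c s * ?f s = 0" if "abs z + \<delta> <= abs s" for s
  using bump_eq_0[of \<delta> s z] \<delta> that by simp
 obtain C where C: "!!s. abs (c s * ?f s) <= C * exp (- 1 * abs s)"
  using compact_support_exp_bound[OF cf z0] by blast
 have i: "integrable nu (%s. c s * ?f s)"
  by (rule integrable_nu_bound[OF _ _ C]) (use cm in auto)
 have "0 <= (LINT s|nu. - (c s * ?f s))" using le by (intro integral_nonneg_AE AE_I2) simp
 moreover have "0 <= (LINT s|nu. c s * ?f s)" using \<delta> by (intro nn bump_test bump_nonneg)
 ultimately have "(LINT s|nu. - (c s * ?f s)) = 0" by simp
 then have "AE s in nu. - (c s * ?f s) = 0"
  using i le by (subst (asm) integral_nonneg_eq_0_iff_AE) auto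
 then have "AE s in nu. c s * ?f s = 0" by eventually_elim simp
 then have "(%s. c s * ?f s) = (%s. 0)" by (intro AE_nu_continuous_eq cf) auto
 then have "c z * ?f z = 0" by (rule fun_cong)
 then show False using neg by (simp add: bump_def)
qed

lemma nonneg_if_AE_nonneg:
 assumes c: "cont c" and "AE s in nu. 0 <= c s"
 shows "0 <= (c :: real => real) z"
proof -
 have "c = (%s. max 0 (c s))"
  by (rule AE_nu_continuous_eq) (use assms in \<open>auto intro!: continuous_intros elim!: AE_mp\<close>)
 then show ?thesis by (metis max.cobounded1)
qed

end

locale heat_semigroup = bessel +
 fixes S :: "real => (real => real) => real => real" and k :: "real => real => real => real"
 assumes ES: "exp_semigroup nu LR S"
  and kernel: "t > 0 ==> integral_kernel nu (S t) (k t)"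
  and cont2: "t > 0 ==> continuous_on UNIV (%(s, r). k t s r)"
begin

lemma gen_iff: "generator nu S f h \<longleftrightarrow> LR f (%x. - h x)"
proof -
 have "ALL f h. LR f h \<longleftrightarrow> generator nu S f (%x. - h x)" using ES unfolding exp_semigroup_def by simp
 from this[rule_format, of f "%x. - h x"] show ?thesis by simp
qed

sublocale symmetric_semigroup nu S
proof
 show "C0_semigroup nu S" using ES unfolding exp_semigroup_def by auto
 show "ip h g = ip f k" if "generator nu S f h" "generator nu S g k" for f h g k
  using LR_symmetric[of f "%x. - h x" g "%x. - k x"] that
  by (simp add: gen_iff L2_inner_uminus_left L2_inner_uminus_right)
 show "ip h f <= 0" if g: "generator nu S f h" for f h
 proof -
  obtain f' where f: "wderiv f f'" "!!g g'. wderiv g g' ==> ip f' g' = ip (%x. - h x) g"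
   using LR_D[OF g[unfolded gen_iff]] by blast
  show ?thesis using f(2)[OF f(1)] L2_inner_nonneg[of nu f'] by (simp add: L2_inner_uminus_left)
 qed
 show "EX g h. generator nu S g h & nrm (%x. f x - g x) < e" if f: "f \<in> L2 nu" "e > 0" for f e
 proof -
  obtain g where g: "g \<in> test" "nrm (%s. f s - g s) < e" using test_dense[OF f] by blast
  obtain g' q where "domA g g' q" using test_domA[OF g(1)] by blast
  then have "generator nu S g (%x. - q x)" unfolding gen_iff by (simp add: domA_LR)
  then show ?thesis using g by blast
 qed
qed

lemma domA_gen: "domA g g' q ==> generator nu S g (%x. - q x)"
 unfolding gen_iff by (simp add: domA_LR)

text \<open>The integral of \<open>Phi (S s f x)\<close> starts at \<open>0\<close>, and its
  derivative is minus the pairing of \<open>Psi (S s f)\<close> with the operator, hence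
  nonpositive. The derivative is available for \<open>s > 0\<close> only, so continuity up to
  \<open>0\<close> is proved separately from the Taylor bound.\<close>

lemma S_nonneg:
 assumes g: "generator nu S f h" and nn: "AE x in nu. 0 <= f x" and t: "t > 0"
 shows "AE x in nu. 0 <= S t f x"
proof -
 have L: "f \<in> L2 nu" "h \<in> L2 nu" using g by (auto simp: generator_def)
 have SL: "S s f \<in> L2 nu" if "s >= 0" for s using that L by auto
 have "(LINT x|nu. Phi (S t f x)) <= (LINT x|nu. Phi (S 0 f x))"
 proof (rule DERIV_nonpos_imp_decreasing_open[of 0 t])
  show "continuous_on {0..t} (%s. LINT x|nu. Phi (S s f x))"
   unfolding continuous_on_def
  proof
   fix s assume s: "s \<in> {0..t}"
   let ?n = "%r. nrm (%x. S r f x - S s f x)"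
   have n: "(?n \<longlongrightarrow> 0) (at s within {0..t})"
    using S_continuous[of s f] s L by (auto intro: tendsto_within_subset)
   have "((%r. (LINT x|nu. Phi (S r f x)) - (LINT x|nu. Phi (S s f x))) \<longlongrightarrow> 0) (at s within {0..t})"
   proof (rule Lim_null_comparison)
    let ?B = "%r. nrm (%x. Psi (S s f x)) * ?n r + ?n r * ?n r"
    have "(?B \<longlongrightarrow> nrm (%x. Psi (S s f x)) * 0 + 0 * 0) (at s within {0..t})"
     by (intro tendsto_intros n)
    then show "(?B \<longlongrightarrow> 0) (at s within {0..t})" by simp
    have "\<forall>\<^sub>F r in at s within {0..t}. r \<in> {0..t}" by (auto simp: eventually_at_filter)
    then show "\<forall>\<^sub>F r in at s within {0..t}. norm ((LINT x|nu. Phi (S r f x)) - (LINT x|nu. Phi (S s f x))) <= ?B r"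
    proof eventually_elim
     case (elim r)
     have L': "S r f \<in> L2 nu" "S s f \<in> L2 nu" using elim s L by auto
     have D: "(%x. S r f x - S s f x) \<in> L2 nu" by (intro L2_intros L')
     have P: "(%x. Psi (S s f x)) \<in> L2 nu" by (intro L2_Psi L')
     have i: "integrable nu (%x. abs (Psi (S s f x)) * abs (S r f x - S s f x) + (S r f x - S s f x)^2)"
      by (intro Bochner_Integration.integrable_add L2_mult_integrable L2_abs P D L2_integrable_sq)
     have "abs ((LINT x|nu. Phi (S r f x)) - (LINT x|nu. Phi (S s f x))) = abs (LINT x|nu. Phi (S r f x) - Phi (S s f x))"
      using integrable_Phi[OF L'(1)] integrable_Phi[OF L'(2)] by simp
     also have "... <= (LINT x|nu. abs (Phi (S r f x) - Phi (S s f x)))" by (rule integral_abs_bound)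
     also have "... <= (LINT x|nu. abs (Psi (S s f x)) * abs (S r f x - S s f x) + (S r f x - S s f x)^2)"
     proof (rule integral_mono[OF _ i])
      show "integrable nu (%x. abs (Phi (S r f x) - Phi (S s f x)))"
       using integrable_Phi[OF L'(1)] integrable_Phi[OF L'(2)] by simp
      fix x
      show "abs (Phi (S r f x) - Phi (S s f x)) <= abs (Psi (S s f x)) * abs (S r f x - S s f x) + (S r f x - S s f x)^2"
       using Phi_taylor[of "S r f x" "S s f x"] unfolding abs_mult[symmetric] by linarith
     qed
     also have "... = ip (%x. abs (Psi (S s f x))) (%x. abs (S r f x - S s f x)) + ?n r * ?n r"
      using L2_mult_integrable[OF L2_abs[OF P] L2_abs[OF D]] L2_integrable_sq[OF D] L2_norm_sq[of nu "%x. S r f x - S s f x"]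
      by (simp add: L2_inner_def[of _ "%x. abs (Psi (S s f x))"] L2_inner_self power2_eq_square[of "?n r"])
     also have "... <= ?B r"
      using L2_cauchy_schwarz[OF L2_abs[OF P] L2_abs[OF D]] by (simp add: L2_norm_def L2_inner_def)
     finally show ?case by simp
    qed
   qed
   then show "((%s. LINT x|nu. Phi (S s f x)) \<longlongrightarrow> (LINT x|nu. Phi (S s f x))) (at s within {0..t})"
    by (rule LIM_zero_cancel)
  qed
  fix s assume s: "0 < s" "s < t"
  have "DERIV (%s. LINT x|nu. Phi (S s f x)) s :> ip (%x. Psi (S s f x)) (S s h)"
   by (rule L2_deriv_integral[OF S_deriv[OF g s(1)]]) (auto intro: Phi_taylor integrable_Phi L2_Psi)
  moreover have "ip (%x. Psi (S s f x)) (S s h) <= 0"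
   using LR_Psi_nonneg[OF generator_S[OF g, of s, unfolded gen_iff]] s by (simp add: L2_inner_uminus_right)
  ultimately show "EX y. (DERIV (%s. LINT x|nu. Phi (S s f x)) s :> y) & y <= 0" by blast
 qed (use t in simp)
 also have "(LINT x|nu. Phi (S 0 f x)) = (LINT x|nu. 0)"
 proof (rule integral_cong_AE)
  show "AE x in nu. Phi (S 0 f x) = 0"
   using nn S_zero[OF L(1)] by eventually_elim (simp add: Phi_eq_0_nonneg)
 qed (use SL[of 0] in auto)
 finally have "(LINT x|nu. Phi (S t f x)) = 0"
  using Phi_bounds by (intro antisym) (auto intro: integral_nonneg_AE)
 then have "AE x in nu. Phi (S t f x) = 0"
  using t by (subst (asm) integral_nonneg_eq_0_iff_AE) (auto intro!: integrable_Phi SL simp: Phi_bounds)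
 then show ?thesis by eventually_elim (rule Phi_eq_0)
qed

text \<open>A version of the semigroup defined at every point, whereas \<open>S t f\<close> is
  determined only almost everywhere. Identities between the two become pointwise once both sides are
  continuous.\<close>

definition P :: "real => (real => real) => real => real" where
 "P t f x = ip (k t x) f"

lemma cont_y: "t > 0 ==> cont (k t x)"
 using continuous_on_compose2[OF cont2, of t UNIV "%y. (x, y)"] by (simp add: continuous_intros)

lemma P_AE: "t > 0 ==> f \<in> L2 nu ==> AE x in nu. S t f x = P t f x"
 using kernel[of t] unfolding integral_kernel_def P_def L2_inner_def by (auto elim!: AE_mp)

text \<open>Compact support reduces the integral to a fixed bounded interval with a jointly
  continuous integrand; nothing is known yet about the decay of the kernel.\<close>

lemma P_test_continuous:
 assumes "f \<in> test" "t > 0"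
 shows "cont (P t f)"
proof -
 obtain N where N: "!!s. abs s >= N ==> f s = 0" using assms(1) unfolding test_def by auto
 let ?h = "%x z. w z * (k t x z * f z)"
 have c: "continuous_on UNIV (%(x, z). ?h x z)"
 proof -
  have "continuous_on UNIV (%p::real \<times> real. w (snd p) * ((%(s, r). k t s r) p * f (snd p)))"
   by (intro continuous_intros cont2 assms continuous_on_compose2[OF continuous_on_w[of UNIV]]
     continuous_on_compose2[OF test_continuous[OF assms(1), of UNIV]]) auto
  then show ?thesis by (simp add: case_prod_unfold)
 qed
 have "cont (%x. integral (cbox (-N) N) (?h x))"
  by (rule integral_continuous_on_param) (rule continuous_on_subset[OF c], simp)
 moreover have "integral (cbox (-N) N) (?h x) = P t f x" for x
 proof -
  have km: "k t x \<in> borel_measurable borel" by (intro borel_measurable_continuous_onI cont_y assms)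
  have hc: "cont (?h x)"
   using cont_y[OF assms(2)] test_continuous[OF assms(1)] by (intro continuous_intros) auto
  have si: "set_integrable lborel {-N..N} (?h x)"
   by (rule borel_integrable_atLeastAtMost'[OF continuous_on_subset[OF hc]]) simp
  have "P t f x = (LINT z|lborel. ?h x z)"
   unfolding P_def L2_inner_def using km test_measurable[OF assms(1)] by (simp add: integral_nu)
  also have "... = (LINT z:{-N..N}|lborel. ?h x z)"
   unfolding set_lebesgue_integral_def
  proof (rule Bochner_Integration.integral_cong[OF refl])
   fix z
   show "?h x z = indicat_real {-N..N} z *\<^sub>R ?h x z"
   proof (cases "z \<in> {-N..N}")
    case False
    then have "f z = 0" by (intro N) auto
    then show ?thesis by simp
   qed simp
  qed
  also have "... = integral {-N..N} (?h x)" by (rule set_borel_integral_eq_integral[OF si])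
  finally show ?thesis by simp
 qed
 ultimately show ?thesis by simp
qed

lemma energy_test:
 assumes "f \<in> test" "t > 0"
 obtains F g where "wderiv_seq F (S t f) g" "(nrm g)^2 * (2 * t) <= (nrm f)^2" "nrm (S t f) <= nrm f"
proof -
 obtain f' q where "domA f f' q" using test_domA[OF assms(1)] by blast
 then have g: "generator nu S f (%x. - q x)" by (rule domA_gen)
 have t0: "t >= 0" using assms by simp
 obtain u where u: "wderiv (S t f) u" "!!g g'. wderiv g g' ==> ip u g' = ip (%x. - S t (%x. - q x) x) g"
  using LR_D[OF generator_S[OF g t0, unfolded gen_iff]] by blast
 obtain F where F: "wderiv_seq F (S t f) u" using u(1) unfolding wderiv_def by auto
 have "(nrm u)^2 = - ip (S t (%x. - q x)) (S t f)"
  using u(2)[OF u(1)] by (simp add: L2_norm_sq L2_inner_uminus_left)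
 then have "(nrm u)^2 * (2 * t) <= (nrm f)^2" using energy_bound[OF g assms(2)] by simp
 then show thesis using F S_contraction[OF test_L2[OF assms(1)] t0] that by blast
qed

text \<open>The energy of \<open>S t f\<close> is at most the square norm of \<open>f\<close>
  divided by \<open>2 * t\<close>. Inserted into the bounds for the continuous representative, which
  coincides with \<open>P t f\<close>, this gives both estimates.\<close>

lemma P_test_bounds:
 assumes "f \<in> test" "t > 0"
 shows "(P t f x)^2 * w x * sqrt (2 * t) <= 2 * (nrm f)^2"
  and "x <= y ==> m > 0 ==> (!!s. s \<in> {x..y} ==> m <= w s) ==>
   (P t f y - P t f x)^2 * m * (2 * t) <= (y - x) * (nrm f)^2"
proof -
 obtain F g where F: "wderiv_seq F (S t f) g" and g: "(nrm g)^2 * (2 * t) <= (nrm f)^2"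
  and c: "nrm (S t f) <= nrm f"
  using energy_test[OF assms] by blast
 obtain u where u: "cont u" "AE s in nu. S t f s = u s"
  "!!x. (u x)^2 * w x <= 2 * nrm (S t f) * nrm g"
  "!!x y m. x <= y ==> m > 0 ==> \<forall>s\<in>{x..y}. m <= w s ==> (u y - u x)^2 * m <= (y - x) * (nrm g)^2"
  using wderiv_rep[OF F] by blast
 have "AE s in nu. P t f s = u s"
  using P_AE[OF assms(2) test_L2[OF assms(1)]] u(2) by eventually_elim simp
 then have Pu: "P t f = u" by (rule AE_nu_continuous_eq[OF P_test_continuous[OF assms] u(1)])
 have "nrm g * sqrt (2 * t) = sqrt ((nrm g)^2 * (2 * t))"
  by (simp add: real_sqrt_mult L2_norm_nonneg)
 also have "... <= sqrt ((nrm f)^2)" by (rule real_sqrt_le_mono[OF g])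
 finally have g': "nrm g * sqrt (2 * t) <= nrm f" by (simp add: L2_norm_nonneg)
 have "(P t f x)^2 * w x * sqrt (2 * t) <= (2 * nrm (S t f) * nrm g) * sqrt (2 * t)"
  unfolding Pu using assms(2) by (intro mult_right_mono u(3)) auto
 also have "... = 2 * (nrm (S t f) * (nrm g * sqrt (2 * t)))" by simp
 also have "... <= 2 * (nrm f * nrm f)"
  using c g' assms(2) by (intro mult_left_mono mult_mono) (auto simp: L2_norm_nonneg)
 finally show "(P t f x)^2 * w x * sqrt (2 * t) <= 2 * (nrm f)^2" by (simp add: power2_eq_square)
 assume xy: "x <= y" "m > 0" "!!s. s \<in> {x..y} ==> m <= w s"
 have "(P t f y - P t f x)^2 * m * (2 * t) <= ((y - x) * (nrm g)^2) * (2 * t)"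
  unfolding Pu using assms(2) xy by (intro mult_right_mono u(4)) auto
 also have "... = (y - x) * ((nrm g)^2 * (2 * t))" by simp
 also have "... <= (y - x) * (nrm f)^2" using xy by (intro mult_left_mono g) auto
 finally show "(P t f y - P t f x)^2 * m * (2 * t) <= (y - x) * (nrm f)^2" .
qed

text \<open>A row of the kernel is so far only a continuous function. The pointwise bound for
  \<open>P t f x\<close> says that it is a bounded functional on test functions, and duality turns
  this into square integrability with the same bound.\<close>

lemma kL2:
 assumes "t > 0"
 shows "k t x \<in> L2 nu" "(nrm (k t x))^2 <= 2 / (sqrt (2 * t) * w x)"
proof -
 let ?B = "sqrt (2 / (sqrt (2 * t) * w x))"
 have pos: "sqrt (2 * t) * w x > 0" using assms w_pos by simp
 have bd: "abs (LINT s|nu. k t x s * f s) <= ?B * nrm f" if f: "f \<in> test" for f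
 proof -
  have "(P t f x)^2 * (sqrt (2 * t) * w x) <= 2 * (nrm f)^2"
   using P_test_bounds(1)[OF f assms, of x] by (simp add: mult_ac)
  then have "(P t f x)^2 <= 2 * (nrm f)^2 / (sqrt (2 * t) * w x)" by (rule pos_le_divide_eq[OF pos, THEN iffD2])
  then have "sqrt ((P t f x)^2) <= sqrt (2 / (sqrt (2 * t) * w x) * (nrm f)^2)" by (intro real_sqrt_le_mono) simp
  then have "abs (P t f x) <= ?B * nrm f" by (simp only: real_sqrt_mult real_sqrt_abs abs_of_nonneg[OF L2_norm_nonneg])
  then show ?thesis unfolding P_def L2_inner_def .
 qed
 have B0: "?B >= 0" using pos by simp
 show "k t x \<in> L2 nu" by (rule L2_duality(1)[OF cont_y[OF assms] B0 bd])
 have "nrm (k t x) <= ?B" by (rule L2_duality(2)[OF cont_y[OF assms] B0 bd])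
 then have "(nrm (k t x))^2 <= ?B^2" by (intro power_mono L2_norm_nonneg)
 then show "(nrm (k t x))^2 <= 2 / (sqrt (2 * t) * w x)" using pos by simp
qed

lemma k_L2_holder:
 assumes "t > 0" "x <= y" "m > 0" "!!s. s \<in> {x..y} ==> m <= w s"
 shows "(nrm (%z. k t y z - k t x z))^2 * m <= (y - x) / (2 * t)"
proof -
 let ?c = "%z. k t y z - k t x z"
 let ?B = "sqrt ((y - x) / (m * (2 * t)))"
 have pos: "m * (2 * t) > 0" using assms by simp
 have bd: "abs (LINT s|nu. ?c s * f s) <= ?B * nrm f" if f: "f \<in> test" for f
 proof -
  have "(P t f y - P t f x)^2 * (m * (2 * t)) <= (y - x) * (nrm f)^2"
   using P_test_bounds(2)[OF f assms(1) assms(2-4)] by (simp add: mult_ac)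
  then have "(P t f y - P t f x)^2 <= (y - x) * (nrm f)^2 / (m * (2 * t))" by (rule pos_le_divide_eq[OF pos, THEN iffD2])
  then have "sqrt ((P t f y - P t f x)^2) <= sqrt ((y - x) / (m * (2 * t)) * (nrm f)^2)" by (intro real_sqrt_le_mono) simp
  then have "abs (P t f y - P t f x) <= ?B * nrm f" by (simp only: real_sqrt_mult real_sqrt_abs abs_of_nonneg[OF L2_norm_nonneg])
  moreover have "P t f y - P t f x = (LINT s|nu. ?c s * f s)"
   using L2_inner_diff_left[OF kL2(1)[OF assms(1)] kL2(1)[OF assms(1)] test_L2[OF f]]
   unfolding P_def L2_inner_def by simp
  ultimately show ?thesis by simp
 qed
 have B0: "?B >= 0" using pos assms by simp
 have c: "cont ?c" by (intro continuous_intros cont_y assms)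
 have "nrm ?c <= ?B" by (rule L2_duality(2)[OF c B0 bd])
 then have "(nrm ?c)^2 <= ?B^2" by (intro power_mono L2_norm_nonneg)
 also have "... = (y - x) / (m * (2 * t))" using pos assms by simp
 finally have "(nrm ?c)^2 * m <= (y - x) / (m * (2 * t)) * m" using assms by (intro mult_right_mono) auto
 then show ?thesis using assms by simp
qed

lemma P_continuous:
 assumes "f \<in> L2 nu" "t > 0"
 shows "cont (P t f)"
proof -
 have h1: "abs (P t f y - P t f x) <= sqrt (abs (y - x) / (2 * t)) * nrm f" for x y
 proof -
  let ?c = "%z. k t y z - k t x z"
  have *: "(nrm (%z. k t y z - k t x z))^2 <= abs (y - x) / (2 * t)" if "x <= y" for x y
   using k_L2_holder[OF assms(2) that, of 1] w_ge_1 that by simp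
  have "(nrm ?c)^2 <= abs (y - x) / (2 * t)"
   using *[of x y] *[of y x] L2_norm_minus_commute[of nu "k t y" "k t x"] by (cases "x <= y") (auto simp: abs_minus_commute)
  then have "nrm ?c <= sqrt (abs (y - x) / (2 * t))" using real_le_rsqrt by blast
  have kk: "k t y \<in> L2 nu" "k t x \<in> L2 nu" "?c \<in> L2 nu" using kL2[OF assms(2)] by (auto intro: L2_diff)
  have "P t f y - P t f x = ip ?c f"
   unfolding P_def by (simp add: L2_inner_diff_left kk assms)
  then have "abs (P t f y - P t f x) <= nrm ?c * nrm f" using L2_cauchy_schwarz[OF kk(3) assms(1)] by simp
  also have "... <= sqrt (abs (y - x) / (2 * t)) * nrm f"
   by (intro mult_right_mono L2_norm_nonneg) fact
  finally show ?thesis .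
 qed
 show ?thesis unfolding continuous_on_def
 proof
  fix x
  have "((%y. P t f y - P t f x) \<longlongrightarrow> 0) (at x)"
  proof (rule Lim_null_comparison[OF always_eventually[OF allI]])
   show "norm (P t f y - P t f x) <= sqrt (abs (y - x) / (2 * t)) * nrm f" for y using h1 by simp
   have "((%y. sqrt (abs (y - x) / (2 * t)) * nrm f) \<longlongrightarrow> sqrt (abs (x - x) / (2 * t)) * nrm f) (at x)"
    using assms by (intro tendsto_intros) auto
   then show "((%y. sqrt (abs (y - x) / (2 * t)) * nrm f) \<longlongrightarrow> 0) (at x)" by simp
  qed
  then show "(P t f \<longlongrightarrow> P t f x) (at x)" by (rule LIM_zero_cancel)
 qed
qed

lemma P_semi:
 assumes "f \<in> L2 nu" "t > 0" "s > 0"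
 shows "P (t + s) f x = P t (S s f) x"
proof -
 have SL: "S s f \<in> L2 nu" using assms by auto
 have "AE x in nu. P (t + s) f x = P t (S s f) x"
  using P_AE[of "t + s" f] P_AE[of t "S s f"] S_plus[of t s f] assms SL by (auto elim!: AE_mp)
 then have "P (t + s) f = P t (S s f)"
  using assms SL by (intro AE_nu_continuous_eq P_continuous) auto
 then show ?thesis by simp
qed

text \<open>Both sides are continuous in \<open>y\<close>, so it suffices to test them; there
  \<open>S s\<close> is moved across the inner product by symmetry. At equal times the right-hand
  side is symmetric in \<open>x\<close> and \<open>y\<close>, which yields the symmetry of the
  kernel.\<close>

lemma k_semigroup:
 assumes "t > 0" "s > 0"
 shows "k (t + s) x y = ip (k s y) (k t x)"
proof -
 let ?u = "P s (k t x)"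
 have kk: "k t x \<in> L2 nu" "k (t + s) x \<in> L2 nu" using assms by (auto intro: kL2)
 have SL: "S s (k t x) \<in> L2 nu" using assms kk by auto
 have uc: "cont ?u" by (intro P_continuous kk assms)
 have um: "?u \<in> borel_measurable nu" using borel_measurable_continuous_onI[OF uc] by simp
 have uL: "?u \<in> L2 nu" by (rule L2_cong_AE[OF SL um P_AE[OF assms(2) kk(1)]])
 have "AE z in nu. k (t + s) x z - ?u z = 0"
 proof (rule L2_orthogonal_test)
  show "(%z. k (t + s) x z - ?u z) \<in> L2 nu" by (intro L2_diff kk uL)
  fix f assume f: "f \<in> test"
  have fL: "f \<in> L2 nu" by (rule test_L2[OF f])
  have "ip (k (t + s) x) f = P t (S s f) x" using P_semi[OF fL assms] by (simp add: P_def)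
  also have "... = ip (S s (k t x)) f"
   unfolding P_def using assms kk fL by (simp add: S_symmetric)
  also have "... = ip ?u f"
   using P_AE[OF assms(2) kk(1)] SL um fL by (intro L2_inner_cong_AE) auto
  finally show "ip (%z. k (t + s) x z - ?u z) f = 0"
   using kk uL fL by (simp add: L2_inner_diff_left)
 qed
 then have "AE z in nu. k (t + s) x z = ?u z" by eventually_elim simp
 then have "k (t + s) x = ?u" using assms by (intro AE_nu_continuous_eq cont_y uc) auto
 then show ?thesis by (simp add: P_def)
qed

lemma k_symmetric:
 assumes "t > 0"
 shows "k t x y = k t y x"
proof -
 have h: "t / 2 > 0" using assms by simp
 have "k (t / 2 + t / 2) x y = k (t / 2 + t / 2) y x"
  unfolding k_semigroup[OF h h] by (rule L2_inner_commute)
 then show ?thesis by simp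
qed

lemma P_test_nonneg:
 assumes "f \<in> test" "!!s. 0 <= f s" "t > 0"
 shows "0 <= P t f x"
proof (rule nonneg_if_AE_nonneg[OF P_test_continuous[OF assms(1,3)]])
 obtain f' q where "domA f f' q" using test_domA[OF assms(1)] by blast
 then have "AE x in nu. 0 <= S t f x" using assms by (intro S_nonneg[OF domA_gen]) auto
 then show "AE x in nu. 0 <= P t f x"
  using P_AE[OF assms(3) test_L2[OF assms(1)]] by eventually_elim simp
qed

lemma k_nonneg':
 assumes "t > 0"
 shows "0 <= k t x y"
proof (rule nonneg_if_tested[OF cont_y[OF assms]])
 fix f assume "f \<in> test" "!!s. 0 <= f s"
 then show "0 <= (LINT s|nu. k t x s * f s)"
  using P_test_nonneg[OF _ _ assms, of f x] by (simp add: P_def L2_inner_def)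
qed

lemma P_nonneg: "t > 0 ==> AE s in nu. 0 <= f s ==> 0 <= P t f x"
 unfolding P_def L2_inner_def by (rule integral_nonneg_AE) (auto elim!: AE_mp intro: mult_nonneg_nonneg k_nonneg')

sublocale heat_kernel d k
proof
 fix t x y :: real assume t: "t > 0"
 show "cont (k t x)" by (rule cont_y[OF t])
 show "0 <= k t x y" by (rule k_nonneg'[OF t])
 show "k t x y = k t y x" by (rule k_symmetric[OF t])
 show "k t x \<in> L2 nu" by (rule kL2[OF t])
 have t2: "t / 2 > 0" using t by simp
 have "k t x x = (nrm (k (t / 2) x))^2"
  using k_semigroup[OF t2 t2, of x x] by (simp add: L2_norm_sq)
 then show "k t x x <= 2 / (sqrt t * w x)" using kL2(2)[OF t2, of x] by simp
next
 fix t s x y :: real assume "t > 0" "s > 0"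
 then show "k (t + s) x y = ip (k t x) (k s y)" using k_semigroup[of t s x y] by (simp add: L2_inner_commute)
next
 fix s t x :: real assume st: "0 < s" "s <= t"
 have d: "k r x x = (nrm (k (r / 2) x))^2" if "r > 0" for r
  using k_semigroup[of "r / 2" "r / 2" x x] that by (simp add: L2_norm_sq)
 have "nrm (k (t / 2) x) <= nrm (k (s / 2) x)"
 proof (cases "s = t")
  case False
  define r where "r = (t - s) / 2"
  have r: "r > 0" using st False by (simp add: r_def)
  have kL: "k (s / 2) x \<in> L2 nu" using st by (intro kL2) auto
  have "k (t / 2) x = P r (k (s / 2) x)"
  proof
   fix y
   have e: "t / 2 = s / 2 + r" unfolding r_def by (simp add: field_simps)
   show "k (t / 2) x y = P r (k (s / 2) x) y" unfolding e using k_semigroup[of "s / 2" r x y] st r by (simp add: P_def)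
  qed
  then have "nrm (k (t / 2) x) = nrm (S r (k (s / 2) x))"
   using P_AE[OF r kL] st r kL S_L2[of r "k (s / 2) x"] kL2(1)[of "t / 2" x]
   by (intro L2_norm_cong_AE) (auto elim!: AE_mp)
  also have "... <= nrm (k (s / 2) x)" using r kL by (intro S_contraction) auto
  finally show ?thesis .
 qed simp
 then show "k t x x <= k s x x" using d[of s] d[of t] st by (simp add: power_mono L2_norm_nonneg)
next
 fix t x y m :: real
 assume "t > 0" "x <= y" "m > 0" "!!s. s \<in> {x..y} ==> m <= w s"
 then show "(nrm (%z. k t y z - k t x z))^2 * m <= (y - x) / (2 * t)" by (rule k_L2_holder)
next
 fix g g' q t x assume g: "domA g g' q" and t: "t > (0::real)"
 have L: "g \<in> L2 nu" "q \<in> L2 nu" using g by (auto simp: domA_def)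
 \<comment> \<open>The first half of the time is kept in the square integrable row
   \<open>k s x\<close>; what depends on the time variable is an orbit of the semigroup, whose
   derivative is known.\<close>
 define s where "s = t / 2"
 have s: "s > 0" "t - s > 0" using t by (auto simp: s_def)
 have ks: "k s x \<in> L2 nu" using s by (intro kL2)
 have eq: "ip (k r x) f = ip (S (r - s) f) (k s x)" if "r > s" "f \<in> L2 nu" for r f
  using P_semi[OF that(2) s(1), of "r - s" x] P_semi[OF that(2), of s "r - s" x] that s
  by (simp add: P_def L2_inner_commute)
 have "DERIV (%r. ip (S (r - s) g) (k s x)) t :> ip (S (t - s) (%x. - q x)) (k s x) * 1"
  using s by (intro DERIV_chain2[where f = "%r. ip (S r g) (k s x)"] inner_S_deriv[OF domA_gen[OF g]] ks)
   (auto intro!: derivative_eq_intros)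
 moreover have "\<forall>\<^sub>F r in nhds t. ip (S (r - s) g) (k s x) = ip (k r x) g"
  using eventually_nhds_in_open[of "{s<..}" t] s by (auto elim!: eventually_mono simp: eq L)
 ultimately have "DERIV (%r. ip (k r x) g) t :> ip (S (t - s) (%x. - q x)) (k s x) * 1"
  by (rule DERIV_cong_ev[THEN iffD1, OF refl _ refl, rotated])
 then show "DERIV (%t. ip (k t x) g) t :> - ip (k t x) q"
  using eq[of t "%x. - q x"] s L by (simp add: L2_uminus L2_inner_uminus_right)
next
 fix g g' q t K x assume g: "domA g g' q" and t: "t > (0::real)" and sup: "!!s. 0 <= q s + K * g s"
 have L: "g \<in> L2 nu" "q \<in> L2 nu" "(%s. - q s) \<in> L2 nu" using g by (auto simp: domA_def intro: L2_uminus)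
 have gc: "cont g" using g unfolding domA_def
  by (auto intro!: continuous_at_imp_continuous_on intro: DERIV_isCont)
 have SL: "S t g \<in> L2 nu" using L t by auto
 \<comment> \<open>The function paired with the orbit is the positive part of the very difference to
   be estimated. The discounted pairing with the orbit of \<open>g\<close> decreases in time, hence
   the square norm of this positive part is at most \<open>0\<close>.\<close>
 define f where "f s = max 0 (S t g s - exp (K * t) * g s)" for s
 have fL: "f \<in> L2 nu"
  by (rule L2_bound[of _ _ "%s. S t g s - exp (K * t) * g s" 1])
   (use L2_diff[OF SL L2_scale[OF L(1), of "exp (K * t)"]] SL L(1) in \<open>auto simp: f_def[abs_def]\<close>)
 have fnn: "0 <= f s" for s by (simp add: f_def)
 have le1: "exp (- K * t) * ip (S t g) f <= exp (- K * 0) * ip (S 0 g) f"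
 proof (rule DERIV_nonpos_imp_decreasing_open[of 0 t])
  show "continuous_on {0..t} (%s. exp (- K * s) * ip (S s g) f)"
   by (intro continuous_intros continuous_on_subset[OF continuous_on_inner_S[OF L(1) fL]]) auto
  fix s assume s: "0 < s" "s < t"
  have "DERIV (%s. exp (- K * s) * ip (S s g) f) s :> exp (- K * s) * (- K) * ip (S s g) f + ip (S s (%x. - q x)) f * exp (- K * s)"
   by (intro DERIV_mult inner_S_deriv[OF domA_gen[OF g] s(1) fL]) (auto intro!: derivative_eq_intros)
  moreover have "exp (- K * s) * (- K) * ip (S s g) f + ip (S s (%x. - q x)) f * exp (- K * s)
    = - (exp (- K * s) * ip (S s (%z. 1 * q z + K * g z)) f)"
  proof -
   have s0: "s >= 0" using s by simp
   have "ip (S s (%z. 1 * q z + K * g z)) f = ip (%z. 1 * q z + K * g z) (S s f)"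
    by (intro S_symmetric L2_lincomb L fL s0)
   also have "... = ip q (S s f) + K * ip g (S s f)"
    using S_L2[OF s0 fL] L by (simp add: L2_inner_add_left L2_intros L2_inner_scale_left)
   also have "... = - ip (S s (%x. - q x)) f + K * ip (S s g) f"
    using S_symmetric[OF L(3) fL s0] S_symmetric[OF L(1) fL s0] by (simp add: L2_inner_uminus_left)
   finally have e: "ip (S s (%z. 1 * q z + K * g z)) f
     = - ip (S s (%x. - q x)) f + K * ip (S s g) f" .
   show ?thesis unfolding e by (simp add: algebra_simps)
  qed
  moreover have "0 <= ip (S s (%z. 1 * q z + K * g z)) f"
   unfolding L2_inner_def
  proof (rule integral_nonneg_AE)
   show "AE x in nu. 0 <= S s (%z. 1 * q z + K * g z) x * f x"
    using P_AE[OF s(1) L2_lincomb[OF L(2,1), of 1 K]]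
   proof eventually_elim
    case (elim x)
    have "0 <= P s (%z. 1 * q z + K * g z) x" by (rule P_nonneg[OF s(1)]) (use sup in simp)
    then show ?case using elim fnn by simp
   qed
  qed
  ultimately show "EX y. (DERIV (%s. exp (- K * s) * ip (S s g) f) s :> y) & y <= 0"
   by (smt (verit, best) exp_ge_zero mult_nonneg_nonneg)
 qed (use t in simp)
 have S0: "ip (S 0 g) f = ip g f"
  using S_zero[OF L(1)] S_L2[OF order_refl L(1)] L fL by (intro L2_inner_cong_AE) auto
 have "exp (K * t) * (exp (- K * t) * ip (S t g) f) <= exp (K * t) * (exp (- K * 0) * ip g f)"
  by (rule mult_left_mono[OF le1[unfolded S0]]) simp
 moreover have "exp (K * t) * (exp (- K * t) * c) = c" for c by (simp add: exp_minus)
 ultimately have "ip (S t g) f <= exp (K * t) * ip g f" by (simp only: mult_zero_right exp_zero mult_1)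
 then have "ip (%s. S t g s - exp (K * t) * g s) f <= 0"
  unfolding L2_inner_diff_left[OF SL L2_scale[OF L(1)] fL] L2_inner_scale_left by simp
 moreover have "ip (%s. S t g s - exp (K * t) * g s) f = ip f f"
  unfolding L2_inner_def by (intro Bochner_Integration.integral_cong) (auto simp: f_def max_def)
 ultimately have "nrm f = 0" using L2_inner_nonneg[of nu f] by (simp add: L2_norm_def)
 then have "AE s in nu. f s = 0" using L2_norm_eq_0_iff[OF fL] by simp
 then have "AE s in nu. 0 <= exp (K * t) * g s - P t g s"
  using P_AE[OF t L(1)] by eventually_elim (simp add: f_def max_def split: if_splits)
 then have "0 <= exp (K * t) * g x - P t g x"
  by (intro nonneg_if_AE_nonneg continuous_intros gc P_continuous L t)
 then show "ip (k t x) g <= exp (K * t) * g x" by (simp add: P_def)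
qed

end

section \<open>Transfer to the weighted line\<close>

lemma coord_chart [simp]: "coord (chart s) = s"
 by (auto simp: coord_def chart_def sgn_if)

lemma chart_coord: "x \<in> X ==> x ~= -1 ==> chart (coord x) = x"
 by (auto simp: coord_def chart_def sgn_if X_def)

lemma chart_X [simp]: "chart s \<in> X"
 by (auto simp: chart_def X_def)

lemma coord_measurable [measurable]: "meas coord"
 and chart_measurable [measurable]: "meas chart"
 unfolding coord_def chart_def by measurable

lemma space_mu [simp]: "space (mu d) = X"
 and sets_mu: "sets (mu d) = sets (restrict_space borel X)"
 by (simp_all add: mu_def space_restrict_space sets_restrict_space)

lemma coord_measurable_mu [measurable]: "coord \<in> borel_measurable (mu d)"
 using measurable_restrict_space1[OF coord_measurable, of X] by (simp add: measurable_cong_sets[OF sets_mu refl])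

context bessel
begin

lemma chart_measurable_mu [measurable]: "chart \<in> measurable nu (mu d)"
proof -
 have "chart \<in> measurable borel (restrict_space borel X)" by (rule measurable_restrict_space2) auto
 then show ?thesis by (simp add: measurable_cong_sets[OF sets_nu sets_mu])
qed

lemma distr_chart: "distr nu (mu d) chart = mu d"
proof (rule measure_eqI)
 fix A assume "A \<in> sets (distr nu (mu d) chart)"
 then have A: "A \<in> sets (mu d)" by simp
 have "X \<in> sets borel" by (auto simp: X_def)
 then have Ab: "A \<in> sets borel" "A \<subseteq> X" using A by (auto simp: sets_mu sets_restrict_space)
 let ?g = "%x. ennreal (abs x powr (d - 1)) * indicator A x"
 have gm: "?g \<in> borel_measurable borel" using Ab by measurable
 have "emeasure (mu d) A = (\<integral>\<^sup>+x. ennreal (abs x powr (d - 1)) * indicator A x \<partial>restrict_space lborel X)"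
  unfolding mu_def using A by (subst emeasure_density) (auto simp: mu_def intro!: measurable_restrict_space1)
 also have "... = (\<integral>\<^sup>+x. ?g x * indicator X x \<partial>lborel)"
  using \<open>X \<in> sets borel\<close> by (subst nn_integral_restrict_space) auto
 also have "... = (\<integral>\<^sup>+x. ?g x * indicator {0<..} x + ?g x * indicator {..<0} x \<partial>lborel)"
  using Ab(2) by (intro nn_integral_cong) (auto simp: indicator_def X_def)
 also have "... = (\<integral>\<^sup>+x. ?g x * indicator {0<..} x \<partial>lborel) + (\<integral>\<^sup>+x. ?g x * indicator {..<0} x \<partial>lborel)"
  using gm by (intro nn_integral_add) auto
 also have "(\<integral>\<^sup>+x. ?g x * indicator {0<..} x \<partial>lborel) = (\<integral>\<^sup>+s. ?g (1 + 1 * s) * indicator {0<..} (1 + 1 * s) \<partial>lborel)"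
  using gm by (subst nn_integral_real_affine[where c = 1 and t = 1]) auto
 also have "(\<integral>\<^sup>+x. ?g x * indicator {..<0} x \<partial>lborel) = (\<integral>\<^sup>+s. ?g (-1 + 1 * s) * indicator {..<0} (-1 + 1 * s) \<partial>lborel)"
  using gm by (subst nn_integral_real_affine[where c = 1 and t = "-1"]) auto
 also have "(\<integral>\<^sup>+s. ?g (1 + 1 * s) * indicator {0<..} (1 + 1 * s) \<partial>lborel) + (\<integral>\<^sup>+s. ?g (-1 + 1 * s) * indicator {..<0} (-1 + 1 * s) \<partial>lborel)
   = (\<integral>\<^sup>+s. ?g (1 + 1 * s) * indicator {0<..} (1 + 1 * s) + ?g (-1 + 1 * s) * indicator {..<0} (-1 + 1 * s) \<partial>lborel)"
  using gm by (intro nn_integral_add[symmetric]) auto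
 also have "... = (\<integral>\<^sup>+s. ennreal (w s) * indicator (chart -` A) s \<partial>lborel)"
 proof (rule nn_integral_cong_AE)
  have "AE s in lborel. s ~= (0::real)" by (rule AE_lborel_singleton)
  then show "AE s in lborel. ?g (1 + 1 * s) * indicator {0<..} (1 + 1 * s) + ?g (-1 + 1 * s) * indicator {..<0} (-1 + 1 * s)
    = ennreal (w s) * indicator (chart -` A) s"
  proof eventually_elim
   case (elim s)
   then show ?case using Ab(2) by (cases "s < 0") (auto simp: indicator_def chart_def w_def X_def add_ac)
  qed
 qed
 also have "... = emeasure nu (chart -` A)"
  unfolding nu_def using measurable_sets_borel[OF chart_measurable Ab(1)] by (subst emeasure_density) auto
 also have "... = emeasure (distr nu (mu d) chart) A"
  using A by (subst emeasure_distr) auto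
 finally show "emeasure (distr nu (mu d) chart) A = emeasure (mu d) A" by simp
qed simp

lemma measurable_chart: "f \<in> borel_measurable (mu d) ==> (%s. f (chart s)) \<in> borel_measurable nu"
 by (rule measurable_compose[OF chart_measurable_mu])

lemma integral_mu: "f \<in> borel_measurable (mu d) ==> (LINT x|mu d. f x) = (LINT s|nu. f (chart s) :: real)"
 using integral_distr[OF chart_measurable_mu, of f] by (simp add: distr_chart)

lemma integrable_mu: "f \<in> borel_measurable (mu d) ==> integrable (mu d) f \<longleftrightarrow> integrable nu (%s. f (chart s) :: real)"
 using integrable_distr_eq[OF chart_measurable_mu, of f] by (simp add: distr_chart)

lemma AE_mu: "AE x in mu d. Q x ==> AE s in nu. Q (chart s)"
 by (rule AE_distrD[OF chart_measurable_mu, unfolded distr_chart])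

lemma L2_mu: "f \<in> L2 (mu d) \<longleftrightarrow> f \<in> borel_measurable (mu d) & (%s. f (chart s)) \<in> L2 nu"
 unfolding L2_def using integrable_mu[of "%x. (f x)^2"] measurable_chart[of f] by auto

lemma L2_inner_mu: "f \<in> borel_measurable (mu d) ==> g \<in> borel_measurable (mu d) ==>
  L2_inner (mu d) f g = ip (%s. f (chart s)) (%s. g (chart s))"
 unfolding L2_inner_def by (rule integral_mu) measurable

lemma L2_norm_mu: "f \<in> borel_measurable (mu d) ==> L2_norm (mu d) f = nrm (%s. f (chart s))"
 by (simp add: L2_norm_def L2_inner_mu)

text \<open>\<open>coord\<close> takes the same value at \<open>-1\<close> and \<open>1\<close>, so
  a lifted function automatically respects the gluing.\<close>

definition lift :: "(real => real) => real => real" where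
 "lift f x = f (coord x)"

lemma lift_chart [simp]: "lift f (chart s) = f s"
 by (simp add: lift_def)

lemma lift_measurable: "meas f ==> lift f \<in> borel_measurable (mu d)"
 unfolding lift_def[abs_def] by (rule measurable_compose[OF coord_measurable_mu])

lemma lift_measurable_iff: "lift f \<in> borel_measurable (mu d) \<longleftrightarrow> f \<in> borel_measurable borel"
proof
 assume "lift f \<in> borel_measurable (mu d)"
 from measurable_chart[OF this] show "meas f" by simp
qed (rule lift_measurable)

lemma lift_L2: "lift f \<in> L2 (mu d) \<longleftrightarrow> f \<in> L2 nu"
proof -
 have "meas f" if "f \<in> L2 nu" using L2_measurable[OF that] by simp
 then show ?thesis unfolding L2_mu lift_measurable_iff by auto
qed

lemma lift_chart_AE: "AE x in mu d. lift (%s. f (chart s)) x = f x"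
proof (rule AE_I')
 have "emeasure (mu d) {-1} = emeasure (distr nu (mu d) chart) {-1}" by (simp add: distr_chart)
 also have "... = emeasure nu (chart -` {-1} \<inter> space nu)"
  by (rule emeasure_distr) (auto simp: sets_mu sets_restrict_space X_def intro!: image_eqI[of _ _ "{-1}"])
 also have "chart -` {-1} \<inter> space nu = {}" by (auto simp: chart_def split: if_splits)
 finally show "{-1} \<in> null_sets (mu d)"
  by (auto simp: null_sets_def sets_mu sets_restrict_space X_def intro!: image_eqI[of _ _ "{-1}"])
 show "{x \<in> space (mu d). lift (%s. f (chart s)) x ~= f x} \<subseteq> {-1}"
 proof
  fix x assume "x \<in> {x \<in> space (mu d). lift (%s. f (chart s)) x ~= f x}"
  then show "x \<in> {-1}" using chart_coord[of x] by (cases "x = -1") (auto simp: lift_def)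
 qed
qed

lemma C1c_iff: "f \<in> C1c \<longleftrightarrow> f (-1) = f 1 & (%s. f (chart s)) \<in> C1R"
 by (simp add: C1c_def C1R_def comp_def)

lemma lift_C1c: "lift f \<in> C1c \<longleftrightarrow> f \<in> C1R"
 unfolding C1c_iff lift_chart by (simp add: lift_def coord_def)

lemma C1c_diff: "f \<in> C1c ==> g \<in> C1c ==> (%x. f x - g x) \<in> C1c"
 unfolding C1c_iff using C1R_diff(1)[of "%s. f (chart s)" "%s. g (chart s)"] by simp

lemma C1c_measurable:
 assumes "f \<in> C1c"
 shows "f \<in> borel_measurable (mu d)"
proof -
 have "lift (%s. f (chart s)) \<in> borel_measurable (mu d)"
  using assms by (intro lift_measurable C1R_measurable) (simp add: C1c_iff)
 moreover have "lift (%s. f (chart s)) x = f x" if "x \<in> space (mu d)" for x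
  using that assms chart_coord[of x] by (cases "x = -1") (auto simp: lift_def C1c_iff coord_def chart_def)
 ultimately show ?thesis using measurable_cong[of "mu d" "lift (%s. f (chart s))" f] by blast
qed

lemma bessel_form_QR:
 assumes "f \<in> C1c" "g \<in> C1c"
 shows "bessel_form d f g = QR (%s. f (chart s)) (%s. g (chart s))"
proof -
 have x: "xderiv h = lift (deriv (%s. h (chart s)))" for h
  by (auto simp: xderiv_def lift_def comp_def)
 have m: "xderiv f \<in> borel_measurable (mu d)" "xderiv g \<in> borel_measurable (mu d)"
  unfolding x using assms by (auto intro!: lift_measurable C1R_measurable simp: C1c_iff)
 have "bessel_form d f g = (LINT s|nu. xderiv f (chart s) * xderiv g (chart s))"
  unfolding bessel_form_def using m by (intro integral_mu) measurable
 then show ?thesis unfolding x by (simp add: QR_def)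
qed

lemma form_approx_transfer:
 assumes F: "!!n. F n \<in> C1c" and f: "f \<in> borel_measurable (mu d)"
 shows "form_approx (mu d) C1c (bessel_form d) F f \<longleftrightarrow> form_approx nu C1R QR (%n s. F n (chart s)) (%s. f (chart s))"
proof -
 have "L2_norm (mu d) (%x. F n x - f x) = nrm (%s. F n (chart s) - f (chart s))" for n
  using C1c_measurable[OF F] f by (intro L2_norm_mu) measurable
 moreover have "bessel_form d (%x. F m x - F n x) (%x. F m x - F n x)
   = QR (%s. F m (chart s) - F n (chart s)) (%s. F m (chart s) - F n (chart s))" for m n
  by (rule bessel_form_QR) (intro C1c_diff F)+
 moreover have "(%s. F n (chart s)) \<in> C1R" for n using F by (simp add: C1c_iff)
 ultimately show ?thesis unfolding form_approx_def using F f by (simp add: L2_mu)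
qed

lemma form_approx_lift:
 assumes "form_approx nu C1R QR F (%s. f (chart s))" "f \<in> borel_measurable (mu d)"
 shows "form_approx (mu d) C1c (bessel_form d) (%n. lift (F n)) f"
proof -
 have "lift (F n) \<in> C1c" for n using assms(1) by (simp add: lift_C1c form_approx_def)
 from form_approx_transfer[OF this assms(2)] show ?thesis using assms(1) by simp
qed

lemma form_approx_C1c: "form_approx (mu d) C1c (bessel_form d) F f ==> F n \<in> C1c"
 and form_approx_measurable: "form_approx (mu d) C1c (bessel_form d) F f ==> f \<in> borel_measurable (mu d)"
 by (auto simp: form_approx_def L2_measurable)

lemma closure_domain_transfer:
 assumes "f \<in> borel_measurable (mu d)"
 shows "f \<in> closure_domain (mu d) C1c (bessel_form d) \<longleftrightarrow> (%s. f (chart s)) \<in> closure_domain nu C1R QR"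
 unfolding closure_domain_def mem_Collect_eq
proof
 assume "EX F. form_approx (mu d) C1c (bessel_form d) F f"
 then obtain F where F: "form_approx (mu d) C1c (bessel_form d) F f" ..
 then show "EX F. form_approx nu C1R QR F (%s. f (chart s))"
  by (intro exI) (rule form_approx_transfer[OF form_approx_C1c[OF F] assms, THEN iffD1, OF F])
next
 assume "EX F. form_approx nu C1R QR F (%s. f (chart s))"
 then obtain F where "form_approx nu C1R QR F (%s. f (chart s))" ..
 then show "EX F. form_approx (mu d) C1c (bessel_form d) F f" by (intro exI) (rule form_approx_lift[OF _ assms])
qed

lemma closure_form_transfer:
 assumes f: "f \<in> borel_measurable (mu d)" and g: "g \<in> borel_measurable (mu d)"
 shows "closure_form (mu d) C1c (bessel_form d) f g = closure_form nu C1R QR (%s. f (chart s)) (%s. g (chart s))"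
proof -
 have "(ALL F G. form_approx (mu d) C1c (bessel_form d) F f --> form_approx (mu d) C1c (bessel_form d) G g -->
    (%n. bessel_form d (F n) (G n)) \<longlonglongrightarrow> q) \<longleftrightarrow>
   (ALL F G. form_approx nu C1R QR F (%s. f (chart s)) --> form_approx nu C1R QR G (%s. g (chart s)) -->
    (%n. QR (F n) (G n)) \<longlonglongrightarrow> q)" (is "?L \<longleftrightarrow> ?R") for q
 proof
  assume L: ?L
  show ?R
  proof (intro allI impI)
   fix F G assume FG: "form_approx nu C1R QR F (%s. f (chart s))" "form_approx nu C1R QR G (%s. g (chart s))"
   have "(%n. bessel_form d (lift (F n)) (lift (G n))) \<longlonglongrightarrow> q"
    by (rule L[rule_format, OF form_approx_lift[OF FG(1) f] form_approx_lift[OF FG(2) g]])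
   moreover have "bessel_form d (lift (F n)) (lift (G n)) = QR (F n) (G n)" for n
    using FG by (subst bessel_form_QR) (auto simp: lift_C1c form_approx_def)
   ultimately show "(%n. QR (F n) (G n)) \<longlonglongrightarrow> q" by simp
  qed
 next
  assume R: ?R
  show ?L
  proof (intro allI impI)
   fix F G assume FG: "form_approx (mu d) C1c (bessel_form d) F f" "form_approx (mu d) C1c (bessel_form d) G g"
   have "(%n. QR (%s. F n (chart s)) (%s. G n (chart s))) \<longlonglongrightarrow> q"
    by (rule R[rule_format, OF form_approx_transfer[OF form_approx_C1c[OF FG(1)] f, THEN iffD1, OF FG(1)]
       form_approx_transfer[OF form_approx_C1c[OF FG(2)] g, THEN iffD1, OF FG(2)]])
   then show "(%n. bessel_form d (F n) (G n)) \<longlonglongrightarrow> q"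
    using bessel_form_QR[OF form_approx_C1c[OF FG(1)] form_approx_C1c[OF FG(2)]] by simp
  qed
 qed
 then show ?thesis unfolding closure_form_def by simp
qed

lemma operator_transfer: "LR f h \<longleftrightarrow> bessel_operator d (lift f) (lift h)"
proof (cases "meas f & h \<in> borel_measurable borel")
 case True
 then have m: "lift f \<in> borel_measurable (mu d)" "lift h \<in> borel_measurable (mu d)" by (auto intro: lift_measurable)
 have "(\<forall>g\<in>closure_domain nu C1R QR. closure_form nu C1R QR f g = ip h g) \<longleftrightarrow>
  (\<forall>g\<in>closure_domain (mu d) C1c (bessel_form d). closure_form (mu d) C1c (bessel_form d) (lift f) g = L2_inner (mu d) (lift h) g)"
  (is "?L \<longleftrightarrow> ?R")
 proof
  assume L: ?L
  show ?R
  proof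
   fix g assume g: "g \<in> closure_domain (mu d) C1c (bessel_form d)"
   then have gm: "g \<in> borel_measurable (mu d)" by (auto simp: closure_domain_def intro: form_approx_measurable)
   have "(%s. g (chart s)) \<in> closure_domain nu C1R QR" using g closure_domain_transfer[OF gm] by simp
   then show "closure_form (mu d) C1c (bessel_form d) (lift f) g = L2_inner (mu d) (lift h) g"
    using L closure_form_transfer[OF m(1) gm] L2_inner_mu[OF m(2) gm] by simp
  qed
 next
  assume R: ?R
  show ?L
  proof
   fix g assume g: "g \<in> closure_domain nu C1R QR"
   then have "g \<in> L2 nu" by (auto simp: closure_domain_def form_approx_def)
   then have gm: "lift g \<in> borel_measurable (mu d)" by (intro lift_measurable) (auto dest: L2_measurable)
   have "lift g \<in> closure_domain (mu d) C1c (bessel_form d)" using g closure_domain_transfer[OF gm] by simp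
   then have "closure_form (mu d) C1c (bessel_form d) (lift f) (lift g) = L2_inner (mu d) (lift h) (lift g)" using R by blast
   then show "closure_form nu C1R QR f g = ip h g"
    using closure_form_transfer[OF m(1) gm] L2_inner_mu[OF m(2) gm] by simp
  qed
 qed
 then show ?thesis
  unfolding LR_def bessel_operator_def form_operator_def using closure_domain_transfer[OF m(1)] lift_L2[of h] by simp
next
 case False
 have "~ LR f h"
 proof
  assume l: "LR f h"
  obtain f' where "wderiv f f'" "h \<in> L2 nu" using LR_D[OF l] by blast
  then show False using False wderiv_L2[of f f'] by (auto dest!: L2_measurable)
 qed
 moreover have "~ bessel_operator d (lift f) (lift h)"
 proof
  assume "bessel_operator d (lift f) (lift h)"
  then have "lift f \<in> borel_measurable (mu d)" "lift h \<in> borel_measurable (mu d)"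
   unfolding bessel_operator_def form_operator_def
   by (auto simp: closure_domain_def intro: form_approx_measurable L2_measurable)
  then show False using False by (simp add: lift_measurable_iff)
 qed
 ultimately show ?thesis by simp
qed

lemma heat_semigroup_if_kernel:
 assumes "bessel_heat_kernel d T"
 obtains S where "heat_semigroup d S (%t s r. T t (chart s) (chart r))"
proof -
 obtain S where ES: "exp_semigroup (mu d) (bessel_operator d) S"
  and ker: "!!t. t > 0 ==> integral_kernel (mu d) (S t) (T t)" "!!t. t > 0 ==> continuous_kernel (T t)"
  using assms unfolding bessel_heat_kernel_def by auto
 interpret m: c0_semigroup "mu d" S by unfold_locales (use ES in \<open>simp add: exp_semigroup_def\<close>)
 define S' where "S' t f s = S t (lift f) (chart s)" for t f s
 have lL: "f \<in> L2 nu ==> lift f \<in> L2 (mu d)" for f by (simp add: lift_L2)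
 have SL: "t >= 0 ==> f \<in> L2 nu ==> S t (lift f) \<in> L2 (mu d)" for t f using lL by auto
 have S'L: "t >= 0 ==> f \<in> L2 nu ==> S' t f \<in> L2 nu" for t f
  using SL[of t f] unfolding S'_def[abs_def] by (simp add: L2_mu)
 have norm_lift: "f \<in> L2 nu ==> L2_norm (mu d) (lift f) = nrm f" for f
  using L2_norm_mu[OF L2_measurable[OF lL[of f]]] by simp
 have nS: "t >= 0 ==> f \<in> L2 nu ==> L2_norm (mu d) (S t (lift f)) = nrm (S' t f)" for t f
  using L2_norm_mu[OF L2_measurable[OF SL[of t f]]] unfolding S'_def[abs_def] by simp
 have C0: "C0_semigroup nu S'"
  unfolding C0_semigroup_def
 proof (intro conjI allI impI ballI)
  fix t :: real and f g a b assume t: "0 <= t" and f: "f \<in> L2 nu" and g: "g \<in> L2 nu"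
  have "lift (%z. a * f z + b * g z) = (%z. a * lift f z + b * lift g z)" by (auto simp: lift_def)
  then show "AE x in nu. S' t (%z. a * f z + b * g z) x = a * S' t f x + b * S' t g x"
   unfolding S'_def using AE_mu[OF m.S_lin[OF t lL[OF f] lL[OF g], of a b]] by simp
 next
  fix t :: real assume t: "0 <= t"
  obtain K where K: "!!f. f \<in> L2 (mu d) ==> L2_norm (mu d) (S t f) <= K * L2_norm (mu d) f"
   using m.S_bounded[OF t] by auto
  then show "EX K. \<forall>f\<in>L2 nu. nrm (S' t f) <= K * nrm f"
   by (intro exI[of _ K] ballI) (simp add: nS[OF t, symmetric] norm_lift[symmetric] lL)
 next
  fix f assume f: "f \<in> L2 nu"
  show "AE x in nu. S' 0 f x = f x" using AE_mu[OF m.S_zero[OF lL[OF f]]] by (simp add: S'_def)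
 next
  fix s t :: real and f assume st: "0 <= s" "0 <= t" and f: "f \<in> L2 nu"
  \<comment> \<open>\<open>chart\<close> never takes the value \<open>-1\<close>, so lifting
    \<open>S' t f\<close> recovers \<open>S t (lift f)\<close> only off that null point. The outer
    operator must therefore respect equality almost everywhere.\<close>
  have "AE x in mu d. S s (lift (S' t f)) x = S s (S t (lift f)) x"
   using lift_chart_AE[of "S t (lift f)"]
   by (intro m.S_cong st SL f lL S'L) (simp add: S'_def[abs_def])
  then have "AE x in mu d. S (s + t) (lift f) x = S s (lift (S' t f)) x"
   using m.S_plus[OF st lL[OF f]] by eventually_elim simp
  then show "AE x in nu. S' (s + t) f x = S' s (S' t f) x"
   unfolding S'_def[of "s + t"] S'_def[of s] by (rule AE_mu)
 next
  fix f assume f: "f \<in> L2 nu"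
  have "\<forall>\<^sub>F t in at_right 0. L2_norm (mu d) (%x. S t (lift f) x - lift f x) = nrm (%x. S' t f x - f x)"
   using eventually_at_right_less[of "0::real"]
  proof eventually_elim
   case (elim t)
   then show ?case using L2_norm_mu[OF L2_measurable[OF L2_diff[OF SL[of t f] lL[OF f]]]] f by (simp add: S'_def)
  qed
  then show "((%t. nrm (%x. S' t f x - f x)) \<longlongrightarrow> 0) (at_right 0)"
   using m.S_cont0[OF lL[OF f]] by (rule Lim_transform_eventually[rotated])
 qed (fact S'L)
 have gen: "generator nu S' f h \<longleftrightarrow> generator (mu d) S (lift f) (lift h)" for f h
 proof -
  have "((%t. nrm (%x. (S' t f x - f x) / t - h x)) \<longlongrightarrow> 0) (at_right 0) \<longleftrightarrow>
   ((%t. L2_norm (mu d) (%x. (S t (lift f) x - lift f x) / t - lift h x)) \<longlongrightarrow> 0) (at_right 0)"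
   if f: "f \<in> L2 nu" and h: "h \<in> L2 nu"
  proof (rule tendsto_cong)
   show "\<forall>\<^sub>F t in at_right 0. nrm (%x. (S' t f x - f x) / t - h x)
     = L2_norm (mu d) (%x. (S t (lift f) x - lift f x) / t - lift h x)"
    using eventually_at_right_less[of "0::real"]
   proof eventually_elim
    case (elim t)
    have "(%x. (S t (lift f) x - lift f x) / t - lift h x) \<in> L2 (mu d)"
     using elim by (intro L2_intros SL lL f h) auto
    from L2_norm_mu[OF L2_measurable[OF this]] show ?case by (simp add: S'_def)
   qed
  qed
  then show ?thesis unfolding generator_def by (auto simp: lift_L2)
 qed
 have ES': "exp_semigroup nu LR S'"
  unfolding exp_semigroup_def
 proof (intro conjI allI C0)
  fix f h
  have "LR f h \<longleftrightarrow> generator (mu d) S (lift f) (%x. - lift h x)"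
   unfolding operator_transfer using ES unfolding exp_semigroup_def by simp
  also have "(%x. - lift h x) = lift (%x. - h x)" by (auto simp: lift_def)
  finally show "LR f h \<longleftrightarrow> generator nu S' f (%x. - h x)" unfolding gen .
 qed
 have cont: "continuous_on UNIV (%(s, r). T t (chart s) (chart r))" if "t > 0" for t
  using ker(2)[OF that] unfolding continuous_kernel_def by simp
 have ik: "integral_kernel nu (S' t) (%s r. T t (chart s) (chart r))" if t: "t > 0" for t
  unfolding integral_kernel_def
 proof (intro conjI ballI)
  have e: "sets (nu \<Otimes>\<^sub>M nu) = sets (borel :: (real \<times> real) measure)"
   unfolding borel_prod[symmetric] by (intro sets_pair_measure_cong sets_nu)
  show "(%(s, r). T t (chart s) (chart r)) \<in> borel_measurable (nu \<Otimes>\<^sub>M nu)"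
   unfolding measurable_cong_sets[OF e refl] by (intro borel_measurable_continuous_onI cont t)
  fix f assume f: "f \<in> L2 nu"
  have "AE x in mu d. integrable (mu d) (%y. T t x y * lift f y) & S t (lift f) x = (LINT y|mu d. T t x y * lift f y)"
   using ker(1)[OF t] lL[OF f] unfolding integral_kernel_def by simp
  from AE_mu[OF this]
  show "AE s in nu. integrable nu (%r. T t (chart s) (chart r) * f r) &
    S' t f s = (LINT r|nu. T t (chart s) (chart r) * f r)"
  proof eventually_elim
   case (elim s)
   then have m: "(%y. T t (chart s) y * lift f y) \<in> borel_measurable (mu d)"
    by (intro borel_measurable_integrable) simp
   show ?case using elim integrable_mu[OF m] integral_mu[OF m] by (simp add: S'_def)
  qed
 qed
 have "heat_semigroup d S' (%t s r. T t (chart s) (chart r))"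
  by unfold_locales (use ES' ik cont in auto)
 then show thesis by (rule that)
qed

end

section \<open>Exponential supersolutions\<close>

lemma DERIV_If_0:
 fixes f g :: "real => real"
 assumes f: "!!s. s >= 0 ==> (DERIV f s :> f' s)"
  and g: "!!s. s <= 0 ==> (DERIV g s :> g' s)"
  and eq: "f 0 = g 0" "f' 0 = g' 0"
 shows "DERIV (%s. if s >= 0 then f s else g s) s :> (if s >= 0 then f' s else g' s)"
proof -
 let ?h = "%s. if s >= 0 then f s else g s"
 consider "s > 0" | "s < 0" | "s = 0" by linarith
 then show ?thesis
 proof cases
  case 1
  have "DERIV ?h s :> f' s"
   by (rule has_field_derivative_transform_within_open[OF f, of _ "{0<..}"]) (use 1 in auto)
  then show ?thesis using 1 by simp
 next
  case 2
  have "DERIV ?h s :> g' s"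
   by (rule has_field_derivative_transform_within_open[OF g, of _ "{..<0}"]) (use 2 in auto)
  then show ?thesis using 2 by simp
 next
  case 3
  have "(?h has_real_derivative f' 0) (at 0 within {0..})"
   by (rule has_field_derivative_transform_within[OF has_field_derivative_at_within[OF f] zero_less_one]) auto
  moreover have "(?h has_real_derivative f' 0) (at 0 within {..0})"
   unfolding eq(2)
   by (rule has_field_derivative_transform_within[OF has_field_derivative_at_within[OF g] zero_less_one]) (use eq in auto)
  ultimately have "(?h has_real_derivative f' 0) (at 0 within {0..} \<union> {..0})"
   unfolding has_field_derivative_iff by (rule Lim_Un)
  moreover have "{0..} \<union> {..0} = (UNIV :: real set)" by auto
  ultimately show ?thesis using 3 by simp
 qed
qed

text \<open>\<open>bow \<alpha>\<close> is a smooth substitute for \<open>\<alpha> \<bar>s\<bar>\<close> whose derivative is also bounded by \<open>\<alpha>\<^sup>2 \<bar>s\<bar>\<close>: near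
  the origin it compensates the drift \<open>(d - 1) / (1 + \<bar>s\<bar>)\<close>, which is not small there.\<close>

definition bow :: "real => real => real" where
 "bow \<alpha> s = sqrt (1 + (\<alpha> * s)^2)"

definition bow' :: "real => real => real" where
 "bow' \<alpha> s = \<alpha>^2 * s / bow \<alpha> s"

definition bow'' :: "real => real => real" where
 "bow'' \<alpha> s = \<alpha>^2 / bow \<alpha> s ^ 3"

lemma bow_ge_1: "bow \<alpha> s >= 1"
 by (simp add: bow_def)

lemma bow_sq: "(bow \<alpha> s)^2 = 1 + (\<alpha> * s)^2"
 by (simp add: bow_def)

lemma bow_ge: "\<bar>\<alpha> * s\<bar> <= bow \<alpha> s"
 unfolding bow_def by (rule real_le_rsqrt) simp

lemma bow_le: "bow \<alpha> s <= 1 + \<bar>\<alpha> * s\<bar>"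
 unfolding bow_def by (rule real_le_lsqrt) (auto simp: power2_sum)

lemma bow_0 [simp]: "bow \<alpha> 0 = 1" "bow' \<alpha> 0 = 0"
 by (simp_all add: bow_def bow'_def)

lemma bow_uminus [simp]: "bow \<alpha> (- s) = bow \<alpha> s"
 by (simp add: bow_def)

lemma DERIV_bow: "DERIV (bow \<alpha>) s :> bow' \<alpha> s"
proof -
 have "1 + (\<alpha> * s)^2 > 0" by (smt (verit) zero_le_power2)
 then show ?thesis unfolding bow_def[abs_def] bow'_def
  by (auto intro!: derivative_eq_intros simp: bow_def field_simps power2_eq_square)
qed

lemma DERIV_bow': "DERIV (bow' \<alpha>) s :> bow'' \<alpha> s"
proof -
 have b: "bow \<alpha> s > 0" using bow_ge_1[of \<alpha> s] by linarith
 have "DERIV (bow' \<alpha>) s :> (\<alpha>^2 * bow \<alpha> s - \<alpha>^2 * s * bow' \<alpha> s) / (bow \<alpha> s * bow \<alpha> s)"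
  using DERIV_divide[OF DERIV_cmult_Id[of "\<alpha>^2" s] DERIV_bow[of \<alpha> s]] b unfolding bow'_def[abs_def] by simp
 moreover have "(\<alpha>^2 * bow \<alpha> s - \<alpha>^2 * s * bow' \<alpha> s) / (bow \<alpha> s * bow \<alpha> s) = bow'' \<alpha> s"
 proof -
  have "\<alpha>^2 * bow \<alpha> s - \<alpha>^2 * s * bow' \<alpha> s = \<alpha>^2 * ((bow \<alpha> s)^2 - (\<alpha> * s)^2) / bow \<alpha> s"
   using b by (simp add: bow'_def field_simps power2_eq_square)
  also have "... = \<alpha>^2 / bow \<alpha> s" by (simp add: bow_sq)
  finally show ?thesis using b by (simp add: bow''_def power3_eq_cube)
 qed
 ultimately show ?thesis by simp
qed

lemma bow'_bounds: "\<bar>bow' \<alpha> s\<bar> <= \<bar>\<alpha>\<bar>" "\<bar>bow' \<alpha> s\<bar> <= \<alpha>^2 * abs s"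
proof -
 have b: "bow \<alpha> s > 0" using bow_ge_1[of \<alpha> s] by linarith
 have "\<bar>bow' \<alpha> s\<bar> = \<bar>\<alpha>\<bar> * \<bar>\<alpha> * s\<bar> / bow \<alpha> s"
  using b by (simp add: bow'_def abs_mult power2_eq_square)
 also have "... <= \<bar>\<alpha>\<bar> * bow \<alpha> s / bow \<alpha> s"
  using b bow_ge[of \<alpha> s] by (intro divide_right_mono mult_left_mono) auto
 finally show "\<bar>bow' \<alpha> s\<bar> <= \<bar>\<alpha>\<bar>" using b by simp
 have "\<bar>bow' \<alpha> s\<bar> = \<alpha>^2 * abs s / bow \<alpha> s" using b by (simp add: bow'_def abs_mult)
 also have "... <= \<alpha>^2 * abs s / 1" using bow_ge_1 b by (intro divide_left_mono) auto
 finally show "\<bar>bow' \<alpha> s\<bar> <= \<alpha>^2 * abs s" by simp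
qed

lemma bow'_sgn: "0 <= s * bow' \<alpha> s"
proof -
 have "s * bow' \<alpha> s = (\<alpha> * s)^2 / bow \<alpha> s" by (simp add: bow'_def power2_eq_square)
 then show ?thesis using bow_ge_1[of \<alpha> s] by simp
qed

lemma bow''_bounds: "0 <= bow'' \<alpha> s" "bow'' \<alpha> s <= \<alpha>^2"
proof -
 have b: "bow \<alpha> s ^ 3 >= 1" using bow_ge_1 by (rule one_le_power)
 have p: "bow \<alpha> s > 0" using bow_ge_1[of \<alpha> s] by linarith
 then show "0 <= bow'' \<alpha> s" unfolding bow''_def using bow_ge_1[of \<alpha> s]
  by (intro divide_nonneg_nonneg[OF zero_le_power2 zero_le_power]) auto
 have "\<alpha>^2 / bow \<alpha> s ^ 3 <= \<alpha>^2 / 1" using b p by (intro divide_left_mono) auto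
 then show "bow'' \<alpha> s <= \<alpha>^2" by (simp add: bow''_def)
qed

lemma continuous_on_bow [continuous_intros]: "continuous_on A (bow \<alpha>)" "continuous_on A (bow' \<alpha>)" "continuous_on A (bow'' \<alpha>)"
proof -
 have "bow \<alpha> s ~= 0" for s using bow_ge_1[of \<alpha> s] by linarith
 then show "continuous_on A (bow \<alpha>)" "continuous_on A (bow' \<alpha>)" "continuous_on A (bow'' \<alpha>)"
  unfolding bow''_def bow'_def
  by (auto intro!: continuous_intros continuous_at_imp_continuous_on DERIV_isCont[OF DERIV_bow])
qed

context bessel
begin

text \<open>Since \<open>h'' = - drift * h'\<close>, the second derivative of \<open>h\<close> and
  its drift term cancel. What remains is linear in \<open>h\<close> and \<open>h'\<close>, which
  lets the cases \<open>h = 1\<close> and \<open>h = hm\<close> be treated alike.\<close>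

lemma domA_exp:
 assumes h: "!!s. (DERIV h s :> h' s)" "!!s. s ~= 0 ==> (DERIV h' s :> - drift s * h' s)"
   "cont h'" "!!s. abs (h s) <= 1" "!!s. abs (h' s) <= H"
  and \<phi>: "!!s. (DERIV \<phi> s :> \<phi>' s)" "!!s. s ~= 0 ==> (DERIV \<phi>' s :> \<phi>'' s)"
   "cont \<phi>'" "\<phi>'' \<in> borel_measurable borel" "!!s. \<bar>\<phi>' s\<bar> <= H" "!!s. \<bar>\<phi>'' s\<bar> <= H"
   "\<kappa> > 0" "!!s. exp (\<phi> s) <= C * exp (- \<kappa> * abs s)"
 shows "EX g'. domA (%s. h s * exp (\<phi> s)) g'
   (%s. - exp (\<phi> s) * (2 * h' s * \<phi>' s + h s * (\<phi>'' s + (\<phi>' s)^2 + drift s * \<phi>' s)))"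
proof -
 let ?g = "%s. h s * exp (\<phi> s)" and ?g' = "%s. (h' s + h s * \<phi>' s) * exp (\<phi> s)"
 let ?a = "%s. - drift s * h' s + 2 * h' s * \<phi>' s + h s * \<phi>'' s + h s * (\<phi>' s)^2"
 have H: "0 <= H" using h(5)[of 0] by linarith
 have ch: "cont h" "cont \<phi>"
  using h \<phi> by (auto intro!: continuous_at_imp_continuous_on DERIV_isCont)
 have de: "DERIV (%s. exp (\<phi> s)) s :> exp (\<phi> s) * \<phi>' s" for s
  by (rule DERIV_chain2[OF DERIV_exp \<phi>(1)])
 have d1: "DERIV ?g s :> ?g' s" for s
  using DERIV_mult[OF h(1) de] by (simp add: algebra_simps)
 have d2: "DERIV ?g' s :> ?a s * exp (\<phi> s)" if "s ~= 0" for s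
  using DERIV_mult[OF DERIV_add[OF h(2)[OF that] DERIV_mult[OF h(1) \<phi>(2)[OF that]]] de]
  by (simp add: algebra_simps power2_eq_square)
 have m: "meas h" "meas h'" "\<phi> \<in> borel_measurable borel" "\<phi>' \<in> borel_measurable borel"
  by (auto intro: borel_measurable_continuous_onI ch h \<phi>)
 define B where "B = 1 + H + H + (d - 1) * H + 2 * H * H + H + H^2"
 have p1: "abs (h s * v) <= abs v" for s v
  unfolding abs_mult using mult_right_mono[OF h(4)[of s], of "abs v"] by simp
 have a: "abs (?a s) <= (d - 1) * H + 2 * H * H + H + H^2" for s
 proof -
  have "abs (drift s * h' s) <= (d - 1) * H" unfolding abs_mult using abs_drift_le_const h(5) d by (intro mult_mono) auto
  moreover have "\<bar>h' s * \<phi>' s\<bar> <= H * H" unfolding abs_mult using h(5) \<phi>(5) H by (intro mult_mono) auto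
  moreover have "\<bar>h s * \<phi>'' s\<bar> <= H" using p1[of s "\<phi>'' s"] \<phi>(6)[of s] by linarith
  moreover have "\<bar>h s * (\<phi>' s)^2\<bar> <= H^2" using p1[of s "(\<phi>' s)^2"] power_mono[OF \<phi>(5)[of s], of 2] by simp
  ultimately show ?thesis by (simp add: abs_le_iff)
 qed
 have b: "\<bar>v * exp (\<phi> s)\<bar> <= (B * C) * exp (- \<kappa> * abs s)" if "abs v <= B" for v s
 proof -
  have "abs v * exp (\<phi> s) <= B * (C * exp (- \<kappa> * abs s))" using that \<phi>(8) by (intro mult_mono) auto
  then show ?thesis by (simp add: abs_mult mult.assoc)
 qed
 have HB: "0 <= (d - 1) * H" "0 <= 2 * H * H" "0 <= H^2" using H d by auto
 have "domA ?g ?g' (%s. - (?a s * exp (\<phi> s) + drift s * ?g' s))"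
 proof (rule domA_I[OF d1 d2 _ _ \<phi>(7), of "B * C"])
  show "cont ?g'" by (intro continuous_intros ch h \<phi>)
  show "meas (%s. ?a s * exp (\<phi> s))" using m \<phi>(4) by measurable
  fix s
  show "abs (?g s) <= (B * C) * exp (- \<kappa> * abs s)"
   using h(4)[of s] H HB unfolding B_def by (intro b[unfolded B_def]) linarith
  have "\<bar>h' s + h s * \<phi>' s\<bar> <= H + H" using p1[of s "\<phi>' s"] h(5)[of s] \<phi>(5)[of s] by linarith
  then show "abs (?g' s) <= (B * C) * exp (- \<kappa> * abs s)"
   using H HB unfolding B_def by (intro b[unfolded B_def]) linarith
  show "\<bar>?a s * exp (\<phi> s)\<bar> <= (B * C) * exp (- \<kappa> * abs s)"
   using a[of s] H HB unfolding B_def by (intro b[unfolded B_def]) linarith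
 qed
 moreover have "(%s. - (?a s * exp (\<phi> s) + drift s * ?g' s))
   = (%s. - exp (\<phi> s) * (2 * h' s * \<phi>' s + h s * (\<phi>'' s + (\<phi>' s)^2 + drift s * \<phi>' s)))"
  by (auto simp: algebra_simps)
 ultimately show ?thesis by auto
qed

text \<open>\<open>hm x\<close> is the probability that the diffusion from \<open>x\<close> ends up at \<open>-\<infinity>\<close>.\<close>

definition hm :: "real => real" where
 "hm s = (if s >= 0 then (1 + abs s) powr (2 - d) / 2 else 1 - (1 + abs s) powr (2 - d) / 2)"

text \<open>The power is the reciprocal of \<open>w\<close>, so the flux \<open>w * hm'\<close> is
  constant; that is harmonicity. The formula is the same on both sides, which makes
  \<open>hm\<close> continuously differentiable at the gluing point.\<close>

definition hm' :: "real => real" where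
 "hm' s = - ((d - 2) / 2 * (1 + abs s) powr (1 - d))"

lemma powr_le_1: "0 < (1 + abs s) powr (2 - d)" "(1 + abs s) powr (2 - d) <= 1"
proof -
 show "0 < (1 + abs s) powr (2 - d)" by (simp add: powr_gt_zero add_pos_nonneg[THEN less_imp_neq, symmetric])
 have "(1 + abs s) powr (2 - d) <= (1 + abs s) powr 0" using d by (intro powr_mono) auto
 then show "(1 + abs s) powr (2 - d) <= 1" by (simp add: add_pos_nonneg[THEN less_imp_neq, symmetric])
qed

lemma DERIV_hm: "DERIV hm s :> hm' s"
proof -
 have pos: "DERIV (%s. (1 + s) powr (2 - d) / 2) s :> - ((d - 2) / 2 * (1 + s) powr (1 - d))" if "s >= 0" for s
  using that by (auto intro!: derivative_eq_intros simp: field_simps)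
 have neg: "DERIV (%s. 1 - (1 - s) powr (2 - d) / 2) s :> - ((d - 2) / 2 * (1 - s) powr (1 - d))" if "s <= 0" for s
  using that by (auto intro!: derivative_eq_intros simp: field_simps)
 have "(%s. if s >= 0 then (1 + s) powr (2 - d) / 2 else 1 - (1 - s) powr (2 - d) / 2) = hm"
  by (auto simp: hm_def)
 moreover have "(if s >= 0 then - ((d - 2) / 2 * (1 + s) powr (1 - d)) else - ((d - 2) / 2 * (1 - s) powr (1 - d))) = hm' s"
  by (simp add: hm'_def)
 ultimately show ?thesis using DERIV_If_0[OF pos neg, of s] by simp
qed

lemma DERIV_hm': "s ~= 0 ==> (DERIV hm' s :> - drift s * hm' s)"
proof -
 assume s: "s ~= 0"
 have "DERIV (%s. 1 + abs s) s :> sgn s" using DERIV_add[OF DERIV_const DERIV_abs_real[OF s], of 1] by simp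
 then have "DERIV (%s. (1 + abs s) powr (1 - d)) s :> ((1 - d) * (1 + abs s) powr (1 - d - 1)) * sgn s"
  by (intro DERIV_chain2[where f = "%x. x powr (1 - d)"] has_real_derivative_powr) auto
 from DERIV_cmult[OF this, of "- ((d - 2) / 2)"]
 have "DERIV hm' s :> - ((d - 2) / 2) * (((1 - d) * (1 + abs s) powr (1 - d - 1)) * sgn s)"
  by (simp add: hm'_def[abs_def])
 moreover have "(1 + abs s) powr (1 - d - 1) = (1 + abs s) powr (1 - d) / (1 + abs s)"
  by (subst powr_diff) (simp add: add_pos_nonneg[THEN less_imp_neq, symmetric])
 moreover have "- a * ((- b * (p / q)) * \<sigma>) = - (b * \<sigma> / q) * - (a * p)" for a b p q \<sigma> :: real
  by simp
 from this[of "(d - 2) / 2" "d - 1"]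
 have "- ((d - 2) / 2) * (((1 - d) * (p / q)) * \<sigma>) = - ((d - 1) * \<sigma> / q) * - ((d - 2) / 2 * p)" for p q \<sigma> :: real
  unfolding minus_diff_eq .
 ultimately show ?thesis by (simp only: drift_def hm'_def)
qed

lemma hm_pos: "0 < hm s" and hm_le_1: "hm s <= 1"
 using powr_le_1[of s] by (auto simp: hm_def)

lemma hm_ge_half: "s < 0 ==> 1 / 2 <= hm s"
 using powr_le_1[of s] by (auto simp: hm_def)

lemma continuous_on_hm [continuous_intros]: "continuous_on A hm" "continuous_on A hm'"
proof -
 show "continuous_on A hm" by (intro continuous_at_imp_continuous_on ballI DERIV_isCont[OF DERIV_hm])
 show "continuous_on A hm'" unfolding hm'_def by (intro continuous_intros) auto
qed

text \<open>The logarithmic derivative of \<open>hm\<close> decays as the drift does, so the cross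
  term with \<open>\<phi>'\<close> costs no more than the drift term.\<close>

lemma abs_hm': "abs (hm' s) <= (d - 2) * hm s / (1 + abs s)"
proof -
 have X: "1 + abs s > 0" by linarith
 have "(1 + abs s) powr (1 - d) = (1 + abs s) powr (2 - d - 1)" by (simp add: algebra_simps)
 also have "... = (1 + abs s) powr (2 - d) / (1 + abs s)" using X by (subst powr_diff) simp
 finally have "abs (hm' s) = (d - 2) * ((1 + abs s) powr (2 - d) / 2) / (1 + abs s)"
  using d by (simp add: hm'_def abs_mult)
 also have "... <= (d - 2) * hm s / (1 + abs s)"
  using d X powr_le_1[of s] by (intro divide_right_mono mult_left_mono) (auto simp: hm_def)
 finally show ?thesis .
qed

text \<open>The bounded expression is \<open>exp (- \<phi>)\<close> times the generator applied to \<open>h * exp \<phi>\<close>.\<close>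

lemma gen_bound:
 assumes h: "0 <= h" "abs h' <= (d - 2) * h / (1 + abs s)" and a: "0 <= a" "\<bar>\<phi>'\<bar> <= a * abs s" "\<phi>'^2 <= a"
 shows "\<phi>'' <= a ==> 2 * h' * \<phi>' + h * (\<phi>'' + \<phi>'^2 + drift s * \<phi>') <= 3 * (d - 1) * a * h"
  and "- a <= \<phi>'' ==> - (3 * (d - 1) * a * h) <= 2 * h' * \<phi>' + h * (\<phi>'' + \<phi>'^2 + drift s * \<phi>')"
proof -
 have X: "1 + abs s > 0" by linarith
 have q: "abs s / (1 + abs s) <= 1" using X by simp
 have "\<bar>h' * \<phi>'\<bar> <= ((d - 2) * h / (1 + abs s)) * (a * abs s)"
  unfolding abs_mult using h a d X by (intro mult_mono) auto
 also have "... = ((d - 2) * h * a) * (abs s / (1 + abs s))" by simp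
 also have "... <= ((d - 2) * h * a) * 1" using q h a d by (intro mult_left_mono) auto
 finally have 1: "\<bar>h' * \<phi>'\<bar> <= (d - 2) * (a * h)" by (simp add: mult_ac)
 have "\<bar>drift s * \<phi>'\<bar> <= ((d - 1) / (1 + abs s)) * (a * abs s)"
  unfolding abs_mult using abs_drift_le[of s] a d X by (intro mult_mono) auto
 also have "... = ((d - 1) * a) * (abs s / (1 + abs s))" by simp
 also have "... <= ((d - 1) * a) * 1" using q a d by (intro mult_left_mono) auto
 finally have 2: "\<bar>drift s * \<phi>'\<bar> <= (d - 1) * a" by simp
 have p: "0 <= (d - 2) * (a * h)" "0 <= a * h" using h a d by auto
 show "2 * h' * \<phi>' + h * (\<phi>'' + \<phi>'^2 + drift s * \<phi>') <= 3 * (d - 1) * a * h" if "\<phi>'' <= a"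
 proof -
  have "h * (\<phi>'' + \<phi>'^2 + drift s * \<phi>') <= h * (a + a + (d - 1) * a)"
   using that a 2 h by (intro mult_left_mono) linarith+
  then have "2 * h' * \<phi>' + h * (\<phi>'' + \<phi>'^2 + drift s * \<phi>') <= 2 * ((d - 2) * (a * h)) + h * (a + a + (d - 1) * a)"
   using 1 by (simp add: mult.assoc)
  also have "... = 3 * (d - 1) * a * h" by (simp add: algebra_simps)
  finally show ?thesis .
 qed
 show "- (3 * (d - 1) * a * h) <= 2 * h' * \<phi>' + h * (\<phi>'' + \<phi>'^2 + drift s * \<phi>')" if "- a <= \<phi>''"
 proof -
  have "h * (- a - (d - 1) * a) <= h * (\<phi>'' + \<phi>'^2 + drift s * \<phi>')"
  proof (rule mult_left_mono[OF _ h(1)])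
   have "0 <= \<phi>'^2" by simp
   then show "- a - (d - 1) * a <= \<phi>'' + \<phi>'^2 + drift s * \<phi>'" using that 2 by linarith
  qed
  then have "- (2 * ((d - 2) * (a * h))) + h * (- a - (d - 1) * a) <= 2 * h' * \<phi>' + h * (\<phi>'' + \<phi>'^2 + drift s * \<phi>')"
   using 1 by (simp add: mult.assoc)
  moreover have "- (3 * (d - 1) * a * h) = - (2 * ((d - 2) * (a * h))) + h * (- a - (d - 1) * a) - a * h"
   by (simp add: algebra_simps)
  ultimately show ?thesis using p by linarith
 qed
qed

end

section \<open>Reflection of the line\<close>

context bessel
begin

lemma w_uminus [simp]: "w (- s) = w s"
 by (simp add: w_def)

lemma bow'_sq: "(bow' \<alpha> s)^2 <= \<alpha>^2"
 using power_mono[OF bow'_bounds(1)[of \<alpha> s] abs_ge_zero, of 2] by simp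

lemma distr_nu_uminus: "distr nu borel uminus = nu"
proof -
 have "distr nu borel uminus = density (distr lborel borel uminus) (%s. ennreal (w s))"
  unfolding nu_def
  by (subst density_distr) auto
 then show ?thesis by (simp add: lborel_distr_uminus nu_def)
qed

lemma integrable_nu_uminus:
 fixes f :: "real => real"
 shows "meas f ==> integrable nu (%s. f (- s)) \<longleftrightarrow> integrable nu f"
 using integrable_distr_eq[of uminus nu borel f] by (simp add: distr_nu_uminus)

lemma integral_nu_uminus:
 fixes f :: "real => real"
 shows "meas f ==> (LINT s|nu. f (- s)) = (LINT s|nu. f s)"
 using integral_distr[of uminus nu borel f] by (simp add: distr_nu_uminus)

lemma L2_nu_uminus:
 assumes "f \<in> L2 nu"
 shows "(%s. f (- s)) \<in> L2 nu"
proof -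
 have f: "meas f" "integrable nu (%s. (f s)^2)" using assms by (auto simp: L2_def)
 then have "integrable nu (%s. (f (- s))^2)" by (subst integrable_nu_uminus) auto
 with f(1) show ?thesis by (auto simp: L2_def)
qed

lemma L2_inner_uminus:
 assumes "f \<in> L2 nu" "g \<in> L2 nu"
 shows "ip (%s. f (- s)) g = ip f (%s. g (- s))"
proof -
 have [measurable]: "meas f" "meas g" using assms by (auto simp: L2_def)
 have "meas (%s. f s * g (- s))" by measurable
 from integral_nu_uminus[OF this] show ?thesis by (simp add: L2_inner_def)
qed

lemma domA_uminus:
 assumes "domA g g' q"
 shows "domA (%s. g (- s)) (%s. - g' (- s)) (%s. q (- s))"
proof -
 have D: "!!s. (DERIV g s :> g' s)" "cont g'"
   "!!s. s ~= 0 ==> (DERIV (%s. w s * g' s) s :> - (w s * q s))"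
   "g \<in> L2 nu" "g' \<in> L2 nu" "q \<in> L2 nu" using assms unfolding domA_def by auto
 have m: "DERIV uminus s :> -1" for s :: real by (auto intro!: derivative_eq_intros)
 show ?thesis unfolding domA_def
 proof (intro conjI allI impI)
  fix s :: real
  show "DERIV (%s. g (- s)) s :> - g' (- s)" using DERIV_chain2[OF D(1) m] by simp
  assume "s ~= 0"
  then have "DERIV (%s. w (- s) * g' (- s)) s :> - (w (- s) * q (- s)) * (- 1)"
   by (intro DERIV_chain2[where f = "%s. w s * g' s", OF D(3) m]) auto
  from DERIV_minus[OF this] show "DERIV (%s. w s * - g' (- s)) s :> - (w s * q (- s))"
   by simp
 next
  show "cont (%s. - g' (- s))"
   by (intro continuous_intros continuous_on_compose2[OF D(2)]) auto
  show "(%s. - g' (- s)) \<in> L2 nu" by (rule L2_uminus[OF L2_nu_uminus[OF D(5)]])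
 qed (auto intro: L2_nu_uminus D)
qed

end

section \<open>Exponential moments by comparison\<close>

context heat_kernel
begin

lemma k_measurable [measurable]: "t > 0 ==> k t x \<in> borel_measurable borel"
 using k_cont by (intro borel_measurable_continuous_onI)

lemma heat_kernel_uminus: "heat_kernel d (%t x y. k t (- x) (- y))"
proof (unfold_locales, goal_cases)
 case (1 t x) show ?case by (intro continuous_on_compose2[OF k_cont[OF 1]] continuous_intros) auto
next
 case (2 t x y) then show ?case by (rule k_nonneg)
next
 case (3 t x y) then show ?case by (rule k_sym)
next
 case (4 t x) then show ?case by (intro L2_nu_uminus k_L2)
next
 case (5 t s x y) then show ?case
  by (subst k_semi) (auto simp: L2_inner_uminus k_L2 L2_nu_uminus)
next
 case (6 t x) then show ?case using k_diag[of t "- x"] by simp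
next
 case (7 s t x) then show ?case by (rule k_diag_mono)
next
 case (8 t x y m)
 have "m <= w s" if "s \<in> {- y..- x}" for s using 8(4)[of "- s"] that by simp
 from k_holder[OF 8(1) _ 8(3) this, of "- y" "- x"] 8(2)
 have "(nrm (%z. k t (- x) z - k t (- y) z))^2 * m <= (y - x) / (2 * t)" by auto
 moreover have "nrm (%z. k t (- y) (- z) - k t (- x) (- z)) = nrm (%z. k t (- x) z - k t (- y) z)"
 proof -
  let ?f = "%z. k t (- y) z - k t (- x) z"
  have "?f \<in> L2 nu" using k_L2 8(1) by (intro L2_diff)
  then have "nrm (%z. ?f (- z)) = nrm ?f"
   unfolding L2_norm_def using L2_inner_uminus[of ?f "%z. ?f (- z)"] L2_nu_uminus[of ?f] by simp
  then show ?thesis using L2_norm_minus_commute[of nu "k t (- y)" "k t (- x)"] by simp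
 qed
 ultimately show ?case by simp
next
 case (9 g g' q t x)
 have g: "g \<in> L2 nu" "q \<in> L2 nu" using 9 by (auto simp: domA_def)
 have "DERIV (%t. ip (k t (- x)) (%s. g (- s))) t :> - ip (k t (- x)) (%s. q (- s))"
  by (rule k_deriv[OF domA_uminus[OF 9(1)] 9(2)])
 then have "DERIV (%t. ip (%y. k t (- x) (- y)) g) t :> - ip (k t (- x)) (%s. q (- s))"
  by (rule has_field_derivative_transform_within_open[where S = "{0<..}"])
    (use 9 g in \<open>auto simp: L2_inner_uminus k_L2\<close>)
 then show ?case using 9 g by (simp add: L2_inner_uminus k_L2)
next
 case (10 g g' q t K x)
 have "ip (k t (- x)) (%s. g (- s)) <= exp (K * t) * g (- (- x))"
  by (rule k_compare[OF domA_uminus[OF 10(1)] 10(2)]) (rule 10(3))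
 then show ?case using 10 by (simp add: L2_inner_uminus k_L2 domA_def)
qed

text \<open>A bound on the expectation of \<open>f\<close> under the diffusion started at
  \<open>x\<close>. Integrability is part of it, since otherwise an integral with the default value
  \<open>0\<close> would satisfy any nonnegative bound.\<close>

definition ebd :: "real => real => (real => real) => real => bool" where
 "ebd t x f B \<longleftrightarrow> f \<in> borel_measurable borel & integrable nu (%z. k t x z * f z) & (LINT z|nu. k t x z * f z) <= B"

lemma ebd_mono:
 assumes "ebd t x f B" "t > 0" "meas g" "!!z. 0 <= g z" "!!z. g z <= f z" "B <= B'"
 shows "ebd t x g B'"
proof -
 have [measurable]: "meas g" by fact
 have i: "integrable nu (%z. k t x z * f z)" using assms(1) by (simp add: ebd_def)
 have le: "k t x z * g z <= k t x z * f z" for z using assms k_nonneg by (intro mult_left_mono) auto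
 have j: "integrable nu (%z. k t x z * g z)"
 proof (rule Bochner_Integration.integrable_bound[OF i])
  show "(%z. k t x z * g z) \<in> borel_measurable nu" using assms(2) by measurable
  show "AE z in nu. norm (k t x z * g z) <= norm (k t x z * f z)"
  proof (rule AE_I2)
   fix z have "0 <= k t x z * g z" using assms k_nonneg by auto
   then show "norm (k t x z * g z) <= norm (k t x z * f z)" using le[of z] by simp
  qed
 qed
 have "(LINT z|nu. k t x z * g z) <= (LINT z|nu. k t x z * f z)" by (rule integral_mono[OF j i le])
 then show ?thesis using assms j by (auto simp: ebd_def)
qed

lemma ebd_add: "ebd t x f B ==> ebd t x g C ==> ebd t x (%z. f z + g z) (B + C)"
 by (auto simp: ebd_def ring_distribs)

lemma ebd_cmult: "ebd t x f B ==> 0 <= c ==> ebd t x (%z. c * f z) (c * B)"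
 by (auto simp: ebd_def mult.left_commute[of _ c] mult_left_mono)

lemma ebd_uminus:
 assumes "heat_kernel.ebd d (%t x y. k t (- x) (- y)) t x f B" "t > 0"
 shows "ebd t (- x) (%z. f (- z)) B"
proof -
 interpret R: heat_kernel d "%t x y. k t (- x) (- y)" by (rule heat_kernel_uminus)
 have [measurable]: "meas f" using assms(1) unfolding R.ebd_def by auto
 have m: "meas (%z. k t (- x) z * f (- z))" using assms(2) by measurable
 show ?thesis using assms(1) integrable_nu_uminus[OF m] integral_nu_uminus[OF m]
  unfolding R.ebd_def ebd_def by simp
qed

text \<open>Comparison with \<open>exp (- bow \<alpha> s)\<close>. The factor \<open>exp 1\<close>
  pays for replacing \<open>bow \<alpha>\<close>, which lies between \<open>\<alpha> * abs s\<close>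
  and \<open>1 + \<alpha> * abs s\<close>, by its asymptote.\<close>

lemma ebd_exp:
 assumes "\<alpha> > 0" "t > 0"
 shows "ebd t x (%z. exp (- \<alpha> * abs z)) (exp 1 * exp (3 * (d - 1) * \<alpha>^2 * t - \<alpha> * abs x))"
proof -
 let ?K = "3 * (d - 1) * \<alpha>^2"
 let ?\<phi> = "%s. - bow \<alpha> s"
 have "EX g'. domA (%s. 1 * exp (?\<phi> s)) g'
   (%s. - exp (?\<phi> s) * (2 * 0 * - bow' \<alpha> s + 1 * (- bow'' \<alpha> s + (- bow' \<alpha> s)^2 + drift s * - bow' \<alpha> s)))"
 proof (rule domA_exp[where H = "\<alpha> + \<alpha>^2" and \<kappa> = \<alpha> and C = 1])
  fix s
  show "DERIV (%s. - bow \<alpha> s) s :> - bow' \<alpha> s" by (intro DERIV_minus DERIV_bow)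
  show "DERIV (%s. - bow' \<alpha> s) s :> - bow'' \<alpha> s" by (intro DERIV_minus DERIV_bow')
  show "\<bar>- bow' \<alpha> s\<bar> <= \<alpha> + \<alpha>^2" "\<bar>- bow'' \<alpha> s\<bar> <= \<alpha> + \<alpha>^2"
   using bow'_bounds(1)[of \<alpha> s] bow''_bounds[of \<alpha> s] assms by auto
  show "exp (- bow \<alpha> s) <= 1 * exp (- \<alpha> * abs s)" using bow_ge[of \<alpha> s] assms by (simp add: abs_mult)
 qed (use assms in \<open>auto intro!: continuous_intros borel_measurable_continuous_onI\<close>)
 then obtain g' where g': "domA (%s. exp (?\<phi> s)) g'
   (%s. - exp (?\<phi> s) * (2 * 0 * - bow' \<alpha> s + 1 * (- bow'' \<alpha> s + (- bow' \<alpha> s)^2 + drift s * - bow' \<alpha> s)))" by auto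
 have "ip (k t x) (%s. exp (?\<phi> s)) <= exp (?K * t) * exp (?\<phi> x)"
 proof (rule k_compare[OF g' assms(2)])
  fix s
  have "(2 * 0 * - bow' \<alpha> s + 1 * (- bow'' \<alpha> s + (- bow' \<alpha> s)^2 + drift s * - bow' \<alpha> s)) <= 3 * (d - 1) * \<alpha>^2 * 1"
   by (rule gen_bound(1)) (use bow'_bounds[of \<alpha> s] bow''_bounds[of \<alpha> s] bow'_sq[of \<alpha> s] assms d in auto)
  from mult_left_mono[OF this, of "exp (?\<phi> s)"]
  show "0 <= - exp (?\<phi> s) * (2 * 0 * - bow' \<alpha> s + 1 * (- bow'' \<alpha> s + (- bow' \<alpha> s)^2 + drift s * - bow' \<alpha> s)) + ?K * exp (?\<phi> s)"
   by (simp add: algebra_simps)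
 qed
 moreover have "integrable nu (%z. k t x z * exp (?\<phi> z))"
  using g' k_L2[OF assms(2)] by (intro L2_mult_integrable) (auto simp: domA_def)
 ultimately have "ebd t x (%s. exp (?\<phi> s)) (exp (?K * t) * exp (?\<phi> x))"
  unfolding ebd_def L2_inner_def using continuous_on_bow(1)[of UNIV \<alpha>]
  by (auto intro!: borel_measurable_continuous_onI continuous_intros)
 from ebd_cmult[OF this, of "exp 1"] show ?thesis
 proof (rule ebd_mono[OF _ assms(2)])
  show "exp (- \<alpha> * abs z) <= exp 1 * exp (- bow \<alpha> z)" for z
   unfolding exp_add[symmetric] using bow_le[of \<alpha> z] assms by (simp add: abs_mult)
  show "exp 1 * (exp (?K * t) * exp (- bow \<alpha> x)) <= exp 1 * exp (?K * t - \<alpha> * abs x)"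
   unfolding exp_add[symmetric] using bow_ge[of \<alpha> x] assms by (simp add: abs_mult)
 qed auto
qed

text \<open>A continuously differentiable version of the signed exponent
  \<open>- \<alpha> * z\<close>: it rewards the left side and penalises the right, so it measures
  the true distance across the gluing point rather than a difference of moduli.\<close>

definition theta :: "real => real => real" where
 "theta \<alpha> z = (if z >= 0 then - (bow \<alpha> z - 1) else bow \<alpha> z - 1)"

text \<open>On the left \<open>theta\<close> is unbounded; it is approximated by exponents that turn round at the level \<open>R\<close>.\<close>

definition theta_R :: "real => real => real => real" where
 "theta_R R \<alpha> z = (if z >= 0 then - (bow \<alpha> z - 1) else bow 1 (1 - R) - bow 1 (bow \<alpha> z - R))"

lemma bow_ge_self: "x <= bow 1 x" "- x <= bow 1 x"
 using bow_ge[of 1 x] by auto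

lemma bow_1_mono: "bow 1 x <= bow 1 y + abs (x - y)"
proof -
 have "bow 1 x = sqrt (1^2 + x^2)" "bow 1 y = sqrt (1^2 + y^2)" by (simp_all add: bow_def)
 then show ?thesis using real_sqrt_sum_squares_triangle_ineq[of 1 0 y "x - y"] by simp
qed

lemma theta_R_le: "theta_R R \<alpha> z <= theta \<alpha> z"
 using bow_1_mono[of "1 - R" "bow \<alpha> z - R"] bow_1_mono[of "R - 1" "R - bow \<alpha> z"] bow_ge_1[of \<alpha> z]
 by (auto simp: theta_R_def theta_def)

lemma theta_R_tendsto: "(%n. theta_R (real n) \<alpha> z) \<longlonglongrightarrow> theta \<alpha> z"
proof (cases "z >= 0")
 case True then show ?thesis by (simp add: theta_R_def theta_def)
next
 case False
 have *: "(%n. bow 1 (a - real n) - (real n - a)) \<longlonglongrightarrow> 0" for a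
 proof (rule tendsto_sandwich[of "%_. 0"])
  have "bow 1 (a - real n) <= (real n - a) + 1 / (real n - a)" if "real n > a" for n
   unfolding bow_def
  proof (rule real_le_lsqrt)
   have "((real n - a) + 1 / (real n - a))^2 = (real n - a)^2 + 2 + (1 / (real n - a))^2"
    using that by (subst power2_sum) (simp add: field_simps)
   then show "1 + (1 * (a - real n))^2 <= ((real n - a) + 1 / (real n - a))^2"
    by (simp add: power2_commute[of a])
  qed (use that in auto)
  moreover have "\<forall>\<^sub>F n in sequentially. real n > a"
   using eventually_gt_at_top[of "nat \<lceil>a\<rceil>"] by eventually_elim linarith
  ultimately show "\<forall>\<^sub>F n in sequentially. bow 1 (a - real n) - (real n - a) <= 1 / (real n - a)"
   by (auto elim!: eventually_mono) (smt (verit))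
  show "\<forall>\<^sub>F n in sequentially. 0 <= bow 1 (a - real n) - (real n - a)"
   using bow_ge_self(2)[of "a - real _"] by (intro always_eventually) (auto simp: algebra_simps)
  have "filterlim (%n. - a + real n) at_top sequentially"
   by (rule filterlim_tendsto_add_at_top[OF tendsto_const filterlim_real_sequentially])
  then have "(%n. inverse (- a + real n)) \<longlonglongrightarrow> 0" by (rule tendsto_inverse_0_at_top)
  then show "(%n. 1 / (real n - a)) \<longlonglongrightarrow> 0" by (simp add: divide_inverse)
 qed simp
 have "(%n. (bow 1 (1 - real n) - (real n - 1)) - (bow 1 (bow \<alpha> z - real n) - (real n - bow \<alpha> z)) + (bow \<alpha> z - 1))
   \<longlonglongrightarrow> 0 - 0 + (bow \<alpha> z - 1)"
  by (intro tendsto_intros *)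
 then show ?thesis using False by (simp add: theta_R_def theta_def)
qed

text \<open>\<open>gen_bound\<close> asks for an upper bound on the second derivative of the
  exponent. The bend at the level \<open>R\<close> contributes a term of the favourable sign, so the
  rate does not depend on \<open>R\<close>, and Fatou's lemma removes the truncation.\<close>

lemma ebd_hm_theta:
 assumes "\<alpha> > 0" "t > 0"
 shows "ebd t x (%z. hm z * exp (theta \<alpha> z)) (exp (3 * (d - 1) * \<alpha>^2 * t) * (hm x * exp (theta \<alpha> x)))"
proof -
 let ?K = "3 * (d - 1) * \<alpha>^2"
 have R: "integrable nu (%z. k t x z * (hm z * exp (theta_R R \<alpha> z))) &
   (LINT z|nu. k t x z * (hm z * exp (theta_R R \<alpha> z))) <= exp (?K * t) * (hm x * exp (theta \<alpha> x))" for R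
 proof -
  let ?\<phi> = "theta_R R \<alpha>"
  let ?\<phi>1 = "%z. if z >= 0 then - bow' \<alpha> z else - (bow' 1 (bow \<alpha> z - R) * bow' \<alpha> z)"
  let ?\<phi>2 = "%z. if z >= 0 then - bow'' \<alpha> z else - (bow'' 1 (bow \<alpha> z - R) * (bow' \<alpha> z)^2 + bow' 1 (bow \<alpha> z - R) * bow'' \<alpha> z)"
  let ?q = "%s. 2 * hm' s * ?\<phi>1 s + hm s * (?\<phi>2 s + (?\<phi>1 s)^2 + drift s * ?\<phi>1 s)"
  have ch: "DERIV (%z. f (bow \<alpha> z - R)) z :> f' (bow \<alpha> z - R) * bow' \<alpha> z"
   if f: "!!s. (DERIV f s :> f' s)" for f f' z
   using DERIV_chain2[OF f DERIV_diff[OF DERIV_bow DERIV_const]] by simp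
  have d1: "DERIV ?\<phi> s :> ?\<phi>1 s" for s
   unfolding theta_R_def[abs_def]
  proof (rule DERIV_If_0)
   fix s
   show "DERIV (%s. - (bow \<alpha> s - 1)) s :> - bow' \<alpha> s"
    using DERIV_minus[OF DERIV_diff[OF DERIV_bow DERIV_const]] by simp
   show "DERIV (%z. bow 1 (1 - R) - bow 1 (bow \<alpha> z - R)) s :> - (bow' 1 (bow \<alpha> s - R) * bow' \<alpha> s)"
    using DERIV_diff[OF DERIV_const ch[OF DERIV_bow]] by simp
  qed auto
  have d2: "DERIV ?\<phi>1 s :> ?\<phi>2 s" if "s ~= 0" for s
  proof (cases "s > 0")
   case True
   have "DERIV ?\<phi>1 s :> - bow'' \<alpha> s"
    by (rule has_field_derivative_transform_within_open[OF DERIV_minus[OF DERIV_bow'], of "{0<..}"])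
      (use True in auto)
   then show ?thesis using True by simp
  next
   case False
   have "DERIV (%s. - (bow' 1 (bow \<alpha> s - R) * bow' \<alpha> s)) s :> ?\<phi>2 s"
    using DERIV_minus[OF DERIV_mult[OF ch[OF DERIV_bow'[of 1]] DERIV_bow'[of \<alpha>]]] False that
    by (auto simp: power2_eq_square algebra_simps)
   then show ?thesis
    by (rule has_field_derivative_transform_within_open[of _ _ _ "{..<0}"]) (use False that in auto)
  qed
  have b1: "\<bar>?\<phi>1 s\<bar> <= \<bar>bow' \<alpha> s\<bar>" for s
   using mult_right_mono[OF bow'_bounds(1)[of 1 "bow \<alpha> s - R"], of "\<bar>bow' \<alpha> s\<bar>"] by (simp add: abs_mult)
  have b2: "?\<phi>2 s <= \<alpha>^2" for s
  proof -
   have "\<bar>bow' 1 (bow \<alpha> s - R) * bow'' \<alpha> s\<bar> <= 1 * \<alpha>^2"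
    unfolding abs_mult using bow'_bounds(1)[of 1 "bow \<alpha> s - R"] bow''_bounds[of \<alpha> s] by (intro mult_mono) auto
   moreover have "0 <= bow'' 1 (bow \<alpha> s - R) * (bow' \<alpha> s)^2" using bow''_bounds by simp
   ultimately have "- (bow'' 1 (bow \<alpha> s - R) * (bow' \<alpha> s)^2 + bow' 1 (bow \<alpha> s - R) * bow'' \<alpha> s) <= \<alpha>^2" by linarith
   moreover have "- bow'' \<alpha> s <= \<alpha>^2" using bow''_bounds(1)[of \<alpha> s] zero_le_power2[of \<alpha>] by linarith
   ultimately show ?thesis by simp
  qed
  have b2': "\<bar>?\<phi>2 s\<bar> <= \<alpha>^2 + \<alpha>^2" for s
  proof -
   have "\<bar>bow' 1 (bow \<alpha> s - R) * bow'' \<alpha> s\<bar> <= 1 * \<alpha>^2"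
    unfolding abs_mult using bow'_bounds(1)[of 1 "bow \<alpha> s - R"] bow''_bounds[of \<alpha> s] by (intro mult_mono) auto
   moreover have "\<bar>bow'' 1 (bow \<alpha> s - R) * (bow' \<alpha> s)^2\<bar> <= 1 * \<alpha>^2"
    unfolding abs_mult using bow''_bounds[of 1 "bow \<alpha> s - R"] bow'_sq[of \<alpha> s] by (intro mult_mono) auto
   moreover have "\<bar>bow'' \<alpha> s\<bar> <= \<alpha>^2" using bow''_bounds[of \<alpha> s] by simp
   ultimately show ?thesis by (auto simp: abs_le_iff)
  qed
  have "EX g'. domA (%s. hm s * exp (?\<phi> s)) g' (%s. - exp (?\<phi> s) * ?q s)"
  proof (rule domA_exp[OF DERIV_hm DERIV_hm' _ _ _ d1 d2, where H = "(d - 2) + \<alpha> + 2 * \<alpha>^2" and \<kappa> = \<alpha>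
      and C = "exp (1 + bow 1 (1 - R) + abs R)"])
   fix s
   show "abs (hm s) <= 1" using hm_pos[of s] hm_le_1[of s] by simp
   have "(d - 2) * hm s / (1 + abs s) <= (d - 2) * 1 / 1"
    using hm_pos[of s] hm_le_1[of s] d by (intro frac_le mult_left_mono) auto
   then have "abs (hm' s) <= d - 2" using order_trans[OF abs_hm'[of s]] by simp
   then show "abs (hm' s) <= (d - 2) + \<alpha> + 2 * \<alpha>^2" 
    using assms zero_le_power2[of \<alpha>] by linarith
   show "\<bar>?\<phi>1 s\<bar> <= (d - 2) + \<alpha> + 2 * \<alpha>^2"
    using b1[of s] bow'_bounds(1)[of \<alpha> s] assms d zero_le_power2[of \<alpha>] by linarith
   show "\<bar>?\<phi>2 s\<bar> <= (d - 2) + \<alpha> + 2 * \<alpha>^2" using b2'[of s] assms d by linarith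
   have "?\<phi> s <= 1 + bow 1 (1 - R) + abs R - \<alpha> * abs s"
    using bow_ge[of \<alpha> s] bow_ge_self(1)[of "bow \<alpha> s - R"] bow_ge_1[of 1 "1 - R"] assms
    unfolding theta_R_def by (auto simp: abs_mult)
   then show "exp (?\<phi> s) <= exp (1 + bow 1 (1 - R) + abs R) * exp (- \<alpha> * abs s)" by (simp flip: exp_add)
  next
   have "cont (%z. if - z <= 0 then - bow' \<alpha> z else - (bow' 1 (bow \<alpha> z - R) * bow' \<alpha> z))"
    by (rule continuous_on_cases_le) (auto intro!: continuous_intros continuous_on_compose2[OF continuous_on_bow(2)[of UNIV]])
   then show c1: "cont ?\<phi>1" by simp
   have [measurable]: "bow \<alpha> \<in> borel_measurable borel" "bow' \<beta> \<in> borel_measurable borel" "bow'' \<beta> \<in> borel_measurable borel" for \<beta>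
    by (auto intro!: borel_measurable_continuous_onI continuous_intros)
   show "?\<phi>2 \<in> borel_measurable borel" by measurable
  qed (use assms in \<open>auto intro!: continuous_intros borel_measurable_continuous_onI\<close>)
  then obtain g' where g': "domA (%s. hm s * exp (?\<phi> s)) g' (%s. - exp (?\<phi> s) * ?q s)" by blast
  have "ip (k t x) (%s. hm s * exp (?\<phi> s)) <= exp (?K * t) * (hm x * exp (?\<phi> x))"
  proof (rule k_compare[OF g' assms(2)])
   fix s
   have "?q s <= 3 * (d - 1) * \<alpha>^2 * hm s"
   proof (rule gen_bound(1)[OF less_imp_le[OF hm_pos] abs_hm' _ _ _ b2])
    show "\<bar>?\<phi>1 s\<bar> <= \<alpha>^2 * abs s" using b1[of s] bow'_bounds(2)[of \<alpha> s] by linarith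
    show "(?\<phi>1 s)^2 <= \<alpha>^2"
     using power_mono[OF order_trans[OF b1[of s] bow'_bounds(1)[of \<alpha> s]] abs_ge_zero, of 2] by simp
   qed simp
   from mult_left_mono[OF this, of "exp (?\<phi> s)"]
   show "0 <= - exp (?\<phi> s) * ?q s + ?K * (hm s * exp (?\<phi> s))" by (simp add: mult_ac)
  qed
  also have "... <= exp (?K * t) * (hm x * exp (theta \<alpha> x))"
   using theta_R_le hm_pos[of x] by (intro mult_left_mono) auto
  finally have "ip (k t x) (%s. hm s * exp (?\<phi> s)) <= exp (?K * t) * (hm x * exp (theta \<alpha> x))" .
  moreover have "integrable nu (%z. k t x z * (hm z * exp (?\<phi> z)))"
   using g' k_L2[OF assms(2)] by (intro L2_mult_integrable) (auto simp: domA_def)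
  ultimately show ?thesis by (simp add: L2_inner_def)
 qed
 have m: "meas (%z. hm z * exp (theta \<alpha> z))"
 proof -
  have [measurable]: "meas hm" "bow \<alpha> \<in> borel_measurable borel"
   by (auto intro!: borel_measurable_continuous_onI continuous_intros)
  show ?thesis unfolding theta_def by measurable
 qed
 have f1: "integrable nu (%z. k t x z * (hm z * exp (theta_R (real n) \<alpha> z)))" for n
  by (rule conjunct1[OF R])
 have f2: "AE z in nu. 0 <= k t x z * (hm z * exp (theta_R (real n) \<alpha> z))" for n
  using k_nonneg[OF assms(2)] less_imp_le[OF hm_pos] by (intro AE_I2 mult_nonneg_nonneg) auto
 have f3: "(%z. k t x z * (hm z * exp (theta \<alpha> z))) \<in> borel_measurable nu" using m assms(2) by measurable
 have f4: "AE z in nu. (%n. k t x z * (hm z * exp (theta_R (real n) \<alpha> z))) \<longlonglongrightarrow> k t x z * (hm z * exp (theta \<alpha> z))"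
  by (intro AE_I2 tendsto_mult tendsto_const tendsto_exp theta_R_tendsto)
 have f5: "\<forall>\<^sub>F n in sequentially. (LINT z|nu. k t x z * (hm z * exp (theta_R (real n) \<alpha> z))) <= exp (?K * t) * (hm x * exp (theta \<alpha> x))"
  by (intro always_eventually allI conjunct2[OF R])
 note conjI[OF integral_Fatou[OF f1 f2 f3 f4 f5]]
 then show ?thesis using m by (simp add: ebd_def)
qed

end

section \<open>Moments and conservation\<close>

lemma (in bessel) domA_minus:
 assumes "domA g g' q"
 shows "domA (%s. - g s) (%s. - g' s) (%s. - q s)"
 unfolding domA_def
proof (intro conjI allI impI)
 have D: "!!s. (DERIV g s :> g' s)" "cont g'"
   "!!s. s ~= 0 ==> (DERIV (%s. w s * g' s) s :> - (w s * q s))"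
   "g \<in> L2 nu" "g' \<in> L2 nu" "q \<in> L2 nu" using assms unfolding domA_def by auto
 fix s :: real
 show "DERIV (%s. - g s) s :> - g' s" by (intro DERIV_minus D)
 show "DERIV (%s. w s * - g' s) s :> - (w s * - q s)" if "s ~= 0"
  using DERIV_minus[OF D(3)[OF that]] by simp
 show "cont (%s. - g' s)" by (intro continuous_intros D)
 show "(%s. - g s) \<in> L2 nu" "(%s. - g' s) \<in> L2 nu" "(%s. - q s) \<in> L2 nu" by (intro L2_uminus D)+
qed

context heat_kernel
begin

abbreviation "K0 == 3 * (d - 1)"

text \<open>On the left \<open>hm\<close> is at least \<open>1 / 2\<close>, so the weight
  \<open>hm z * exp (theta \<alpha> z)\<close> dominates the exponential there, and it is
  nonnegative on the right.\<close>

lemma ebd_exp_left_theta: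
 assumes "\<alpha> > 0" "t > 0"
 shows "ebd t x (%z. if z <= 0 then exp (\<alpha> * abs z) else 0) (2 * exp 1 * (exp (K0 * \<alpha>^2 * t) * (hm x * exp (theta \<alpha> x))))"
proof (rule ebd_mono[OF ebd_cmult[OF ebd_hm_theta[OF assms]] assms(2)])
 show "(if z <= 0 then exp (\<alpha> * abs z) else 0) <= 2 * exp 1 * (hm z * exp (theta \<alpha> z))" for z
 proof (cases "z <= 0")
  case True
  have "exp (\<alpha> * abs z) <= exp (1 + theta \<alpha> z)"
   using True bow_ge[of \<alpha> z] bow_ge_1[of \<alpha> z] assms by (cases "z = 0") (auto simp: theta_def abs_mult)
  also have "... = 2 * exp 1 * (1/2 * exp (theta \<alpha> z))" by (simp add: exp_add)
  also have "... <= 2 * exp 1 * (hm z * exp (theta \<alpha> z))"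
   using True hm_ge_half[of z] by (intro mult_left_mono mult_right_mono) (auto simp: hm_def)
  finally show ?thesis using True by simp
 next
  case False then show ?thesis using hm_pos[of z] by simp
 qed
qed auto

text \<open>For a start on the right, both gains come from the value of the supersolution at
  \<open>x\<close>: \<open>hm x\<close> is the price of crossing, and
  \<open>exp (theta \<alpha> x)\<close> accounts for the way to the gluing point.\<close>

lemma ebd_exp_left:
 assumes "\<alpha> > 0" "t > 0" "x >= 0"
 shows "ebd t x (%z. if z <= 0 then exp (\<alpha> * abs z) else 0) (exp 2 * (1 + abs x) powr (2 - d) * exp (K0 * \<alpha>^2 * t - \<alpha> * abs x))"
proof (rule ebd_mono[OF ebd_exp_left_theta[OF assms(1,2)] assms(2)])
 have "exp (theta \<alpha> x) <= exp (1 - \<alpha> * abs x)" using assms bow_ge[of \<alpha> x] by (simp add: theta_def abs_mult)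
 then have "2 * exp 1 * (exp (K0 * \<alpha>^2 * t) * (hm x * exp (theta \<alpha> x)))
   <= 2 * exp 1 * (exp (K0 * \<alpha>^2 * t) * (hm x * exp (1 - \<alpha> * abs x)))"
  using hm_pos[of x] by (intro mult_left_mono) auto
 also have "... = (exp 1 * exp 1) * (1 + abs x) powr (2 - d) * (exp (K0 * \<alpha>^2 * t) * exp (- \<alpha> * abs x))"
  using assms(3) by (simp add: hm_def exp_diff exp_minus field_simps)
 also have "... = exp 2 * (1 + abs x) powr (2 - d) * exp (K0 * \<alpha>^2 * t - \<alpha> * abs x)"
  unfolding exp_add[symmetric] by simp
 finally show "2 * exp 1 * (exp (K0 * \<alpha>^2 * t) * (hm x * exp (theta \<alpha> x)))
   <= exp 2 * (1 + abs x) powr (2 - d) * exp (K0 * \<alpha>^2 * t - \<alpha> * abs x)" .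
qed auto

lemma theta_le: "\<alpha> > 0 ==> theta \<alpha> x <= \<alpha> * abs x"
proof (cases "x >= 0")
 case True
 assume "\<alpha> > 0"
 then have "0 <= \<alpha> * abs x" by simp
 then show ?thesis using True bow_ge_1[of \<alpha> x] by (simp add: theta_def)
next
 case False
 assume "\<alpha> > 0"
 then have "bow \<alpha> x <= 1 + \<alpha> * abs x" using bow_le[of \<alpha> x] by (simp add: abs_mult)
 then show ?thesis using False by (simp add: theta_def)
qed

lemma ebd_exp_left':
 assumes "\<alpha> > 0" "t > 0"
 shows "ebd t x (%z. if z <= 0 then exp (\<alpha> * abs z) else 0) (2 * exp 1 * exp (K0 * \<alpha>^2 * t + \<alpha> * abs x))"
proof (rule ebd_mono[OF ebd_exp_left_theta[OF assms] assms(2)])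
 note theta_le[OF assms(1), of x]
 then have "hm x * exp (theta \<alpha> x) <= 1 * exp (\<alpha> * abs x)"
  using hm_pos[of x] hm_le_1[of x] by (intro mult_mono) auto
 then show "2 * exp 1 * (exp (K0 * \<alpha>^2 * t) * (hm x * exp (theta \<alpha> x))) <= 2 * exp 1 * exp (K0 * \<alpha>^2 * t + \<alpha> * abs x)"
  by (simp add: exp_add)
qed auto

lemma ebd_exp_pos:
 assumes "\<alpha> > 0" "t > 0"
 shows "ebd t x (%z. exp (\<alpha> * abs z)) (4 * exp 1 * exp (K0 * \<alpha>^2 * t + \<alpha> * abs x))"
proof -
 interpret R: heat_kernel d "%t x y. k t (- x) (- y)" by (rule heat_kernel_uminus)
 have "ebd t x (%z. if - z <= 0 then exp (\<alpha> * abs (- z)) else 0) (2 * exp 1 * exp (K0 * \<alpha>^2 * t + \<alpha> * abs (- x)))"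
  using ebd_uminus[OF R.ebd_exp_left'[OF assms, of "- x"] assms(2)] by simp
 from ebd_add[OF ebd_exp_left'[OF assms, of x] this] show ?thesis
  by (rule ebd_mono[OF _ assms(2)]) auto
qed

text \<open>The absolute value in the exponent is resolved by adding the two signs: growth of
  \<open>abs z\<close> is controlled by \<open>ebd_exp_pos\<close> and decrease by
  \<open>ebd_exp\<close>.\<close>

lemma ebd_exp_diff:
 assumes "\<alpha> > 0" "t > 0"
 shows "ebd t x (%z. exp (\<alpha> * abs (abs z - abs x))) (5 * exp 1 * exp (K0 * \<alpha>^2 * t))"
proof (rule ebd_mono[OF ebd_add[OF ebd_cmult[OF ebd_exp_pos[OF assms]] ebd_cmult[OF ebd_exp[OF assms]]] assms(2)])
 show "exp (\<alpha> * abs (abs z - abs x)) <= exp (- \<alpha> * abs x) * exp (\<alpha> * abs z) + exp (\<alpha> * abs x) * exp (- \<alpha> * abs z)" for z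
  unfolding exp_add[symmetric] by (cases "abs z >= abs x") (auto simp: algebra_simps)
 have "exp (- \<alpha> * abs x) * (4 * exp 1 * exp (K0 * \<alpha>^2 * t + \<alpha> * abs x)) + exp (\<alpha> * abs x) * (exp 1 * exp (K0 * \<alpha>^2 * t - \<alpha> * abs x))
   = 4 * exp 1 * exp (- \<alpha> * abs x + (K0 * \<alpha>^2 * t + \<alpha> * abs x)) + exp 1 * exp (\<alpha> * abs x + (K0 * \<alpha>^2 * t - \<alpha> * abs x))"
  unfolding exp_add by (simp add: mult_ac)
 then show "exp (- \<alpha> * abs x) * (4 * exp 1 * exp (K0 * \<alpha>^2 * t + \<alpha> * abs x)) + exp (\<alpha> * abs x) * (exp 1 * exp (K0 * \<alpha>^2 * t - \<alpha> * abs x))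
   <= 5 * exp 1 * exp (K0 * \<alpha>^2 * t)" by simp
qed auto

text \<open>\<open>h * exp (- e * bow 1 s)\<close> lies in the domain and is both a super- and a
  subsolution up to the rate \<open>K0 * e\<close>. As \<open>e\<close> tends to \<open>0\<close>
  both bounds tend to \<open>h x\<close>. A small coefficient in front of a fixed
  \<open>bow 1\<close> makes the functions increase to \<open>h\<close>, so monotone convergence
  applies.\<close>

lemma conservation:
 assumes h: "!!s. (DERIV h s :> h' s)" "!!s. s ~= 0 ==> (DERIV h' s :> - drift s * h' s)"
   "cont h'" "!!s. 0 <= h s" "!!s. h s <= 1" "!!s. abs (h' s) <= (d - 2) * h s / (1 + abs s)" and t: "t > 0"
 shows "integrable nu (%z. k t x z * h z)" "(LINT z|nu. k t x z * h z) = h x"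
proof -
 have hb: "abs (h' s) <= d - 2" for s
 proof -
  have "(d - 2) * h s / (1 + abs s) <= (d - 2) * 1 / 1"
   using h(4,5)[of s] d by (intro frac_le mult_left_mono) auto
  then show ?thesis using order_trans[OF h(6)[of s]] by simp
 qed
 define e where "e n = 1 / real (Suc n)" for n
 have e: "e n > 0" "e n <= 1" for n by (auto simp: e_def)
 have e0: "e \<longlonglongrightarrow> 0" unfolding e_def by (rule lim_1_over_n[THEN LIMSEQ_Suc])
 let ?g = "%n s. h s * exp (- (e n * bow 1 s))"
 have G: "integrable nu (%z. k t x z * ?g n z) & (LINT z|nu. k t x z * ?g n z) <= exp (K0 * e n * t) * ?g n x
   & exp (- (K0 * e n) * t) * ?g n x <= (LINT z|nu. k t x z * ?g n z)" for n
 proof -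
  let ?\<phi>1 = "%s. - (e n * bow' 1 s)" and ?\<phi>2 = "%s. - (e n * bow'' 1 s)"
  let ?q = "%s. 2 * h' s * ?\<phi>1 s + h s * (?\<phi>2 s + (?\<phi>1 s)^2 + drift s * ?\<phi>1 s)"
  have b: "\<bar>?\<phi>1 s\<bar> <= e n * abs s" "\<bar>?\<phi>1 s\<bar> <= e n" "\<bar>?\<phi>2 s\<bar> <= e n" "(?\<phi>1 s)^2 <= e n" for s
  proof -
   show "\<bar>?\<phi>1 s\<bar> <= e n * abs s" and 1: "\<bar>?\<phi>1 s\<bar> <= e n" and "\<bar>?\<phi>2 s\<bar> <= e n"
    using bow'_bounds[of 1 s] bow''_bounds[of 1 s] e[of n] by (auto simp: abs_mult)
   have "(?\<phi>1 s)^2 <= (e n)^2" using power_mono[OF 1 abs_ge_zero, of 2] by simp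
   also have "... <= e n" using e[of n] by (simp add: power2_eq_square mult_left_le)
   finally show "(?\<phi>1 s)^2 <= e n" .
  qed
  have "EX g'. domA (?g n) g' (%s. - exp (- (e n * bow 1 s)) * ?q s)"
  proof (rule domA_exp[OF h(1) h(2), where H = "(d - 2) + 1" and \<kappa> = "e n" and C = 1])
   fix s
   show "DERIV (%s. - (e n * bow 1 s)) s :> ?\<phi>1 s" by (intro DERIV_minus DERIV_cmult DERIV_bow)
   show "DERIV ?\<phi>1 s :> ?\<phi>2 s" by (intro DERIV_minus DERIV_cmult DERIV_bow')
   show "\<bar>?\<phi>1 s\<bar> <= d - 2 + 1" "\<bar>?\<phi>2 s\<bar> <= d - 2 + 1" using b(2,3)[of s] e(2)[of n] d by linarith+
   show "abs (h' s) <= d - 2 + 1" using hb[of s] by simp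
   show "abs (h s) <= 1" using h(4,5)[of s] by simp
   show "exp (- (e n * bow 1 s)) <= 1 * exp (- e n * abs s)" using bow_ge[of 1 s] e[of n] by simp
  qed (use h(3) e in \<open>auto intro!: continuous_intros borel_measurable_continuous_onI\<close>)
  then obtain g' where g': "domA (?g n) g' (%s. - exp (- (e n * bow 1 s)) * ?q s)" by blast
  have q: "?q s <= K0 * e n * h s" "- (K0 * e n * h s) <= ?q s" for s
   by (rule gen_bound[OF h(4,6) less_imp_le[OF e(1)] b(1) b(4)], use b(3)[of s] in linarith)+
  have "ip (k t x) (?g n) <= exp (K0 * e n * t) * ?g n x"
  proof (rule k_compare[OF g' t])
   fix s
   show "0 <= - exp (- (e n * bow 1 s)) * ?q s + K0 * e n * ?g n s"
    using mult_left_mono[OF q(1)[of s], of "exp (- (e n * bow 1 s))"] by (simp add: mult_ac)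
  qed
  moreover
  \<comment> \<open>\<open>k_compare\<close> gives upper bounds only. Applied to the negative
    function with the rate of opposite sign, it gives the matching lower bound.\<close>
  note domA_minus[OF g']
  then have "ip (k t x) (%s. - ?g n s) <= exp (- (K0 * e n) * t) * - ?g n x"
  proof (rule k_compare[OF _ t])
   fix s
   show "0 <= - (- exp (- (e n * bow 1 s)) * ?q s) + - (K0 * e n) * - ?g n s"
    using mult_left_mono[OF q(2)[of s], of "exp (- (e n * bow 1 s))"] by (simp add: mult_ac)
  qed
  then have "exp (- (K0 * e n) * t) * ?g n x <= ip (k t x) (?g n)" by (simp add: L2_inner_def)
  moreover have "integrable nu (%z. k t x z * ?g n z)"
   using g' k_L2[OF t] by (intro L2_mult_integrable) (auto simp: domA_def)
  ultimately show ?thesis by (simp add: L2_inner_def)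
 qed
 have lim: "(%n. LINT z|nu. k t x z * ?g n z) \<longlonglongrightarrow> h x"
 proof (rule tendsto_sandwich)
  show "\<forall>\<^sub>F n in sequentially. (LINT z|nu. k t x z * ?g n z) <= exp (K0 * e n * t) * ?g n x" using G by auto
  show "\<forall>\<^sub>F n in sequentially. exp (- (K0 * e n) * t) * ?g n x <= (LINT z|nu. k t x z * ?g n z)" using G by auto
  have "(%n. exp (K0 * e n * t) * ?g n x) \<longlonglongrightarrow> exp (K0 * 0 * t) * (h x * exp (- (0 * bow 1 x)))"
   by (intro tendsto_intros e0)
  then show "(%n. exp (K0 * e n * t) * ?g n x) \<longlonglongrightarrow> h x" by simp
  have "(%n. exp (- (K0 * e n) * t) * ?g n x) \<longlonglongrightarrow> exp (- (K0 * 0) * t) * (h x * exp (- (0 * bow 1 x)))"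
   by (intro tendsto_intros e0)
  then show "(%n. exp (- (K0 * e n) * t) * ?g n x) \<longlonglongrightarrow> h x" by simp
 qed
 have ch: "cont h" using h by (auto intro!: continuous_at_imp_continuous_on DERIV_isCont)
 have "integrable nu (%z. k t x z * h z) & (LINT z|nu. k t x z * h z) = h x"
 proof -
  have i: "integrable nu (%z. k t x z * ?g n z)" for n using G by blast
  have mono: "AE z in nu. mono (%n. k t x z * ?g n z)"
  proof (intro AE_I2 monoI mult_left_mono k_nonneg t h)
   fix z :: real and m n :: nat assume "m <= n"
   then have "e n * bow 1 z <= e m * bow 1 z"
    using bow_ge_1[of 1 z] by (intro mult_right_mono) (auto simp: e_def frac_le)
   then show "exp (- (e m * bow 1 z)) <= exp (- (e n * bow 1 z))" by simp
  qed
  have "(%n. k t x z * ?g n z) \<longlonglongrightarrow> k t x z * (h z * exp (- (0 * bow 1 z)))" for z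
   by (intro tendsto_intros e0)
  then have l: "AE z in nu. (%n. k t x z * ?g n z) \<longlonglongrightarrow> k t x z * h z" by simp
  have m: "(%z. k t x z * h z) \<in> borel_measurable nu"
   using borel_measurable_continuous_onI[OF ch] t by measurable
  show ?thesis using integrable_monotone_convergence[OF i mono l lim m] integral_monotone_convergence[OF i mono l lim m]
   by blast
 qed
 then show "integrable nu (%z. k t x z * h z)" "(LINT z|nu. k t x z * h z) = h x" by auto
qed

lemma k_mass:
 assumes "t > 0"
 shows "integrable nu (k t x)" "(LINT z|nu. k t x z) = 1"
proof -
 have "integrable nu (%z. k t x z * 1) & (LINT z|nu. k t x z * 1) = 1"
  by (intro conjI conservation[where h' = "%_. 0"]) (use assms d in auto)
 then show "integrable nu (k t x)" "(LINT z|nu. k t x z) = 1" by simp_all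
qed

lemma hm_mass:
 assumes "t > 0"
 shows "integrable nu (%z. k t x z * hm z)" "(LINT z|nu. k t x z * hm z) = hm x"
 using conservation[OF DERIV_hm DERIV_hm' continuous_on_hm(2) less_imp_le[OF hm_pos] hm_le_1 abs_hm' assms] by auto

lemma ebd_bounded:
 assumes "t > 0" "meas f" "!!z. 0 <= f z" "!!z. f z <= B"
 shows "ebd t x f B"
proof -
 have "ebd t x (%_. 1) 1" using k_mass[OF assms(1)] by (simp add: ebd_def)
 from ebd_cmult[OF this, of B] have "ebd t x (%_. B * 1) (B * 1)" using order_trans[OF assms(3,4)] by auto
 then show ?thesis by (rule ebd_mono) (use assms in auto)
qed

end

section \<open>On-diagonal upper bound\<close>

text \<open>\<open>(R\<^sup>2 + s\<^sup>2) powr (-\<gamma>)\<close> is a supersolution with a strictly positive source on \<open>{-R..R}\<close>; this is where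
  transience (\<open>d > 2\<close>) enters: the process spends little time near the gluing point.\<close>

context bessel
begin

text \<open>\<open>drift s * s\<close> increases in \<open>abs s\<close> to \<open>d - 1\<close>,
  which exceeds \<open>d / 2\<close> exactly when \<open>d > 2\<close>. The second summand is
  negative only for \<open>abs s < d / (d - 2)\<close>, and there half of \<open>R^2\<close>
  outweighs it.\<close>

lemma source_bound:
 assumes R: "R >= d^2 / (d - 2)"
 shows "R^2 / 2 <= R^2 * (1 + drift s * s) + s^2 * (drift s * s - d / 2)"
proof -
 have s: "drift s * s = (d - 1) * (abs s / (1 + abs s))" by (simp add: drift_def abs_sgn mult_ac)
 have nn: "0 <= drift s * s" unfolding s using d by simp
 have R2: "0 <= R^2" "0 <= R^2 * (drift s * s)" using nn by auto
 show ?thesis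
 proof (cases "drift s * s >= d / 2")
  case True
  then have "0 <= s^2 * (drift s * s - d / 2)" by simp
  then show ?thesis using R2 by (simp add: distrib_left)
 next
  case False
  have X: "1 + abs s > 0" by linarith
  have "(d - 1) * abs s < d / 2 * (1 + abs s)" using False X unfolding s by (simp add: field_simps)
  then have "abs s * (d - 2) <= d" by (simp add: field_simps)
  then have "abs s <= d / (d - 2)" using d by (simp add: field_simps)
  then have "s^2 <= (d / (d - 2))^2" using power_mono[OF _ abs_ge_zero, of s _ 2] by simp
  also have "... = 1 / d^2 * (d^2 / (d - 2))^2" using d by (simp add: field_simps power2_eq_square)
  also have "... <= 1 / d^2 * R^2" using R d by (intro mult_left_mono power_mono) auto
  also have "... <= 1 / d * R^2" using d by (intro mult_right_mono frac_le) (auto simp: power2_eq_square)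
  finally have "s^2 * (d / 2) <= 1 / d * R^2 * (d / 2)" using d by (intro mult_right_mono) auto
  then have "s^2 * (d / 2) <= R^2 / 2" using d by simp
  moreover have "0 <= s^2 * (drift s * s)" using nn by simp
  ultimately show ?thesis using R2 by (simp add: algebra_simps)
 qed
qed

text \<open>\<open>\<gamma>\<close> is half of the exponent \<open>(d - 2) / 2\<close> for which the
  power would behave like the decaying harmonic function \<open>abs s powr (2 - d)\<close>; below
  that exponent superharmonicity is strict. The factor \<open>exp (- bow \<alpha> s)\<close>
  provides the decay required for the domain and costs a multiple of
  \<open>\<alpha>^2\<close>.\<close>

lemma source_domA:
 assumes R: "R >= d^2 / (d - 2)" and \<alpha>: "\<alpha> > 0"
 defines "\<gamma> == (d - 2) / 4"
 defines "\<phi> == %s. - (\<gamma> * ln (R^2 + s^2)) - bow \<alpha> s"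
 shows "EX g' q. domA (%s. exp (\<phi> s)) g' q &
  (ALL s. exp (\<phi> s) * (2 * \<gamma> * (R^2 / 2) / (R^2 + s^2)^2 - (4 * \<gamma> + 1) * \<alpha>^2) <= q s)"
proof -
 have "1 <= d^2 / (d - 2)" using d power_increasing[of 1 2 d] by simp
 then have R1: "R >= 1" using R by linarith
 then have "R * 1 <= R * R" by (intro mult_left_mono) auto
 then have R2: "R^2 >= 1" unfolding power2_eq_square using R1 by linarith
 have \<gamma>: "\<gamma> > 0" using d by (simp add: \<gamma>_def)
 let ?D = "%s. R^2 + s^2"
 have D: "?D s > 0" "?D s >= 1" "s^2 <= ?D s" for s using R2 zero_le_power2[of s] by linarith+
 have sD: "abs s <= ?D s" for s
 proof (cases "abs s <= 1")
  case False
  then have "abs s * 1 <= abs s * abs s" by (intro mult_left_mono) auto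
  then show ?thesis using R2 by (simp add: power2_eq_square)
 qed (use D(2)[of s] in linarith)
 let ?p1 = "%s. - (2 * \<gamma> * s / ?D s) - bow' \<alpha> s"
 let ?p2 = "%s. - (2 * \<gamma> * (R^2 - s^2) / (?D s)^2) - bow'' \<alpha> s"
 have d1: "DERIV \<phi> s :> ?p1 s" for s
  unfolding \<phi>_def using D(1)[of s]
  by (auto intro!: derivative_eq_intros DERIV_bow simp: power2_eq_square field_simps)
 have d2: "DERIV ?p1 s :> ?p2 s" for s
 proof -
  have "DERIV (%s. 2 * \<gamma> * s / ?D s) s :> (2 * \<gamma> * ?D s - 2 * \<gamma> * s * (2 * s)) / (?D s * ?D s)"
   using D(1)[of s] by (auto intro!: derivative_eq_intros)
  moreover have "(2 * \<gamma> * ?D s - 2 * \<gamma> * s * (2 * s)) / (?D s * ?D s) = 2 * \<gamma> * (R^2 - s^2) / (?D s)^2"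
   by (simp add: power2_eq_square algebra_simps)
  ultimately show ?thesis using DERIV_diff[OF DERIV_minus DERIV_bow'[of \<alpha> s]] by simp
 qed
 have b1: "\<bar>2 * \<gamma> * s / ?D s\<bar> <= 2 * \<gamma>" for s
 proof -
  have "\<bar>2 * \<gamma> * s / ?D s\<bar> = 2 * \<gamma> * abs s / ?D s" using D(1)[of s] \<gamma> by (simp add: abs_mult)
  also have "... <= 2 * \<gamma> * ?D s / ?D s" using D(1)[of s] \<gamma> sD by (intro divide_right_mono mult_left_mono) auto
  also have "... = 2 * \<gamma>" using D(1)[of s] by (intro nonzero_mult_div_cancel_right) linarith
  finally show ?thesis .
 qed
 have b2: "\<bar>2 * \<gamma> * (R^2 - s^2) / (?D s)^2\<bar> <= 2 * \<gamma>" for s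
 proof -
  have "\<bar>R^2 - s^2\<bar> <= ?D s" using zero_le_power2[of R] zero_le_power2[of s] by linarith
  also have "?D s * 1 <= ?D s * ?D s" using D(2)[of s] by (intro mult_left_mono) auto
  finally have "2 * \<gamma> * \<bar>R^2 - s^2\<bar> / (?D s)^2 <= 2 * \<gamma> * (?D s)^2 / (?D s)^2"
   using \<gamma> by (intro divide_right_mono mult_left_mono) (auto simp: power2_eq_square)
  also have "... = 2 * \<gamma>" using D(1)[of s] by (intro nonzero_mult_div_cancel_right power_not_zero) linarith
  finally show ?thesis using \<gamma> by (simp add: abs_mult)
 qed
 let ?G = "%s. 2 * 0 * ?p1 s + 1 * (?p2 s + (?p1 s)^2 + drift s * ?p1 s)"
 have "EX g'. domA (%s. 1 * exp (\<phi> s)) g' (%s. - exp (\<phi> s) * ?G s)"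
 proof (rule domA_exp[where H = "2 * \<gamma> + \<alpha> + \<alpha>^2" and \<kappa> = \<alpha> and C = 1])
  fix s
  show "DERIV \<phi> s :> ?p1 s" by (rule d1)
  show "DERIV ?p1 s :> ?p2 s" by (rule d2)
  have "\<bar>2 * \<gamma> * s / ?D s + bow' \<alpha> s\<bar> <= 2 * \<gamma> + \<alpha>" using b1[of s] bow'_bounds(1)[of \<alpha> s] \<alpha> by linarith
  then show "abs (?p1 s) <= 2 * \<gamma> + \<alpha> + \<alpha>^2" using zero_le_power2[of \<alpha>] by linarith
  show "abs (?p2 s) <= 2 * \<gamma> + \<alpha> + \<alpha>^2" using b2[of s] bow''_bounds[of \<alpha> s] \<alpha> by linarith
  have "0 <= \<gamma> * ln (?D s)" using \<gamma> D(2)[of s] by simp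
  then have "\<phi> s <= - \<alpha> * abs s" unfolding \<phi>_def using bow_ge[of \<alpha> s] \<alpha> by (simp add: abs_mult)
  then show "exp (\<phi> s) <= 1 * exp (- \<alpha> * abs s)" by simp
 next
  have D0: "?D s ~= 0" "(?D s)^2 ~= 0" for s using D(1)[of s] by auto
  show "cont ?p1" using D0 by (intro continuous_intros) auto
  have "cont ?p2" using D0 by (intro continuous_intros) auto
  then show "meas ?p2" by (rule borel_measurable_continuous_onI)
  show "0 < \<alpha>" by fact
  show "abs 0 <= 2 * \<gamma> + \<alpha> + \<alpha>^2" using \<gamma> \<alpha> by simp
 qed auto
 then obtain g' where g': "domA (%s. exp (\<phi> s)) g' (%s. - exp (\<phi> s) * ?G s)" by auto
 have G_le: "?G s <= (4 * \<gamma> + 1) * \<alpha>^2 - 2 * \<gamma> * (R^2 / 2) / (?D s)^2" for s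
 proof -
  define N where "N = R^2 * (1 + drift s * s) + s^2 * (drift s * s - d / 2)"
  let ?u = "2 * \<gamma> * s / ?D s" and ?b = "bow' \<alpha> s"
  have g4: "d / 2 = 1 + 2 * \<gamma>" by (simp add: \<gamma>_def field_simps)
  have e: "?u^2 = 4 * \<gamma>^2 * s^2 / (?D s)^2" by (simp add: power_mult_distrib power_divide)
  have e2: "drift s * ?u = 2 * \<gamma> * (drift s * s * ?D s) / (?D s)^2"
   using D(1)[of s] by (simp add: power2_eq_square)
  \<comment> \<open>The terms free of \<open>\<alpha>\<close> combine exactly to the quantity of
    \<open>source_bound\<close>, because \<open>1 + 2 * \<gamma> = d / 2\<close>.\<close>
  have main: "- (2 * \<gamma> * (R^2 - s^2) / (?D s)^2) + ?u^2 - drift s * ?u = - (2 * \<gamma> * N / (?D s)^2)"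
  proof -
   have "- (2 * \<gamma> * (R^2 - s^2)) + 4 * \<gamma>^2 * s^2 - 2 * \<gamma> * (drift s * s * ?D s) = - (2 * \<gamma> * N)"
    unfolding N_def g4 by (simp add: algebra_simps power2_eq_square)
   then show ?thesis unfolding e e2 minus_divide_left add_divide_distrib[symmetric] diff_divide_distrib[symmetric]
    by simp
  qed
  have "s * ?b <= \<alpha>^2 * s^2"
  proof -
   have "s * ?b <= abs s * abs ?b" unfolding abs_mult[symmetric] by simp
   also have "... <= abs s * (\<alpha>^2 * abs s)" by (intro mult_left_mono bow'_bounds) auto
   finally show ?thesis by (simp add: power2_eq_square mult_ac)
  qed
  also have "... <= \<alpha>^2 * ?D s" using D(3) by (intro mult_left_mono) auto
  finally have "s * ?b <= \<alpha>^2 * ?D s" .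
  then have "4 * \<gamma> * (s * ?b) / ?D s <= 4 * \<gamma> * (\<alpha>^2 * ?D s) / ?D s"
   using D(1)[of s] \<gamma> by (intro divide_right_mono mult_left_mono) auto
  also have "... = 4 * \<gamma> * \<alpha>^2 * ?D s / ?D s" by (simp only: mult.assoc)
  also have "... = 4 * \<gamma> * \<alpha>^2" using D(1)[of s] by (intro nonzero_mult_div_cancel_right) linarith
  finally have c1: "2 * ?u * ?b <= 4 * \<gamma> * \<alpha>^2" by (simp add: mult_ac)
  have c2: "0 <= drift s * ?b"
  proof -
   have "drift s * ?b = (d - 1) * (sgn s * ?b) / (1 + abs s)" by (simp add: drift_def)
   moreover have "0 <= sgn s * ?b" using bow'_sgn[of s \<alpha>] by (auto simp: sgn_if zero_le_mult_iff)
   ultimately show ?thesis using d by simp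
  qed
  have "2 * \<gamma> * (R^2 / 2) / (?D s)^2 <= 2 * \<gamma> * N / (?D s)^2"
   using source_bound[OF R, of s] \<gamma> unfolding N_def by (intro divide_right_mono mult_left_mono) auto
  moreover have "?G s = - (2 * \<gamma> * N / (?D s)^2) + 2 * ?u * ?b + ?b^2 - bow'' \<alpha> s - drift s * ?b"
   unfolding main[symmetric] by (simp add: power2_eq_square algebra_simps)
  ultimately show ?thesis using c1 c2 bow'_sq[of \<alpha> s] bow''_bounds(1)[of \<alpha> s] by (simp add: distrib_right)
 qed
 have "2 * \<gamma> * (R^2 / 2) / (?D s)^2 - (4 * \<gamma> + 1) * \<alpha>^2 <= - ?G s" for s
 proof -
  have "X - Y <= - g" if "g <= Y - X" for g X Y :: real using that by linarith
  from this[OF G_le] show ?thesis .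
 qed
 from mult_left_mono[OF this, of "exp (\<phi> s)" s for s]
 have "exp (\<phi> s) * (2 * \<gamma> * (R^2 / 2) / (?D s)^2 - (4 * \<gamma> + 1) * \<alpha>^2) <= - exp (\<phi> s) * ?G s" for s
  unfolding mult_minus_right mult_minus_left by simp
 then show ?thesis using g' by blast
qed

end

context heat_kernel
begin

text \<open>The expectation of the supersolution falls by at most its maximum \<open>G\<close>
  during \<open>[t, 2 * t]\<close>, while each unit of time spent in \<open>{-R..R}\<close> costs a
  multiple of \<open>G / R^2\<close>. The mean value theorem replaces the time average by a single
  time \<open>s\<close>.\<close>

lemma occupation_bound:
 obtains C R0 where "C > 0" "R0 >= 1" "!!R t x. R >= R0 ==> R^2 <= t ==>
  EX s. t < s & s < 2 * t & ebd s x (indicator {-R..R}) (C * R^2 / t)"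
proof -
 define \<gamma> where "\<gamma> = (d - 2) / 4"
 define c where "c = exp (- \<gamma> * ln 2 - 2)"
 have \<gamma>: "\<gamma> > 0" using d by (simp add: \<gamma>_def)
 have c: "c > 0" by (simp add: c_def)
 show thesis
 proof (rule that[of "(4 * \<gamma> + 2) * 4 / (c * \<gamma>)" "d^2 / (d - 2)"])
  show "0 < (4 * \<gamma> + 2) * 4 / (c * \<gamma>)" using \<gamma> c by simp
  show "1 <= d^2 / (d - 2)" using d power_increasing[of 1 2 d] by simp
  fix R t x :: real
  assume R: "R >= d^2 / (d - 2)" and Rt: "R^2 <= t"
  have R1: "R >= 1" using R \<open>1 <= d^2 / (d - 2)\<close> by linarith
  have t: "t > 0" using R1 Rt zero_less_power2[of R] by linarith
  \<comment> \<open>At this scale the loss \<open>(4 * \<gamma> + 1) * \<alpha>^2 * G\<close> over a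
    time of length \<open>t\<close> is comparable to \<open>G\<close>, and the damping factor stays
    bounded below on \<open>{-R..R}\<close>, since \<open>\<alpha> * R <= 1\<close>.\<close>
  define \<alpha> where "\<alpha> = 1 / sqrt t"
  have \<alpha>: "\<alpha> > 0" "\<alpha>^2 = 1 / t" using t by (auto simp: \<alpha>_def power_divide)
  have "R <= sqrt t" using Rt R1 by (simp add: real_le_rsqrt)
  then have \<alpha>R: "\<alpha> * R <= 1" using t by (simp add: \<alpha>_def)
  define \<phi> where "\<phi> = (%s. - (\<gamma> * ln (R^2 + s^2)) - bow \<alpha> s)"
  obtain g' q where g: "domA (%s. exp (\<phi> s)) g' q"
   and q: "!!s. exp (\<phi> s) * (2 * \<gamma> * (R^2 / 2) / (R^2 + s^2)^2 - (4 * \<gamma> + 1) * \<alpha>^2) <= q s"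
   using source_domA[OF R \<alpha>(1)] unfolding \<phi>_def \<gamma>_def by blast
  define G where "G = exp (- (\<gamma> * ln (R^2)))"
  have G: "G > 0" by (simp add: G_def)
  have R2: "R^2 > 0" using R1 by simp
  have gG: "exp (\<phi> s) <= G" for s
  proof -
   have "\<gamma> * ln (R^2) <= \<gamma> * ln (R^2 + s^2)" using \<gamma> R2 zero_le_power2[of s]
    by (intro mult_left_mono ln_mono) (auto intro: add_pos_nonneg)
   then show ?thesis unfolding \<phi>_def G_def using bow_ge_1[of \<alpha> s] by simp
  qed
  have gc: "G * c <= exp (\<phi> s)" if "s \<in> {-R..R}" for s
  proof -
   have s: "abs s <= R" using that by auto
   then have "s^2 <= R^2" using power_mono[OF s, of 2] by simp
   then have "\<gamma> * ln (R^2 + s^2) <= \<gamma> * ln (2 * R^2)" using \<gamma> R2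
    by (intro mult_left_mono ln_mono) (auto intro: add_pos_nonneg)
   also have "... = \<gamma> * ln 2 + \<gamma> * ln (R^2)" using R1 by (subst ln_mult) (auto simp: algebra_simps)
   finally have "\<gamma> * ln (R^2 + s^2) <= \<gamma> * ln 2 + \<gamma> * ln (R^2)" .
   moreover have "\<alpha> * abs s <= \<alpha> * R" using s \<alpha> by (intro mult_left_mono) auto
   from order_trans[OF this \<alpha>R] have "\<bar>\<alpha> * s\<bar> <= 1" using \<alpha>(1) by (simp add: abs_mult)
   then have "bow \<alpha> s <= 2" using bow_le[of \<alpha> s] by linarith
   ultimately have "bow \<alpha> s <= 2" "\<gamma> * ln (R^2 + s^2) <= \<gamma> * ln 2 + \<gamma> * ln (R^2)" by auto
   then show ?thesis unfolding G_def c_def exp_add[symmetric] \<phi>_def by simp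
  qed
  have ge: "G * c * \<gamma> / (4 * R^2) * indicator {-R..R} s - (4 * \<gamma> + 1) * \<alpha>^2 * G <= q s" for s
  proof -
   have a: "(4 * \<gamma> + 1) * \<alpha>^2 * exp (\<phi> s) <= (4 * \<gamma> + 1) * \<alpha>^2 * G"
    using \<gamma> by (intro mult_left_mono gG) auto
   have "G * c * \<gamma> / (4 * R^2) * indicator {-R..R} s <= exp (\<phi> s) * (2 * \<gamma> * (R^2 / 2) / (R^2 + s^2)^2)"
   proof (cases "s \<in> {-R..R}")
    case True
    then have "abs s <= R" by auto
    then have "s^2 <= R^2" using power_mono[of "abs s" R 2] by simp
    then have le: "(R^2 + s^2)^2 <= (2 * R^2)^2" by (intro power_mono) auto
    have "G * c * \<gamma> / (4 * R^2) = (G * c) * (2 * \<gamma> * (R^2 / 2) / (2 * R^2)^2)"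
     using R2 by (simp add: power2_eq_square field_simps)
    also have "... <= exp (\<phi> s) * (2 * \<gamma> * (R^2 / 2) / (R^2 + s^2)^2)"
     using gc[OF True] le \<gamma> R2 G c add_pos_nonneg[OF R2 zero_le_power2[of s]] by (intro mult_mono divide_left_mono mult_pos_pos) auto
    finally show ?thesis using True by simp
   next
    case False then show ?thesis using \<gamma> by simp
   qed
   then show ?thesis using a q[of s] by (simp add: right_diff_distrib mult_ac)
  qed
  let ?u = "%t. ip (k t x) (%s. exp (\<phi> s))"
  have gL: "(%s. exp (\<phi> s)) \<in> L2 nu" "q \<in> L2 nu" using g by (auto simp: domA_def)
  have "EX s. t < s & s < 2 * t & ?u (2 * t) - ?u t = (2 * t - t) * (- ip (k s x) q)"
   by (rule MVT2) (use t k_deriv[OF g] in auto)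
  then obtain s where s: "t < s" "s < 2 * t" "?u (2 * t) - ?u t = t * (- ip (k s x) q)" by auto
  have "?u t <= G"
  proof -
   have "ebd t x (%s. exp (\<phi> s)) G" using gL by (intro ebd_bounded t gG) (auto simp: L2_def)
   then show ?thesis by (simp add: ebd_def L2_inner_def)
  qed
  moreover have "?u (2 * t) >= 0" unfolding L2_inner_def using k_nonneg t by simp
  ultimately have up: "t * ip (k s x) q <= G" using s(3) by simp
  have i: "integrable nu (%z. k s x z * indicator {-R..R} z)"
   using k_mass(1)[of s x] s t integrable_real_mult_indicator[of "{-R..R}" nu "k s x"] by simp
  have "(LINT z|nu. G * c * \<gamma> / (4 * R^2) * (k s x z * indicator {-R..R} z) - (4 * \<gamma> + 1) * \<alpha>^2 * G * k s x z) <= ip (k s x) q"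
   unfolding L2_inner_def
  proof (rule integral_mono)
   show "integrable nu (%z. G * c * \<gamma> / (4 * R^2) * (k s x z * indicator {-R..R} z) - (4 * \<gamma> + 1) * \<alpha>^2 * G * k s x z)"
    using s t by (intro Bochner_Integration.integrable_diff integrable_mult_right i k_mass) auto
   show "integrable nu (%z. k s x z * q z)" using gL s t by (intro L2_mult_integrable k_L2) auto
   show "G * c * \<gamma> / (4 * R^2) * (k s x z * indicator {-R..R} z) - (4 * \<gamma> + 1) * \<alpha>^2 * G * k s x z <= k s x z * q z" for z
    using mult_left_mono[OF ge[of z] k_nonneg[of s x z]] s t by (simp add: right_diff_distrib mult_ac)
  qed
  also have "(LINT z|nu. G * c * \<gamma> / (4 * R^2) * (k s x z * indicator {-R..R} z) - (4 * \<gamma> + 1) * \<alpha>^2 * G * k s x z)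
    = G * c * \<gamma> / (4 * R^2) * (LINT z|nu. k s x z * indicator {-R..R} z) - (4 * \<gamma> + 1) * \<alpha>^2 * G"
   using i k_mass[of s x] s t by (subst Bochner_Integration.integral_diff) auto
  also have "ip (k s x) q <= G / t" using up t by (simp add: pos_le_divide_eq mult.commute)
  finally have "G * c * \<gamma> / (4 * R^2) * (LINT z|nu. k s x z * indicator {-R..R} z) - (4 * \<gamma> + 1) * \<alpha>^2 * G <= G / t"
   by simp
  then have "G * (c * \<gamma> / (4 * R^2) * (LINT z|nu. k s x z * indicator {-R..R} z)) <= G * ((4 * \<gamma> + 2) / t)"
  proof -
   assume a: "G * c * \<gamma> / (4 * R^2) * (LINT z|nu. k s x z * indicator {-R..R} z) - (4 * \<gamma> + 1) * \<alpha>^2 * G <= G / t"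
   have "G / t + (4 * \<gamma> + 1) * (1 / t) * G = G * ((4 * \<gamma> + 2) / t)"
    using t by (simp add: field_simps)
   then show ?thesis using a unfolding \<alpha> by simp
  qed
  then have "c * \<gamma> / (4 * R^2) * (LINT z|nu. k s x z * indicator {-R..R} z) <= (4 * \<gamma> + 2) / t"
   using G mult_le_cancel_left_pos by blast
  from mult_right_mono[OF this, of "4 * R^2 / (c * \<gamma>)"]
  have "(LINT z|nu. k s x z * indicator {-R..R} z) <= (4 * \<gamma> + 2) / t * (4 * R^2 / (c * \<gamma>))"
   using c \<gamma> R2 by simp
  also have "... = (4 * \<gamma> + 2) * 4 / (c * \<gamma>) * R^2 / t" by (simp add: algebra_simps)
  finally show "EX s. t < s & s < 2 * t & ebd s x (indicator {-R..R}) ((4 * \<gamma> + 2) * 4 / (c * \<gamma>) * R^2 / t)"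
   using s i by (auto simp: ebd_def)
 qed
qed

end

section \<open>Recursion in time for the diagonal\<close>

context heat_kernel
begin

lemma k_le_diag: "t > 0 ==> k t x y <= sqrt (k t x x * k t y y)"
proof -
 assume t: "t > 0"
 have h: "k t a b = ip (k (t / 2) a) (k (t / 2) b)" for a b
  using k_semi[of "t / 2" "t / 2" a b] t by simp
 have "k t x y <= nrm (k (t / 2) x) * nrm (k (t / 2) y)"
  unfolding h using L2_cauchy_schwarz[OF k_L2 k_L2, of "t / 2" "t / 2" x y] t by auto
 also have "... = sqrt (k t x x * k t y y)" unfolding L2_norm_def h[symmetric] by (simp add: real_sqrt_mult)
 finally show ?thesis .
qed

lemma k_le_ebd:
 assumes "t > 0" "s > 0" "ebd t x f B" "!!z. k s y z <= f z"
 shows "k (t + s) x y <= B"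
proof -
 have "k (t + s) x y = (LINT z|nu. k t x z * k s y z)" using assms by (simp add: k_semi L2_inner_def)
 moreover have "ebd t x (k s y) B"
  by (rule ebd_mono[OF assms(3) assms(1) k_measurable[OF assms(2)] k_nonneg[OF assms(2)] assms(4) order_refl])
 ultimately show ?thesis by (simp add: ebd_def)
qed

text \<open>Chapman--Kolmogorov at the time \<open>s + t\<close>. Near the gluing point the crude
  bound \<open>M\<close> is multiplied by the small probability \<open>\<delta>\<close> of being
  there; elsewhere the weight is at least \<open>R powr (d - 1)\<close>, the local bound
  \<open>k_diag\<close> is good, and by Cauchy--Schwarz only the square root of \<open>M\<close>
  enters.\<close>

lemma diag_step:
 assumes occ: "ebd s x (indicator {-R..R}) \<delta>" and s: "t < s" "s < 2 * t" and R: "R > 0"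
  and M: "!!z. k t z z <= M"
 shows "k (4 * t) x x <= \<delta> * M + sqrt (2 / (sqrt t * R powr (d - 1)) * M)"
proof -
 have t: "t > 0" using s by linarith
 have M0: "0 <= M" using M[of 0] k_nonneg[OF t, of 0 0] by linarith
 define b where "b = 2 / (sqrt t * R powr (d - 1))"
 have b: "0 <= b" using t by (simp add: b_def)
 define r where "r = sqrt (b * M)"
 have r: "0 <= r" using b M0 by (simp add: r_def)
 have le: "k t x z <= M * indicator {-R..R} z + r * 1" for z
 proof (cases "z \<in> {-R..R}")
  case True
  have "k t x x * k t z z <= M * M" using M k_nonneg[OF t] M0 by (intro mult_mono) auto
  then have "sqrt (k t x x * k t z z) <= M" using M0 by (intro real_le_lsqrt) (auto simp: power2_eq_square)
  then have "k t x z <= M" using k_le_diag[OF t, of x z] by linarith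
  then show ?thesis using True r by simp
 next
  case False
  then have "R <= 1 + abs z" by auto
  then have "R powr (d - 1) <= w z" unfolding w_def using R d by (intro powr_mono2) auto
  then have "2 / (sqrt t * w z) <= b" unfolding b_def using t R w_pos[of z]
   by (intro divide_left_mono mult_left_mono mult_pos_pos) auto
  then have "k t z z <= b" using k_diag[OF t, of z] by linarith
  then have "k t x x * k t z z <= M * b" using M k_nonneg[OF t] M0 by (intro mult_mono) auto
  then have "sqrt (k t x x * k t z z) <= r" unfolding r_def by (simp add: mult.commute)
  then show ?thesis using False k_le_diag[OF t, of x z] by simp
 qed
 have "ebd s x (%_. 1) 1" using s t by (intro ebd_bounded) auto
 then have "ebd s x (%z. M * indicator {-R..R} z + r * 1) (M * \<delta> + r * 1)"
  using M0 r by (intro ebd_add ebd_cmult occ) auto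
 then have "k (s + t) x x <= M * \<delta> + r * 1" by (rule k_le_ebd[rotated 2]) (use s t le in auto)
 moreover have "k (4 * t) x x <= k (s + t) x x" using s t by (intro k_diag_mono) auto
 ultimately have "k (4 * t) x x <= \<delta> * M + r" by (simp only: mult.commute[of M] mult_1_right)
 then show ?thesis unfolding r_def b_def .
qed

lemma sqrt_powr: "t > 0 ==> sqrt t powr a = t powr (a / 2)" for t :: real
 by (simp add: powr_half_sqrt[symmetric] powr_powr)

lemma sqrt_mult_powr:
 assumes "t > 0"
 shows "sqrt t * sqrt t powr (d - 1) = t powr (d / 2)"
proof -
 have e: "1 / 2 + (d - 1) / 2 = d / 2" by (simp add: field_simps)
 show ?thesis
  using assms powr_add[of t "1 / 2" "(d - 1) / 2"] unfolding e by (simp add: sqrt_powr powr_half_sqrt)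
qed

lemma inverse_powr_sqrt:
 assumes "\<epsilon> > 0" "t > 0"
 shows "2 / (sqrt t * (\<epsilon> * sqrt t) powr (d - 1)) = 2 * \<epsilon> powr (1 - d) * t powr (- d / 2)"
proof -
 have 1: "(\<epsilon> * sqrt t) powr (d - 1) = \<epsilon> powr (d - 1) * sqrt t powr (d - 1)"
  by (rule powr_mult)
 have "sqrt t * (\<epsilon> * sqrt t) powr (d - 1) = \<epsilon> powr (d - 1) * t powr (d / 2)"
  unfolding 1 sqrt_mult_powr[OF assms(2), symmetric] by simp
 moreover have "\<epsilon> powr (1 - d) = inverse (\<epsilon> powr (d - 1))" "t powr (- d / 2) = inverse (t powr (d / 2))"
  using powr_minus[of \<epsilon> "d - 1"] powr_minus[of t "d / 2"] by simp_all
 ultimately show ?thesis by (simp only: divide_inverse inverse_mult_distrib mult.assoc)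
qed

text \<open>\<open>diag_step\<close> with \<open>R\<close> proportional to \<open>sqrt t\<close>
  reproduces the rate \<open>t powr (- d / 2)\<close> with the same constant \<open>B\<close> when
  \<open>t\<close> becomes \<open>4 * t\<close>. The start is the period from \<open>t0\<close> to
  \<open>4 * t0\<close>, where the local bound suffices.\<close>

lemma diag_large_time:
 obtains B t0 where "B > 0" "t0 > 0" "!!t x. t >= t0 ==> k t x x <= B * t powr (- d / 2)"
proof -
 obtain C R0 where C: "C > 0" "R0 >= 1" and occ: "!!R t x. R >= R0 ==> R^2 <= t ==>
  EX s. t < s & s < 2 * t & ebd s x (indicator {-R..R}) (C * R^2 / t)" by (rule occupation_bound) blast
 \<comment> \<open>The factor that one step must gain, \<open>4 powr (- d / 2)\<close>. It is split
   into halves: \<open>\<epsilon>\<close> makes the term linear in \<open>B\<close> at most one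
   half, and a large \<open>B\<close> does the same for the square-root term.\<close>
 define c where "c = (2::real) powr (- d)"
 have c: "0 < c" by (simp add: c_def)
 define \<epsilon> where "\<epsilon> = sqrt (min 1 (c / (2 * C)))"
 have e: "0 < \<epsilon>" "\<epsilon>^2 <= 1" "C * \<epsilon>^2 <= c / 2"
 proof -
  have "0 < min 1 (c / (2 * C))" using c C by simp
  then show "0 < \<epsilon>" and e2: "\<epsilon>^2 <= 1" by (auto simp: \<epsilon>_def)
  have "\<epsilon>^2 <= c / (2 * C)" using \<open>0 < min 1 (c / (2 * C))\<close> by (simp add: \<epsilon>_def)
  then show "C * \<epsilon>^2 <= c / 2" using C by (simp add: field_simps)
 qed
 define t0 where "t0 = (R0 / \<epsilon>)^2"
 have t0: "t0 > 0" using C e by (simp add: t0_def)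
 define D where "D = 2 * \<epsilon> powr (1 - d)"
 have D: "D > 0" using e by (simp add: D_def)
 \<comment> \<open>The first entry gives \<open>sqrt (D * B) <= c / 2 * B\<close>; the second covers
   the initial period.\<close>
 define B where "B = max (4 * D / c^2) (2 * (4 * t0) powr (d / 2) / sqrt t0)"
 have B: "B >= 4 * D / c^2" "B > 0" "2 * (4 * t0) powr (d / 2) / sqrt t0 <= B"
  using D c unfolding B_def by (auto simp: less_max_iff_disj)
 have step: "ALL x. k (4 * t) x x <= B * (4 * t) powr (- d / 2)" if t: "t >= t0" and IH: "ALL x. k t x x <= B * t powr (- d / 2)" for t
 proof
  fix x
  define p where "p = t powr (- d / 2)"
  have tp: "t > 0" using t t0 by linarith
  have p: "p > 0" using tp by (simp add: p_def)
  have R: "\<epsilon> * sqrt t >= R0"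
  proof -
   have "R0 / \<epsilon> = sqrt t0" unfolding t0_def using C e by (intro real_sqrt_unique[symmetric]) auto
   then have "R0 / \<epsilon> <= sqrt t" using t by simp
   then show ?thesis using e by (simp add: field_simps)
  qed
  have R2: "(\<epsilon> * sqrt t)^2 = \<epsilon>^2 * t" using tp by (simp add: power_mult_distrib)
  have "\<epsilon>^2 * t <= t" using e tp by simp
  then obtain s where s: "t < s" "s < 2 * t" "ebd s x (indicator {-(\<epsilon> * sqrt t)..\<epsilon> * sqrt t}) (C * (\<epsilon> * sqrt t)^2 / t)"
   using occ[OF R, of t x] R2 by auto
  have bp: "2 / (sqrt t * (\<epsilon> * sqrt t) powr (d - 1)) = D * p"
   unfolding D_def p_def by (rule inverse_powr_sqrt[OF e(1) tp])
  have "k (4 * t) x x <= (C * (\<epsilon> * sqrt t)^2 / t) * (B * p) + sqrt (2 / (sqrt t * (\<epsilon> * sqrt t) powr (d - 1)) * (B * p))"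
   by (rule diag_step[OF s(3,1,2)]) (use e tp IH in \<open>auto simp: p_def\<close>)
  also have "... = C * \<epsilon>^2 * (B * p) + sqrt (D * B * p^2)"
   unfolding bp R2 using tp by (simp add: power2_eq_square mult_ac)
  also have "... <= c / 2 * (B * p) + c / 2 * (B * p)"
  proof (rule add_mono)
   show "C * \<epsilon>^2 * (B * p) <= c / 2 * (B * p)" using e B p by (intro mult_right_mono) auto
   show "sqrt (D * B * p^2) <= c / 2 * (B * p)"
   proof (rule real_le_lsqrt)
    have "4 * D <= B * c^2" using B(1) c by (simp add: pos_divide_le_eq)
    then have "D * B * p^2 <= (B * c^2 / 4) * B * p^2" using B by (intro mult_right_mono) auto
    then show "D * B * p^2 <= (c / 2 * (B * p))^2" by (simp add: power2_eq_square mult_ac)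
   qed (use B D c p in auto)
  qed
  also have "... = B * (4 * t) powr (- d / 2)"
  proof -
   have "(4::real) powr (- d / 2) = (2 powr 2) powr (- d / 2)" by simp
   also have "... = c" unfolding powr_powr c_def by simp
   finally show ?thesis using tp by (simp add: powr_mult p_def)
  qed
  finally show "k (4 * t) x x <= B * (4 * t) powr (- d / 2)" .
 qed
 have base: "ALL x. k t x x <= B * t powr (- d / 2)" if "t0 <= t" "t <= 4 * t0" for t
 proof
  fix x
  have "k t x x <= 2 / (sqrt t * w x)" using that t0 by (intro k_diag) auto
  also have "... <= 2 / (sqrt t0 * 1)" using that t0 w_ge_1[of x] w_pos[of x]
   by (intro divide_left_mono mult_mono mult_pos_pos) auto
  also have "... = 2 * (4 * t0) powr (d / 2) / sqrt t0 * (4 * t0) powr (- d / 2)"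
   using t0 by (simp add: powr_minus)
  also have "... <= B * (4 * t0) powr (- d / 2)" using B by (intro mult_right_mono) auto
  also have "... <= B * t powr (- d / 2)" using that t0 d B by (intro mult_left_mono powr_mono2') auto
  finally show "k t x x <= B * t powr (- d / 2)" .
 qed
 have "ALL t. 4 ^ n * t0 <= t & t <= 4 ^ Suc n * t0 --> (ALL x. k t x x <= B * t powr (- d / 2))" for n
 proof (induction n)
  case 0 then show ?case using base by simp
 next
  case (Suc n)
  show ?case
  proof (intro allI impI)
   fix t x assume a: "4 ^ Suc n * t0 <= t & t <= 4 ^ Suc (Suc n) * t0"
   have "1 * t0 <= 4 ^ n * t0" using t0 by (intro mult_right_mono one_le_power) auto
   moreover have "4 ^ n * t0 <= t / 4" "t / 4 <= 4 ^ Suc n * t0" using a by auto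
   ultimately have "t / 4 >= t0" "ALL x. k (t / 4) x x <= B * (t / 4) powr (- d / 2)" using Suc by auto
   from step[OF this] show "k t x x <= B * t powr (- d / 2)" by simp
  qed
 qed
 moreover have "EX n. 4 ^ n * t0 <= t & t <= 4 ^ Suc n * t0" if "t >= t0" for t
 proof -
  obtain m where m: "t / t0 < 4 ^ m" using real_arch_pow[of 4 "t / t0"] by auto
  define n where "n = (LEAST m. t / t0 < 4 ^ m)"
  have n: "t / t0 < 4 ^ n" unfolding n_def by (rule LeastI[where P = "%m. t / t0 < 4 ^ m", OF m])
  have "n ~= 0" using n that t0 by (cases n) (auto simp: field_simps)
  then obtain j where j: "n = Suc j" using not0_implies_Suc by blast
  have "~ t / t0 < 4 ^ j" using not_less_Least[of j "%m. t / t0 < 4 ^ m"] j unfolding n_def[symmetric] by simp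
  then show ?thesis using n t0 unfolding j by (intro exI[of _ j]) (auto simp: field_simps)
 qed
 ultimately show thesis using that[OF B(2) t0] by blast
qed

text \<open>An explicit function comparable with the volume of the ball of radius
  \<open>sqrt t\<close> about the point with coordinate \<open>x\<close>; the comparison with the
  measure itself is postponed to \<open>ball_volume\<close>.\<close>

definition V :: "real => real => real" where
 "V t x = sqrt t * (1 + abs x + sqrt t) powr (d - 1)"

lemma V_pos: "t > 0 ==> V t x > 0"
proof -
 assume t: "t > 0"
 then have "0 < sqrt t" "1 + abs x + sqrt t ~= 0" using real_sqrt_gt_zero[OF t] by linarith+
 then show ?thesis by (simp add: V_def)
qed

text \<open>If \<open>sqrt t <= 1 + abs x\<close> the local bound is already of the right size; for
  bounded times near the gluing point the volumes differ by a constant only; for large times the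
  recursion applies.\<close>

lemma diag_upper:
 obtains C where "C > 0" "!!t x. t > 0 ==> k t x x <= C / V t x"
proof -
 obtain B t0 where B: "B > 0" "t0 > 0" "!!t x. t >= t0 ==> k t x x <= B * t powr (- d / 2)"
  by (rule diag_large_time) blast
 define C where "C = 2 powr (d - 1) * max B (2 * max 1 (t0 powr ((d - 1) / 2)))"
 show thesis
 proof (rule that)
  show "C > 0" using B by (simp add: C_def less_max_iff_disj)
  fix t x :: real assume t: "t > 0"
  have "k t x x * V t x <= C"
  proof -
   have kn: "0 <= k t x x" by (rule k_nonneg[OF t])
   have VD: "V t x <= 2 powr (d - 1) * (sqrt t * m powr (d - 1))" if "1 + abs x <= m" "sqrt t <= m" for m
   proof -
    have "(1 + abs x + sqrt t) powr (d - 1) <= (2 * m) powr (d - 1)" using that t d by (intro powr_mono2) auto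
    also have "... = 2 powr (d - 1) * m powr (d - 1)" using that by (simp add: powr_mult)
    finally show ?thesis unfolding V_def using t by (simp add: mult.left_commute[of "sqrt t"])
   qed
   have w1: "k t x x * (sqrt t * w x) <= 2"
    using k_diag[OF t, of x] t w_pos[of x] by (simp add: pos_le_divide_eq)
   have "k t x x * V t x <= 2 powr (d - 1) * max B (2 * max 1 (t0 powr ((d - 1) / 2)))"
   proof -
    consider "sqrt t <= 1 + abs x" | "1 + abs x < sqrt t" "t < t0" | "1 + abs x < sqrt t" "t0 <= t" by linarith
    then show ?thesis
    proof cases
     case 1
     have "k t x x * V t x <= k t x x * (2 powr (d - 1) * (sqrt t * w x))"
      unfolding w_def by (intro mult_left_mono VD kn) (use 1 in auto)
     also have "... = 2 powr (d - 1) * (k t x x * (sqrt t * w x))" by simp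
     also have "... <= 2 powr (d - 1) * max B (2 * max 1 (t0 powr ((d - 1) / 2)))" using w1 by (intro mult_left_mono) auto
     finally show ?thesis .
    next
     case 2
     have "k t x x * V t x <= k t x x * (2 powr (d - 1) * (sqrt t * sqrt t powr (d - 1)))"
      by (intro mult_left_mono VD kn) (use 2 in auto)
     also have "... = 2 powr (d - 1) * (k t x x * (sqrt t * 1)) * sqrt t powr (d - 1)" by simp
     also have "... <= 2 powr (d - 1) * (k t x x * (sqrt t * w x)) * t0 powr ((d - 1) / 2)"
     proof (intro mult_mono mult_left_mono w_ge_1 kn)
      have "sqrt t powr (d - 1) = t powr ((d - 1) / 2)" by (rule sqrt_powr[OF t])
      also have "... <= t0 powr ((d - 1) / 2)" using 2 t d by (intro powr_mono2) auto
      finally show "sqrt t powr (d - 1) <= t0 powr ((d - 1) / 2)" .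
     qed (use kn t w_pos[of x] in auto)
     also have "... <= 2 powr (d - 1) * 2 * t0 powr ((d - 1) / 2)" using w1 by (intro mult_right_mono mult_left_mono) auto
     also have "... = 2 powr (d - 1) * (2 * t0 powr ((d - 1) / 2))" by simp
     also have "... <= 2 powr (d - 1) * max B (2 * max 1 (t0 powr ((d - 1) / 2)))" by (intro mult_left_mono) auto
     finally show ?thesis .
    next
     case 3
     have "k t x x * V t x <= (B * t powr (- d / 2)) * (2 powr (d - 1) * (sqrt t * sqrt t powr (d - 1)))"
      by (intro mult_mono VD B) (use 3 kn B t V_pos[OF t, of x] in auto)
     also have "sqrt t * sqrt t powr (d - 1) = t powr (d / 2)" by (rule sqrt_mult_powr[OF t])
     also have "(B * t powr (- d / 2)) * (2 powr (d - 1) * t powr (d / 2)) = 2 powr (d - 1) * B * (t powr (- d / 2) * t powr (d / 2))" by simp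
     also have "t powr (- d / 2) * t powr (d / 2) = 1" using t by (simp add: powr_add[symmetric])
     finally have "k t x x * V t x <= 2 powr (d - 1) * B" by simp
     also have "... <= 2 powr (d - 1) * max B (2 * max 1 (t0 powr ((d - 1) / 2)))" by (intro mult_left_mono) auto
     finally show ?thesis .
    qed
   qed
   then show ?thesis by (simp add: C_def)
  qed
  then show "k t x x <= C / V t x" using V_pos[OF t, of x] by (simp add: pos_le_divide_eq)
 qed
qed

end

section \<open>Off-diagonal upper bounds\<close>

text \<open>Half of the Gaussian exponent absorbs a linear exponential in \<open>r / sqrt t\<close>.
  Such factors arise whenever the centre of a volume is moved.\<close>

lemma gauss_absorb:
 fixes t c b r :: real
 assumes "t > 0" "c > 0"
 shows "exp (b * r / sqrt t) * exp (- (r^2 / (c * t))) <= exp (b^2 * c / 2) * exp (- (r^2 / (2 * c * t)))"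
proof -
 have "2 * (r / sqrt (c * t)) * (b * sqrt c) <= (r / sqrt (c * t))^2 + (b * sqrt c)^2"
  using sum_squares_bound by blast
 moreover have "(r / sqrt (c * t)) * (b * sqrt c) = b * r / sqrt t" using assms by (simp add: real_sqrt_mult)
 moreover have "(r / sqrt (c * t))^2 = r^2 / (c * t)" "(b * sqrt c)^2 = b^2 * c"
  using assms by (simp_all add: power_divide power_mult_distrib)
 moreover have "r^2 / (2 * c * t) = r^2 / (c * t) / 2" by simp
 ultimately have "b * r / sqrt t - r^2 / (c * t) <= b^2 * c / 2 - r^2 / (2 * c * t)" by linarith
 then show ?thesis unfolding exp_add[symmetric] by simp
qed

text \<open>Completing the square: a Gaussian lies below each of its tangent exponentials, which can
  be paired with exponential moments.\<close>

lemma gauss_linear: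
 fixes t c a r :: real
 assumes "t > 0" "c > 0"
 shows "exp (- (r^2 / (c * t))) <= exp (c * a^2 * t / 4 - a * r)"
proof -
 have "0 <= (r / sqrt (c * t) - a * sqrt (c * t) / 2)^2" by simp
 also have "... = r^2 / (c * t) + a^2 * (c * t) / 4 - a * r"
  using assms by (simp add: power2_diff power_divide power_mult_distrib)
 finally show ?thesis by (simp add: mult_ac)
qed

context heat_kernel
begin

text \<open>A shift by \<open>r\<close> multiplies the radius term by at most
  \<open>1 + r / sqrt t\<close>, since that term is at least \<open>sqrt t\<close>.\<close>

lemma V_le_exp:
 assumes "t > 0" "abs x <= abs y + r" "0 <= r"
 shows "V t x <= exp ((d - 1) * r / sqrt t) * V t y"
proof -
 let ?Y = "1 + abs y + sqrt t"
 have s: "sqrt t > 0" using assms by simp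
 have Y: "sqrt t <= ?Y" "?Y > 0" using s by linarith+
 have "1 + abs x + sqrt t <= ?Y + r" using assms by linarith
 also have "?Y + r <= ?Y * (1 + r / sqrt t)"
 proof -
  have "r * sqrt t <= r * ?Y" using Y(1) assms(3) by (rule mult_left_mono)
  then show ?thesis using s by (simp add: field_simps)
 qed
 also have "... <= ?Y * exp (r / sqrt t)" using Y exp_ge_add_one_self by (intro mult_left_mono) auto
 finally have "(1 + abs x + sqrt t) powr (d - 1) <= (?Y * exp (r / sqrt t)) powr (d - 1)"
  using s d by (intro powr_mono2) linarith+
 also have "... = ?Y powr (d - 1) * exp ((d - 1) * r / sqrt t)"
  by (simp add: powr_mult exp_powr_real)
 finally show ?thesis unfolding V_def using s by (simp add: mult_ac)
qed

lemma V_mono: "0 < s ==> s <= t ==> V s x <= V t x"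
 unfolding V_def using d by (intro mult_mono powr_mono2) auto

lemma V_doubling:
 assumes "0 < s" "t <= 4 * s"
 shows "V t x <= 2 powr d * V s x"
proof -
 have "sqrt t <= sqrt (2^2 * s)" using assms by simp
 then have q: "sqrt t <= 2 * sqrt s" by (simp add: real_sqrt_mult)
 have s: "sqrt s > 0" using assms by simp
 consider "t >= 0" | "t < 0" by linarith
 then show ?thesis
 proof cases
  case 1
  have "V t x <= (2 * sqrt s) * (2 * (1 + abs x + sqrt s)) powr (d - 1)"
   unfolding V_def using q s 1 d by (intro mult_mono powr_mono2) auto
  also have "(2 * (1 + abs x + sqrt s)) powr (d - 1) = 2 powr (d - 1) * (1 + abs x + sqrt s) powr (d - 1)" by (rule powr_mult)
  also have "(2 * sqrt s) * (2 powr (d - 1) * (1 + abs x + sqrt s) powr (d - 1)) = 2 * 2 powr (d - 1) * V s x" by (simp add: V_def)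
  also have "2 * 2 powr (d - 1) = 2 powr d" by (simp add: powr_diff)
  finally show ?thesis .
 next
  case 2
  then have "V t x <= 0" unfolding V_def by (intro mult_nonpos_nonneg) auto
  moreover have "0 <= 2 powr d * V s x" using V_pos[OF assms(1), of x] by simp
  ultimately show ?thesis by linarith
 qed
qed

lemma k_le_exp:
 obtains C where "C > 0" "!!t x z. t > 0 ==> k t x z <= C / V t x * exp ((d - 1) * abs (abs z - abs x) / sqrt t)"
proof -
 obtain C where C: "C > 0" "!!t x. t > 0 ==> k t x x <= C / V t x" by (rule diag_upper) blast
 show thesis
 proof (rule that[OF C(1)])
  fix t x z :: real assume t: "t > 0"
  let ?e = "exp ((d - 1) * abs (abs z - abs x) / sqrt t)"
  have e: "1 <= ?e" using d t by simp
  have Vx: "V t x > 0" and Vz: "V t z > 0" using V_pos[OF t] by auto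
  have "V t x <= ?e * V t z" by (rule V_le_exp[OF t]) auto
  then have "C / V t z <= C / V t x * ?e" using Vx Vz C by (simp add: field_simps)
  then have z: "k t z z <= C / V t x * ?e" using C(2)[OF t, of z] by linarith
  have "C / V t x * 1 <= C / V t x * ?e" using e C Vx by (intro mult_left_mono) auto
  then have x: "k t x x <= C / V t x * ?e" using C(2)[OF t, of x] by linarith
  have "k t x x * k t z z <= (C / V t x * ?e) * (C / V t x * ?e)"
   using x z k_nonneg[OF t] C Vx by (intro mult_mono) auto
  then have "sqrt (k t x x * k t z z) <= C / V t x * ?e"
   using C Vx by (intro real_le_lsqrt) (auto simp: power2_eq_square)
  then show "k t x z <= C / V t x * ?e" using k_le_diag[OF t, of x z] by linarith
 qed
qed

text \<open>At the midpoint \<open>z\<close> the modulus is away by at least half of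
  \<open>abs (abs x - abs y)\<close> from that of \<open>x\<close> or that of \<open>y\<close>. In
  each case an exponential weight is inserted, and the integral is bounded by a moment of
  \<open>abs (abs z - abs x)\<close> or its mirror image. Only moduli appear, so nothing is gained
  here from crossing the gluing point.\<close>

lemma k_le_gauss_modulus:
 obtains C c where "C > 0" "c > 0"
  "!!t x y. t > 0 ==> k t x y <= C / V t x * exp (- ((abs x - abs y)^2 / (c * t)))"
proof -
 obtain D where D: "D > 0" "!!t x z. t > 0 ==> k t x z <= D / V t x * exp ((d - 1) * abs (abs z - abs x) / sqrt t)"
  by (rule k_le_exp) blast
 have K: "K0 > 0" using d by simp
 define c where "c = 32 * K0"
 have c: "c > 0" using K by (simp add: c_def)
 let ?B = "exp ((2 * (d - 1))^2 * c / 2)"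
 define E where "E = D * (5 * exp 1 * exp (2 * K0 * (d - 1)^2))"
 define A where "A = 2 * E"
 have E: "E > 0" and A: "A > 0" using D by (auto simp: E_def A_def)
 have main: "k (t + t) x y <= A * ?B / V t x * exp (- ((abs x - abs y)^2 / (2 * c * t)))" if t: "t > 0" for t x y
 proof -
  define r where "r = abs (abs x - abs y)"
  \<comment> \<open>The minimiser of \<open>2 * K0 * \<alpha>^2 * t - \<alpha> * r / 2\<close>; the
    minimum is \<open>- r^2 / (32 * K0 * t)\<close>, which explains \<open>c\<close>. The additional
    rate \<open>\<beta>\<close> absorbs the growth permitted by \<open>k_le_exp\<close>.\<close>
  define \<alpha> where "\<alpha> = r / (8 * K0 * t)"
  define \<beta> where "\<beta> = (d - 1) / sqrt t"
  have r: "r >= 0" by (simp add: r_def)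
  have \<alpha>: "\<alpha> >= 0" and \<beta>: "\<beta> > 0" using r K t d by (auto simp: \<alpha>_def \<beta>_def)
  have V: "V t z > 0" for z by (rule V_pos[OF t])
  let ?e = "%x z. exp (\<alpha> * (abs (abs z - abs x) - r / 2))"
  let ?g = "exp (2 * (\<beta> * r)) * exp (- (r^2 / (c * t)))"
  have sq: "K0 * (\<alpha> + \<beta>)^2 * t <= 2 * K0 * \<alpha>^2 * t + 2 * K0 * (d - 1)^2"
  proof -
   have "(\<alpha> + \<beta>)^2 <= 2 * \<alpha>^2 + 2 * \<beta>^2" using sum_squares_bound[of \<alpha> \<beta>] unfolding power2_sum by linarith
   then have "K0 * t * (\<alpha> + \<beta>)^2 <= K0 * t * (2 * \<alpha>^2 + 2 * \<beta>^2)" using K t by (intro mult_left_mono) auto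
   moreover have "t * \<beta>^2 = (d - 1)^2" using t by (simp add: \<beta>_def power_divide)
   moreover have "K * t * (2 * a + 2 * b) = 2 * K * a * t + 2 * K * (t * b)" "K * t * p = K * p * t" for K a b p :: real
    by (simp_all add: algebra_simps)
   ultimately show ?thesis by (simp only:)
  qed
  have half: "ebd t x (%z. k t y z * ?e x z) (E / v * ?g)"
   if xy: "abs (abs x - abs y) = r" and v: "v > 0" "1 / V t y <= exp (\<beta> * r) / v" for x y v
  proof -
   let ?q = "D / V t y * exp (\<beta> * r - \<alpha> * r / 2)"
   have q: "0 <= ?q" using D V[of y] by simp
   have "ebd t x (%z. ?q * exp ((\<alpha> + \<beta>) * abs (abs z - abs x))) (?q * (5 * exp 1 * exp (K0 * (\<alpha> + \<beta>)^2 * t)))"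
    by (intro ebd_cmult ebd_exp_diff t q) (use \<alpha> \<beta> in auto)
   then show ?thesis
   proof (rule ebd_mono[OF _ t])
    fix z
    have "abs (abs z - abs y) <= abs (abs z - abs x) + r" using xy by linarith
    then have "\<beta> * abs (abs z - abs y) <= \<beta> * (abs (abs z - abs x) + r)" using \<beta> by (intro mult_left_mono) auto
    then have "D / V t y * exp ((d - 1) * abs (abs z - abs y) / sqrt t) <= D / V t y * exp (\<beta> * (abs (abs z - abs x) + r))"
     using D V[of y] by (intro mult_left_mono) (auto simp: \<beta>_def)
    from mult_right_mono[OF order_trans[OF D(2)[OF t] this], of "?e x z"]
    have "k t y z * ?e x z <= D / V t y * (exp (\<beta> * (abs (abs z - abs x) + r)) * ?e x z)" by (simp add: mult.assoc)
    also have "exp (\<beta> * (abs (abs z - abs x) + r)) * ?e x z = exp (\<beta> * r - \<alpha> * r / 2) * exp ((\<alpha> + \<beta>) * abs (abs z - abs x))"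
     unfolding exp_add[symmetric] by (simp add: algebra_simps)
    finally show "k t y z * ?e x z <= ?q * exp ((\<alpha> + \<beta>) * abs (abs z - abs x))" by (simp add: mult.assoc)
    have m: "exp (\<beta> * r - \<alpha> * r / 2) * exp (K0 * (\<alpha> + \<beta>)^2 * t) <= exp (2 * K0 * (d - 1)^2) * (exp (\<beta> * r) * exp (- (r^2 / (c * t))))"
    proof -
     have "- k * r / 2 + 2 * K * k^2 * t = - (r^2 / (32 * K * t))" if "K > 0" "k = r / (8 * K * t)" for K k
      unfolding that(2) using t that(1) by (simp add: power2_eq_square field_simps)
     from this[OF K \<alpha>_def] show ?thesis unfolding exp_add[symmetric] c_def using sq by simp
    qed
    have "D * (5 * exp 1) * ((1 / V t y) * (exp (\<beta> * r - \<alpha> * r / 2) * exp (K0 * (\<alpha> + \<beta>)^2 * t)))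
      <= D * (5 * exp 1) * ((exp (\<beta> * r) / v) * (exp (2 * K0 * (d - 1)^2) * (exp (\<beta> * r) * exp (- (r^2 / (c * t))))))"
     by (rule mult_left_mono[OF mult_mono[OF v(2) m]]) (use D v in auto)
    then show "?q * (5 * exp 1 * exp (K0 * (\<alpha> + \<beta>)^2 * t)) <= E / v * ?g"
     unfolding mult_2 exp_add E_def by (simp add: mult_ac)
   qed (use t k_nonneg in auto)
  qed
  have "V t x <= exp ((d - 1) * r / sqrt t) * V t y" by (rule V_le_exp[OF t]) (auto simp: r_def)
  then have "1 / V t y <= exp (\<beta> * r) / V t x" using V[of x] V[of y] by (simp add: \<beta>_def field_simps)
  then have 1: "ebd t x (%z. k t y z * ?e x z) (E / V t x * ?g)" by (intro half V) (simp_all add: r_def)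
  have "1 / V t x <= exp (\<beta> * r) / V t x" using V[of x] \<beta> r by (intro divide_right_mono) auto
  then have 2: "ebd t y (%z. k t x z * ?e y z) (E / V t x * ?g)" by (intro half V) (simp_all add: r_def abs_minus_commute)
  note i = conjunct1[OF conjunct2[OF 1[unfolded ebd_def]]] conjunct1[OF conjunct2[OF 2[unfolded ebd_def]]]
  have "k (t + t) x y = (LINT z|nu. k t x z * k t y z)" unfolding k_semi[OF t t] L2_inner_def ..
  also have "... <= (LINT z|nu. k t x z * (k t y z * ?e x z) + k t y z * (k t x z * ?e y z))"
  proof (rule integral_mono[OF L2_mult_integrable[OF k_L2[OF t] k_L2[OF t]] Bochner_Integration.integrable_add[OF i]])
   fix z
   \<comment> \<open>At least one of the two weights is at least \<open>1\<close> at every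
     \<open>z\<close>, so their sum may be inserted for free.\<close>
   have "r <= abs (abs z - abs x) + abs (abs z - abs y)" unfolding r_def by linarith
   then have "0 <= abs (abs z - abs x) - r / 2 \<or> 0 <= abs (abs z - abs y) - r / 2" by linarith
   then have "1 <= ?e x z \<or> 1 <= ?e y z" using \<alpha> by auto
   then have "1 <= ?e x z + ?e y z" by (metis add_increasing add_increasing2 exp_ge_zero)
   from mult_left_mono[OF this mult_nonneg_nonneg[OF k_nonneg[OF t] k_nonneg[OF t]], of x z y z]
   show "k t x z * k t y z <= k t x z * (k t y z * ?e x z) + k t y z * (k t x z * ?e y z)" by (simp add: algebra_simps)
  qed
  also have "... <= E / V t x * ?g + E / V t x * ?g"
   unfolding Bochner_Integration.integral_add[OF i] using 1 2 by (intro add_mono) (auto simp: ebd_def)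
  also have "... = A / V t x * (exp (2 * (d - 1) * r / sqrt t) * exp (- (r^2 / (c * t))))" by (simp add: A_def \<beta>_def)
  also have "... <= A / V t x * (?B * exp (- (r^2 / (2 * c * t))))"
   using gauss_absorb[OF t c, of "2 * (d - 1)" r] A V[of x] by (intro mult_left_mono) auto
  finally show ?thesis by (simp add: r_def)
 qed
 show thesis
 proof (rule that)
  show "0 < A * ?B * 2 powr d" using A by simp
  show "0 < c" by (rule c)
  fix t x y :: real assume t: "t > 0"
  have Vx: "V (t / 2) x > 0" "V t x > 0" using V_pos t by auto
  have "V t x <= 2 powr d * V (t / 2) x" using t by (intro V_doubling) auto
  then have le: "1 / V (t / 2) x <= 2 powr d / V t x" using Vx by (simp add: field_simps)
  have "k t x y <= A * ?B / V (t / 2) x * exp (- ((abs x - abs y)^2 / (c * t)))"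
   using main[of "t / 2" x y] t by simp
  also have "... = (A * ?B) * (1 / V (t / 2) x) * exp (- ((abs x - abs y)^2 / (c * t)))" by simp
  also have "... <= (A * ?B) * (2 powr d / V t x) * exp (- ((abs x - abs y)^2 / (c * t)))"
   using A by (intro mult_right_mono mult_left_mono le) auto
  finally show "k t x y <= A * ?B * 2 powr d / V t x * exp (- ((abs x - abs y)^2 / (c * t)))" by simp
 qed
qed

end

section \<open>Upper bounds across the gluing point\<close>

context heat_kernel
begin

abbreviation U :: "real => real" where "U x == (1 + abs x) powr (2 - d)"

lemma V_uminus [simp]: "V t (- x) = V t x"
 by (simp add: V_def)

text \<open>With the midpoint \<open>z\<close> on the side of \<open>y\<close>, the Gaussian between
  \<open>y\<close> and \<open>z\<close> is replaced by a tangent exponential growing in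
  \<open>abs z\<close>, and the one-sided moment from \<open>x\<close> contributes both the crossing
  factor and the decay in \<open>abs x\<close>. Together the exponents contain the full distance
  \<open>abs x + abs y\<close>.\<close>

lemma half_opposite_upper:
 obtains C c where "C > 0" "c > 0"
  "!!t x y. t > 0 ==> x >= 0 ==> y <= 0 ==>
   ebd t x (%z. if z <= 0 then k t y z else 0) (C * U x / V t x * exp (- ((x - y)^2 / (c * t))))"
proof -
 obtain A a where A: "A > 0" "a > 0" and G:
  "!!t x y. t > 0 ==> k t x y <= A / V t x * exp (- ((abs x - abs y)^2 / (a * t)))"
  by (rule k_le_gauss_modulus) blast
 \<comment> \<open>The coefficient of \<open>\<alpha>^2 * t\<close>: \<open>a / 4\<close> from the
   tangent exponential and \<open>K0\<close> from the moment.\<close>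
 define m where "m = a / 4 + K0"
 have m: "m > 0" using A d by (simp add: m_def)
 let ?B = "exp ((d - 1)^2 * (4 * m) / 2)"
 show thesis
 proof (rule that)
  show "0 < A * exp 2 * ?B" "0 < 2 * (4 * m)" using A m by auto
  fix t x y :: real assume t: "t > 0" and x: "x >= 0" and y: "y <= 0"
  have V: "V t x > 0" "V t y > 0" using V_pos[OF t] by auto
  define r where "r = x - y"
  have r: "r = abs x + abs y" "r >= 0" using x y by (auto simp: r_def)
  let ?f = "%z. if z <= 0 then k t y z else 0"
  have meas: "meas ?f" using t by measurable
  have f0: "0 <= ?f z" for z using k_nonneg[OF t] by simp
  show "ebd t x ?f (A * exp 2 * ?B * U x / V t x * exp (- ((x - y)^2 / (2 * (4 * m) * t))))"
  \<comment> \<open>The moment bounds need \<open>\<alpha> > 0\<close>, so coinciding points at the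
    gluing point are treated apart; there the crossing factor is \<open>1\<close>.\<close>
  proof (cases "r = 0")
   case True
   then have z: "x = 0" "y = 0" using r by auto
   have "ebd t x ?f (A / V t x)"
   proof (rule ebd_bounded[OF t meas f0])
    fix z
    have "k t y z <= A / V t x * exp (- ((abs y - abs z)^2 / (a * t)))" using G[OF t, of y z] z by simp
    also have "... <= A / V t x * 1" using A V t by (intro mult_left_mono) auto
    finally show "?f z <= A / V t x" using A V by simp
   qed
   then show ?thesis
   proof (rule ebd_mono[OF _ t meas f0 order_refl])
    have "1 * 1 <= exp 2 * ?B" using m by (intro mult_mono) auto
    then have "A / V t x * 1 <= A / V t x * (exp 2 * ?B)" using A V by (intro mult_left_mono) auto
    then show "A / V t x <= A * exp 2 * ?B * U x / V t x * exp (- ((x - y)^2 / (2 * (4 * m) * t)))" using z by simp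
   qed
  next
   case False
   then have r0: "r > 0" using r by simp
   \<comment> \<open>The minimiser of \<open>m * \<alpha>^2 * t - \<alpha> * r\<close>, with the
     minimum \<open>- r^2 / (4 * m * t)\<close>.\<close>
   define \<alpha> where "\<alpha> = r / (2 * m * t)"
   have \<alpha>: "\<alpha> > 0" using r0 m t by (simp add: \<alpha>_def)
   let ?q = "A / V t y * exp (a * \<alpha>^2 * t / 4 - \<alpha> * abs y)"
   have q: "0 <= ?q" using A V by simp
   have "ebd t x (%z. ?q * (if z <= 0 then exp (\<alpha> * abs z) else 0)) (?q * (exp 2 * U x * exp (K0 * \<alpha>^2 * t - \<alpha> * abs x)))"
    by (intro ebd_cmult ebd_exp_left \<alpha> t x q)
   then show ?thesis
   proof (rule ebd_mono[OF _ t meas f0])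
    fix z
    show "?f z <= ?q * (if z <= 0 then exp (\<alpha> * abs z) else 0)"
    proof (cases "z <= 0")
     case True
     have "k t y z <= A / V t y * exp (- ((abs y - abs z)^2 / (a * t)))" by (rule G[OF t])
     also have "... <= A / V t y * exp (a * \<alpha>^2 * t / 4 - \<alpha> * (abs y - abs z))"
      using gauss_linear[OF t A(2), of "abs y - abs z" \<alpha>] A V by (intro mult_left_mono) auto
     also have "exp (a * \<alpha>^2 * t / 4 - \<alpha> * (abs y - abs z)) = exp (a * \<alpha>^2 * t / 4 - \<alpha> * abs y) * exp (\<alpha> * abs z)"
      unfolding exp_add[symmetric] by (simp add: algebra_simps)
     finally show ?thesis using True by (simp add: mult.assoc)
    qed simp
    have "V t x <= exp ((d - 1) * r / sqrt t) * V t y" by (rule V_le_exp[OF t]) (auto simp: r)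
    then have VV: "1 / V t y <= exp ((d - 1) * r / sqrt t) / V t x" using V by (simp add: field_simps)
    have e: "a * \<alpha>^2 * t / 4 - \<alpha> * abs y + (K0 * \<alpha>^2 * t - \<alpha> * abs x) = - (r^2 / (4 * m * t))"
    proof -
     have "a * \<alpha>^2 * t / 4 - \<alpha> * abs y + (K0 * \<alpha>^2 * t - \<alpha> * abs x) = m * \<alpha>^2 * t - \<alpha> * r"
      unfolding m_def r(1) by (simp add: algebra_simps)
     also have "... = - (r^2 / (4 * m * t))"
      unfolding \<alpha>_def using m t by (simp add: power2_eq_square field_simps)
     finally show ?thesis .
    qed
    have "?q * (exp 2 * U x * exp (K0 * \<alpha>^2 * t - \<alpha> * abs x)) = (A * exp 2 * U x) * (1 / V t y) * exp (- (r^2 / (4 * m * t)))"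
     unfolding e[symmetric] exp_add by simp
    also have "... <= (A * exp 2 * U x) * (exp ((d - 1) * r / sqrt t) / V t x) * exp (- (r^2 / (4 * m * t)))"
     using A by (intro mult_right_mono mult_left_mono VV) auto
    also have "... = A * exp 2 * U x / V t x * (exp ((d - 1) * r / sqrt t) * exp (- (r^2 / (4 * m * t))))" by simp
    also have "... <= A * exp 2 * U x / V t x * (?B * exp (- (r^2 / (2 * (4 * m) * t))))"
     using gauss_absorb[OF t, of "4 * m" "d - 1" r] m A V by (intro mult_left_mono) auto
    finally show "?q * (exp 2 * U x * exp (K0 * \<alpha>^2 * t - \<alpha> * abs x)) <= A * exp 2 * ?B * U x / V t x * exp (- ((x - y)^2 / (2 * (4 * m) * t)))"
     by (simp add: r_def mult_ac)
   qed
  qed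
 qed
qed

text \<open>The midpoint is classified by its side. On the side of \<open>y\<close> the passage is
  charged to \<open>x\<close>; on the side of \<open>x\<close> it is charged to \<open>y\<close> by
  reflection. This is where the sum of the two powers comes from.\<close>

lemma opposite_upper:
 obtains C c where "C > 0" "c > 0"
  "!!t x y. t > 0 ==> x >= 0 ==> y <= 0 ==> k t x y <= C * (U x + U y) / V t x * exp (- ((x - y)^2 / (c * t)))"
proof -
 interpret R: heat_kernel d "%t x y. k t (- x) (- y)" by (rule heat_kernel_uminus)
 obtain C1 c1 where C1: "C1 > 0" "c1 > 0" and L:
  "!!t x y. t > 0 ==> x >= 0 ==> y <= 0 ==>
   ebd t x (%z. if z <= 0 then k t y z else 0) (C1 * U x / V t x * exp (- ((x - y)^2 / (c1 * t))))"
  by (rule half_opposite_upper) blast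
 obtain C2 c2 where C2: "C2 > 0" "c2 > 0" and L':
  "!!t x y. t > 0 ==> x >= 0 ==> y <= 0 ==>
   R.ebd t x (%z. if z <= 0 then k t (- y) (- z) else 0) (C2 * U x / V t x * exp (- ((x - y)^2 / (c2 * t))))"
  by (rule R.half_opposite_upper) blast
 define B where "B = exp ((d - 1)^2 * c2 / 2)"
 have B: "B >= 1" using C2 by (simp add: B_def)
 define c where "c = max c1 (2 * c2)"
 define C where "C = max C1 (C2 * B)"
 show thesis
 proof (rule that)
  show "0 < C * 2 powr d" "0 < c / 2" using C1 by (auto simp: C_def c_def less_max_iff_disj)
  fix t x y :: real assume t0: "t > 0" and x: "x >= 0" and y: "y <= 0"
  define t' where "t' = t / 2"
  have t: "t' > 0" "t = t' + t'" using t0 by (auto simp: t'_def)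
  have V: "V t' x > 0" "V t' y > 0" "V t x > 0" using V_pos t t0 by auto
  define r where "r = x - y"
  let ?e = "exp (- (r^2 / (c * t')))"
  have mono: "exp (- (r^2 / (b * t'))) <= ?e" if "0 < b" "b <= c" for b
  proof -
   have "r^2 / (c * t') <= r^2 / (b * t')" using that t by (intro divide_left_mono mult_right_mono) auto
   then show ?thesis by simp
  qed
  let ?f = "%z. if z <= 0 then k t' y z else 0" and ?g = "%z. if - z <= 0 then k t' x z else 0"
  have 1: "ebd t' x ?f (C * U x / V t' x * ?e)"
  proof (rule ebd_mono[OF L[OF t(1) x y] t(1)])
   show "C1 * U x / V t' x * exp (- ((x - y)^2 / (c1 * t'))) <= C * U x / V t' x * ?e"
    unfolding r_def[symmetric] using V C1
    by (intro mult_mono mono divide_right_mono mult_right_mono) (auto simp: C_def c_def)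
  qed (use t k_nonneg in auto)
  have 2: "ebd t' y ?g (C * U y / V t' x * ?e)"
  proof (rule ebd_mono[OF _ t(1)])
   show "ebd t' y ?g (C2 * U y / V t' y * exp (- (r^2 / (c2 * t'))))"
    using ebd_uminus[OF L'[OF t(1), of "- y" "- x"] t(1)] x y unfolding minus_minus by (simp add: r_def)
   have "V t' x <= exp ((d - 1) * r / sqrt t') * V t' y" by (rule V_le_exp[OF t(1)]) (use x y in \<open>auto simp: r_def\<close>)
   then have VV: "1 / V t' y <= exp ((d - 1) * r / sqrt t') / V t' x" using V by (simp add: field_simps)
   have "C2 * U y / V t' y * exp (- (r^2 / (c2 * t'))) = C2 * U y * (1 / V t' y) * exp (- (r^2 / (c2 * t')))" by simp
   also have "... <= C2 * U y * (exp ((d - 1) * r / sqrt t') / V t' x) * exp (- (r^2 / (c2 * t')))"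
    using C2 by (intro mult_right_mono mult_left_mono VV) auto
   also have "... = C2 * U y / V t' x * (exp ((d - 1) * r / sqrt t') * exp (- (r^2 / (c2 * t'))))" by simp
   also have "... <= C2 * U y / V t' x * (B * exp (- (r^2 / (2 * c2 * t'))))"
    unfolding B_def using C2 V by (intro mult_left_mono gauss_absorb t) auto
   also have "... = C2 * B * U y / V t' x * exp (- (r^2 / (2 * c2 * t')))" by simp
   also have "... <= C * U y / V t' x * ?e"
    using V C1 C2 by (intro mult_mono mono divide_right_mono mult_right_mono) (auto simp: C_def c_def)
   finally show "C2 * U y / V t' y * exp (- (r^2 / (c2 * t'))) <= C * U y / V t' x * ?e" .
  qed (use t k_nonneg in auto)
  have i: "integrable nu (%z. k t' x z * ?f z)" "integrable nu (%z. k t' y z * ?g z)"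
   using 1 2 by (auto simp: ebd_def)
  have "k t x y = (LINT z|nu. k t' x z * k t' y z)" unfolding t(2) k_semi[OF t(1) t(1)] L2_inner_def ..
  also have "... <= (LINT z|nu. k t' x z * ?f z + k t' y z * ?g z)"
  proof (rule integral_mono)
   show "integrable nu (%z. k t' x z * k t' y z)" using t by (intro L2_mult_integrable k_L2)
   show "integrable nu (%z. k t' x z * ?f z + k t' y z * ?g z)" by (intro Bochner_Integration.integrable_add i)
   show "k t' x z * k t' y z <= k t' x z * ?f z + k t' y z * ?g z" for z
    using k_nonneg[OF t(1)] by (auto simp: mult.commute)
  qed
  also have "... = (LINT z|nu. k t' x z * ?f z) + (LINT z|nu. k t' y z * ?g z)"
   by (rule Bochner_Integration.integral_add[OF i])
  also have "... <= C * U x / V t' x * ?e + C * U y / V t' x * ?e" using 1 2 by (intro add_mono) (auto simp: ebd_def)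
  also have "... = C * (U x + U y) * ?e * (1 / V t' x)" by (simp add: algebra_simps add_divide_distrib)
  also have "... <= C * (U x + U y) * ?e * (2 powr d / V t x)"
  proof -
   have "V t x <= 2 powr d * V t' x" using t by (intro V_doubling) auto
   then have "1 / V t' x <= 2 powr d / V t x" using V by (simp add: field_simps)
   then show ?thesis using C1 by (intro mult_left_mono) (auto simp: C_def)
  qed
  also have "... = C * 2 powr d * (U x + U y) / V t x * exp (- ((x - y)^2 / (c / 2 * t)))"
   by (simp add: r_def t'_def)
  finally show "k t x y <= C * 2 powr d * (U x + U y) / V t x * exp (- ((x - y)^2 / (c / 2 * t)))" .
 qed
qed

end

section \<open>Lower bounds near the diagonal\<close>

context bessel
begin

lemma nu_interval:
 assumes "a <= b"
 shows "integrable nu (indicator {a..b} :: real => real)"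
  and "(!!s. s \<in> {a..b} ==> w s <= M) ==> (LINT s|nu. indicator {a..b} s) <= M * (b - a)"
  and "(!!s. s \<in> {a..b} ==> m <= w s) ==> m * (b - a) <= (LINT s|nu. indicator {a..b} s)"
proof -
 have L: "integrable lborel (%s. c * indicator {a..b} s)" "(LINT s|lborel. c * indicator {a..b} s) = c * (b - a)" for c :: real
  using assms by auto
 obtain B where B: "!!s. s \<in> {a..b} ==> w s <= B"
  using compact_imp_bounded[OF compact_continuous_image[OF continuous_on_w compact_Icc[of a b]]]
  unfolding bounded_iff by (metis abs_le_D1 image_eqI real_norm_def)
 have i: "integrable lborel (%s. w s * indicator {a..b} s)"
 proof (rule Bochner_Integration.integrable_bound[OF L(1)[of B]])
  show "AE s in lborel. norm (w s * indicator {a..b} s) <= norm (B * indicator {a..b} s)"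
   using B w_pos by (intro AE_I2) (force simp: indicator_def abs_of_pos)
 qed measurable
 then show "integrable nu (indicator {a..b} :: real => real)" by (subst integrable_nu) auto
 have e: "(LINT s|nu. indicator {a..b} s) = (LINT s|lborel. w s * indicator {a..b} s)"
  by (subst integral_nu) auto
 show "(LINT s|nu. indicator {a..b} s) <= M * (b - a)" if "!!s. s \<in> {a..b} ==> w s <= M"
  unfolding e L(2)[symmetric] using that by (intro integral_mono i L) (auto simp: indicator_def)
 show "m * (b - a) <= (LINT s|nu. indicator {a..b} s)" if "!!s. s \<in> {a..b} ==> m <= w s"
  unfolding e L(2)[symmetric] using that by (intro integral_mono i L) (auto simp: indicator_def)
qed

lemma w_mono: "abs s <= abs r ==> w s <= w r"
 unfolding w_def using d by (intro powr_mono2) auto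

end

context heat_kernel
begin

text \<open>Unit mass is concentrated, up to a small part, on a set of measure at most a multiple of
  \<open>V t x\<close>. By Cauchy--Schwarz the square integral of the row, which is the diagonal
  value at twice the time, cannot be small.\<close>

lemma diag_lower:
 obtains c where "c > 0" "!!t x. t > 0 ==> c / V t x <= k t x x"
proof -
 \<comment> \<open>Makes the mass outside the set, \<open>exp (- A) * (5 * exp 1 * exp K0)\<close>,
   at most \<open>1 / 4\<close>.\<close>
 define A where "A = max 1 (ln (20 * exp 1 * exp K0))"
 have A: "A >= 1" "20 * exp 1 * exp K0 <= exp A"
 proof -
  have "20 * exp 1 * exp K0 = exp (ln (20 * exp 1 * exp K0))" by (subst exp_ln) auto
  also have "... <= exp A" by (simp only: exp_le_cancel_iff A_def max.cobounded2)
  finally show "20 * exp 1 * exp K0 <= exp A" .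
 qed (simp add: A_def)
 have main: "1 / (16 * A powr d) <= k (t + t) x x * V t x" if t: "t > 0" for t x
 proof -
  let ?s = "sqrt t"
  have s: "?s > 0" using t by simp
  define m where "m = 4 * A powr d * V t x"
  have m: "m > 0" using V_pos[OF t, of x] A by (simp add: m_def)
  \<comment> \<open>The moment controls the modulus of \<open>z\<close> only, so the set has to
    contain the mirror interval as well; this costs a factor two in measure.\<close>
  let ?E = "%z. indicator {abs x - A * ?s..abs x + A * ?s} z + indicator {- abs x - A * ?s..- abs x + A * ?s} z :: real"
  have E: "integrable nu ?E" "(LINT z|nu. ?E z) <= m"
  proof -
   let ?M = "(A * (1 + abs x + ?s)) powr (d - 1)"
   have wM: "w z <= ?M" if "abs z <= abs x + A * ?s" for z
   proof -
    have "1 + abs x <= A * (1 + abs x)" using A mult_right_mono[of 1 A "1 + abs x"] by simp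
    then have "1 + abs z <= A * (1 + abs x + ?s)" using that by (simp add: algebra_simps)
    then show ?thesis unfolding w_def using d by (intro powr_mono2) auto
   qed
   have le: "a - A * ?s <= a + A * ?s" for a using A s by simp
   note I = nu_interval[OF le]
   show "integrable nu ?E" by (intro Bochner_Integration.integrable_add I)
   have "(LINT z|nu. ?E z) = (LINT z|nu. indicator {abs x - A * ?s..abs x + A * ?s} z) + (LINT z|nu. indicator {- abs x - A * ?s..- abs x + A * ?s} z)"
    by (intro Bochner_Integration.integral_add I)
   also have "... <= ?M * ((abs x + A * ?s) - (abs x - A * ?s)) + ?M * ((- abs x + A * ?s) - (- abs x - A * ?s))"
    by (intro add_mono I(2) wM) auto
   also have "... = 4 * (A * A powr (d - 1)) * V t x" by (simp add: powr_mult V_def)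
   also have "A * A powr (d - 1) = A powr d" using A by (simp add: powr_diff)
   finally show "(LINT z|nu. ?E z) <= m" by (simp add: m_def)
  qed
  let ?R = "%z. exp (- A) * exp (1 / ?s * abs (abs z - abs x))"
  have R: "ebd t x ?R (1 / 4)"
  proof -
   have e: "K0 * (1 / ?s)^2 * t = K0" using t by (simp add: power_divide)
   have "ebd t x ?R (exp (- A) * (5 * exp 1 * exp (K0 * (1 / ?s)^2 * t)))"
    using s t by (intro ebd_cmult ebd_exp_diff) auto
   then have "ebd t x ?R (exp (- A) * (5 * exp 1 * exp K0))" unfolding e .
   moreover have "exp (- A) * (5 * exp 1 * exp K0) <= 1 / 4"
    using A(2) by (simp add: exp_minus field_simps)
   ultimately show ?thesis unfolding ebd_def by auto
  qed
  have kk: "integrable nu (%z. k t x z * k t x z)" "(LINT z|nu. k t x z * k t x z) = k (t + t) x x"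
   unfolding k_semi[OF t t] L2_inner_def by (auto intro!: L2_mult_integrable k_L2 t)
  have i: "integrable nu (%z. k t x z * ?R z)" "(LINT z|nu. k t x z * ?R z) <= 1 / 4" using R by (auto simp: ebd_def)
  have ip: "integrable nu (%z. m * (k t x z * k t x z))" and iq: "integrable nu (%z. 1 / (4 * m) * ?E z)"
   by (intro integrable_mult_right kk E)+
  note ipq = Bochner_Integration.integrable_add[OF ip iq]
  have "(LINT z|nu. k t x z) <= (LINT z|nu. (m * (k t x z * k t x z) + 1 / (4 * m) * ?E z) + k t x z * ?R z)"
  proof (rule integral_mono[OF k_mass(1)[OF t] Bochner_Integration.integrable_add[OF ipq i(1)]])
   fix z
   have R0: "0 <= k t x z * ?R z" using k_nonneg[OF t] by simp
   show "k t x z <= (m * (k t x z * k t x z) + 1 / (4 * m) * ?E z) + k t x z * ?R z"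
   proof (cases "abs (abs z - abs x) <= A * ?s")
    case True
    have "1 <= ?E z" using True by (auto simp: indicator_def abs_if split: if_splits)
    then have "1 / (4 * m) * 1 <= 1 / (4 * m) * ?E z" using m by (intro mult_left_mono) auto
    \<comment> \<open>The pointwise form of Cauchy--Schwarz, from the square of
      \<open>k t x z - 1 / (2 * m)\<close>; it lets all contributions be added under one
      integral.\<close>
    moreover have "k t x z <= m * (k t x z * k t x z) + 1 / (4 * m)"
    proof -
     have "0 <= m * (k t x z - 1 / (2 * m))^2" using m by simp
     also have "... = m * (k t x z * k t x z) + 1 / (4 * m) - k t x z"
      using m by (simp add: power2_eq_square field_simps)
     finally show ?thesis by simp
    qed
    ultimately show ?thesis using R0 by linarith
   next
    case False
    then have "1 <= ?R z" using s by (simp flip: exp_add add: field_simps)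
    then have "k t x z * 1 <= k t x z * ?R z" using k_nonneg[OF t] by (intro mult_left_mono) auto
    moreover have "0 <= m * (k t x z * k t x z)" "0 <= 1 / (4 * m) * ?E z" using m by (auto simp: indicator_def)
    ultimately show ?thesis by linarith
   qed
  qed
  then have "1 <= (m * k (t + t) x x + 1 / (4 * m) * (LINT z|nu. ?E z)) + (LINT z|nu. k t x z * ?R z)"
   unfolding Bochner_Integration.integral_add[OF ipq i(1)] Bochner_Integration.integral_add[OF ip iq]
    integral_mult_right_zero kk(2) k_mass(2)[OF t] .
  moreover have "1 / (4 * m) * (LINT z|nu. ?E z) <= 1 / (4 * m) * m"
   by (rule mult_left_mono[OF E(2)]) (use m in simp)
  moreover have "1 / (4 * m) * m = 1 / 4" using m by simp
  ultimately have "1 / 4 <= m * k (t + t) x x" using i(2) by linarith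
  then show ?thesis using A by (simp add: m_def field_simps)
 qed
 show thesis
 proof (rule that)
  show "0 < 1 / (16 * A powr d)" using A by simp
  fix t x :: real assume t: "t > 0"
  have "1 / (16 * A powr d) <= k t x x * V (t / 2) x" using main[of "t / 2" x] t by simp
  also have "... <= k t x x * V t x" using t k_nonneg by (intro mult_left_mono V_mono) auto
  finally show "1 / (16 * A powr d) / V t x <= k t x x" using V_pos[OF t, of x] by (simp only: pos_divide_le_eq)
 qed
qed

text \<open>The Hoelder bound for rows involves the weight near \<open>x\<close>, the diagonal bound
  the volume \<open>V t x\<close>. Under \<open>\<delta> * sqrt t <= 1 + abs x\<close> the volume is
  at most a constant times \<open>sqrt t\<close> times that weight, so a small
  \<open>\<epsilon>\<close> makes the oscillation less than half of the diagonal value.\<close>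

lemma near_diag_lower:
 assumes \<delta>: "\<delta> > 0"
 obtains \<epsilon> a where "\<epsilon> > 0" "a > 0"
  "!!t x y. t > 0 ==> \<delta> * sqrt t <= 1 + abs x ==> abs (x - y) <= \<epsilon> * sqrt t ==> a / V t x <= k t x y"
proof -
 obtain c where c: "c > 0" "!!t x. t > 0 ==> c / V t x <= k t x x" by (rule diag_lower) blast
 obtain C where C: "C > 0" "!!t x. t > 0 ==> k t x x <= C / V t x" by (rule diag_upper) blast
 define D where "D = (2 * (1 + 1 / \<delta>)) powr (d - 1)"
 have D: "D > 0" using \<delta> by (simp add: D_def add_pos_pos[THEN less_imp_neq, symmetric])
 \<comment> \<open>The first entry keeps the weight between \<open>x\<close> and \<open>y\<close>
   comparable with \<open>w x\<close>; the second makes the oscillation at most half of the diagonal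
   bound.\<close>
 define \<epsilon> where "\<epsilon> = min (\<delta> / 2) (c^2 / (4 * C * D))"
 have e: "\<epsilon> > 0" "\<epsilon> <= \<delta> / 2" "\<epsilon> <= c^2 / (4 * C * D)" using \<delta> c C D by (auto simp: \<epsilon>_def)
 have Ce: "C * (\<epsilon> * D) <= (c / 2)^2"
 proof -
  have "\<epsilon> * (4 * C * D) <= c^2" using e(3) C D by (simp add: pos_le_divide_eq)
  then show ?thesis by (simp add: power_divide mult_ac)
 qed
 show thesis
 proof (rule that)
  show "\<epsilon> > 0" "0 < c / 2" using e c by auto
  fix t x y :: real assume t: "t > 0" and X: "\<delta> * sqrt t <= 1 + abs x" and xy: "abs (x - y) <= \<epsilon> * sqrt t"
  have s: "sqrt t > 0" using t by simp
  have V: "V t x > 0" by (rule V_pos[OF t])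
  define m where "m = ((1 + abs x) / 2) powr (d - 1)"
  have X0: "1 + abs x > 0" by linarith
  then have m: "m > 0" by (simp add: m_def)
  have mw: "m <= w r" if "r \<in> {min x y..max x y}" for r
  proof -
   have "\<epsilon> * sqrt t <= \<delta> / 2 * sqrt t" using e s by (intro mult_right_mono) auto
   then have "(1 + abs x) / 2 <= 1 + abs r" using that X xy by auto
   then show ?thesis unfolding m_def w_def using d by (intro powr_mono2) auto
  qed
  have Vm: "V t x <= D * (sqrt t * m)"
  proof -
   have "sqrt t <= (1 + abs x) / \<delta>" using X \<delta> by (simp add: field_simps)
   moreover have "(2 * (1 + 1 / \<delta>)) * ((1 + abs x) / 2) = 1 + abs x + (1 + abs x) / \<delta>" using \<delta> by (simp add: field_simps)
   ultimately have "1 + abs x + sqrt t <= (2 * (1 + 1 / \<delta>)) * ((1 + abs x) / 2)" by linarith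
   then have "(1 + abs x + sqrt t) powr (d - 1) <= ((2 * (1 + 1 / \<delta>)) * ((1 + abs x) / 2)) powr (d - 1)"
    using s d by (intro powr_mono2) auto
   also have "... = D * m" unfolding D_def m_def by (rule powr_mult)
   finally show ?thesis unfolding V_def using s by (simp add: mult_ac)
  qed
  let ?t = "t / 2"
  have t2: "?t > 0" "?t + ?t = t" using t by auto
  have h: "k t a b = ip (k ?t a) (k ?t b)" for a b using k_semi[OF t2(1) t2(1), of a b] t2 by simp
  let ?N = "nrm (%z. k ?t y z - k ?t x z)"
  have N: "?N^2 * m <= abs (x - y) / t"
  proof (cases "x <= y")
   case True
   then show ?thesis using k_holder[OF t2(1) True m] mw by (simp add: min_def max_def)
  next
   case False
   then have "y <= x" by simp
   from k_holder[OF t2(1) this m] mw False show ?thesis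
    by (simp add: min_def max_def L2_norm_minus_commute[of nu "k ?t y"])
  qed
  have "?N^2 * V t x <= ?N^2 * (D * (sqrt t * m))" by (intro mult_left_mono Vm) auto
  also have "... = D * sqrt t * (?N^2 * m)" by (simp add: mult_ac)
  also have "... <= D * sqrt t * (abs (x - y) / t)" using D s by (intro mult_left_mono N) auto
  also have "... <= D * sqrt t * (\<epsilon> * sqrt t / t)" using D s t xy by (intro mult_left_mono divide_right_mono) auto
  also have "... = \<epsilon> * D * (sqrt t * sqrt t) / t" by simp
  also have "... = \<epsilon> * D" using t by simp
  finally have N2: "?N^2 <= \<epsilon> * D / V t x" using V by (simp add: pos_le_divide_eq)
  have "abs (k t x y - k t x x) = abs (ip (k ?t x) (%z. k ?t y z - k ?t x z))"
   unfolding h by (subst L2_inner_diff_right) (use k_L2[OF t2(1)] in auto)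
  also have "... <= nrm (k ?t x) * ?N" using k_L2[OF t2(1)] by (intro L2_cauchy_schwarz L2_diff)
  also have "nrm (k ?t x) = sqrt (k t x x)" by (simp add: L2_norm_def h)
  also have "sqrt (k t x x) * ?N <= c / 2 / V t x"
  proof -
   have "sqrt (k t x x) * ?N = sqrt (k t x x * ?N^2)" by (simp add: real_sqrt_mult L2_norm_nonneg)
   also have "... <= c / 2 / V t x"
   proof (rule real_le_lsqrt)
    have "k t x x * ?N^2 <= C / V t x * (\<epsilon> * D / V t x)"
     using C(2)[OF t] C V N2 by (intro mult_mono) auto
    also have "... = C * (\<epsilon> * D) / (V t x)^2" by (simp add: power2_eq_square)
    also have "... <= (c / 2)^2 / (V t x)^2" by (intro divide_right_mono Ce) auto
    finally show "k t x x * ?N^2 <= (c / 2 / V t x)^2" by (simp add: power_divide)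
   qed (use c V in auto)
   finally show ?thesis .
  qed
  finally have "abs (k t x y - k t x x) <= c / 2 / V t x" .
  moreover have "c / V t x <= k t x x" "c / V t x = c / 2 / V t x + c / 2 / V t x" using c(2)[OF t] by (auto simp: field_simps)
  ultimately show "c / 2 / V t x <= k t x y" by linarith
 qed
qed

end

section \<open>Chaining along a half-line\<close>

context heat_kernel
begin

text \<open>The probability that the diffusion from \<open>x\<close> is in the interval at time
  \<open>t\<close>.\<close>

definition pr :: "real => real => real => real => real" where
 "pr t x a b = (LINT z|nu. k t x z * indicator {a..b} z)"

lemma pr_integrable: "t > 0 ==> integrable nu (%z. k t x z * indicator {a..b} z)"
 using k_mass(1)[of t x] integrable_real_mult_indicator[of "{a..b}" nu "k t x"] by simp

lemma pr_ge:
 assumes "t > 0" "a <= b" "0 <= \<gamma>" "!!z. z \<in> {a..b} ==> \<gamma> <= k t x z" "!!z. z \<in> {a..b} ==> m <= w z"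
 shows "\<gamma> * (m * (b - a)) <= pr t x a b"
proof -
 have "\<gamma> * (m * (b - a)) <= \<gamma> * (LINT z|nu. indicator {a..b} z)"
  using assms by (intro mult_left_mono nu_interval(3)) auto
 also have "... = (LINT z|nu. \<gamma> * indicator {a..b} z)" by simp
 also have "... <= pr t x a b" unfolding pr_def
 proof (rule integral_mono)
  show "integrable nu (%z. \<gamma> * indicator {a..b} z)" by (intro integrable_mult_right nu_interval assms)
  show "integrable nu (%z. k t x z * indicator {a..b} z)" by (intro pr_integrable assms)
  show "\<gamma> * indicator {a..b} z <= k t x z * indicator {a..b} z" for z using assms(4)[of z] by (auto simp: indicator_def)
 qed
 finally show ?thesis .
qed

lemma k_ge_pr:
 assumes "t > 0" "s > 0" "0 <= \<beta>" "!!z. z \<in> {a..b} ==> \<beta> <= k s z y"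
 shows "\<beta> * pr t x a b <= k (t + s) x y"
proof -
 have "\<beta> * pr t x a b = (LINT z|nu. \<beta> * (k t x z * indicator {a..b} z))" by (simp add: pr_def)
 also have "... <= (LINT z|nu. k t x z * k s y z)"
 proof (rule integral_mono)
  show "integrable nu (%z. \<beta> * (k t x z * indicator {a..b} z))" by (intro integrable_mult_right pr_integrable assms)
  show "integrable nu (%z. k t x z * k s y z)" by (intro L2_mult_integrable k_L2 assms)
  show "\<beta> * (k t x z * indicator {a..b} z) <= k t x z * k s y z" for z
   using assms(4)[of z] k_nonneg[OF assms(1), of x z] k_nonneg[OF assms(2), of y z]
   by (auto simp: indicator_def k_sym[OF assms(2), of z y] mult.commute[of \<beta>] intro: mult_left_mono)
 qed
 also have "... = k (t + s) x y" by (simp add: k_semi assms L2_inner_def)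
 finally show ?thesis .
qed

lemma V_mono_abs: "t > 0 ==> abs x <= abs y ==> V t x <= V t y"
 unfolding V_def using d by (intro mult_left_mono powr_mono2) auto

text \<open>With \<open>\<eta> = \<epsilon> * sqrt \<tau> / 2\<close>, a single kernel reaches a
  distance \<open>2 * \<eta>\<close>, and each additional one advances by at least
  \<open>\<eta>\<close>; hence \<open>n + 1\<close> kernels cover \<open>n + 2\<close> such units.
  The volume is taken at the farther point, which makes the estimate symmetric, and the path moves
  outwards from the nearer point, so it never leaves \<open>[j, \<infinity>)\<close>.\<close>

lemma chain:
 assumes \<tau>: "\<tau> > 0" and \<epsilon>: "\<epsilon> > 0" and j: "j >= 0" and a: "a > 0"
  and H: "!!x y. j <= x ==> j <= y ==> abs (x - y) <= \<epsilon> * sqrt \<tau> ==> a / V \<tau> (max x y) <= k \<tau> x y"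
  and xy: "j <= x" "j <= y" "abs (x - y) <= real (n + 2) * (\<epsilon> * sqrt \<tau> / 2)"
 shows "a * (a * (\<epsilon> / 2 * (\<epsilon> / 2 / (1 + \<epsilon>)) powr (d - 1) * exp (- (d - 1) * \<epsilon>))) ^ n / V \<tau> (max x y) <= k (real (n + 1) * \<tau>) x y"
 using xy
proof (induction n arbitrary: x y)
 case 0
 then show ?case using H[of x y] by simp
next
 case (Suc n)
 define \<eta> where "\<eta> = \<epsilon> * sqrt \<tau> / 2"
 define q where "q = \<epsilon> / 2 / (1 + \<epsilon>)"
 define b where "b = a * (\<epsilon> / 2 * q powr (d - 1) * exp (- (d - 1) * \<epsilon>))"
 have s: "sqrt \<tau> > 0" using \<tau> by simp
 have \<eta>: "\<eta> > 0" using \<epsilon> s by (simp add: \<eta>_def)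
 have q: "q > 0" "q <= 1" "q * (1 + \<epsilon>) = \<epsilon> / 2" using \<epsilon> by (auto simp: q_def field_simps)
 have b: "b > 0" using a \<epsilon> q by (simp add: b_def)
 let ?T = "real (n + 1) * \<tau>"
 have T: "?T > 0" using \<tau> by (intro mult_pos_pos) auto
 have T2: "\<tau> + ?T = real (Suc n + 1) * \<tau>" by (simp add: algebra_simps)
 have IH: "a * b ^ n / V \<tau> (max x y) <= k ?T x y" if "j <= x" "j <= y" "abs (x - y) <= real (n + 2) * \<eta>" for x y
  using Suc.IH[of x y] that unfolding b_def q_def \<eta>_def by simp
 have main: "a * b ^ Suc n / V \<tau> y <= k (real (Suc n + 1) * \<tau>) x y"
  if x: "j <= x" and xy: "x <= y" and yx: "y - x <= real (Suc n + 2) * \<eta>" for x y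
 proof -
  \<comment> \<open>The intermediate points run through \<open>{x + \<eta>..x + 2 * \<eta>}\<close>:
    far enough to gain one unit, near enough for \<open>H\<close>. The number \<open>q\<close>
    compares the weight at the inner end with the volume at the outer one.\<close>
  let ?z = "x + 2 * \<eta>"
  have V: "V \<tau> y > 0" "V \<tau> ?z > 0" using V_pos[OF \<tau>] by auto
  define \<beta> where "\<beta> = a * b ^ n * (exp (- (d - 1) * \<epsilon>) / V \<tau> y)"
  have \<beta>: "\<beta> >= 0" using a b V by (simp add: \<beta>_def)
  have k2: "\<beta> <= k ?T z y" if z: "z \<in> {x + \<eta>..?z}" for z
  proof -
   have e: "(d - 1) * (2 * \<eta>) / sqrt \<tau> = (d - 1) * \<epsilon>" using s by (simp add: \<eta>_def)
   have "V \<tau> (max z y) <= exp ((d - 1) * (2 * \<eta>) / sqrt \<tau>) * V \<tau> y"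
    by (rule V_le_exp[OF \<tau>]) (use z x xy j \<eta> in auto)
   then have "V \<tau> (max z y) <= exp ((d - 1) * \<epsilon>) * V \<tau> y" unfolding e .
   then have "exp (- (d - 1) * \<epsilon>) / V \<tau> y <= 1 / V \<tau> (max z y)"
   proof -
    have "inverse p / v <= 1 / M" if "M <= p * v" "p > 0" "v > 0" "M > 0" for p v M :: real
     using that by (simp add: field_simps)
    from this[OF \<open>V \<tau> (max z y) <= exp ((d - 1) * \<epsilon>) * V \<tau> y\<close> exp_gt_zero V(1) V_pos[OF \<tau>]]
    show ?thesis unfolding mult_minus_left exp_minus .
   qed
   then have "\<beta> <= a * b ^ n * (1 / V \<tau> (max z y))" unfolding \<beta>_def using a b by (intro mult_left_mono) auto
   also have "... <= k ?T z y"
   proof -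
    have "abs (z - y) <= real (n + 2) * \<eta>"
    proof -
     have "0 <= real n * \<eta>" using \<eta> by simp
     moreover have "y - x <= real n * \<eta> + 3 * \<eta>" "real (n + 2) * \<eta> = real n * \<eta> + 2 * \<eta>"
      using yx by (auto simp: algebra_simps)
     moreover have "x + \<eta> <= z" "z <= x + 2 * \<eta>" using z by auto
     ultimately show ?thesis using xy \<eta> by linarith
    qed
    then show ?thesis using IH[of z y] z x xy \<eta> by simp
   qed
   finally show ?thesis .
  qed
  have "a / V \<tau> ?z * (w (x + \<eta>) * (?z - (x + \<eta>))) <= pr \<tau> x (x + \<eta>) ?z"
  proof (rule pr_ge)
   fix z assume z: "z \<in> {x + \<eta>..?z}"
   have "a / V \<tau> ?z <= a / V \<tau> z"
    using z x j \<eta> a V V_pos[OF \<tau>, of z] by (intro divide_left_mono V_mono_abs \<tau> mult_pos_pos) auto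
   also have "... <= k \<tau> x z" using H[of x z] z x \<eta> by (simp add: \<eta>_def max_def)
   finally show "a / V \<tau> ?z <= k \<tau> x z" .
   show "w (x + \<eta>) <= w z" using z x j \<eta> by (intro w_mono) auto
  qed (use \<tau> \<eta> a V in auto)
  moreover have "a * (\<epsilon> / 2 * q powr (d - 1)) <= a / V \<tau> ?z * (w (x + \<eta>) * (?z - (x + \<eta>)))"
  proof -
   have "q * (1 + abs ?z + sqrt \<tau>) <= 1 + \<bar>x + \<eta>\<bar>"
   proof -
    have "q * (1 + x) <= 1 + x" using q x j by (intro mult_left_le_one_le) auto
    moreover have "q * (2 * \<eta> + sqrt \<tau>) = \<eta>"
    proof -
     have "q * (2 * \<eta> + sqrt \<tau>) = q * (1 + \<epsilon>) * sqrt \<tau>" by (simp add: \<eta>_def algebra_simps)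
     then show ?thesis unfolding q(3) by (simp add: \<eta>_def)
    qed
    ultimately show ?thesis using x j \<eta> by (simp add: algebra_simps)
   qed
   then have "(q * (1 + abs ?z + sqrt \<tau>)) powr (d - 1) <= w (x + \<eta>)"
    unfolding w_def using q s d by (intro powr_mono2) auto
   moreover have "(q * (1 + abs ?z + sqrt \<tau>)) powr (d - 1) = q powr (d - 1) * (1 + abs ?z + sqrt \<tau>) powr (d - 1)" by (rule powr_mult)
   ultimately have "q powr (d - 1) * (1 + abs ?z + sqrt \<tau>) powr (d - 1) * (\<epsilon> / 2 * sqrt \<tau>) <= w (x + \<eta>) * (\<epsilon> / 2 * sqrt \<tau>)"
    using \<epsilon> s by (intro mult_right_mono) auto
   then have "\<epsilon> / 2 * q powr (d - 1) * V \<tau> ?z <= w (x + \<eta>) * \<eta>"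
    by (simp add: V_def \<eta>_def mult_ac)
   then have "\<epsilon> / 2 * q powr (d - 1) <= w (x + \<eta>) * \<eta> / V \<tau> ?z" using V(2) by (simp only: pos_le_divide_eq)
   from mult_left_mono[OF this, of a] show ?thesis using a by (simp add: algebra_simps)
  qed
  ultimately have "a * (\<epsilon> / 2 * q powr (d - 1)) <= pr \<tau> x (x + \<eta>) ?z" by linarith
  then have "\<beta> * (a * (\<epsilon> / 2 * q powr (d - 1))) <= \<beta> * pr \<tau> x (x + \<eta>) ?z" using \<beta> by (rule mult_left_mono)
  also have "... <= k (\<tau> + ?T) x y" by (rule k_ge_pr[OF \<tau> T \<beta> k2])
  also have "\<tau> + ?T = real (Suc n + 1) * \<tau>" by (rule T2)
  finally show ?thesis by (simp add: \<beta>_def b_def mult_ac)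
 qed
 have yx: "abs (x - y) <= real (Suc n + 2) * \<eta>" using Suc.prems(3) by (simp only: \<eta>_def)
 have TT: "real (Suc n + 1) * \<tau> > 0" using \<tau> by simp
 have "a * b ^ Suc n / V \<tau> (max x y) <= k (real (Suc n + 1) * \<tau>) x y"
 proof (cases "x <= y")
  case True
  then show ?thesis using main[OF Suc.prems(1) True] yx by (simp add: max_def)
 next
  case False
  then show ?thesis using main[OF Suc.prems(2), of x] yx k_sym[OF TT, of x y] by (simp add: max_def)
 qed
 then show ?case unfolding b_def q_def .
qed

lemma exp_linear_ge: "t > 0 ==> exp (- (b^2 / 2)) * exp (- (r^2 / t / 2)) <= exp (- (b * r / sqrt t))" for t b r :: real
proof -
 assume t: "t > 0"
 have "2 * b * (r / sqrt t) <= b^2 + (r / sqrt t)^2" by (rule sum_squares_bound)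
 then have "b * r / sqrt t <= b^2 / 2 + r^2 / t / 2" using t by (simp add: power_divide)
 then show ?thesis by (simp flip: exp_add)
qed

lemma V_inverse_ge:
 assumes "t > 0" "abs x <= abs y + r" "0 <= r"
 shows "exp (- ((d - 1)^2 / 2)) * exp (- (r^2 / t / 2)) / V t y <= 1 / V t x"
proof -
 have V: "V t x > 0" "V t y > 0" using V_pos assms by auto
 have "exp (- ((d - 1)^2 / 2)) * exp (- (r^2 / t / 2)) / V t y <= exp (- ((d - 1) * r / sqrt t)) / V t y"
  using V by (intro divide_right_mono exp_linear_ge assms) auto
 also have "... <= 1 / V t x" using V_le_exp[OF assms] V by (simp add: exp_minus field_simps)
 finally show ?thesis .
qed

text \<open>The time is divided into about \<open>r^2 / t\<close> pieces, up to a constant, so that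
  each piece of the path is within the reach of \<open>H\<close>. The product of that many constants
  is the Gaussian factor.\<close>

lemma gauss_lower_if_near_diag:
 assumes \<epsilon>: "\<epsilon> > 0" and a: "a > 0"
  and H: "!!t x y. t > 0 ==> 0 <= x ==> 0 <= y ==> abs (x - y) <= \<epsilon> * sqrt t ==> a / V t (max x y) <= k t x y"
 obtains c C where "c > 0" "C > 0" "!!t x y. t > 0 ==> 0 <= x ==> 0 <= y ==> c / V t x * exp (- (C * ((x - y)^2 / t))) <= k t x y"
proof -
 define b0 where "b0 = a * (\<epsilon> / 2 * (\<epsilon> / 2 / (1 + \<epsilon>)) powr (d - 1) * exp (- (d - 1) * \<epsilon>))"
 \<comment> \<open>The cap at \<open>1 / 2\<close> makes \<open>L\<close> positive and the powers of
   \<open>b\<close> decreasing in the exponent.\<close>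
 define b where "b = min b0 (1 / 2)"
 have b0: "b0 > 0" using a \<epsilon> by (simp add: b0_def)
 then have b: "0 < b" "b <= 1 / 2" "b <= b0" by (auto simp: b_def)
 define L where "L = - ln b"
 have L: "L > 0" using b by (simp add: L_def)
 show thesis
 proof (rule that)
  show "0 < a * b * exp (- ((d - 1)^2 / 2))" "0 < 4 * L / \<epsilon>^2 + 1 / 2" using a b L \<epsilon> by (auto intro: add_pos_pos)
  fix t x y :: real assume t: "t > 0" and x: "0 <= x" and y: "0 <= y"
  define r where "r = abs (x - y)"
  \<comment> \<open>The least number of pieces, rounded up below:
    \<open>r <= (n + 1) * (\<epsilon> * sqrt \<tau> / 2)\<close> with
    \<open>\<tau> = t / (n + 1)\<close> means \<open>Q <= n + 1\<close>.\<close>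
  define Q where "Q = 4 * r^2 / (\<epsilon>^2 * t)"
  have Q: "Q >= 0" using t by (simp add: Q_def)
  define n where "n = nat \<lceil>Q\<rceil>"
  have n: "Q <= real n" "real n <= Q + 1" using Q unfolding n_def by linarith+
  define \<tau> where "\<tau> = t / real (n + 1)"
  have \<tau>: "\<tau> > 0" "real (n + 1) * \<tau> = t" "\<tau> <= t" using t by (auto simp: \<tau>_def field_simps)
  have "r <= real (n + 2) * (\<epsilon> * sqrt \<tau> / 2)"
  proof -
   have "r^2 = Q * (\<epsilon>^2 * t) / 4" using \<epsilon> t by (simp add: Q_def)
   also have "... <= real (n + 1) * (\<epsilon>^2 * t) / 4" using n t by (intro divide_right_mono mult_right_mono) auto
   also have "... = (real (n + 1) * (\<epsilon> * sqrt \<tau> / 2))^2"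
    unfolding \<tau>(2)[symmetric] using \<tau>(1) by (simp add: power2_eq_square)
   finally have "r <= real (n + 1) * (\<epsilon> * sqrt \<tau> / 2)" using \<epsilon> \<tau> by (intro power2_le_imp_le[of r]) auto
   also have "... <= real (n + 2) * (\<epsilon> * sqrt \<tau> / 2)" using \<epsilon> \<tau> by (intro mult_right_mono) auto
   finally show ?thesis .
  qed
  then have ch: "a * b0 ^ n / V \<tau> (max x y) <= k t x y"
   using chain[OF \<tau>(1) \<epsilon> order_refl a H[OF \<tau>(1)] x y, of n] unfolding b0_def \<tau>(2) r_def by simp
  have V: "V t (max x y) > 0" "V \<tau> (max x y) > 0" "V t x > 0" using V_pos t \<tau> by auto
  have bn: "b * exp (- (4 * L / \<epsilon>^2 * (r^2 / t))) <= b0 ^ n"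
  proof -
   have "b * exp (- (4 * L / \<epsilon>^2 * (r^2 / t))) = b powr (Q + 1)"
   proof -
    have "4 * L / \<epsilon>^2 * (r^2 / t) = L * Q" by (simp add: Q_def)
    moreover have "b powr (Q + 1) = exp (- (L * Q)) * b" using b by (simp add: powr_add powr_def[of b Q] L_def mult.commute)
    ultimately show ?thesis by (simp only: mult.commute)
   qed
   also have "... <= b powr real n" using n b by (intro powr_mono') auto
   also have "... <= b0 ^ n" using b by (simp add: powr_realpow power_mono)
   finally show ?thesis .
  qed
  have "exp (- ((d - 1)^2 / 2)) * exp (- (r^2 / t / 2)) / V t x <= 1 / V t (max x y)"
   by (rule V_inverse_ge[OF t]) (use x y in \<open>auto simp: r_def\<close>)
  also have "... <= 1 / V \<tau> (max x y)" using V \<tau> by (intro divide_left_mono V_mono) auto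
  finally have vv: "exp (- ((d - 1)^2 / 2)) * exp (- (r^2 / t / 2)) / V t x <= 1 / V \<tau> (max x y)" .
  have "a * (b * exp (- (4 * L / \<epsilon>^2 * (r^2 / t)))) * (exp (- ((d - 1)^2 / 2)) * exp (- (r^2 / t / 2)) / V t x)
    <= a * b0 ^ n * (1 / V \<tau> (max x y))"
   using a b b0 V bn vv by (intro mult_mono) auto
  moreover have "a * (b * exp (- (4 * L / \<epsilon>^2 * (r^2 / t)))) * (exp (- ((d - 1)^2 / 2)) * exp (- (r^2 / t / 2)) / V t x)
    = a * b * exp (- ((d - 1)^2 / 2)) / V t x * exp (- ((4 * L / \<epsilon>^2 + 1 / 2) * ((x - y)^2 / t)))"
  proof -
   have "exp (- ((4 * L / \<epsilon>^2 + 1 / 2) * ((x - y)^2 / t))) = exp (- (4 * L / \<epsilon>^2 * (r^2 / t))) * exp (- (r^2 / t / 2))"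
   proof -
    have "- ((u + 1 / 2) * v) = - (u * v) + - (v / 2)" for u v :: real by (simp add: algebra_simps)
    then show ?thesis unfolding exp_add[symmetric] r_def power2_abs by (simp only:)
   qed
   then show ?thesis by (simp add: mult_ac)
  qed
  moreover have "a * b0 ^ n * (1 / V \<tau> (max x y)) = a * b0 ^ n / V \<tau> (max x y)" by simp
  ultimately show "a * b * exp (- ((d - 1)^2 / 2)) / V t x * exp (- ((4 * L / \<epsilon>^2 + 1 / 2) * ((x - y)^2 / t))) <= k t x y"
   using ch by linarith
 qed
qed

end

section \<open>Mass arriving on the other side\<close>

context heat_kernel
begin

lemma hm_eq: "x >= 0 ==> hm x = U x / 2"
 by (simp add: hm_def)

lemma U_le_hm: "U x <= 2 * hm x"
 using powr_le_1[of x] by (auto simp: hm_def)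

text \<open>The weight and the power multiply to \<open>1 + abs s\<close>, so the integral near the
  gluing point is quadratic in \<open>b\<close>, much smaller than the volume.\<close>

lemma nu_interval_U:
 assumes "0 <= b"
 shows "integrable nu (%z. U z * indicator {-b..b} z)" "(LINT z|nu. U z * indicator {-b..b} z) <= (1 + b) * (2 * b)"
proof -
 have L: "integrable lborel (%s. (1 + b) * indicator {-b..b} s)" "(LINT s|lborel. (1 + b) * indicator {-b..b} s) = (1 + b) * (2 * b)"
  using assms by auto
 have wU: "w s * U s = 1 + abs s" for s :: real
 proof -
  have "w s * U s = (1 + abs s) powr (d - 1 + (2 - d))" unfolding w_def by (rule powr_add[symmetric])
  then show ?thesis by simp
 qed
 have le: "0 <= w s * (U s * indicator {-b..b} s)" "w s * (U s * indicator {-b..b} s) <= (1 + b) * indicator {-b..b} s" for s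
  unfolding mult.assoc[symmetric] wU by (auto simp: indicator_def)
 have i: "integrable lborel (%s. w s * (U s * indicator {-b..b} s))"
  by (rule Bochner_Integration.integrable_bound[OF L(1)]) (use le assms in \<open>auto intro!: AE_I2 simp: abs_of_nonneg\<close>)
 then show "integrable nu (%z. U z * indicator {-b..b} z)" by (subst integrable_nu) auto
 have "(LINT z|nu. U z * indicator {-b..b} z) = (LINT s|lborel. w s * (U s * indicator {-b..b} s))"
  by (subst integral_nu) auto
 also have "... <= (1 + b) * (2 * b)" unfolding L(2)[symmetric] by (intro integral_mono i L le)
 finally show "(LINT z|nu. U z * indicator {-b..b} z) <= (1 + b) * (2 * b)" .
qed

text \<open>Prepares the region around the gluing point in the balance of \<open>hm\<close>. From
  right to left the crossing estimate is used, on the right \<open>hm z\<close> itself is small, and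
  for \<open>x\<close> on the left \<open>hm x\<close> is at least \<open>1 / 2\<close>.\<close>

lemma k_hm_le:
 obtains C where "C > 0" "!!t x z. t > 0 ==> k t x z * hm z <= C / V t x * (hm x + U z)"
proof -
 obtain C1 c1 where C1: "C1 > 0" "c1 > 0"
  "!!t x y. t > 0 ==> x >= 0 ==> y <= 0 ==> k t x y <= C1 * (U x + U y) / V t x * exp (- ((x - y)^2 / (c1 * t)))"
  by (rule opposite_upper) blast
 obtain C2 c2 where C2: "C2 > 0" "c2 > 0" "!!t x y. t > 0 ==> k t x y <= C2 / V t x * exp (- ((abs x - abs y)^2 / (c2 * t)))"
  by (rule k_le_gauss_modulus) blast
 show thesis
 proof (rule that)
  show "0 < 2 * max C1 C2" using C1 by (simp add: less_max_iff_disj)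
  fix t x z :: real assume t: "t > 0"
  have V: "V t x > 0" by (rule V_pos[OF t])
  have h: "0 < hm x" "0 < hm z" "hm z <= 1" "0 < U z" "0 < U x" using hm_pos hm_le_1 by auto
  have k1: "k t x z <= max C1 C2 / V t x"
  proof -
   have "k t x z <= C2 / V t x * exp (- ((abs x - abs z)^2 / (c2 * t)))" by (rule C2(3)[OF t])
   also have "... <= max C1 C2 / V t x * 1" using C2 V t by (intro mult_mono divide_right_mono) auto
   finally show ?thesis by simp
  qed
  consider "x >= 0" "z <= 0" | "x >= 0" "z > 0" | "x < 0" by linarith
  then have "k t x z * hm z <= max C1 C2 / V t x * (2 * (hm x + U z))"
  proof cases
   case 1
   have "k t x z <= C1 * (U x + U z) / V t x * exp (- ((x - z)^2 / (c1 * t)))" by (rule C1(3)[OF t 1])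
   also have "... <= C1 * (U x + U z) / V t x * 1" using C1 V t h by (intro mult_left_mono) auto
   also have "... = C1 / V t x * (U x + U z)" by simp
   also have "... <= max C1 C2 / V t x * (2 * (hm x + U z))"
    using C1 V h 1 by (intro mult_mono divide_right_mono) (auto simp: hm_eq)
   finally have "k t x z * 1 <= max C1 C2 / V t x * (2 * (hm x + U z))" by simp
   then show ?thesis using mult_left_mono[OF h(3) k_nonneg[OF t, of x z]] by linarith
  next
   case 2
   have "u / 2 <= 2 * (h + u)" if "0 < h" "0 < u" for h u :: real using that by (simp add: field_simps)
   from this[OF h(1,4)] have "hm z <= 2 * (hm x + U z)" unfolding hm_eq[OF less_imp_le[OF 2(2)]] .
   then show ?thesis using k1 h V C1 by (intro mult_mono) auto
  next
   case 3
   have "hm z <= 2 * (hm x + U z)" using h hm_ge_half[OF 3] unfolding distrib_left by linarith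
   then show ?thesis using k1 h V C1 by (intro mult_mono) auto
  qed
  moreover have "p / v * (2 * y) = 2 * p / v * y" for p v y :: real by simp
  ultimately show "k t x z * hm z <= 2 * max C1 C2 / V t x * (hm x + U z)" by (simp only:)
 qed
qed

text \<open>The identity that the expectation of \<open>hm\<close> equals \<open>hm x\<close> is
  split into four regions. Around the gluing point, far to the right and far to the left the
  contributions are at most \<open>1 / 8\<close>, \<open>1 / 4\<close> and \<open>1 / 8\<close> of
  \<open>hm x\<close>; the remaining half must come from the annulus on the left, where
  \<open>hm <= 1\<close>.\<close>

lemma left_mass:
 obtains \<kappa> \<delta> A where "\<kappa> > 0" "\<kappa> <= \<delta>" "\<delta> <= 1" "1 <= A"
  "!!t x. t > 0 ==> 1 + abs x <= \<kappa> * sqrt t ==> hm x / 2 <= pr t x (- (A * sqrt t)) (- (\<delta> * sqrt t))"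
proof -
 obtain C where C: "C > 0" "!!t x z. t > 0 ==> k t x z * hm z <= C / V t x * (hm x + U z)" by (rule k_hm_le) blast
 \<comment> \<open>The central region contributes at most \<open>(2 + 8) * C * \<delta>\<close>
   times \<open>hm x\<close>, that is, \<open>1 / 8\<close> of it.\<close>
 define \<delta> where "\<delta> = min 1 (1 / (80 * C))"
 have \<delta>: "\<delta> > 0" "\<delta> <= 1" "C * \<delta> <= 1 / 80"
 proof -
  show "\<delta> > 0" "\<delta> <= 1" using C by (auto simp: \<delta>_def)
  have "\<delta> <= 1 / (80 * C)" by (simp add: \<delta>_def)
  then show "C * \<delta> <= 1 / 80" using C by (simp add: field_simps)
 qed
 \<comment> \<open>Chosen so that \<open>q powr (2 - d) = 4\<close>: points to the right of
   \<open>\<delta> * sqrt t\<close> then have \<open>hm\<close> at most a quarter of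
   \<open>hm x\<close>, as soon as \<open>1 + abs x <= \<delta> * q * sqrt t\<close>.\<close>
 define q where "q = (4::real) powr (- 1 / (d - 2))"
 have q: "q > 0" "q <= 1" "q powr (2 - d) = 4"
 proof -
  show "q > 0" by (simp add: q_def)
  have "(4::real) powr (- 1 / (d - 2)) <= 4 powr 0" using d by (intro powr_mono) auto
  then show "q <= 1" by (simp add: q_def)
  have "- 1 / (d - 2) * (2 - d) = 1" using d by (simp add: field_simps)
  then show "q powr (2 - d) = 4" unfolding q_def powr_powr by simp
 qed
 define \<kappa> where "\<kappa> = \<delta> * q"
 have \<kappa>: "\<kappa> > 0" "\<kappa> <= \<delta>" using \<delta> q by (auto simp: \<kappa>_def mult_left_le)
 \<comment> \<open>The factor \<open>16 * exp 2\<close> collects \<open>2 * exp 1\<close> from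
   \<open>ebd_exp_left_theta\<close>, \<open>exp 1\<close> from \<open>theta (1 / s) x <= 1\<close>
   and the desired \<open>1 / 8\<close>.\<close>
 define A where "A = max 1 (ln (16 * exp 2 * exp K0))"
 have A: "A >= 1" "16 * exp 2 * exp K0 <= exp A"
 proof -
  have "16 * exp 2 * exp K0 = exp (ln (16 * exp 2 * exp K0))" by (subst exp_ln) auto
  also have "... <= exp A" by (simp only: exp_le_cancel_iff A_def max.cobounded2)
  finally show "16 * exp 2 * exp K0 <= exp A" .
 qed (simp add: A_def)
 show thesis
 proof (rule that[OF \<kappa> \<delta>(2) A(1)])
  fix t x :: real assume t: "t > 0" and X: "1 + abs x <= \<kappa> * sqrt t"
  define s where "s = sqrt t"
  have s: "s > 0" "s * s = t" using t by (auto simp: s_def)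
  have Xs: "1 + abs x <= \<delta> * s" "1 + abs x <= s" "1 <= \<delta> * s"
  proof -
   show 1: "1 + abs x <= \<delta> * s" unfolding s_def by (rule order_trans[OF X mult_right_mono[OF \<kappa>(2)]]) (use t in simp)
   moreover have "\<delta> * s <= 1 * s" using \<delta> s by (intro mult_right_mono) auto
   ultimately show "1 + abs x <= s" by linarith
   show "1 <= \<delta> * s" using 1 by simp
  qed
  have V: "V t x > 0" by (rule V_pos[OF t])
  have h: "hm x > 0" by (rule hm_pos)
  let ?I = "%z. indicator {-(\<delta> * s)..\<delta> * s} z :: real"
  let ?R = "%z. exp (- A) * (if z <= 0 then exp (1 / s * abs z) else 0)"
  let ?D = "%z. indicator {- (A * s)..- (\<delta> * s)} z :: real"
  let ?f = "%z. C / V t x * (hm x * ?I z + U z * ?I z)"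
  have b: "0 <= \<delta> * s" "- (\<delta> * s) <= \<delta> * s" using \<delta> s by auto
  note iU = nu_interval_U[OF b(1)] and iI = nu_interval[OF b(2)]
  have f: "integrable nu ?f" "(LINT z|nu. ?f z) <= hm x / 8"
  proof -
   note i1 = integrable_mult_right[OF iI(1), of "hm x"]
   show "integrable nu ?f" by (intro integrable_mult_right Bochner_Integration.integrable_add i1 iU)
   have Is: "(LINT z|nu. ?I z) <= (1 + \<delta> * s) powr (d - 1) * (\<delta> * s - - (\<delta> * s))"
    by (rule iI(2)) (use d in \<open>auto simp: w_def intro!: powr_mono2\<close>)
   have Vb: "s * (1 + \<delta> * s) powr (d - 1) <= V t x" "s * s powr (d - 1) <= V t x"
   proof -
    have le: "\<delta> * s <= s" using mult_right_mono[OF \<delta>(2), of s] s by simp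
    show "s * (1 + \<delta> * s) powr (d - 1) <= V t x" "s * s powr (d - 1) <= V t x"
     unfolding V_def s_def[symmetric] using s b d le by (intro mult_left_mono powr_mono2; linarith)+
   qed
   have "C / V t x * (hm x * (LINT z|nu. ?I z)) <= hm x / 40"
   proof -
    have "hm x * (LINT z|nu. ?I z) <= hm x * (2 * \<delta> * (s * (1 + \<delta> * s) powr (d - 1)))"
     using order_trans[OF Is, of "2 * \<delta> * (s * (1 + \<delta> * s) powr (d - 1))"] h by (intro mult_left_mono) auto
    also have "... <= hm x * (2 * \<delta> * V t x)" using h \<delta> Vb by (intro mult_left_mono) auto
    finally have "C / V t x * (hm x * (LINT z|nu. ?I z)) <= C / V t x * (hm x * (2 * \<delta> * V t x))"
     by (rule mult_left_mono) (use C V in simp)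
    also have "... = hm x * (2 * (C * \<delta>))" using V by simp
    also have "... <= hm x * (2 * (1 / 80))" using h \<delta> by (intro mult_left_mono) auto
    finally show ?thesis by simp
   qed
   moreover have "C / V t x * (LINT z|nu. U z * ?I z) <= hm x / 10"
   proof -
    have "(LINT z|nu. U z * ?I z) <= (1 + \<delta> * s) * (2 * (\<delta> * s))" by (rule iU(2))
    also have "... <= (2 * (\<delta> * s)) * (2 * (\<delta> * s))" using Xs b by (intro mult_right_mono) auto
    also have "... = 4 * \<delta> * \<delta> * (s * s)" by simp
    also have "... <= 4 * \<delta> * 1 * (s * s)" using \<delta> s by (intro mult_right_mono mult_left_mono) auto
    also have "s * s = s powr (2 - d) * (s * s powr (d - 1))"
    proof -
     have "s powr (2 - d) * (s * s powr (d - 1)) = s * (s powr (2 - d + (d - 1)))" unfolding powr_add by simp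
     then show ?thesis using s by simp
    qed
    also have "4 * \<delta> * 1 * (s powr (2 - d) * (s * s powr (d - 1))) <= 4 * \<delta> * 1 * (U x * V t x)"
    proof -
     have "s powr (2 - d) <= U x" using Xs d by (intro powr_mono2') auto
     then show ?thesis using \<delta> Vb(2) s by (intro mult_left_mono mult_mono) auto
    qed
    also have "... <= 4 * \<delta> * 1 * (2 * hm x * V t x)" using U_le_hm[of x] \<delta> V by (intro mult_left_mono mult_right_mono) auto
    finally have "C / V t x * (LINT z|nu. U z * ?I z) <= C / V t x * (4 * \<delta> * 1 * (2 * hm x * V t x))"
     by (rule mult_left_mono) (use C V in simp)
    also have "... = hm x * (8 * (C * \<delta>))" using V by simp
    also have "... <= hm x * (8 * (1 / 80))" using h \<delta> by (intro mult_left_mono) auto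
    finally show ?thesis by simp
   qed
   moreover have "(LINT z|nu. ?f z) = C / V t x * (hm x * (LINT z|nu. ?I z)) + C / V t x * (LINT z|nu. U z * ?I z)"
    unfolding integral_mult_right_zero Bochner_Integration.integral_add[OF i1 iU(1)] by (rule distrib_left)
   ultimately show "(LINT z|nu. ?f z) <= hm x / 8" by linarith
  qed
  have R: "integrable nu (%z. k t x z * ?R z)" "(LINT z|nu. k t x z * ?R z) <= hm x / 8"
  proof -
   have \<alpha>: "1 / s > 0" using s by simp
   have e: "K0 * (1 / s)^2 * t = K0" using t by (simp add: s_def power_divide)
   have E: "ebd t x ?R (exp (- A) * (2 * exp 1 * (exp K0 * (hm x * exp (theta (1 / s) x)))))"
    using ebd_cmult[OF ebd_exp_left_theta[OF \<alpha> t, of x], of "exp (- A)"] unfolding e by simp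
   have "1 / s * abs x <= 1" using Xs(2) s by (simp add: field_simps)
   then have "theta (1 / s) x <= 1" using theta_le[OF \<alpha>, of x] by linarith
   then have "exp (- A) * (2 * exp 1 * (exp K0 * (hm x * exp (theta (1 / s) x)))) <= exp (- A) * (2 * exp 1 * (exp K0 * (hm x * exp 1)))"
    using h by (intro mult_left_mono) auto
   also have "... = (16 * exp 2 * exp K0) * exp (- A) * (hm x / 8)"
    using exp_add[of "1::real" 1] by simp
   also have "... <= exp A * exp (- A) * (hm x / 8)" using A h by (intro mult_right_mono) auto
   also have "... = hm x / 8" by (simp flip: exp_add)
   finally show "integrable nu (%z. k t x z * ?R z)" "(LINT z|nu. k t x z * ?R z) <= hm x / 8" using E by (auto simp: ebd_def)
  qed
  have i3: "integrable nu (%z. hm x / 4 * k t x z)" by (intro integrable_mult_right k_mass t)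
  have i4: "integrable nu (%z. k t x z * ?D z)" by (rule pr_integrable[OF t])
  note s1 = Bochner_Integration.integrable_add[OF f(1) i3]
  note s2 = Bochner_Integration.integrable_add[OF s1 R(1)]
  note s3 = Bochner_Integration.integrable_add[OF s2 i4]
  have pt: "k t x z * hm z <= ((?f z + hm x / 4 * k t x z) + k t x z * ?R z) + k t x z * ?D z" for z
  proof -
   have k0: "0 <= k t x z" by (rule k_nonneg[OF t])
   have nn: "0 <= ?f z" "0 <= hm x / 4 * k t x z" "0 <= k t x z * ?R z" "0 <= k t x z * ?D z"
    using k0 h C V by auto
   consider "abs z <= \<delta> * s" | "z > \<delta> * s" | "z < - (A * s)" | "- (A * s) <= z" "z <= - (\<delta> * s)" by linarith
   then show ?thesis
   proof cases
    case 1
    then have "?I z = 1" by (auto simp: indicator_def)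
    then have "k t x z * hm z <= ?f z" using C(2)[OF t, of x z] by simp
    then show ?thesis using nn by linarith
   next
    case 2
    then have z: "z >= 0" "\<delta> * s <= 1 + abs z" using b by linarith+
    have "U z <= (\<delta> * s) powr (2 - d)" using z b Xs(3) d by (intro powr_mono2') auto
    also have "... = (\<kappa> * s) powr (2 - d) / 4"
    proof -
     have "(\<kappa> * s) powr (2 - d) = (\<delta> * s) powr (2 - d) * q powr (2 - d)"
      unfolding \<kappa>_def by (subst powr_mult[symmetric]) (simp add: mult_ac)
     then show ?thesis unfolding q(3) by simp
    qed
    also have "... <= U x / 4" using X d by (intro divide_right_mono powr_mono2') (auto simp: s_def)
    finally have "hm z <= hm x / 4" using U_le_hm[of x] z by (simp add: hm_eq)
    then have "k t x z * hm z <= k t x z * (hm x / 4)" using k0 by (intro mult_left_mono)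
    then show ?thesis using nn by (simp add: mult.commute)
   next
    case 3
    then have z: "z <= 0" "A * s <= abs z" using A s mult_nonneg_nonneg[of A s] by linarith+
    then have "A <= 1 / s * abs z" using s by (simp add: field_simps)
    then have "1 <= ?R z" using z by (simp flip: exp_add)
    then have "k t x z * hm z <= k t x z * ?R z" using hm_le_1[of z] k0 by (intro mult_left_mono) linarith+
    then show ?thesis using nn by linarith
   next
    case 4
    then have "?D z = 1" by (simp add: indicator_def)
    then have "k t x z * hm z <= k t x z * ?D z" using hm_le_1[of z] k0 by (intro mult_left_mono) auto
    then show ?thesis using nn by linarith
   qed
  qed
  have "hm x <= (LINT z|nu. ((?f z + hm x / 4 * k t x z) + k t x z * ?R z) + k t x z * ?D z)"
   using integral_mono[OF hm_mass(1)[OF t] s3 pt] unfolding hm_mass(2)[OF t] .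
  also have "... = (((LINT z|nu. ?f z) + hm x / 4 * 1) + (LINT z|nu. k t x z * ?R z)) + pr t x (- (A * s)) (- (\<delta> * s))"
   unfolding Bochner_Integration.integral_add[OF s2 i4] Bochner_Integration.integral_add[OF s1 R(1)]
    Bochner_Integration.integral_add[OF f(1) i3] integral_mult_right_zero k_mass(2)[OF t] pr_def ..
  finally show "hm x / 2 <= pr t x (- (A * sqrt t)) (- (\<delta> * sqrt t))"
   using f(2) R(2) unfolding s_def by linarith
 qed
qed

end

section \<open>Global lower bounds\<close>

context heat_kernel
begin

text \<open>Both points send mass of order \<open>hm\<close> to the annulus on the left, by
  \<open>left_mass\<close>. Inside the annulus the near-diagonal estimate holds and a fixed number
  of chaining steps joins any two points, so two applications of Chapman--Kolmogorov give the
  product.\<close>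

lemma core_lower:
 obtains \<kappa> c where "\<kappa> > 0" "c > 0"
  "!!t x y. t > 0 ==> 1 + abs x <= \<kappa> * sqrt t ==> 1 + abs y <= \<kappa> * sqrt t ==> c * (hm x * hm y) / V t x <= k t x y"
proof -
 interpret R: heat_kernel d "%t x y. k t (- x) (- y)" by (rule heat_kernel_uminus)
 obtain \<kappa> \<delta> A where \<kappa>: "\<kappa> > 0" "\<kappa> <= \<delta>" "\<delta> <= 1" "1 <= A" and M:
  "!!t x. t > 0 ==> 1 + abs x <= \<kappa> * sqrt t ==> hm x / 2 <= pr t x (- (A * sqrt t)) (- (\<delta> * sqrt t))"
  by (rule left_mass) blast
 have \<delta>: "\<delta> > 0" using \<kappa> by linarith
 obtain \<epsilon> a where \<epsilon>: "\<epsilon> > 0" "a > 0" and N: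
  "!!t x y. t > 0 ==> \<delta> * sqrt t <= 1 + abs x ==> abs (x - y) <= \<epsilon> * sqrt t ==> a / V t x <= k t (- x) (- y)"
  by (rule R.near_diag_lower[OF \<delta>]) blast
 define b where "b = a * (\<epsilon> / 2 * (\<epsilon> / 2 / (1 + \<epsilon>)) powr (d - 1) * exp (- (d - 1) * \<epsilon>))"
 have b: "b > 0" using \<epsilon> by (simp add: b_def)
 define n where "n = nat \<lceil>2 * A / \<epsilon>\<rceil>"
 have n: "A <= real (n + 2) * (\<epsilon> / 2)"
 proof -
  have "2 * A / \<epsilon> <= real (n + 2)" unfolding n_def by linarith
  then show ?thesis using \<epsilon> by (simp add: pos_divide_le_eq)
 qed
 define c where "c = a * b ^ n / (4 * (A + 2) powr (d - 1))"
 have c: "c > 0" using \<epsilon> b \<kappa> by (simp add: c_def)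
 have main: "c * (hm x * hm y) / V t x <= k (t + (t + real (n + 1) * t)) x y"
  if t: "t > 0" and x: "1 + abs x <= \<kappa> * sqrt t" and y: "1 + abs y <= \<kappa> * sqrt t" for t x y
 proof -
  let ?s = "sqrt t" and ?T = "real (n + 1) * t"
  have s: "?s > 0" "?T > 0" using t by auto
  have V: "V t x > 0" "V t (A * ?s) > 0" using V_pos[OF t] by auto
  have h: "hm x > 0" "hm y > 0" using hm_pos by auto
  define \<beta> where "\<beta> = a * b ^ n / V t (A * ?s)"
  have \<beta>: "\<beta> > 0" using \<epsilon> b V by (simp add: \<beta>_def)
  have mid: "\<beta> <= k ?T z z'" if z: "z \<in> {- (A * ?s)..- (\<delta> * ?s)}" and z': "z' \<in> {- (A * ?s)..- (\<delta> * ?s)}" for z z'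
  proof -
   have d0: "0 <= \<delta> * ?s" using \<delta> s by simp
   have H: "a / V t (max x y) <= k t (- x) (- y)" if "\<delta> * ?s <= x" "\<delta> * ?s <= y" "abs (x - y) <= \<epsilon> * ?s" for x y
   proof -
    have "a / V t (max x y) <= a / V t x" using that d0 \<epsilon> V_pos[OF t] by (intro divide_left_mono V_mono_abs t mult_pos_pos) auto
    also have "... <= k t (- x) (- y)" using that by (intro N t) auto
    finally show ?thesis .
   qed
   have "abs (- z - - z') <= A * ?s" using z z' d0 by auto
   also have "... <= real (n + 2) * (\<epsilon> / 2) * ?s" using n s by (intro mult_right_mono) auto
   finally have "abs (- z - - z') <= real (n + 2) * (\<epsilon> * ?s / 2)" by (simp add: mult_ac)
   from R.chain[OF t \<epsilon>(1) d0 \<epsilon>(2) H _ _ this]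
   have "a * b ^ n / V t (max (- z) (- z')) <= k ?T z z'" unfolding b_def using z z' by simp
   moreover have "\<beta> <= a * b ^ n / V t (max (- z) (- z'))"
    unfolding \<beta>_def using z z' d0 \<epsilon> b V V_pos[OF t] by (intro divide_left_mono V_mono_abs t mult_pos_pos) auto
   ultimately show ?thesis by linarith
  qed
  have step: "\<beta> * (hm y / 2) <= k (t + ?T) z y" if z: "z \<in> {- (A * ?s)..- (\<delta> * ?s)}" for z
  proof -
   have "\<beta> * (hm y / 2) <= \<beta> * pr t y (- (A * ?s)) (- (\<delta> * ?s))" using \<beta> by (intro mult_left_mono M t y) auto
   also have "... <= k (t + ?T) y z" by (rule k_ge_pr[OF t s(2)]) (use \<beta> mid z in auto)
   also have "... = k (t + ?T) z y" using s t by (intro k_sym) linarith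
   finally show ?thesis .
  qed
  have "\<beta> * (hm y / 2) * (hm x / 2) <= \<beta> * (hm y / 2) * pr t x (- (A * ?s)) (- (\<delta> * ?s))"
   using \<beta> h by (intro mult_left_mono M t x) auto
  also have "... <= k (t + (t + ?T)) x y" 
  proof (rule k_ge_pr[OF t])
   show "0 < t + ?T" using s t by linarith
  qed (use \<beta> h step in auto)
  finally have le: "\<beta> * (hm y / 2) * (hm x / 2) <= k (t + (t + ?T)) x y" .
  have "V t (A * ?s) <= (A + 2) powr (d - 1) * V t x"
  proof -
   have "1 <= \<kappa> * ?s" using x by linarith
   also have "... <= 1 * ?s" using \<kappa> s by (intro mult_right_mono) auto
   finally have "1 + abs (A * ?s) + ?s <= (A + 2) * ?s" using \<kappa> s by (simp add: distrib_right)
   also have "... <= (A + 2) * (1 + abs x + ?s)" using \<kappa> by (intro mult_left_mono) auto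
   finally have "(1 + abs (A * ?s) + ?s) powr (d - 1) <= ((A + 2) * (1 + abs x + ?s)) powr (d - 1)"
    using s d by (intro powr_mono2) auto
   also have "... = (A + 2) powr (d - 1) * (1 + abs x + ?s) powr (d - 1)" by (rule powr_mult)
   finally show ?thesis unfolding V_def using s by (simp add: mult_ac)
  qed
  then have "1 / ((A + 2) powr (d - 1) * V t x) <= 1 / V t (A * ?s)" using V \<kappa> by (intro divide_left_mono mult_pos_pos) auto
  then have "a * b ^ n / 4 * (hm x * hm y) * (1 / ((A + 2) powr (d - 1) * V t x)) <= a * b ^ n / 4 * (hm x * hm y) * (1 / V t (A * ?s))"
   using \<epsilon> b h by (intro mult_left_mono) auto
  then show ?thesis using le by (simp add: c_def \<beta>_def mult_ac)
 qed
 \<comment> \<open>The path uses \<open>n + 3\<close> time units; the condition on \<open>x\<close>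
   and \<open>y\<close> is rescaled accordingly.\<close>
 define q where "q = sqrt (real (n + 3))"
 have q: "q >= 1" "q * q = real (n + 3)" by (auto simp: q_def)
 show thesis
 proof (rule that)
  show "\<kappa> / q > 0" "c > 0" using \<kappa> q c by auto
  fix t x y :: real assume t: "t > 0" and x: "1 + abs x <= \<kappa> / q * sqrt t" and y: "1 + abs y <= \<kappa> / q * sqrt t"
  let ?t = "t / real (n + 3)"
  have "?t + (?t + real (n + 1) * ?t) = real (n + 3) * ?t" by (simp only: of_nat_add distrib_right)
  then have t': "?t > 0" "?t <= t" "?t + (?t + real (n + 1) * ?t) = t" using t by (auto simp: pos_divide_le_eq)
  have "sqrt ?t = sqrt t / q" by (simp add: real_sqrt_divide q_def)
  then have "c * (hm x * hm y) / V ?t x <= k t x y" using main[OF t'(1), of x y] x y unfolding t'(3) by simp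
  moreover have "c * (hm x * hm y) / V t x <= c * (hm x * hm y) / V ?t x"
   using c hm_pos[of x] hm_pos[of y] t' V_pos t by (intro divide_left_mono V_mono mult_nonneg_nonneg mult_pos_pos) auto
  ultimately show "c * (hm x * hm y) / V t x <= k t x y" by linarith
 qed
qed

lemma hm_ge_half': "s <= 0 ==> 1 / 2 <= hm s"
 using hm_ge_half[of s] by (cases "s = 0") (auto simp: hm_def)

text \<open>Near the gluing point at large times the near-diagonal estimate is replaced by the
  reflected \<open>core_lower\<close>: its annulus is on the right, and for points on the right the
  reflected \<open>hm\<close> is at least \<open>1 / 2\<close>. Together they cover all
  near-diagonal pairs, and chaining does the rest.\<close>

lemma same_side_lower:
 obtains c C where "c > 0" "C > 0" "!!t x y. t > 0 ==> 0 <= x ==> 0 <= y ==> c / V t x * exp (- (C * ((x - y)^2 / t))) <= k t x y"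
proof -
 interpret R: heat_kernel d "%t x y. k t (- x) (- y)" by (rule heat_kernel_uminus)
 obtain \<kappa> c where \<kappa>: "\<kappa> > 0" "c > 0" and core:
  "!!t x y. t > 0 ==> 1 + abs x <= \<kappa> * sqrt t ==> 1 + abs y <= \<kappa> * sqrt t ==> c * (hm x * hm y) / V t x <= k t (- x) (- y)"
  by (rule R.core_lower) blast
 obtain \<epsilon> a where \<epsilon>: "\<epsilon> > 0" "a > 0" and N:
  "!!t x y. t > 0 ==> \<kappa> / 2 * sqrt t <= 1 + abs x ==> abs (x - y) <= \<epsilon> * sqrt t ==> a / V t x <= k t x y"
  by (rule near_diag_lower[of "\<kappa> / 2"]) (use \<kappa> in auto)
 show thesis
 proof (rule gauss_lower_if_near_diag[of "min \<epsilon> (\<kappa> / 2)" "min a (c / 4)"])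
  show "min \<epsilon> (\<kappa> / 2) > 0" "min a (c / 4) > 0" using \<kappa> \<epsilon> by auto
  fix t x y :: real assume t: "t > 0" and x: "0 <= x" and y: "0 <= y" and xy: "abs (x - y) <= min \<epsilon> (\<kappa> / 2) * sqrt t"
  have s: "sqrt t > 0" using t by simp
  have V: "V t x > 0" "V t (max x y) > 0" using V_pos[OF t] by auto
  have e: "min \<epsilon> (\<kappa> / 2) * sqrt t <= \<epsilon> * sqrt t" "min \<epsilon> (\<kappa> / 2) * sqrt t <= \<kappa> / 2 * sqrt t"
   using s by (auto intro!: mult_right_mono)
  have "min a (c / 4) / V t (max x y) <= min a (c / 4) / V t x"
   using x y V \<kappa> \<epsilon> by (intro divide_left_mono V_mono_abs t mult_pos_pos) auto
  also have "... <= k t x y"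
  proof (cases "\<kappa> / 2 * sqrt t <= 1 + abs x")
   case True
   have "min a (c / 4) / V t x <= a / V t x" using V by (intro divide_right_mono) auto
   then show ?thesis using N[OF t True, of y] xy e by linarith
  next
   case False
   have "abs y <= abs x + abs (x - y)" by linarith
   then have XY: "1 + abs x <= \<kappa> * sqrt t" "1 + abs y <= \<kappa> * sqrt t" using False xy e x y by auto
   have "min a (c / 4) / V t x <= c / 4 / V t x" using V by (intro divide_right_mono) auto
   also have "... = c * (1 / 2 * (1 / 2)) / V t x" by simp
   also have "... <= c * (hm (- x) * hm (- y)) / V t x"
    using \<kappa> V x y by (intro divide_right_mono mult_left_mono mult_mono hm_ge_half' less_imp_le[OF hm_pos]) auto
   also have "... <= k t x y" using core[OF t, of "- x" "- y"] XY by simp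
   finally show ?thesis .
  qed
  finally show "min a (c / 4) / V t (max x y) <= k t x y" .
 qed (use that in blast)
qed

text \<open>\<open>core_lower\<close> uses the annulus on the left and gives a multiple of
  \<open>U x\<close>, its reflection the one on the right and a multiple of \<open>U y\<close>; the
  average of the two bounds contains the sum.\<close>

lemma glue_lower:
 obtains \<kappa> c where "\<kappa> > 0" "c > 0"
  "!!t x y. t > 0 ==> 0 <= x ==> x <= \<kappa> * sqrt t ==> y <= 0 ==> - (\<kappa> * sqrt t) <= y ==> c * (U x + U y) / V t x <= k t x y"
proof -
 interpret R: heat_kernel d "%t x y. k t (- x) (- y)" by (rule heat_kernel_uminus)
 obtain \<kappa>1 c1 where \<kappa>1: "\<kappa>1 > 0" "c1 > 0" and core1:
  "!!t x y. t > 0 ==> 1 + abs x <= \<kappa>1 * sqrt t ==> 1 + abs y <= \<kappa>1 * sqrt t ==> c1 * (hm x * hm y) / V t x <= k t x y"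
  by (rule core_lower) blast
 obtain \<kappa>2 c2 where \<kappa>2: "\<kappa>2 > 0" "c2 > 0" and core2:
  "!!t x y. t > 0 ==> 1 + abs x <= \<kappa>2 * sqrt t ==> 1 + abs y <= \<kappa>2 * sqrt t ==> c2 * (hm x * hm y) / V t x <= k t (- x) (- y)"
  by (rule R.core_lower) blast
 define \<delta> where "\<delta> = min \<kappa>1 \<kappa>2 / 2"
 have \<delta>: "\<delta> > 0" using \<kappa>1 \<kappa>2 by (simp add: \<delta>_def)
 obtain \<epsilon> a where \<epsilon>: "\<epsilon> > 0" "a > 0" and N:
  "!!t x y. t > 0 ==> \<delta> * sqrt t <= 1 + abs x ==> abs (x - y) <= \<epsilon> * sqrt t ==> a / V t x <= k t x y"
  by (rule near_diag_lower[OF \<delta>]) blast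
 define \<kappa> where "\<kappa> = min \<delta> (\<epsilon> / 2)"
 define c where "c = min (a / 2) (min c1 c2 / 8)"
 have c: "c > 0" "c <= a / 2" "c <= c1 / 8" "c <= c2 / 8" using \<epsilon> \<kappa>1 \<kappa>2 by (auto simp: c_def)
 show thesis
 proof (rule that)
  show "\<kappa> > 0" "c > 0" using \<epsilon> \<delta> c by (auto simp: \<kappa>_def)
  fix t x y :: real assume t: "t > 0" and x: "0 <= x" "x <= \<kappa> * sqrt t" and y: "y <= 0" "- (\<kappa> * sqrt t) <= y"
  have s: "sqrt t > 0" using t by simp
  have V: "V t x > 0" by (rule V_pos[OF t])
  have \<kappa>s: "\<kappa> * sqrt t <= \<delta> * sqrt t" "\<kappa> * sqrt t <= \<epsilon> / 2 * sqrt t"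
   unfolding \<kappa>_def using s by (auto intro!: mult_right_mono)
  have U: "0 < U x" "0 < U y" "U x <= 1" "U y <= 1" using powr_le_1 by auto
  show "c * (U x + U y) / V t x <= k t x y"
  proof (cases "\<delta> * sqrt t <= 1")
   \<comment> \<open>At such small times the condition of the near-diagonal estimate holds at every
     point, and both powers are at most \<open>1\<close>.\<close>
   case True
   have "c * (U x + U y) / V t x <= a / 2 * (1 + 1) / V t x"
    using V c U \<epsilon> by (intro divide_right_mono mult_mono add_mono) auto
   also have "... <= k t x y"
   proof -
    have "abs (x - y) <= \<epsilon> * sqrt t" using x y \<kappa>s by auto
    then show ?thesis using N[OF t _ \<open>abs (x - y) <= \<epsilon> * sqrt t\<close>] True by simp
   qed
   finally show ?thesis .
  next
   case False
   have 2: "2 * (\<delta> * sqrt t) <= \<kappa>1 * sqrt t" "2 * (\<delta> * sqrt t) <= \<kappa>2 * sqrt t"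
    unfolding \<delta>_def using s by (auto intro!: mult_right_mono)
   have XY: "1 + abs x <= 2 * (\<delta> * sqrt t)" "1 + abs y <= 2 * (\<delta> * sqrt t)" using False x y \<kappa>s by auto
   have "c * U x / V t x <= c1 / 8 * U x / V t x" using c U V by (intro divide_right_mono mult_right_mono) auto
   also have "... = c1 * (U x / 2 * (1 / 2)) / V t x / 2" by simp
   also have "... <= c1 * (hm x * hm y) / V t x / 2"
    using \<kappa>1 V x y U by (intro divide_right_mono mult_left_mono mult_mono hm_ge_half') (auto simp: hm_eq)
   also have "... <= k t x y / 2" using core1[OF t order_trans[OF XY(1) 2(1)] order_trans[OF XY(2) 2(1)]] by (rule divide_right_mono) simp
   finally have 1: "c * U x / V t x <= k t x y / 2" .
   have "c * U y / V t x <= c2 / 8 * U y / V t x" using c U V by (intro divide_right_mono mult_right_mono) auto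
   also have "... = c2 * (1 / 2 * (U (- y) / 2)) / V t x / 2" by simp
   also have "... <= c2 * (hm (- x) * hm (- y)) / V t x / 2"
    using \<kappa>2 V x y U hm_eq[of "- y"] less_imp_le[OF hm_pos[of "- x"]] by (intro divide_right_mono mult_left_mono mult_mono hm_ge_half') auto
   also have "... <= k t x y / 2"
    using core2[OF t, of "- x" "- y"] order_trans[OF XY(1) 2(2)] order_trans[OF XY(2) 2(2)] by simp
   finally have "c * U y / V t x <= k t x y / 2" .
   moreover have "c * (U x + U y) / V t x = c * U x / V t x + c * U y / V t x" by (simp add: distrib_left add_divide_distrib)
   ultimately show ?thesis using 1 by linarith
  qed
 qed
qed

text \<open>The target interval has length and distance from \<open>0\<close> of order
  \<open>sqrt t\<close>, so its measure is comparable with \<open>V t 0\<close>. Passing from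
  \<open>V t x\<close> to \<open>V t 0\<close> costs only a Gaussian factor, by
  \<open>V_inverse_ge\<close>.\<close>

lemma pr_near_glue:
 assumes \<kappa>: "\<kappa> > 0"
 obtains c C where "c > 0" "C > 0" "!!t x. t > 0 ==> 0 <= x ==> c * exp (- (C * (x^2 / t))) <= pr t x (\<kappa> * sqrt t / 2) (\<kappa> * sqrt t)"
proof -
 obtain c C where c: "c > 0" "C > 0" and L:
  "!!t x y. t > 0 ==> 0 <= x ==> 0 <= y ==> c / V t x * exp (- (C * ((x - y)^2 / t))) <= k t x y"
  by (rule same_side_lower) blast
 define q where "q = min 1 (\<kappa> / 2)"
 have q: "q > 0" "q <= 1" "q <= \<kappa> / 2" using \<kappa> by (auto simp: q_def)
 define B where "B = exp (- ((d - 1)^2 / 2))"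
 have B: "B > 0" by (simp add: B_def)
 show thesis
 proof (rule that)
  show "0 < c * exp (- (C * \<kappa>^2)) * (B * (q powr (d - 1) * (\<kappa> / 2)))" "0 < C + 1 / 2" using c B q \<kappa> by auto
  fix t x :: real assume t: "t > 0" and x: "0 <= x"
  let ?s = "sqrt t" and ?a = "\<kappa> * sqrt t / 2"
  have s: "?s > 0" "?a > 0" using t \<kappa> by auto
  have V: "V t x > 0" "V t 0 > 0" using V_pos[OF t] by auto
  define \<gamma> where "\<gamma> = c / V t x * (exp (- (C * \<kappa>^2)) * exp (- (C * (x^2 / t))))"
  have \<gamma>: "\<gamma> >= 0" using c V by (simp add: \<gamma>_def)
  have "\<gamma> * (w ?a * (\<kappa> * ?s - ?a)) <= pr t x ?a (\<kappa> * ?s)"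
  proof (rule pr_ge[OF t _ \<gamma>])
   fix z assume z: "z \<in> {?a..\<kappa> * ?s}"
   then have z0: "0 <= z" "z <= \<kappa> * ?s" using s by auto
   \<comment> \<open>Both points are on the right, so the cross term helps, and \<open>z^2\<close>
     is of order \<open>t\<close>.\<close>
   have "(x - z)^2 <= x^2 + z^2" using mult_nonneg_nonneg[OF x z0(1)] by (simp add: power2_diff)
   also have "z^2 <= (\<kappa> * ?s)^2" using z0 by (intro power_mono) auto
   also have "(\<kappa> * ?s)^2 = \<kappa>^2 * t" using t by (simp add: power_mult_distrib)
   finally have "(x - z)^2 / t <= (x^2 + \<kappa>^2 * t) / t" using t by (intro divide_right_mono) auto
   then have "(x - z)^2 / t <= \<kappa>^2 + x^2 / t" using t by (simp add: add_divide_distrib)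
   then have "C * ((x - z)^2 / t) <= C * (\<kappa>^2 + x^2 / t)" using c by (intro mult_left_mono) auto
   then have "\<gamma> <= c / V t x * exp (- (C * ((x - z)^2 / t)))"
    unfolding \<gamma>_def exp_add[symmetric] using c V by (intro mult_left_mono) (auto simp: distrib_left)
   also have "... <= k t x z" by (rule L[OF t x z0(1)])
   finally show "\<gamma> <= k t x z" .
   show "w ?a <= w z" using z s by (intro w_mono) auto
  qed (use s in auto)
  moreover have "c * exp (- (C * \<kappa>^2)) * (B * (q powr (d - 1) * (\<kappa> / 2))) * exp (- ((C + 1 / 2) * (x^2 / t))) <= \<gamma> * (w ?a * (\<kappa> * ?s - ?a))"
  proof -
   have "q * (1 + abs 0 + ?s) <= 1 + abs ?a"
   proof -
    have "q * ?s <= \<kappa> / 2 * ?s" using q s by (intro mult_right_mono) auto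
    moreover have "q * (1 + abs 0 + ?s) = q + q * ?s" "abs ?a = \<kappa> / 2 * ?s" using s by (auto simp: algebra_simps)
    ultimately show ?thesis using q by linarith
   qed
   then have "(q * (1 + abs 0 + ?s)) powr (d - 1) <= w ?a" unfolding w_def using q s d by (intro powr_mono2) auto
   then have "q powr (d - 1) * (1 + abs 0 + ?s) powr (d - 1) * ?a <= w ?a * ?a"
    using s by (simp only: powr_mult[symmetric]) (intro mult_right_mono, auto)
   then have 1: "q powr (d - 1) * (\<kappa> / 2) * V t 0 <= w ?a * (\<kappa> * ?s - ?a)" by (simp add: V_def mult_ac)
   have 2: "B * exp (- (x^2 / t / 2)) / V t 0 <= 1 / V t x"
    unfolding B_def by (rule V_inverse_ge[OF t]) (use x in auto)
   have e: "exp (- ((C + 1 / 2) * (x^2 / t))) = exp (- (C * (x^2 / t))) * exp (- (x^2 / t / 2))"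
   proof -
    have "- ((C + 1 / 2) * v) = - (C * v) + - (v / 2)" for v :: real by (simp add: algebra_simps)
    then show ?thesis unfolding exp_add[symmetric] by (simp only:)
   qed
   have "c * exp (- (C * \<kappa>^2)) * (B * (q powr (d - 1) * (\<kappa> / 2))) * exp (- ((C + 1 / 2) * (x^2 / t)))
     = c * (exp (- (C * \<kappa>^2)) * exp (- (C * (x^2 / t)))) * ((B * exp (- (x^2 / t / 2)) / V t 0) * (q powr (d - 1) * (\<kappa> / 2) * V t 0))"
    unfolding e using V by simp
   also have "... <= c * (exp (- (C * \<kappa>^2)) * exp (- (C * (x^2 / t)))) * (1 / V t x * (w ?a * (\<kappa> * ?s - ?a)))"
    using c V \<kappa> by (intro mult_left_mono mult_mono 1 2) auto
   finally show ?thesis by (simp add: \<gamma>_def)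
  qed
  ultimately show "c * exp (- (C * \<kappa>^2)) * (B * (q powr (d - 1) * (\<kappa> / 2))) * exp (- ((C + 1 / 2) * (x^2 / t))) <= pr t x ?a (\<kappa> * ?s)"
   by linarith
 qed
qed

end

text \<open>One constant for both directions: it bounds the prefactors from both sides and is the
  reciprocal or the factor of the time in the exponents. Enlarging \<open>K\<close> then weakens
  everything at once.\<close>

definition two_sided :: "real => real => real => real => real => bool" where
 "two_sided K q r t v \<longleftrightarrow> inverse K * q * exp (- (K * (r^2 / t))) <= v & v <= K * q * exp (- (r^2 / (K * t)))"

lemma two_sided_I:
 assumes "c * q * exp (- (C * (r^2 / t))) <= v" "v <= A * q * exp (- (r^2 / (a * t)))"
  and "t > 0" "q >= 0" "c > 0" "C > 0" "A > 0" "a > 0" "inverse c <= K" "C <= K" "A <= K" "a <= K"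
 shows "two_sided K q r t v"
proof -
 have r: "0 <= r^2 / t" using assms by simp
 have "inverse K <= c" using assms le_imp_inverse_le[of "inverse c" K] by simp
 moreover have "C * (r^2 / t) <= K * (r^2 / t)" using assms r by (intro mult_right_mono) auto
 ultimately have "inverse K * q * exp (- (K * (r^2 / t))) <= c * q * exp (- (C * (r^2 / t)))"
  using assms by (intro mult_mono mult_right_mono) auto
 moreover have "r^2 / (K * t) <= r^2 / (a * t)" using assms by (intro divide_left_mono mult_right_mono) auto
 then have "A * q * exp (- (r^2 / (a * t))) <= K * q * exp (- (r^2 / (K * t)))"
  using assms by (intro mult_mono mult_right_mono) auto
 ultimately show ?thesis using assms(1,2) by (simp add: two_sided_def)
qed

lemma two_sided_mono:
 assumes "two_sided K q r t v" "K > 0" "K * l <= K'" "l >= 1" "t > 0" "0 <= q" "q <= l * q'" "q' <= l * q"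
 shows "two_sided K' q' r t v"
proof (rule two_sided_I)
 have q': "0 <= q'" using assms(4,6,7) by (metis order_trans zero_le_mult_iff linorder_not_le zero_less_one less_le_trans)
 have "inverse (K * l) * q' <= inverse K * q" using assms by (simp add: field_simps)
 then have "inverse (K * l) * q' * exp (- (K * (r^2 / t))) <= inverse K * q * exp (- (K * (r^2 / t)))" by (rule mult_right_mono) simp
 then show "inverse (K * l) * q' * exp (- (K * (r^2 / t))) <= v" using assms(1) unfolding two_sided_def by linarith
 have "K * q <= K * l * q'" using assms by (simp add: mult.assoc)
 then have "K * q * exp (- (r^2 / (K * t))) <= K * l * q' * exp (- (r^2 / (K * t)))" by (rule mult_right_mono) simp
 then show "v <= K * l * q' * exp (- (r^2 / (K * t)))" using assms(1) unfolding two_sided_def by linarith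
 have Kl: "K * 1 <= K * l" using assms by (intro mult_left_mono) auto
 then show "K <= K'" "K <= K'" using assms(3) by linarith+
 show "inverse (inverse (K * l)) <= K'" "K * l <= K'" using assms(3) by auto
 show "0 <= q'" by (rule q')
qed (use assms in auto)

section \<open>Lower bounds across the gluing point, and the combined estimate\<close>

context heat_kernel
begin

text \<open>Each point first travels along its own half-line to within a multiple of the square root
  of the time, where \<open>glue_lower\<close> applies. Moving towards \<open>0\<close> increases
  the powers and decreases the volume, so only the Gaussian cost of the travel is lost.\<close>

lemma opposite_lower:
 obtains c C where "c > 0" "C > 0"
  "!!t x y. t > 0 ==> x >= 0 ==> y <= 0 ==> c * ((U x + U y) / V t x) * exp (- (C * ((x - y)^2 / t))) <= k t x y"
proof -
 interpret R: heat_kernel d "%t x y. k t (- x) (- y)" by (rule heat_kernel_uminus)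
 obtain \<kappa> c0 where \<kappa>: "\<kappa> > 0" "c0 > 0" and G:
  "!!t x y. t > 0 ==> 0 <= x ==> x <= \<kappa> * sqrt t ==> y <= 0 ==> - (\<kappa> * sqrt t) <= y ==> c0 * (U x + U y) / V t x <= k t x y"
  by (rule glue_lower) blast
 obtain c1 C1 where c1: "c1 > 0" "C1 > 0" and P1:
  "!!t x. t > 0 ==> 0 <= x ==> c1 * exp (- (C1 * (x^2 / t))) <= pr t x (\<kappa> * sqrt t / 2) (\<kappa> * sqrt t)"
  by (rule pr_near_glue[OF \<kappa>(1)]) blast
 obtain c2 C2 where c2: "c2 > 0" "C2 > 0" and R2:
  "!!t x. t > 0 ==> 0 <= x ==> c2 * exp (- (C2 * (x^2 / t))) <= R.pr t x (\<kappa> * sqrt t / 2) (\<kappa> * sqrt t)"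
  by (rule R.pr_near_glue[OF \<kappa>(1)]) blast
 have P2: "c2 * exp (- (C2 * (y^2 / t))) <= pr t y (- (\<kappa> * sqrt t)) (- (\<kappa> * sqrt t / 2))" if t: "t > 0" and y: "y <= 0" for t y
 proof -
  have "meas (%z. k t y z * indicator {- (\<kappa> * sqrt t)..- (\<kappa> * sqrt t / 2)} z)" using t by measurable
  from integral_nu_uminus[OF this]
  have "R.pr t (- y) (\<kappa> * sqrt t / 2) (\<kappa> * sqrt t) = pr t y (- (\<kappa> * sqrt t)) (- (\<kappa> * sqrt t / 2))"
   unfolding R.pr_def pr_def by (simp add: indicator_def conj_commute)
  then show ?thesis using R2[OF t, of "- y"] y by simp
 qed
 have Upos: "0 < U x" for x :: real using powr_le_1 by auto
 have U_anti: "U b <= U a" if "abs a <= abs b" for a b :: real using that d by (intro powr_mono2') auto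
 \<comment> \<open>\<open>c2\<close> serves the case that \<open>y\<close> has to travel;
   \<open>1 / 2 powr d\<close> is the price of doubling the time in the volume when it does
   not.\<close>
 define c3 where "c3 = c0 * min c2 (1 / 2 powr d)"
 have c3: "c3 > 0" "c3 <= c0 * c2" using \<kappa> c2 by (auto simp: c3_def)
 have c3': "c3 <= c0 * (1 / 2 powr d)" unfolding c3_def using \<kappa> by (intro mult_left_mono min.cobounded2) auto
 have S1: "c3 * ((U x + U y) / V t x) * exp (- (C2 * (y^2 / t))) <= k (t + t) x y"
  if t: "t > 0" and x: "0 <= x" "x <= \<kappa> * sqrt t" and y: "y <= 0" for t x y
 proof -
  have V: "V t x > 0" "V (t + t) x > 0" using V_pos t by auto
  have q: "0 <= (U x + U y) / V t x" using V Upos by (simp add: add_nonneg_nonneg)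
  show ?thesis
  proof (cases "- (\<kappa> * sqrt t) <= y")
   case True
   have "c3 * ((U x + U y) / V t x) * exp (- (C2 * (y^2 / t))) <= c0 * (1 / 2 powr d) * ((U x + U y) / V t x) * 1"
    using c3(1) c3' c2 q t \<kappa> by (intro mult_mono mult_nonneg_nonneg) auto
   also have "... = c0 * (U x + U y) * (1 / (2 powr d * V t x))" by simp
   also have "... <= c0 * (U x + U y) * (1 / V (t + t) x)"
    using \<kappa> V Upos V_doubling[OF t, of "t + t" x] t by (intro mult_left_mono divide_left_mono) (auto simp: add_nonneg_nonneg)
   also have "... <= k (t + t) x y"
   proof -
    have "\<kappa> * sqrt t <= \<kappa> * sqrt (t + t)" using \<kappa> t by (intro mult_left_mono) auto
    then show ?thesis using G[of "t + t" x y] t x y True by simp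
   qed
   finally show ?thesis .
  next
   case False
   let ?\<beta> = "c0 * (U x + U y) / V t x"
   have \<beta>: "0 <= ?\<beta>" using mult_nonneg_nonneg[OF less_imp_le[OF \<kappa>(2)] q] by (simp only: times_divide_eq_right)
   have "c3 * ((U x + U y) / V t x) * exp (- (C2 * (y^2 / t))) <= c0 * c2 * ((U x + U y) / V t x) * exp (- (C2 * (y^2 / t)))"
    using c3 q by (intro mult_right_mono) auto
   also have "... = ?\<beta> * (c2 * exp (- (C2 * (y^2 / t))))" by simp
   also have "... <= ?\<beta> * pr t y (- (\<kappa> * sqrt t)) (- (\<kappa> * sqrt t / 2))" by (intro mult_left_mono P2 t y \<beta>)
   also have "... <= k (t + t) y x"
   proof (rule k_ge_pr[OF t t \<beta>])
    fix z assume z: "z \<in> {- (\<kappa> * sqrt t)..- (\<kappa> * sqrt t / 2)}"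
    then have z0: "z <= 0" "abs z <= abs y" using \<kappa> t False by (auto intro: order_trans)
    have "?\<beta> <= c0 * (U x + U z) / V t x" using \<kappa> V U_anti[OF z0(2)] by (intro divide_right_mono mult_left_mono) auto
    also have "... <= k t x z" using z z0 by (intro G t x) auto
    finally show "?\<beta> <= k t z x" by (simp add: k_sym[OF t, of z x])
   qed
   finally show ?thesis using k_sym[of "t + t" x y] t by simp
  qed
 qed
 \<comment> \<open>The path is made of three pieces of duration \<open>t / 3\<close>, and
   \<open>x^2 + y^2 <= (x - y)^2\<close> for points of opposite sign.\<close>
 define C where "C = 3 * max C1 C2"
 have C: "C1 <= C / 3" "C2 <= C / 3" "C > 0" "0 <= C / 3" using c1 by (auto simp: C_def)
 define c where "c = c3 * min 1 c1"
 have c: "c > 0" "c <= c3" "c <= c3 * c1" using c1 c3 by (auto simp: c_def)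
 show thesis
 proof (rule that[OF c(1) C(3)])
  fix t x y :: real assume t: "t > 0" and x: "x >= 0" and y: "y <= 0"
  define \<tau> where "\<tau> = t / 3"
  have \<tau>: "\<tau> > 0" "\<tau> + (\<tau> + \<tau>) = t" "\<tau> <= t" using t by (auto simp: \<tau>_def)
  have V: "V \<tau> x > 0" "V t x > 0" "V (t / 2) x > 0" using V_pos t \<tau> by auto
  have xy: "x^2 + y^2 <= (x - y)^2" using mult_nonneg_nonneg[OF x, of "- y"] y by (simp add: power2_diff)
  have Us: "0 <= U x + U y" using Upos by (simp add: add_nonneg_nonneg)
  show "c * ((U x + U y) / V t x) * exp (- (C * ((x - y)^2 / t))) <= k t x y"
  proof (cases "x <= \<kappa> * sqrt \<tau>")
   case True
   have "C2 * (y^2 / (t / 2)) <= C / 3 * ((x - y)^2 / (t / 3))"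
   proof (intro mult_mono C)
    have "y^2 / (t / 2) <= y^2 / (t / 3)" using t by (intro divide_left_mono) auto
    also have "... <= (x - y)^2 / (t / 3)" using xy t zero_le_power2[of x] by (intro divide_right_mono) linarith+
    finally show "y^2 / (t / 2) <= (x - y)^2 / (t / 3)" .
   qed (use t in auto)
   then have e: "exp (- (C * ((x - y)^2 / t))) <= exp (- (C2 * (y^2 / (t / 2))))" by simp
   have "c * ((U x + U y) / V t x) * exp (- (C * ((x - y)^2 / t))) <= c3 * ((U x + U y) / V (t / 2) x) * exp (- (C2 * (y^2 / (t / 2))))"
    using c c3 Us V e t V_mono[of "t / 2" t x] by (intro mult_mono divide_left_mono) auto
   also have "... <= k (t / 2 + t / 2) x y"
   proof (rule S1)
    have "sqrt \<tau> <= sqrt (t / 2)" using t by (simp add: \<tau>_def)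
    then show "x <= \<kappa> * sqrt (t / 2)" using True \<kappa> mult_left_mono[of "sqrt \<tau>" "sqrt (t / 2)" \<kappa>] by linarith
   qed (use t x y in auto)
   finally show ?thesis by simp
  next
   case False
   let ?\<beta> = "c3 * ((U x + U y) / V \<tau> x) * exp (- (C2 * (y^2 / \<tau>)))"
   have \<beta>: "0 <= ?\<beta>" using c3 Us V by simp
   have e: "exp (- (C * ((x - y)^2 / t))) <= exp (- (C2 * (y^2 / \<tau>))) * exp (- (C1 * (x^2 / \<tau>)))"
   proof -
    have "C1 * (x^2 / \<tau>) + C2 * (y^2 / \<tau>) <= C / 3 * (x^2 / \<tau>) + C / 3 * (y^2 / \<tau>)"
     using C \<tau> by (intro add_mono mult_right_mono) auto
    also have "... = C / 3 * ((x^2 + y^2) / \<tau>)" by (simp add: add_divide_distrib distrib_left)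
    also have "... <= C / 3 * ((x - y)^2 / \<tau>)" using C \<tau> xy by (intro mult_left_mono divide_right_mono) auto
    also have "... = C * ((x - y)^2 / t)" by (simp add: \<tau>_def)
    finally show ?thesis unfolding exp_add[symmetric] by simp
   qed
   have "c * ((U x + U y) / V t x) * exp (- (C * ((x - y)^2 / t)))
     <= c3 * c1 * ((U x + U y) / V \<tau> x) * (exp (- (C2 * (y^2 / \<tau>))) * exp (- (C1 * (x^2 / \<tau>))))"
    using c c1 c3 Us V \<tau> e by (intro mult_mono divide_left_mono V_mono) auto
   also have "... = ?\<beta> * (c1 * exp (- (C1 * (x^2 / \<tau>))))" by simp
   also have "... <= ?\<beta> * pr \<tau> x (\<kappa> * sqrt \<tau> / 2) (\<kappa> * sqrt \<tau>)" by (intro mult_left_mono P1 \<tau> x \<beta>)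
   also have "... <= k (\<tau> + (\<tau> + \<tau>)) x y"
   proof (rule k_ge_pr[OF \<tau>(1) _ \<beta>])
    fix z assume z: "z \<in> {\<kappa> * sqrt \<tau> / 2..\<kappa> * sqrt \<tau>}"
    have "0 <= \<kappa> * sqrt \<tau>" using \<kappa> \<tau> by simp
    then have z0: "0 <= z" "abs z <= abs x" "z <= \<kappa> * sqrt \<tau>" using z False by auto
    have "?\<beta> <= c3 * ((U z + U y) / V \<tau> z) * exp (- (C2 * (y^2 / \<tau>)))"
     using c3 U_anti[OF z0(2)] V V_pos[OF \<tau>(1), of z] Upos[of z] Upos[of y] V_mono_abs[OF \<tau>(1) z0(2)]
     by (intro mult_right_mono mult_left_mono frac_le) auto
    also have "... <= k (\<tau> + \<tau>) z y" by (rule S1[OF \<tau>(1) z0(1,3) y])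
    finally show "?\<beta> <= k (\<tau> + \<tau>) z y" .
   qed (use \<tau> in auto)
   finally show ?thesis unfolding \<tau>(2) .
  qed
 qed
qed

lemma two_sided_right:
 "\<exists>K>0. \<forall>t>0. ALL x>=0. ALL y. (y >= 0 --> two_sided K (1 / V t x) (x - y) t (k t x y)) &
  (y <= 0 --> two_sided K ((U x + U y) / V t x) (x - y) t (k t x y))"
proof -
 obtain c1 C1 where 1: "c1 > 0" "C1 > 0"
  "!!t x y. t > 0 ==> 0 <= x ==> 0 <= y ==> c1 / V t x * exp (- (C1 * ((x - y)^2 / t))) <= k t x y"
  by (rule same_side_lower) blast
 obtain A1 a1 where 2: "A1 > 0" "a1 > 0"
  "!!t x y. t > 0 ==> k t x y <= A1 / V t x * exp (- ((abs x - abs y)^2 / (a1 * t)))"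
  by (rule k_le_gauss_modulus) blast
 obtain c2 C2 where 3: "c2 > 0" "C2 > 0"
  "!!t x y. t > 0 ==> x >= 0 ==> y <= 0 ==> c2 * ((U x + U y) / V t x) * exp (- (C2 * ((x - y)^2 / t))) <= k t x y"
  by (rule opposite_lower) blast
 obtain A2 a2 where 4: "A2 > 0" "a2 > 0"
  "!!t x y. t > 0 ==> x >= 0 ==> y <= 0 ==> k t x y <= A2 * (U x + U y) / V t x * exp (- ((x - y)^2 / (a2 * t)))"
  by (rule opposite_upper) blast
 define K where "K = max (max (inverse c1) (inverse c2)) (max (max C1 C2) (max (max A1 A2) (max a1 a2)))"
 show ?thesis
 proof (intro exI[of _ K] conjI allI impI)
  show "K > 0" using 1 by (auto simp: K_def less_max_iff_disj)
  fix t x y :: real assume t: "t > 0" and x: "x >= 0"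
  have V: "V t x > 0" by (rule V_pos[OF t])
  show "two_sided K (1 / V t x) (x - y) t (k t x y)" if y: "y >= 0"
   by (rule two_sided_I[of c1 _ C1 _ _ _ A1 a1])
     (use 1(1,2) 2(1,2) 1(3)[OF t x y] 2(3)[OF t, of x y] x y t V in \<open>auto simp: K_def le_max_iff_disj\<close>)
  show "two_sided K ((U x + U y) / V t x) (x - y) t (k t x y)" if y: "y <= 0"
   by (rule two_sided_I[of c2 _ C2 _ _ _ A2 a2])
     (use 3(1,2) 4(1,2) 3(3)[OF t x y] 4(3)[OF t x y] x y t V in \<open>auto simp: K_def le_max_iff_disj add_nonneg_nonneg\<close>)
 qed
qed

lemma two_sided_all:
 "\<exists>K>0. \<forall>t>0. ALL x y. (0 <= x & 0 <= y \<or> x <= 0 & y <= 0 --> two_sided K (1 / V t x) (x - y) t (k t x y)) &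
  (0 <= x & y <= 0 \<or> x <= 0 & 0 <= y --> two_sided K ((U x + U y) / V t x) (x - y) t (k t x y))"
proof -
 interpret R: heat_kernel d "%t x y. k t (- x) (- y)" by (rule heat_kernel_uminus)
 obtain K1 where K1: "K1 > 0" "!!t x y. t > 0 ==> x >= 0 ==> y >= 0 ==> two_sided K1 (1 / V t x) (x - y) t (k t x y)"
  "!!t x y. t > 0 ==> x >= 0 ==> y <= 0 ==> two_sided K1 ((U x + U y) / V t x) (x - y) t (k t x y)"
  using two_sided_right by blast
 obtain K2 where K2: "K2 > 0" "!!t x y. t > 0 ==> x >= 0 ==> y >= 0 ==> two_sided K2 (1 / V t x) (x - y) t (k t (- x) (- y))"
  "!!t x y. t > 0 ==> x >= 0 ==> y <= 0 ==> two_sided K2 ((U x + U y) / V t x) (x - y) t (k t (- x) (- y))"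
  using R.two_sided_right by blast
 have m: "two_sided (max K1 K2) q r t v" if "two_sided K q r t v" "K = K1 \<or> K = K2" "t > 0" "q >= 0" for K q r t v
  by (rule two_sided_mono[OF that(1), of 1]) (use that K1(1) K2(1) in auto)
 have neg: "two_sided K q (- x - - y) t v ==> two_sided K q (x - y) t v" for K q x y t v
  by (simp add: two_sided_def power2_commute[of x] add.commute)
 show ?thesis
 proof (intro exI[of _ "max K1 K2"] conjI allI impI)
  show "max K1 K2 > 0" using K1 by auto
  fix t x y :: real assume t: "t > 0"
  have V: "V t x > 0" by (rule V_pos[OF t])
  show "two_sided (max K1 K2) (1 / V t x) (x - y) t (k t x y)" if xy: "0 <= x & 0 <= y \<or> x <= 0 & y <= 0"
  proof (cases "0 <= x & 0 <= y")
   case True then show ?thesis using K1(2)[OF t, of x y] V t by (intro m[of K1]) auto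
  next
   case False
   then have "- x >= 0" "- y >= 0" using xy by auto
   from neg[OF K2(2)[OF t this]] show ?thesis using V t by (intro m[of K2]) auto
  qed
  show "two_sided (max K1 K2) ((U x + U y) / V t x) (x - y) t (k t x y)" if xy: "0 <= x & y <= 0 \<or> x <= 0 & 0 <= y"
  proof (cases "0 <= x & y <= 0")
   case True then show ?thesis using K1(3)[OF t, of x y] V t by (intro m[of K1]) (auto simp: add_nonneg_nonneg)
  next
   case False
   then have "- x >= 0" "- y <= 0" using xy by auto
   from neg[OF K2(3)[OF t this]] show ?thesis using V t by (intro m[of K2]) (auto simp: add_nonneg_nonneg)
  qed
 qed
qed

end

section \<open>The glued space\<close>

lemma rho_chart: "x \<in> X ==> rho x (chart s) = abs (coord x - s)"
 by (auto simp: X_def rho_def chart_def coord_def sgn_if abs_if mult_le_0_iff zero_less_mult_iff)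

lemma rho_coord: "x \<in> X ==> y \<in> X ==> x * y ~= 0 ==> rho x y = abs (coord x - coord y)"
 by (auto simp: X_def rho_def coord_def sgn_if abs_if mult_le_0_iff zero_less_mult_iff)

lemma abs_coord: "x \<in> X ==> 1 + abs (coord x) = abs x"
 by (auto simp: X_def coord_def sgn_if)

text \<open>\<open>chart\<close> represents the glued point by \<open>1\<close>. The value at
  \<open>-1\<close> is recovered only through the compatibility clause of
  \<open>continuous_kernel\<close>.\<close>

lemma kernel_chart_coord:
 assumes K: "continuous_kernel K" and "x \<in> X" "y \<in> X"
 shows "K x y = K (chart (coord x)) (chart (coord y))"
proof -
 have X1: "K x (- 1) = K x 1" "K (- 1) x = K 1 x" if "x \<in> X" for x using K that by (auto simp: continuous_kernel_def)
 have 1: "chart (coord (- 1)) = 1" "(1::real) \<in> X" "(- 1::real) \<in> X" by (auto simp: chart_def coord_def X_def)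
 have "K x y = K (chart (coord x)) y"
  using X1(2)[OF assms(3)] chart_coord[OF assms(2)] 1 by (cases "x = - 1") auto
 also have "... = K (chart (coord x)) (chart (coord y))"
  using X1(1)[of "chart (coord x)"] chart_coord[OF assms(3)] 1 by (cases "y = - 1") auto
 finally show ?thesis .
qed

context heat_kernel
begin

text \<open>In the coordinate the ball is an interval of radius \<open>sqrt t\<close>. Its outward
  end carries enough weight for the lower bound, wherever the gluing point lies in it.\<close>

lemma ball_volume:
 assumes x: "x \<in> X" and t: "t > 0"
 shows "V t (coord x) <= 4 powr d * measure (mu d) (rball x (sqrt t))" "measure (mu d) (rball x (sqrt t)) <= 2 * V t (coord x)"
proof -
 let ?s = "coord x" and ?r = "sqrt t"
 let ?M = "(1 + abs ?s + ?r) powr (d - 1)"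
 have r: "?r > 0" using t by simp
 have pre: "chart -` rball x ?r \<inter> space nu = {?s - ?r<..<?s + ?r}"
  using rho_chart[OF x] by (auto simp: rball_def)
 have "{y. rho x y < ?r} \<in> sets borel" unfolding rho_def by measurable
 then have "rball x ?r \<in> sets (mu d)"
  unfolding sets_mu sets_restrict_space rball_def by (intro image_eqI[of _ _ "{y. rho x y < ?r}"]) auto
 then have m: "measure (mu d) (rball x ?r) = measure nu {?s - ?r<..<?s + ?r}"
  using measure_distr[OF chart_measurable_mu, of "rball x ?r"] unfolding distr_chart pre by blast
 have fm: "{a..b} \<in> fmeasurable nu" for a b
 proof (cases "a <= b")
  case True
  from nu_interval(1)[OF this] have "emeasure nu ({a..b} \<inter> space nu) < \<infinity>"
   unfolding integrable_indicator_iff by blast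
  then show ?thesis by (intro fmeasurableI) auto
 qed (auto simp: fmeasurable_def)
 have I: "{?s - ?r<..<?s + ?r} \<in> fmeasurable nu" by (rule fmeasurableI2[OF fm[of "?s - ?r" "?s + ?r"]]) auto
 have "measure nu {?s - ?r<..<?s + ?r} <= measure nu {?s - ?r..?s + ?r}"
  using I fm by (intro measure_mono_fmeasurable fmeasurableD) auto
 also have "... <= ?M * (?s + ?r - (?s - ?r))"
 proof -
  have "w z <= ?M" if "z \<in> {?s - ?r..?s + ?r}" for z
   unfolding w_def using that d by (intro powr_mono2) auto
  then show ?thesis using nu_interval(2)[of "?s - ?r" "?s + ?r" ?M] r by simp
 qed
 also have "... = 2 * V t ?s" by (simp add: V_def)
 finally show "measure (mu d) (rball x ?r) <= 2 * V t ?s" unfolding m .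
 \<comment> \<open>A subinterval of a quarter of the radius on the outward side, where the weight is
   at least \<open>(1 / 4) powr (d - 1)\<close> times its maximal order.\<close>
 have low: "V t ?s <= 4 powr d * measure nu {?s - ?r<..<?s + ?r}"
  if ab: "b - a = ?r / 4" "?s - ?r < a" "b < ?s + ?r" and z: "!!z. z \<in> {a..b} ==> abs ?s + ?r / 4 <= abs z" for a b
 proof -
  have wz: "(1 / 4) powr (d - 1) * ?M <= w z" if "z \<in> {a..b}" for z
  proof -
   have "(1 / 4 * (1 + abs ?s + ?r)) powr (d - 1) <= w z"
    unfolding w_def using z[OF that] r d by (intro powr_mono2) auto
   then show ?thesis by (simp only: powr_mult)
  qed
  have "a <= b" using ab r by linarith
  then have "(1 / 4) powr (d - 1) * ?M * (b - a) <= measure nu {a..b}" using nu_interval(3)[OF _ wz] by simp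
  also have "... <= measure nu {?s - ?r<..<?s + ?r}" using ab fm I by (intro measure_mono_fmeasurable fmeasurableD) auto
  finally have "(1 / 4) powr (d - 1) * (1 / 4) * V t ?s <= measure nu {?s - ?r<..<?s + ?r}"
   unfolding ab(1) V_def by (simp add: mult_ac)
  also have "(1 / 4::real) powr (d - 1) * (1 / 4) = 1 / 4 powr d" by (simp add: powr_diff powr_divide)
  finally show ?thesis by (simp add: field_simps)
 qed
 show "V t ?s <= 4 powr d * measure (mu d) (rball x ?r)" unfolding m
 proof (cases "?s >= 0")
  case True
  show "V t ?s <= 4 powr d * measure nu {?s - ?r<..<?s + ?r}"
   by (rule low[of "?s + ?r / 2" "?s + ?r / 4"]) (use True r in auto)
 next
  case False
  show "V t ?s <= 4 powr d * measure nu {?s - ?r<..<?s + ?r}"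
  proof (rule low[of "?s - ?r / 4" "?s - ?r / 2"])
   show "?s - ?r < ?s - ?r / 2" "?s - ?r / 4 < ?s + ?r" using r by linarith+
  qed (use False r in auto)
 qed
qed

end

theorem theorem1p5:
  fixes d :: real and T :: "real \<Rightarrow> real \<Rightarrow> real \<Rightarrow> real"
  assumes "d > 2"
    and "bessel_heat_kernel d T"
  shows "\<exists>C>0. \<exists>c1>0. \<exists>c2>0. \<forall>t>0. \<forall>x\<in>X. \<forall>y\<in>X.
    (x * y > 0 \<longrightarrow>
       inverse C / measure (mu d) (rball x (sqrt t)) * exp (- ((rho x y)\<^sup>2 / (c1 * t))) \<le> T t x y \<and>
       T t x y \<le> C / measure (mu d) (rball x (sqrt t)) * exp (- ((rho x y)\<^sup>2 / (c2 * t)))) \<and>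
    (x * y < 0 \<longrightarrow>
       inverse C * ((\<bar>x\<bar> powr (2 - d) + \<bar>y\<bar> powr (2 - d)) / measure (mu d) (rball x (sqrt t)))
         * exp (- ((rho x y)\<^sup>2 / (c1 * t))) \<le> T t x y \<and>
       T t x y \<le> C * ((\<bar>x\<bar> powr (2 - d) + \<bar>y\<bar> powr (2 - d)) / measure (mu d) (rball x (sqrt t)))
         * exp (- ((rho x y)\<^sup>2 / (c2 * t))))"
proof -
 interpret bessel d by (rule bessel.intro[OF assms(1)])
 obtain S where "heat_semigroup d S (%t s r. T t (chart s) (chart r))"
  by (rule heat_semigroup_if_kernel[OF assms(2)])
 then interpret heat_semigroup d S "%t s r. T t (chart s) (chart r)" .
 obtain K where K: "K > 0" and B: "\<forall>t>0. ALL x y.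
   (0 <= x & 0 <= y \<or> x <= 0 & y <= 0 --> two_sided K (1 / V t x) (x - y) t (T t (chart x) (chart y))) &
   (0 <= x & y <= 0 \<or> x <= 0 & 0 <= y --> two_sided K ((U x + U y) / V t x) (x - y) t (T t (chart x) (chart y)))"
  by (rule exE[OF two_sided_all], elim conjE) (rule that)
 let ?m = "%t x. measure (mu d) (rball x (sqrt t))"
 \<comment> \<open>Bounds the ratio of the explicit volume and the measure of the ball in both
   directions.\<close>
 let ?l = "2 * 4 powr d" and ?K = "K * (2 * 4 powr d)"
 have l1: "(1::real) <= 4 powr d" using d by (intro ge_one_powr_ge_zero) auto
 have main: "inverse ?K * (p / ?m t x) * exp (- ((rho x y)^2 / (inverse ?K * t))) <= T t x y &
   T t x y <= ?K * (p / ?m t x) * exp (- ((rho x y)^2 / (?K * t)))"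
  if t: "t > 0" and x: "x \<in> X" and y: "y \<in> X" and xy: "x * y ~= 0" and p: "p >= 0"
   and ts: "two_sided K (p / V t (coord x)) (coord x - coord y) t (T t (chart (coord x)) (chart (coord y)))" for t x y p
 proof -
  have V: "V t (coord x) > 0" by (rule V_pos[OF t])
  note bv = ball_volume[OF x t]
  have m: "?m t x > 0" 
  proof -
   have "0 < 4 powr d * ?m t x" using bv(1) V by linarith
   then show ?thesis by (simp add: zero_less_mult_iff)
  qed
  have "continuous_kernel (T t)" using assms(2) t by (auto simp: bessel_heat_kernel_def)
  note k = kernel_chart_coord[OF this x y]
  have "two_sided ?K (p / ?m t x) (coord x - coord y) t (T t x y)"
   unfolding k
  proof (rule two_sided_mono[OF ts K order_refl])
   have "V t (coord x) <= ?l * ?m t x" "?m t x <= ?l * V t (coord x)"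
   proof -
    show "V t (coord x) <= ?l * ?m t x" using bv(1) V by linarith
    have "1 * V t (coord x) <= 4 powr d * V t (coord x)" using l1 V by (intro mult_right_mono) auto
    then show "?m t x <= ?l * V t (coord x)" using bv(2) by linarith
   qed
   then have "1 / ?m t x <= ?l / V t (coord x)" "1 / V t (coord x) <= ?l / ?m t x"
    using m V by (auto simp: field_simps)
   from mult_left_mono[OF this(1) p] mult_left_mono[OF this(2) p]
   show "p / ?m t x <= ?l * (p / V t (coord x))" "p / V t (coord x) <= ?l * (p / ?m t x)" by (simp_all add: mult_ac)
  qed (use t p V l1 in auto)
  moreover have "(rho x y)^2 = (coord x - coord y)^2" using rho_coord[OF x y xy] by simp
  moreover have "(coord x - coord y)^2 / (inverse ?K * t) = ?K * ((coord x - coord y)^2 / t)" using K by (simp add: field_simps)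
  ultimately show ?thesis unfolding two_sided_def by (simp only:)
 qed
 have K': "?K > 0" "inverse ?K > 0" using K by auto
 show ?thesis
 proof (rule exI[of _ ?K], rule conjI[OF K'(1)], rule exI[of _ "inverse ?K"], rule conjI[OF K'(2)],
   rule exI[of _ ?K], rule conjI[OF K'(1)], intro allI ballI impI conjI)
  fix t x y :: real assume t: "t > 0" and x: "x \<in> X" and y: "y \<in> X"
  \<comment> \<open>Both representatives of the glued point have the coordinate \<open>0\<close>, so
    the thresholds are \<open>-1\<close> and \<open>1\<close>; the weak inequalities let this point
    be treated as lying on either side.\<close>
  have sgn: "0 <= coord x \<longleftrightarrow> - 1 <= x" "coord x <= 0 \<longleftrightarrow> x <= 1" if "x \<in> X" for x
   using that by (auto simp: X_def coord_def sgn_if)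
  show "inverse ?K / ?m t x * exp (- ((rho x y)^2 / (inverse ?K * t))) <= T t x y"
   "T t x y <= ?K / ?m t x * exp (- ((rho x y)^2 / (?K * t)))" if xy: "x * y > 0"
  proof -
   have "0 <= coord x & 0 <= coord y \<or> coord x <= 0 & coord y <= 0"
    using xy sgn[OF x] sgn[OF y] x y by (auto simp: X_def zero_less_mult_iff)
   then have "two_sided K (1 / V t (coord x)) (coord x - coord y) t (T t (chart (coord x)) (chart (coord y)))"
    using B[rule_format, OF t] by blast
   note M = main[OF t x y _ zero_le_one this, unfolded times_divide_eq_right mult_1_right]
   have "x * y ~= 0" using less_imp_neq[OF xy] by metis
   from M[OF this] show "inverse ?K / ?m t x * exp (- ((rho x y)^2 / (inverse ?K * t))) <= T t x y"
    "T t x y <= ?K / ?m t x * exp (- ((rho x y)^2 / (?K * t)))" by blast+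
  qed
  let ?p = "abs x powr (2 - d) + abs y powr (2 - d)"
  show "inverse ?K * (?p / ?m t x) * exp (- ((rho x y)^2 / (inverse ?K * t))) <= T t x y"
   "T t x y <= ?K * (?p / ?m t x) * exp (- ((rho x y)^2 / (?K * t)))" if xy: "x * y < 0"
  proof -
   have "0 <= coord x & coord y <= 0 \<or> coord x <= 0 & 0 <= coord y"
    using xy sgn[OF x] sgn[OF y] x y by (auto simp: X_def mult_less_0_iff)
   then have "two_sided K (?p / V t (coord x)) (coord x - coord y) t (T t (chart (coord x)) (chart (coord y)))"
    using B[rule_format, OF t] unfolding abs_coord[OF x, symmetric] abs_coord[OF y, symmetric] by blast
   moreover have "x * y ~= 0" using less_imp_neq[OF xy] .
   moreover have "0 <= ?p" by simp
   ultimately have M: "inverse ?K * (?p / ?m t x) * exp (- ((rho x y)^2 / (inverse ?K * t))) <= T t x y &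
     T t x y <= ?K * (?p / ?m t x) * exp (- ((rho x y)^2 / (?K * t)))" by (intro main[OF t x y])
   from M show "inverse ?K * (?p / ?m t x) * exp (- ((rho x y)^2 / (inverse ?K * t))) <= T t x y"
    "T t x y <= ?K * (?p / ?m t x) * exp (- ((rho x y)^2 / (?K * t)))" by blast+
  qed
 qed
qed

end
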